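(* Let $A$ be a unital C*-algebra, let $G$ be a finite group, and let $\alpha\colon G\to\operatorname{Aut}(A)$ be a strictly approximately inner action. Let $\iota\colon A\to C^*(G,A,\alpha)$ be the inclusion map. Then: (1) The map $\operatorname{W}(\iota)\colon \operatorname{W}(A)\to \operatorname{W}(C^*(G,A,\alpha))$ is an ordered semigroup isomorphism onto its range. (2) The map $\operatorname{Cu}(\iota)\colon \operatorname{Cu}(A)\to \operatorname{Cu}(C^*(G,A,\alpha))$ is an ordered semigroup isomorphism onto its range.
   Context: $C^*(G,A,\alpha)$ is the crossed product. $\operatorname{U}(B)$ is the unitary group of a unital C*-algebra $B$, $B_+$ is the set of positive elements, $\mathcal{K}$ is the algebra of compact operators on a separable infinite-dimensional Hilbert space. Strictly approximately inner: an action $\alpha\colon G\to\operatorname{Aut}(A)$ of a finite group on a unital C*-algebra is strictly approximately inner if for every finite set $F\subset A$ and every $\varepsilon>0$ there are $z_g\in \operatorname{U}(A)$ for $g\in G$ such that (i) $\|\alpha_g(a)-z_g a z_g^*\|<\varepsilon$ for all $g\in G$, $a\in F$; (ii) $\|z_g z_h-z_{gh}\|<\varepsilon$ for all $g,h\in G$. Cuntz semigroups: let $M_\infty(A)=\bigcup_n M_n(A)$. For $a,b\in M_\infty(A)_+$ write $a\precsim_A b$ if there is a sequence $(c_n)$ in $M_\infty(A)$ with $\lim_n c_n b c_n^*=a$, and $a\sim_A b$ if $a\precsim_A b$ and $b\precsim_A a$; $\langle a\rangle_A$ is the class of $a$. $\operatorname{W}(A)=M_\infty(A)_+/\sim_A$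 with addition $\langle a\rangle_A+\langle b\rangle_A=\langle a\oplus b\rangle_A$ and order $\langle a\rangle_A\le\langle b\rangle_A$ iff $a\precsim_A b$. $\operatorname{Cu}(A)=\operatorname{W}(\mathcal{K}\otimes A)$, with classes written $\langle a\rangle_A$ for $a\in(\mathcal{K}\otimes A)_+$. A homomorphism $\psi\colon A\to B$ induces $\operatorname{W}(\psi)\colon\operatorname{W}(A)\to\operatorname{W}(B)$ and $\operatorname{Cu}(\psi)\colon\operatorname{Cu}(A)\to\operatorname{Cu}(B)$ by $\langle a\rangle_A\mapsto\langle\psi(a)\rangle_B$ (with $\psi$ amplified to $M_\infty(A)$ or $\mathcal{K}\otimes A$). *)

theory Defs
  imports Complex_Main "HOL-Algebra.Module" "HOL-Algebra.Bij"
begin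

text \<open>
  C*-algebras are records over the HOL-Algebra module record with complex scalars. They need not
  be unital: the field \<open>one\<close> is only meaningful for algebras satisfying
  \<open>unital_cstar_algebra\<close>.
\<close>

record 'a star_alg = "(complex, 'a) module" +
  star :: "'a \<Rightarrow> 'a"

record 'a cstar_alg = "'a star_alg" +
  cnorm :: "'a \<Rightarrow> real"

locale star_algebra = abelian_group A for A :: "('a, 'm) star_alg_scheme" (structure) +
  assumes mult_closed: "\<lbrakk>x \<in> carrier A; y \<in> carrier A\<rbrakk> \<Longrightarrow> x \<otimes> y \<in> carrier A"
    and mult_assoc: "\<lbrakk>x \<in> carrier A; y \<in> carrier A; z \<in> carrier A\<rbrakk>
          \<Longrightarrow> (x \<otimes> y) \<otimes> z = x \<otimes> (y \<otimes> z)"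
    and distr_right: "\<lbrakk>x \<in> carrier A; y \<in> carrier A; z \<in> carrier A\<rbrakk>
          \<Longrightarrow> (x \<oplus> y) \<otimes> z = x \<otimes> z \<oplus> y \<otimes> z"
    and distr_left: "\<lbrakk>x \<in> carrier A; y \<in> carrier A; z \<in> carrier A\<rbrakk>
          \<Longrightarrow> z \<otimes> (x \<oplus> y) = z \<otimes> x \<oplus> z \<otimes> y"
    and scale_closed: "x \<in> carrier A \<Longrightarrow> c \<odot> x \<in> carrier A"
    and scale_add_left: "x \<in> carrier A \<Longrightarrow> (c + d) \<odot> x = c \<odot> x \<oplus> d \<odot> x"
    and scale_add_right: "\<lbrakk>x \<in> carrier A; y \<in> carrier A\<rbrakk> \<Longrightarrow> c \<odot> (x \<oplus> y) = c \<odot> x \<oplus> c \<odot> y"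
    and scale_scale: "x \<in> carrier A \<Longrightarrow> (c * d) \<odot> x = c \<odot> (d \<odot> x)"
    and scale_one: "x \<in> carrier A \<Longrightarrow> 1 \<odot> x = x"
    and scale_mult_left: "\<lbrakk>x \<in> carrier A; y \<in> carrier A\<rbrakk> \<Longrightarrow> (c \<odot> x) \<otimes> y = c \<odot> (x \<otimes> y)"
    and scale_mult_right: "\<lbrakk>x \<in> carrier A; y \<in> carrier A\<rbrakk> \<Longrightarrow> x \<otimes> (c \<odot> y) = c \<odot> (x \<otimes> y)"
    and star_closed: "x \<in> carrier A \<Longrightarrow> star A x \<in> carrier A"
    and star_star: "x \<in> carrier A \<Longrightarrow> star A (star A x) = x"
    and star_add: "\<lbrakk>x \<in> carrier A; y \<in> carrier A\<rbrakk> \<Longrightarrow> star A (x \<oplus> y) = star A x \<oplus> star A y"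
    and star_scale: "x \<in> carrier A \<Longrightarrow> star A (c \<odot> x) = cnj c \<odot> star A x"
    and star_mult: "\<lbrakk>x \<in> carrier A; y \<in> carrier A\<rbrakk> \<Longrightarrow> star A (x \<otimes> y) = star A y \<otimes> star A x"

definition cstar_seminorm :: "('a, 'm) star_alg_scheme \<Rightarrow> ('a \<Rightarrow> real) \<Rightarrow> bool" where
  "cstar_seminorm A p \<longleftrightarrow>
     (\<forall>x\<in>carrier A. 0 \<le> p x) \<and>
     (\<forall>x\<in>carrier A. \<forall>y\<in>carrier A. p (x \<oplus>\<^bsub>A\<^esub> y) \<le> p x + p y) \<and>
     (\<forall>c. \<forall>x\<in>carrier A. p (c \<odot>\<^bsub>A\<^esub> x) = cmod c * p x) \<and>
     (\<forall>x\<in>carrier A. \<forall>y\<in>carrier A. p (x \<otimes>\<^bsub>A\<^esub> y) \<le> p x * p y) \<and>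
     (\<forall>x\<in>carrier A. p (star A x \<otimes>\<^bsub>A\<^esub> x) = (p x)\<^sup>2)"

definition alg_tendsto :: "('a, 'm) cstar_alg_scheme \<Rightarrow> (nat \<Rightarrow> 'a) \<Rightarrow> 'a \<Rightarrow> bool" where
  "alg_tendsto A s l \<longleftrightarrow> (\<lambda>n. cnorm A (s n \<ominus>\<^bsub>A\<^esub> l)) \<longlonglongrightarrow> 0"

definition alg_Cauchy :: "('a, 'm) cstar_alg_scheme \<Rightarrow> (nat \<Rightarrow> 'a) \<Rightarrow> bool" where
  "alg_Cauchy A s \<longleftrightarrow> (\<forall>e>0. \<exists>N. \<forall>m\<ge>N. \<forall>n\<ge>N. cnorm A (s m \<ominus>\<^bsub>A\<^esub> s n) < e)"

definition alg_lim :: "('a, 'm) cstar_alg_scheme \<Rightarrow> (nat \<Rightarrow> 'a) \<Rightarrow> 'a" where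
  "alg_lim A s = (THE l. l \<in> carrier A \<and> alg_tendsto A s l)"

locale cstar_algebra = star_algebra A for A :: "('a, 'm) cstar_alg_scheme" (structure) +
  assumes cnorm_seminorm: "cstar_seminorm A (cnorm A)"
    and cnorm_definite: "\<lbrakk>x \<in> carrier A; cnorm A x = 0\<rbrakk> \<Longrightarrow> x = \<zero>"
    and complete: "\<lbrakk>\<And>n. s n \<in> carrier A; alg_Cauchy A s\<rbrakk> \<Longrightarrow> \<exists>l\<in>carrier A. alg_tendsto A s l"

locale unital_cstar_algebra = cstar_algebra A for A :: "('a, 'm) cstar_alg_scheme" (structure) +
  assumes one_closed: "\<one> \<in> carrier A"
    and one_left: "x \<in> carrier A \<Longrightarrow> \<one> \<otimes> x = x"
    and one_right: "x \<in> carrier A \<Longrightarrow> x \<otimes> \<one> = x"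

definition unitaries :: "('a, 'm) star_alg_scheme \<Rightarrow> 'a set" where
  "unitaries A = {u \<in> carrier A. star A u \<otimes>\<^bsub>A\<^esub> u = \<one>\<^bsub>A\<^esub> \<and> u \<otimes>\<^bsub>A\<^esub> star A u = \<one>\<^bsub>A\<^esub>}"

definition positives :: "('a, 'm) star_alg_scheme \<Rightarrow> 'a set" where
  "positives A = {star A x \<otimes>\<^bsub>A\<^esub> x | x. x \<in> carrier A}"

definition star_hom ::
  "('a, 'm) star_alg_scheme \<Rightarrow> ('b, 'n) star_alg_scheme \<Rightarrow> ('a \<Rightarrow> 'b) set" where
  "star_hom A B = {\<phi> \<in> carrier A \<rightarrow> carrier B.
     (\<forall>x\<in>carrier A. \<forall>y\<in>carrier A. \<phi> (x \<oplus>\<^bsub>A\<^esub> y) = \<phi> x \<oplus>\<^bsub>B\<^esub> \<phi> y) \<and>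
     (\<forall>c. \<forall>x\<in>carrier A. \<phi> (c \<odot>\<^bsub>A\<^esub> x) = c \<odot>\<^bsub>B\<^esub> \<phi> x) \<and>
     (\<forall>x\<in>carrier A. \<forall>y\<in>carrier A. \<phi> (x \<otimes>\<^bsub>A\<^esub> y) = \<phi> x \<otimes>\<^bsub>B\<^esub> \<phi> y) \<and>
     (\<forall>x\<in>carrier A. \<phi> (star A x) = star B (\<phi> x))}"

definition Aut_cstar :: "('a, 'm) star_alg_scheme \<Rightarrow> ('a \<Rightarrow> 'a) monoid" where
  "Aut_cstar A = BijGroup (carrier A) \<lparr>carrier := Bij (carrier A) \<inter> star_hom A A\<rparr>"

definition strictly_approximately_inner ::
  "('g, 'h) monoid_scheme \<Rightarrow> ('a, 'm) cstar_alg_scheme \<Rightarrow> ('g \<Rightarrow> 'a \<Rightarrow> 'a) \<Rightarrow> bool" where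
  "strictly_approximately_inner G A \<alpha> \<longleftrightarrow>
     (\<forall>F \<epsilon>. finite F \<and> F \<subseteq> carrier A \<and> 0 < \<epsilon> \<longrightarrow>
        (\<exists>z \<in> carrier G \<rightarrow> unitaries A.
           (\<forall>g\<in>carrier G. \<forall>a\<in>F.
              cnorm A (\<alpha> g a \<ominus>\<^bsub>A\<^esub> z g \<otimes>\<^bsub>A\<^esub> a \<otimes>\<^bsub>A\<^esub> star A (z g)) < \<epsilon>) \<and>
           (\<forall>g\<in>carrier G. \<forall>h\<in>carrier G.
              cnorm A (z g \<otimes>\<^bsub>A\<^esub> z h \<ominus>\<^bsub>A\<^esub> z (g \<otimes>\<^bsub>G\<^esub> h)) < \<epsilon>)))"

text \<open>
  The enveloping C*-norm of a *-algebra: the supremum of all C*-seminorms, equivalently of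
  \<open>\<parallel>\<pi>(x)\<parallel>\<close> over all *-representations \<open>\<pi>\<close> by bounded operators on Hilbert spaces. It is used
  below only for *-algebras on which this supremum is finite.
\<close>

definition enveloping_norm :: "('a, 'm) star_alg_scheme \<Rightarrow> 'a \<Rightarrow> real" where
  "enveloping_norm X x = Sup {p x | p. cstar_seminorm X p}"

definition with_enveloping_norm :: "'a star_alg \<Rightarrow> 'a cstar_alg" where
  "with_enveloping_norm X = star_alg.extend X (cstar_alg.fields (enveloping_norm X))"

text \<open>
  The *-algebra of functions from \<open>G\<close> to \<open>A\<close>, where \<open>x\<close> stands for
  \<open>\<Sum>\<^sub>g x(g) u\<^sub>g\<close> with \<open>u\<^sub>g a u\<^sub>g* = \<alpha>\<^sub>g(a)\<close>. For finite \<open>G\<close> it is all of \<open>\<ell>\<^sup>1(G,A,\<alpha>)\<close>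
  and is already complete in its enveloping C*-norm, so that no completion is needed to
  obtain the full crossed product.
\<close>

definition crossed_star_alg ::
  "('g, 'h) monoid_scheme \<Rightarrow> ('a, 'm) star_alg_scheme \<Rightarrow> ('g \<Rightarrow> 'a \<Rightarrow> 'a) \<Rightarrow> ('g \<Rightarrow> 'a) star_alg" where
  "crossed_star_alg G A \<alpha> =
     \<lparr>carrier = carrier G \<rightarrow>\<^sub>E carrier A,
      mult = (\<lambda>x y. \<lambda>g\<in>carrier G.
        \<Oplus>\<^bsub>A\<^esub>h\<in>carrier G. x h \<otimes>\<^bsub>A\<^esub> \<alpha> h (y (inv\<^bsub>G\<^esub> h \<otimes>\<^bsub>G\<^esub> g))),
      one = (\<lambda>g\<in>carrier G. if g = \<one>\<^bsub>G\<^esub> then \<one>\<^bsub>A\<^esub> else \<zero>\<^bsub>A\<^esub>),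
      zero = (\<lambda>g\<in>carrier G. \<zero>\<^bsub>A\<^esub>),
      add = (\<lambda>x y. \<lambda>g\<in>carrier G. x g \<oplus>\<^bsub>A\<^esub> y g),
      smult = (\<lambda>c x. \<lambda>g\<in>carrier G. c \<odot>\<^bsub>A\<^esub> x g),
      star = (\<lambda>x. \<lambda>g\<in>carrier G. \<alpha> g (star A (x (inv\<^bsub>G\<^esub> g))))\<rparr>"

definition crossed_product ::
  "('g, 'h) monoid_scheme \<Rightarrow> ('a, 'm) star_alg_scheme \<Rightarrow> ('g \<Rightarrow> 'a \<Rightarrow> 'a) \<Rightarrow> ('g \<Rightarrow> 'a) cstar_alg" where
  "crossed_product G A \<alpha> = with_enveloping_norm (crossed_star_alg G A \<alpha>)"

definition crossed_inclusion ::
  "('g, 'h) monoid_scheme \<Rightarrow> ('a, 'm) star_alg_scheme \<Rightarrow> 'a \<Rightarrow> 'g \<Rightarrow> 'a" where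
  "crossed_inclusion G A a = (\<lambda>g\<in>carrier G. if g = \<one>\<^bsub>G\<^esub> then a else \<zero>\<^bsub>A\<^esub>)"

text \<open>
  \<open>M\<^sub>n(A)\<close> is realised inside the infinite matrices as the upper left \<open>n\<close> by \<open>n\<close> corner, which
  builds in the embeddings \<open>a \<mapsto> a \<oplus> 0\<close>. The C*-norm of each \<open>M\<^sub>n(A)\<close> is its largest
  C*-seminorm, so these norms together are the enveloping norm of their union.
  \<open>M\<^sub>\<infinity>(A)\<close> has no unit; its \<open>one\<close> is a dummy.
\<close>

definition matrices :: "('a, 'm) star_alg_scheme \<Rightarrow> nat \<Rightarrow> (nat \<Rightarrow> nat \<Rightarrow> 'a) set" where
  "matrices A n = {x. (\<forall>i j. x i j \<in> carrier A) \<and> (\<forall>i j. n \<le> i \<or> n \<le> j \<longrightarrow> x i j = \<zero>\<^bsub>A\<^esub>)}"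

definition Minf_star_alg :: "('a, 'm) star_alg_scheme \<Rightarrow> (nat \<Rightarrow> nat \<Rightarrow> 'a) star_alg" where
  "Minf_star_alg A =
     \<lparr>carrier = (\<Union>n. matrices A n),
      mult = (\<lambda>x y i j. \<Oplus>\<^bsub>A\<^esub>k\<in>{k. x i k \<noteq> \<zero>\<^bsub>A\<^esub>}. x i k \<otimes>\<^bsub>A\<^esub> y k j),
      one = undefined,
      zero = (\<lambda>i j. \<zero>\<^bsub>A\<^esub>),
      add = (\<lambda>x y i j. x i j \<oplus>\<^bsub>A\<^esub> y i j),
      smult = (\<lambda>c x i j. c \<odot>\<^bsub>A\<^esub> x i j),
      star = (\<lambda>x i j. star A (x j i))\<rparr>"

definition Minf :: "('a, 'm) star_alg_scheme \<Rightarrow> (nat \<Rightarrow> nat \<Rightarrow> 'a) cstar_alg" where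
  "Minf A = with_enveloping_norm (Minf_star_alg A)"

definition amplify :: "('a \<Rightarrow> 'b) \<Rightarrow> (nat \<Rightarrow> nat \<Rightarrow> 'a) \<Rightarrow> nat \<Rightarrow> nat \<Rightarrow> 'b" where
  "amplify \<psi> x = (\<lambda>i j. \<psi> (x i j))"

definition corner :: "('a, 'm) star_alg_scheme \<Rightarrow> nat \<Rightarrow> (nat \<Rightarrow> nat \<Rightarrow> 'a) \<Rightarrow> nat \<Rightarrow> nat \<Rightarrow> 'a" where
  "corner A n x = (\<lambda>i j. if i < n \<and> j < n then x i j else \<zero>\<^bsub>A\<^esub>)"

text \<open>
  \<open>\<K> \<otimes> A\<close>, with \<open>\<K>\<close> the compact operators on \<open>\<ell>\<^sup>2(\<nat>)\<close>, is the completion of \<open>M\<^sub>\<infinity>(A)\<close>.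
  Every element is the norm limit of its compressions to the corners \<open>M\<^sub>n(A)\<close>, hence is determined
  by its matrix over \<open>A\<close>, and the matrices that arise are exactly those whose corners form a
  Cauchy sequence. Algebraic operations are those of matrices; the entries of a product are
  norm convergent series in \<open>A\<close>.
\<close>

definition compacts_tensor ::
  "('a, 'm) cstar_alg_scheme \<Rightarrow> (nat \<Rightarrow> nat \<Rightarrow> 'a) cstar_alg" where
  "compacts_tensor A = (Minf A)
     \<lparr>carrier := {x. (\<forall>i j. x i j \<in> carrier A) \<and> alg_Cauchy (Minf A) (\<lambda>n. corner A n x)},
      mult := (\<lambda>x y i j. alg_lim A (\<lambda>n. \<Oplus>\<^bsub>A\<^esub>k\<in>{..<n}. x i k \<otimes>\<^bsub>A\<^esub> y k j)),
      cnorm := (\<lambda>x. lim (\<lambda>n. cnorm (Minf A) (corner A n x)))\<rparr>"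

definition cuntz_le ::
  "('a, 'm) star_alg_scheme \<Rightarrow> (nat \<Rightarrow> nat \<Rightarrow> 'a) \<Rightarrow> (nat \<Rightarrow> nat \<Rightarrow> 'a) \<Rightarrow> bool" where
  "cuntz_le A a b \<longleftrightarrow>
     (\<exists>c. (\<forall>n. c n \<in> carrier (Minf A)) \<and>
          alg_tendsto (Minf A)
            (\<lambda>n. c n \<otimes>\<^bsub>Minf A\<^esub> b \<otimes>\<^bsub>Minf A\<^esub> star (Minf A) (c n)) a)"

definition cuntz_rel ::
  "('a, 'm) star_alg_scheme \<Rightarrow> ((nat \<Rightarrow> nat \<Rightarrow> 'a) \<times> (nat \<Rightarrow> nat \<Rightarrow> 'a)) set" where
  "cuntz_rel A = {(a, b). a \<in> positives (Minf A) \<and> b \<in> positives (Minf A) \<and>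
                          cuntz_le A a b \<and> cuntz_le A b a}"

text \<open>The block diagonal matrix \<open>a \<oplus> b\<close>, for \<open>a\<close> viewed as an element of \<open>M\<^sub>n(A)\<close>.\<close>

definition direct_sum ::
  "('a, 'm) star_alg_scheme \<Rightarrow> nat \<Rightarrow> (nat \<Rightarrow> nat \<Rightarrow> 'a) \<Rightarrow> (nat \<Rightarrow> nat \<Rightarrow> 'a) \<Rightarrow> nat \<Rightarrow> nat \<Rightarrow> 'a" where
  "direct_sum A n a b = (\<lambda>i j. if i < n \<and> j < n then a i j
                               else if n \<le> i \<and> n \<le> j then b (i - n) (j - n)
                               else \<zero>\<^bsub>A\<^esub>)"

record 'c ordered_semigroup = "'c partial_object" +
  sg_add :: "'c \<Rightarrow> 'c \<Rightarrow> 'c"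
  sg_le :: "'c \<Rightarrow> 'c \<Rightarrow> bool"

text \<open>
  Operations on Cuntz classes are defined on representatives; a union of classes over all
  representatives is the class of the result precisely because the operation is well defined.
\<close>

definition W :: "('a, 'm) star_alg_scheme \<Rightarrow> (nat \<Rightarrow> nat \<Rightarrow> 'a) set ordered_semigroup" where
  "W A =
     \<lparr>carrier = positives (Minf A) // cuntz_rel A,
      sg_add = (\<lambda>X Y. \<Union>{cuntz_rel A `` {direct_sum A n a b} | n a b.
                          a \<in> X \<and> a \<in> matrices A n \<and> b \<in> Y}),
      sg_le = (\<lambda>X Y. \<exists>a\<in>X. \<exists>b\<in>Y. cuntz_le A a b)\<rparr>"

definition W_map ::
  "('b, 'n) star_alg_scheme \<Rightarrow> ('a \<Rightarrow> 'b) \<Rightarrow> (nat \<Rightarrow> nat \<Rightarrow> 'a) set \<Rightarrow> (nat \<Rightarrow> nat \<Rightarrow> 'b) set" where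
  "W_map B \<psi> X = (\<Union>a\<in>X. cuntz_rel B `` {amplify \<psi> a})"

definition Cu ::
  "('a, 'm) cstar_alg_scheme \<Rightarrow> (nat \<Rightarrow> nat \<Rightarrow> nat \<Rightarrow> nat \<Rightarrow> 'a) set ordered_semigroup" where
  "Cu A = W (compacts_tensor A)"

definition Cu_map ::
  "('b, 'n) cstar_alg_scheme \<Rightarrow> ('a \<Rightarrow> 'b) \<Rightarrow>
     (nat \<Rightarrow> nat \<Rightarrow> nat \<Rightarrow> nat \<Rightarrow> 'a) set \<Rightarrow> (nat \<Rightarrow> nat \<Rightarrow> nat \<Rightarrow> nat \<Rightarrow> 'b) set" where
  "Cu_map B \<psi> = W_map (compacts_tensor B) (amplify \<psi>)"

definition ordered_semigroup_iso ::
  "('c, 'm) ordered_semigroup_scheme \<Rightarrow> ('d, 'n) ordered_semigroup_scheme \<Rightarrow> ('c \<Rightarrow> 'd) set" where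
  "ordered_semigroup_iso S T = {f. bij_betw f (carrier S) (carrier T) \<and>
     (\<forall>x\<in>carrier S. \<forall>y\<in>carrier S. f (sg_add S x y) = sg_add T (f x) (f y)) \<and>
     (\<forall>x\<in>carrier S. \<forall>y\<in>carrier S. sg_le S x y \<longleftrightarrow> sg_le T (f x) (f y))}"

definition iso_onto_range ::
  "('c, 'm) ordered_semigroup_scheme \<Rightarrow> ('d, 'n) ordered_semigroup_scheme \<Rightarrow> ('c \<Rightarrow> 'd) \<Rightarrow> bool" where
  "iso_onto_range S T f \<longleftrightarrow>
     f \<in> carrier S \<rightarrow> carrier T \<and>
     f \<in> ordered_semigroup_iso S (T\<lparr>carrier := f ` carrier S\<rparr>)"

end

theory Submission
  imports Defs
begin

text \<open>
  For a strictly approximately inner action, the maps \<open>\<Sum>\<^sub>g x\<^sub>g u\<^sub>g \<mapsto> \<Sum>\<^sub>g x\<^sub>g z\<^sub>g\<close>, with \<open>z\<close> running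
  through a net of approximating families of unitaries, are asymptotically multiplicative and
  *-preserving, and in the limit they restrict to the identity of \<open>A\<close>. Hence the upper limit of the
  norms of the images of \<open>x\<close> is a C*-seminorm of \<open>x\<close>, so it is dominated by the enveloping norm of
  the crossed product: if \<open>c b c\<^sup>*\<close> is close to \<open>a\<close> with \<open>c\<close> over the crossed product, then \<open>d b d\<^sup>*\<close>
  is close to \<open>a\<close> for the image \<open>d\<close> of \<open>c\<close>. Thus the inclusion reflects Cuntz comparison over \<open>A\<close>,
  and over \<open>\<K> \<otimes> A\<close> by applying the maps entrywise. As all norms involved are enveloping norms,
  the C*-theory needed reduces to two facts: a C*-seminorm on a C*-algebra is bounded by a multiple
  of the norm, and the entries of a matrix are bounded by its norm (the latter through the
  Cauchy--Schwarz inequality in the Hilbert module \<open>A\<^sup>n\<close>).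
\<close>

subsection \<open>Star algebras and C*-seminorms\<close>

text \<open>The two conditions on the unitaries say that conjugation by z_g is almost \<alpha>_g and
  that z is almost a representation of G, so the identity of A and z form an almost covariant pair;
  unitarity then forces z_1 to be almost 1 and z_g almost the adjoint of z at the inverse of g. As A
  need not be separable, one net indexed by finite subsets and tolerances has to serve all elements
  at once. The obstacle is that an enveloping norm means nothing until the supremum is known to be
  finite. Continuity of an arbitrary C*-seminorm needs square roots, which come from an iteration
  that avoids functional calculus. A lower bound for the norm needs one concrete seminorm: the
  operator norm on columns, whose construction rests on the positivity of star x x. For \<K>
  \<otimes> A boundedness on each element is too weak. The maps extend to the completion because
  their amplifications are bounded uniformly in the matrix size; the regular representation yields
  the order of G as such a bound.\<close>

context star_algebra
begin

declare mult_closed [simp, intro] scale_closed [simp, intro] star_closed [simp, intro]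

lemma self_add_eq_zero: "\<lbrakk>y \<in> carrier A; y \<oplus> y = y\<rbrakk> \<Longrightarrow> y = \<zero>"
  using add.l_cancel_one[of y y] by simp

lemma mult_zero_left [simp]: "x \<in> carrier A \<Longrightarrow> \<zero> \<otimes> x = \<zero>"
  by (rule self_add_eq_zero) (simp_all flip: distr_right)

lemma mult_zero_right [simp]: "x \<in> carrier A \<Longrightarrow> x \<otimes> \<zero> = \<zero>"
  by (rule self_add_eq_zero) (simp_all flip: distr_left)

lemma scale_zero_right [simp]: "c \<odot> \<zero> = \<zero>"
  by (rule self_add_eq_zero) (simp_all flip: scale_add_right)

lemma scale_zero_left [simp]: "x \<in> carrier A \<Longrightarrow> 0 \<odot> x = \<zero>"
  by (rule self_add_eq_zero) (simp_all flip: scale_add_left)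

lemma scale_minus_one: "x \<in> carrier A \<Longrightarrow> (- 1) \<odot> x = \<ominus> x"
  using scale_add_left[of x "-1" 1] by (intro minus_equality[symmetric]) (simp_all add: scale_one)

lemma scale_minus_left: "x \<in> carrier A \<Longrightarrow> (- c) \<odot> x = \<ominus> (c \<odot> x)"
  using scale_scale[of x "-1" c] by (simp add: scale_minus_one)

lemma scale_minus_right: "x \<in> carrier A \<Longrightarrow> c \<odot> (\<ominus> x) = \<ominus> (c \<odot> x)"
  using scale_scale[of x c "-1"] scale_minus_left[of x c] by (simp add: scale_minus_one)

lemma mult_minus_left: "\<lbrakk>x \<in> carrier A; y \<in> carrier A\<rbrakk> \<Longrightarrow> (\<ominus> x) \<otimes> y = \<ominus> (x \<otimes> y)"
  using scale_mult_left[of x y "-1"] by (simp add: scale_minus_one)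

lemma mult_minus_right: "\<lbrakk>x \<in> carrier A; y \<in> carrier A\<rbrakk> \<Longrightarrow> x \<otimes> (\<ominus> y) = \<ominus> (x \<otimes> y)"
  using scale_mult_right[of x y "-1"] by (simp add: scale_minus_one)

lemma star_minus: "x \<in> carrier A \<Longrightarrow> star A (\<ominus> x) = \<ominus> star A x"
  using star_scale[of x "-1"] by (simp add: scale_minus_one)

lemma star_zero [simp]: "star A \<zero> = \<zero>"
  by (rule self_add_eq_zero) (simp_all flip: star_add)

lemma minus_self [simp]: "x \<in> carrier A \<Longrightarrow> x \<ominus> x = \<zero>"
  by (simp add: minus_eq r_neg)

lemma minus_zero_eq [simp]: "\<ominus> \<zero> = \<zero>"
  by (rule minus_equality) simp_all

text \<open>Teaches the \<open>algebra\<close> method the normal forms of a noncommutative ring with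
  scalars and involution. Commutation of particular elements is never built in; it is supplied as an
  extra premise where it is used.\<close>

lemmas star_algebra_simprules
  [algebra add: star_algebra "zero A" "add A" "a_inv A" "a_minus A" "mult A" "smult A" "star A"] =
  a_closed zero_closed a_inv_closed minus_closed mult_closed scale_closed star_closed
  a_assoc l_zero l_neg a_comm minus_eq r_zero r_neg r_neg2 r_neg1 minus_add minus_minus
  minus_zero_eq a_lcomm mult_assoc distr_left distr_right mult_minus_left mult_minus_right
  mult_zero_left mult_zero_right star_add star_minus star_mult star_star star_scale star_zero
  scale_add_right scale_minus_right scale_mult_left scale_mult_right scale_zero_right

lemma eq_if_minus_zero: "\<lbrakk>x \<in> carrier A; y \<in> carrier A; x \<ominus> y = \<zero>\<rbrakk> \<Longrightarrow> x = y"
  using minus_equality[of x "\<ominus> y"] by (simp add: minus_eq minus_minus)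

lemma scale_two: "x \<in> carrier A \<Longrightarrow> 2 \<odot> x = x \<oplus> x"
  using scale_add_left[of x 1 1] by (simp add: scale_one)

lemma half_double: "x \<in> carrier A \<Longrightarrow> (1/2) \<odot> (x \<oplus> x) = x"
  using scale_scale[of x "1/2" 2] by (simp add: scale_two scale_one)

lemma double_half: "x \<in> carrier A \<Longrightarrow> (1/2) \<odot> x \<oplus> (1/2) \<odot> x = x"
  using scale_add_left[of x "1/2" "1/2"] by (simp add: scale_one)

lemma finsum_mult_right:
  "\<lbrakk>f \<in> I \<rightarrow> carrier A; y \<in> carrier A\<rbrakk> \<Longrightarrow> (\<Oplus>i\<in>I. f i) \<otimes> y = (\<Oplus>i\<in>I. f i \<otimes> y)"
proof (induction I rule: infinite_finite_induct)
  case (insert i I)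
  then have "f i \<in> carrier A" "f \<in> I \<rightarrow> carrier A" "(\<lambda>i. f i \<otimes> y) \<in> I \<rightarrow> carrier A" by auto
  with insert show ?case by (simp add: distr_right)
qed auto

lemma finsum_mult_left:
  "\<lbrakk>f \<in> I \<rightarrow> carrier A; y \<in> carrier A\<rbrakk> \<Longrightarrow> y \<otimes> (\<Oplus>i\<in>I. f i) = (\<Oplus>i\<in>I. y \<otimes> f i)"
proof (induction I rule: infinite_finite_induct)
  case (insert i I)
  then have "f i \<in> carrier A" "f \<in> I \<rightarrow> carrier A" "(\<lambda>i. y \<otimes> f i) \<in> I \<rightarrow> carrier A" by auto
  with insert show ?case by (simp add: distr_left)
qed auto

lemma finsum_scale: "f \<in> I \<rightarrow> carrier A \<Longrightarrow> c \<odot> (\<Oplus>i\<in>I. f i) = (\<Oplus>i\<in>I. c \<odot> f i)"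
proof (induction I rule: infinite_finite_induct)
  case (insert i I)
  then have "f i \<in> carrier A" "f \<in> I \<rightarrow> carrier A" "(\<lambda>i. c \<odot> f i) \<in> I \<rightarrow> carrier A" by auto
  with insert show ?case by (simp add: scale_add_right)
qed auto

lemma finsum_star: "f \<in> I \<rightarrow> carrier A \<Longrightarrow> star A (\<Oplus>i\<in>I. f i) = (\<Oplus>i\<in>I. star A (f i))"
proof (induction I rule: infinite_finite_induct)
  case (insert i I)
  then have "f i \<in> carrier A" "f \<in> I \<rightarrow> carrier A" "(\<lambda>i. star A (f i)) \<in> I \<rightarrow> carrier A" by auto
  with insert show ?case by (simp add: star_add)
qed auto

lemma finsum_swap:
  assumes "finite I" "finite J" "\<And>i j. \<lbrakk>i \<in> I; j \<in> J\<rbrakk> \<Longrightarrow> f i j \<in> carrier A"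
  shows "(\<Oplus>i\<in>I. \<Oplus>j\<in>J. f i j) = (\<Oplus>j\<in>J. \<Oplus>i\<in>I. f i j)"
  using assms(1,3)
proof (induction I)
  case empty
  show ?case using assms(2) by simp
next
  case (insert i I)
  have 1: "(\<lambda>j. f i j) \<in> J \<rightarrow> carrier A" "\<And>j. j \<in> J \<Longrightarrow> (\<lambda>i. f i j) \<in> I \<rightarrow> carrier A"
    "\<And>j. j \<in> J \<Longrightarrow> f i j \<in> carrier A"
    using insert by auto
  have 2: "(\<lambda>j. \<Oplus>i\<in>I. f i j) \<in> J \<rightarrow> carrier A" "(\<lambda>i. \<Oplus>j\<in>J. f i j) \<in> I \<rightarrow> carrier A"
    "(\<Oplus>j\<in>J. f i j) \<in> carrier A"
    using insert by (auto intro!: finsum_closed)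
  have "(\<Oplus>j\<in>J. \<Oplus>i\<in>insert i I. f i j) = (\<Oplus>j\<in>J. f i j \<oplus> (\<Oplus>i\<in>I. f i j))"
    using 1 insert by (intro finsum_cong') (auto intro!: finsum_insert finsum_closed)
  also have "\<dots> = (\<Oplus>j\<in>J. f i j) \<oplus> (\<Oplus>j\<in>J. \<Oplus>i\<in>I. f i j)"
    using 1 2 by (intro finsum_addf) auto
  finally show ?case using insert 1 2 by simp
qed

end

text \<open>The seminorm is a separate parameter because one algebra carries several of them: an
  arbitrary competitor in the supremum, the norm of the record, or the norm of the regular
  representation.\<close>

locale seminormed_star_algebra = star_algebra A for A :: "('a, 'm) star_alg_scheme" (structure) +
  fixes p :: "'a \<Rightarrow> real"
  assumes seminorm: "cstar_seminorm A p"
begin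

lemma p_nonneg [simp, intro]: "x \<in> carrier A \<Longrightarrow> 0 \<le> p x"
  and p_add: "\<lbrakk>x \<in> carrier A; y \<in> carrier A\<rbrakk> \<Longrightarrow> p (x \<oplus> y) \<le> p x + p y"
  and p_scale: "x \<in> carrier A \<Longrightarrow> p (c \<odot> x) = cmod c * p x"
  and p_mult: "\<lbrakk>x \<in> carrier A; y \<in> carrier A\<rbrakk> \<Longrightarrow> p (x \<otimes> y) \<le> p x * p y"
  and p_star_mult: "x \<in> carrier A \<Longrightarrow> p (star A x \<otimes> x) = (p x)\<^sup>2"
  using seminorm unfolding cstar_seminorm_def by auto

lemma p_zero [simp]: "p \<zero> = 0"
  using p_scale[of \<zero> 0] by simp

lemma p_minus [simp]: "x \<in> carrier A \<Longrightarrow> p (\<ominus> x) = p x"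
  using p_scale[of x "-1"] by (simp add: scale_minus_one)

lemma p_diff: "\<lbrakk>x \<in> carrier A; y \<in> carrier A\<rbrakk> \<Longrightarrow> p (x \<ominus> y) \<le> p x + p y"
  using p_add[of x "\<ominus> y"] by (simp add: minus_eq)

lemma p_diff_commute: "\<lbrakk>x \<in> carrier A; y \<in> carrier A\<rbrakk> \<Longrightarrow> p (x \<ominus> y) = p (y \<ominus> x)"
  using p_minus[of "x \<ominus> y"] by (simp add: minus_eq minus_add minus_minus a_comm)

lemma p_tri:
  assumes "x \<in> carrier A" "y \<in> carrier A" "z \<in> carrier A"
  shows "p (x \<ominus> z) \<le> p (x \<ominus> y) + p (y \<ominus> z)"
proof -
  have "x \<ominus> z = (x \<ominus> y) \<oplus> (y \<ominus> z)" using assms by algebra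
  then show ?thesis using assms p_add[of "x \<ominus> y" "y \<ominus> z"] by simp
qed

lemma p_le_diff:
  assumes "x \<in> carrier A" "y \<in> carrier A"
  shows "p x \<le> p y + p (x \<ominus> y)"
proof -
  have "x = y \<oplus> (x \<ominus> y)" using assms by algebra
  then show ?thesis using assms p_add[of y "x \<ominus> y"] by simp
qed

text \<open>The C*-identity gives p(x)^2 = p(star x x) \<le> p(star x) p(x), hence p(x) \<le> p(star
  x); the same for star x is the reverse inequality.\<close>

lemma p_star [simp]: 
  assumes "x \<in> carrier A"
  shows "p (star A x) = p x"
proof -
  have "p x \<le> p (star A x)" if x: "x \<in> carrier A" for x
  proof (cases "p x = 0")
    case False
    have "p x * p x \<le> p (star A x) * p x"
      using p_star_mult[OF x] p_mult[of "star A x" x] x by (simp add: power2_eq_square)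
    then show ?thesis using False p_nonneg[OF x] by (simp add: mult_le_cancel_right)
  qed (use x in auto)
  from this[of x] this[of "star A x"] show ?thesis using assms by (simp add: star_star)
qed

lemma p_mult_star: "x \<in> carrier A \<Longrightarrow> p (x \<otimes> star A x) = (p x)\<^sup>2"
  using p_star_mult[of "star A x"] by (simp add: star_star)

lemma p_mult_diff:
  assumes "x \<in> carrier A" "y \<in> carrier A" "x' \<in> carrier A" "y' \<in> carrier A"
  shows "p (x \<otimes> y \<ominus> x' \<otimes> y') \<le> p (x \<ominus> x') * p y + p x' * p (y \<ominus> y')"
proof -
  have "(x \<ominus> x') \<otimes> y \<oplus> x' \<otimes> (y \<ominus> y') = (x \<otimes> y \<ominus> x' \<otimes> y) \<oplus> (x' \<otimes> y \<ominus> x' \<otimes> y')"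
    using assms by (simp add: minus_eq distr_left distr_right mult_minus_left mult_minus_right)
  also have "\<dots> = x \<otimes> y \<ominus> x' \<otimes> y'"
    using assms mult_closed[of x y] mult_closed[of x' y] mult_closed[of x' y'] by algebra
  finally show ?thesis
    using p_add[of "(x \<ominus> x') \<otimes> y" "x' \<otimes> (y \<ominus> y')"] p_mult[of "x \<ominus> x'" y] p_mult[of x' "y \<ominus> y'"] assms
    by simp
qed

lemma p_add_diff:
  assumes "x \<in> carrier A" "y \<in> carrier A" "x' \<in> carrier A" "y' \<in> carrier A"
  shows "p ((x \<oplus> y) \<ominus> (x' \<oplus> y')) \<le> p (x \<ominus> x') + p (y \<ominus> y')"
proof -
  have "(x \<oplus> y) \<ominus> (x' \<oplus> y') = (x \<ominus> x') \<oplus> (y \<ominus> y')" using assms by algebra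
  then show ?thesis using assms p_add[of "x \<ominus> x'" "y \<ominus> y'"] by simp
qed

lemma p_scale_diff:
  assumes "x \<in> carrier A" "y \<in> carrier A"
  shows "p (c \<odot> x \<ominus> c \<odot> y) = cmod c * p (x \<ominus> y)"
  using assms p_scale[of "x \<ominus> y" c] by (simp add: minus_eq scale_add_right scale_minus_right)

lemma p_star_diff:
  assumes "x \<in> carrier A" "y \<in> carrier A"
  shows "p (star A x \<ominus> star A y) = p (x \<ominus> y)"
  using assms p_star[of "x \<ominus> y"] by (simp add: minus_eq star_add star_minus del: p_star)

lemma p_finsum: "\<lbrakk>f \<in> I \<rightarrow> carrier A\<rbrakk> \<Longrightarrow> p (\<Oplus>i\<in>I. f i) \<le> (\<Sum>i\<in>I. p (f i))"
proof (induction I rule: infinite_finite_induct)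
  case (insert i I)
  then have "f i \<in> carrier A" "f \<in> I \<rightarrow> carrier A" by auto
  with insert p_add[of "f i" "\<Oplus>i\<in>I. f i"] show ?case by fastforce
qed auto

text \<open>One notion of asymptotic equality serves limits of sequences, Cauchy sequences (through
  a product filter) and the net of unitaries. Membership in the carrier is demanded at every index,
  so that no side condition has to be carried along the filter.\<close>

definition asy :: "'i filter \<Rightarrow> ('i \<Rightarrow> 'a) \<Rightarrow> ('i \<Rightarrow> 'a) \<Rightarrow> bool" where
  "asy F s t \<longleftrightarrow> (\<forall>i. s i \<in> carrier A) \<and> (\<forall>i. t i \<in> carrier A) \<and> ((\<lambda>i. p (s i \<ominus> t i)) \<longlongrightarrow> 0) F"

definition bd :: "'i filter \<Rightarrow> ('i \<Rightarrow> 'a) \<Rightarrow> bool" where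
  "bd F s \<longleftrightarrow> (\<forall>i. s i \<in> carrier A) \<and> (\<exists>C. \<forall>\<^sub>F i in F. p (s i) \<le> C)"

lemma asyI: "\<lbrakk>\<And>i. s i \<in> carrier A; \<And>i. t i \<in> carrier A; \<And>i. p (s i \<ominus> t i) \<le> r i; (r \<longlongrightarrow> 0) F\<rbrakk>
  \<Longrightarrow> asy F s t"
  unfolding asy_def by (auto intro!: tendsto_sandwich[OF _ _ tendsto_const, where h = r])

lemma asy_closed: "asy F s t \<Longrightarrow> s i \<in> carrier A" "asy F s t \<Longrightarrow> t i \<in> carrier A"
  and asy_tendsto: "asy F s t \<Longrightarrow> ((\<lambda>i. p (s i \<ominus> t i)) \<longlongrightarrow> 0) F"
  by (auto simp: asy_def)

lemma asy_refl: "(\<And>i. s i \<in> carrier A) \<Longrightarrow> asy F s s"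
  by (simp add: asy_def)

lemma asy_sym: "asy F s t \<Longrightarrow> asy F t s"
  by (rule asyI[of _ _ "\<lambda>i. p (s i \<ominus> t i)"]) (auto simp: asy_closed p_diff_commute asy_tendsto)

lemma asy_trans: "\<lbrakk>asy F s t; asy F t u\<rbrakk> \<Longrightarrow> asy F s u"
  by (rule asyI[of s u "\<lambda>i. p (s i \<ominus> t i) + p (t i \<ominus> u i)"])
    (auto simp: asy_closed p_tri intro!: tendsto_eq_intros asy_tendsto)

lemma asy_add: "\<lbrakk>asy F s t; asy F s' t'\<rbrakk> \<Longrightarrow> asy F (\<lambda>i. s i \<oplus> s' i) (\<lambda>i. t i \<oplus> t' i)"
  by (rule asyI[of _ _ "\<lambda>i. p (s i \<ominus> t i) + p (s' i \<ominus> t' i)"])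
    (auto simp: asy_closed p_add_diff intro!: tendsto_eq_intros asy_tendsto)

lemma asy_scale: "\<lbrakk>asy F s t\<rbrakk> \<Longrightarrow> asy F (\<lambda>i. c \<odot> s i) (\<lambda>i. c \<odot> t i)"
  by (rule asyI[of _ _ "\<lambda>i. cmod c * p (s i \<ominus> t i)"])
    (auto simp: asy_closed p_scale_diff intro!: tendsto_eq_intros asy_tendsto)

lemma asy_star: "\<lbrakk>asy F s t\<rbrakk> \<Longrightarrow> asy F (\<lambda>i. star A (s i)) (\<lambda>i. star A (t i))"
  by (rule asyI[of _ _ "\<lambda>i. p (s i \<ominus> t i)"])
    (auto simp: asy_closed p_star_diff intro!: tendsto_eq_intros asy_tendsto)

lemma asy_minus: "\<lbrakk>asy F s t; asy F s' t'\<rbrakk> \<Longrightarrow> asy F (\<lambda>i. s i \<ominus> s' i) (\<lambda>i. t i \<ominus> t' i)"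
  using asy_add[of F s t "\<lambda>i. (-1) \<odot> s' i" "\<lambda>i. (-1) \<odot> t' i"] asy_scale[of F s' t' "-1"]
    asy_closed[of F s' t'] by (simp add: scale_minus_one minus_eq)

lemma bd_const: "x \<in> carrier A \<Longrightarrow> bd F (\<lambda>i. x)"
  unfolding bd_def by (auto intro: exI[of _ "p x"])

lemma asy_bd: "\<lbrakk>asy F s t; bd F t\<rbrakk> \<Longrightarrow> bd F s"
proof -
  assume a: "asy F s t" and "bd F t"
  then obtain C where C: "\<forall>\<^sub>F i in F. p (t i) \<le> C" by (auto simp: bd_def)
  have "\<forall>\<^sub>F i in F. p (s i \<ominus> t i) < 1" using asy_tendsto[OF a] by (rule order_tendstoD) simp
  then have "\<forall>\<^sub>F i in F. p (s i) \<le> C + 1"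
    using C
  proof eventually_elim
    case (elim i)
    then show ?case using p_le_diff[of "s i" "t i"] asy_closed[OF a] by simp
  qed
  then show "bd F s" using asy_closed[OF a] by (auto simp: bd_def)
qed

text \<open>The estimate p(s s' - t t') \<le> p(s - t) p(s') + p(t) p(s' - t') needs bounds on t and
  on s'; the latter is inherited from t' by \<open>asy_bd\<close>.\<close>

lemma asy_mult:
  assumes "asy F s t" "asy F s' t'" "bd F t" "bd F t'"
  shows "asy F (\<lambda>i. s i \<otimes> s' i) (\<lambda>i. t i \<otimes> t' i)"
proof -
  note c = asy_closed[OF assms(1)] asy_closed[OF assms(2)]
  obtain C where C: "\<forall>\<^sub>F i in F. p (t i) \<le> C" using assms(3) by (auto simp: bd_def)
  obtain D where D: "\<forall>\<^sub>F i in F. p (s' i) \<le> D" using asy_bd[OF assms(2,4)] by (auto simp: bd_def)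
  have 1: "((\<lambda>i. p (s i \<ominus> t i) * D + C * p (s' i \<ominus> t' i)) \<longlongrightarrow> 0) F"
    by (auto intro!: tendsto_eq_intros asy_tendsto assms)
  have 2: "\<forall>\<^sub>F i in F. p (s i \<otimes> s' i \<ominus> t i \<otimes> t' i) \<le> p (s i \<ominus> t i) * D + C * p (s' i \<ominus> t' i)"
    using C D
  proof eventually_elim
    case (elim i)
    have "p (s i \<ominus> t i) * p (s' i) \<le> p (s i \<ominus> t i) * D" "p (t i) * p (s' i \<ominus> t' i) \<le> C * p (s' i \<ominus> t' i)"
      using elim c by (auto intro!: mult_left_mono mult_right_mono)
    then show ?case using p_mult_diff[of "s i" "s' i" "t i" "t' i"] c by simp
  qed
  have "((\<lambda>i. p (s i \<otimes> s' i \<ominus> t i \<otimes> t' i)) \<longlongrightarrow> 0) F"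
    by (rule tendsto_sandwich[OF _ 2 tendsto_const 1]) (auto simp: c)
  then show ?thesis by (auto simp: asy_def c)
qed

lemma bd_mult: "\<lbrakk>bd F s; bd F t\<rbrakk> \<Longrightarrow> bd F (\<lambda>i. s i \<otimes> t i)"
proof -
  assume a: "bd F s" "bd F t"
  then obtain C D where CD: "\<forall>\<^sub>F i in F. p (s i) \<le> C" "\<forall>\<^sub>F i in F. p (t i) \<le> D" by (auto simp: bd_def)
  then have "\<forall>\<^sub>F i in F. p (s i \<otimes> t i) \<le> C * D"
  proof eventually_elim
    case (elim i)
    then have "p (s i) * p (t i) \<le> C * D"
      using a order_trans[OF p_nonneg[of "s i"], of C] by (intro mult_mono) (auto simp: bd_def)
    then show ?case using p_mult[of "s i" "t i"] a by (auto simp: bd_def)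
  qed
  then show ?thesis using a by (auto simp: bd_def)
qed

lemma bd_star: "bd F s \<Longrightarrow> bd F (\<lambda>i. star A (s i))"
  by (auto simp: bd_def)

lemma asy_norm:
  assumes "asy F s t" "((\<lambda>i. p (t i)) \<longlongrightarrow> c) F"
  shows "((\<lambda>i. p (s i)) \<longlongrightarrow> c) F"
proof -
  note c = asy_closed[OF assms(1)]
  have "((\<lambda>i. p (s i) - p (t i)) \<longlongrightarrow> 0) F"
  proof (rule tendsto_rabs_zero_cancel, rule tendsto_sandwich[OF _ _ tendsto_const asy_tendsto[OF assms(1)]];
      (rule always_eventually, rule allI)?)
    fix i
    show "0 \<le> \<bar>p (s i) - p (t i)\<bar>" by simp
    show "\<bar>p (s i) - p (t i)\<bar> \<le> p (s i \<ominus> t i)"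
      using p_le_diff[of "s i" "t i"] p_le_diff[of "t i" "s i"] p_diff_commute[of "s i" "t i"] c by auto
  qed
  from tendsto_add[OF this assms(2)] show ?thesis by simp
qed

lemma asy_const_zero: "\<lbrakk>asy F (\<lambda>i. x) (\<lambda>i. y); F \<noteq> bot\<rbrakk> \<Longrightarrow> p (x \<ominus> y) = 0"
  unfolding asy_def using tendsto_unique[OF _ tendsto_const] by blast

end

text \<open>Suprema, limits and upper limits yield only inequalities, and these suffice: homogeneity
  follows by scaling back with the inverse scalar, and the C*-identity from submultiplicativity once
  the involution is seen to be isometric.\<close>

lemma cstar_seminormI:
  assumes "star_algebra A"
    and "\<And>x. x \<in> carrier A \<Longrightarrow> 0 \<le> p x"
    and "\<And>x y. \<lbrakk>x \<in> carrier A; y \<in> carrier A\<rbrakk> \<Longrightarrow> p (x \<oplus>\<^bsub>A\<^esub> y) \<le> p x + p y"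
    and "\<And>c x. x \<in> carrier A \<Longrightarrow> p (c \<odot>\<^bsub>A\<^esub> x) \<le> cmod c * p x"
    and m: "\<And>x y. \<lbrakk>x \<in> carrier A; y \<in> carrier A\<rbrakk> \<Longrightarrow> p (x \<otimes>\<^bsub>A\<^esub> y) \<le> p x * p y"
    and s: "\<And>x. x \<in> carrier A \<Longrightarrow> (p x)\<^sup>2 \<le> p (star A x \<otimes>\<^bsub>A\<^esub> x)"
  shows "cstar_seminorm A p"
proof -
  interpret star_algebra A by fact
  have 1: "p x \<le> p (star A x)" if x: "x \<in> carrier A" for x
  proof (cases "p x = 0")
    case False
    have "p x * p x \<le> p (star A x) * p x"
      using s[OF x] m[of "star A x" x] x by (simp add: power2_eq_square)
    then show ?thesis using False assms(2)[OF x] by (simp add: mult_le_cancel_right)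
  qed (use x assms(2) in auto)
  have 2: "p (star A x \<otimes>\<^bsub>A\<^esub> x) = (p x)\<^sup>2" if x: "x \<in> carrier A" for x
  proof -
    have "p (star A x) = p x" using 1[of x] 1[of "star A x"] x by (simp add: star_star)
    then show ?thesis using s[OF x] m[of "star A x" x] x by (simp add: power2_eq_square)
  qed
  have 3: "p (c \<odot>\<^bsub>A\<^esub> x) = cmod c * p x" if x: "x \<in> carrier A" for c x
  proof (cases "c = 0")
    case True
    then show ?thesis using assms(4)[OF x, of 0] assms(2)[of "\<zero>\<^bsub>A\<^esub>"] x by simp
  next
    case False
    have "p x = p (inverse c \<odot>\<^bsub>A\<^esub> (c \<odot>\<^bsub>A\<^esub> x))"
      using scale_scale[OF x, of "inverse c" c] False x by (simp add: scale_one)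
    also have "\<dots> \<le> cmod (inverse c) * p (c \<odot>\<^bsub>A\<^esub> x)" using assms(4)[of "c \<odot>\<^bsub>A\<^esub> x"] x by simp
    finally have "cmod c * p x \<le> p (c \<odot>\<^bsub>A\<^esub> x)" using False by (simp add: norm_inverse divide_simps norm_divide mult.commute)
    then show ?thesis using assms(4)[OF x, of c] by simp
  qed
  show ?thesis unfolding cstar_seminorm_def by (simp add: assms(2,3) 2 3 m)
qed

sublocale cstar_algebra \<subseteq> seminormed_star_algebra A "cnorm A"
  by unfold_locales (rule cnorm_seminorm)

subsection \<open>Automatic continuity of C*-seminorms\<close>

text \<open>The scalar case a = 1 of the iteration \<open>rt\<close> below. It increases to 1, and
  its increments dominate those of \<open>rt\<close> for every a of norm at most one, so the
  boundary case controls the whole unit ball.\<close>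

primrec tseq :: "nat \<Rightarrow> real" where
  "tseq 0 = 0"
| "tseq (Suc n) = (1 + (tseq n)\<^sup>2) / 2"

lemma tseq_bounds: "0 \<le> tseq n \<and> tseq n \<le> 1"
proof (induction n)
  case (Suc n)
  then have "(tseq n)\<^sup>2 \<le> 1" by (simp add: power_le_one)
  then show ?case by simp
qed simp

lemma tseq_mono: "incseq tseq"
proof (rule incseq_SucI)
  fix n
  have "0 \<le> (1 - tseq n)\<^sup>2" by simp
  then show "tseq n \<le> tseq (Suc n)" by (simp add: power2_eq_square algebra_simps)
qed

lemma tseq_Cauchy: "Cauchy tseq"
  by (rule convergent_Cauchy, rule Bseq_mono_convergent)
    (use tseq_bounds in \<open>auto intro!: BseqI[of 1] incseqD[OF tseq_mono]\<close>)

context cstar_algebra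
begin

lemma complete_asy:
  assumes "\<And>n. s n \<in> carrier A" "alg_Cauchy A s"
  shows "\<exists>l\<in>carrier A. asy sequentially s (\<lambda>_. l)"
  using complete[OF assms] assms(1) unfolding alg_tendsto_def asy_def by auto

lemma asy_unique: "\<lbrakk>asy F s (\<lambda>_. x); asy F s (\<lambda>_. y); F \<noteq> bot\<rbrakk> \<Longrightarrow> x = y"
  using asy_const_zero[OF asy_trans[OF asy_sym]] asy_closed
  by (metis cnorm_definite eq_if_minus_zero minus_closed)

text \<open>A fixed point satisfies 2 y = a + y^2, that is (1 - y)^2 = 1 - a. The iteration thus
  produces 1 - sqrt(1 - a) as a limit of polynomials in a with zero constant term, which makes sense
  in an algebra without unit.\<close>

primrec rt :: "'a \<Rightarrow> nat \<Rightarrow> 'a" where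
  "rt a 0 = \<zero>"
| "rt a (Suc n) = (1/2) \<odot> (a \<oplus> rt a n \<otimes> rt a n)"

lemma rt_closed [simp]: "a \<in> carrier A \<Longrightarrow> rt a n \<in> carrier A"
  by (induction n) simp_all

lemma rt_commute:
  assumes "a \<in> carrier A" "b \<in> carrier A" "a \<otimes> b = b \<otimes> a"
  shows "rt a n \<otimes> b = b \<otimes> rt a n"
proof (induction n)
  case (Suc n)
  let ?y = "rt a n"
  have "?y \<otimes> ?y \<otimes> b = ?y \<otimes> (b \<otimes> ?y)" using assms Suc by (simp add: mult_assoc)
  also have "\<dots> = ?y \<otimes> b \<otimes> ?y" using assms by (simp add: mult_assoc)
  also have "\<dots> = b \<otimes> (?y \<otimes> ?y)" using assms Suc by (simp add: mult_assoc)
  finally show ?case using assms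
    by (simp add: scale_mult_left scale_mult_right distr_left distr_right)
qed (use assms in simp)

lemma rt_sa: "\<lbrakk>a \<in> carrier A; star A a = a\<rbrakk> \<Longrightarrow> star A (rt a n) = rt a n"
  by (induction n) (simp_all add: star_scale star_add star_mult)

lemma rt_norm:
  assumes "a \<in> carrier A" "cnorm A a \<le> 1"
  shows "cnorm A (rt a n) \<le> tseq n"
proof (induction n)
  case (Suc n)
  have "cnorm A (a \<oplus> rt a n \<otimes> rt a n) \<le> cnorm A a + cnorm A (rt a n) * cnorm A (rt a n)"
    using p_add[of a "rt a n \<otimes> rt a n"] p_mult[of "rt a n" "rt a n"] assms by simp
  also have "\<dots> \<le> 1 + tseq n * tseq n"
    using assms Suc tseq_bounds[of n] by (intro add_mono mult_mono) auto
  finally show ?case using assms by (simp add: p_scale power2_eq_square)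
qed simp

text \<open>All iterates are polynomials in a and commute, so the difference of consecutive squares
  factors as (Y + X)(Y - X). The same factorisation of the scalar recursion reproduces the
  majorant.\<close>

lemma rt_diff:
  assumes "a \<in> carrier A" "cnorm A a \<le> 1"
  shows "cnorm A (rt a (Suc n) \<ominus> rt a n) \<le> tseq (Suc n) - tseq n"
proof (induction n)
  case 0
  then show ?case using assms by (simp add: p_scale minus_eq)
next
  case (Suc n)
  let ?x = "rt a n" and ?y = "rt a (Suc n)"
  have c: "?x \<in> carrier A" "?y \<in> carrier A" using assms by (simp_all del: rt.simps)
  have aux: "(1/2) \<odot> (a \<oplus> Y \<otimes> Y) \<ominus> (1/2) \<odot> (a \<oplus> X \<otimes> X) = (1/2) \<odot> ((Y \<oplus> X) \<otimes> (Y \<ominus> X))"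
    if "X \<in> carrier A" "Y \<in> carrier A" "a \<in> carrier A" "Y \<otimes> X = X \<otimes> Y" for X Y
    using that by algebra
  have "?y \<otimes> ?x = ?x \<otimes> ?y"
    by (rule rt_commute[OF assms(1) c(1) rt_commute[OF assms(1) assms(1) refl, symmetric]])
  then have "rt a (Suc (Suc n)) \<ominus> ?y = (1/2) \<odot> ((?y \<oplus> ?x) \<otimes> (?y \<ominus> ?x))"
    unfolding rt.simps(2)[of a "Suc n"] using aux[OF c assms(1)] by simp
  then have "cnorm A (rt a (Suc (Suc n)) \<ominus> ?y) = 1/2 * cnorm A ((?y \<oplus> ?x) \<otimes> (?y \<ominus> ?x))"
    using c by (simp add: p_scale del: rt.simps)
  also have "\<dots> \<le> 1/2 * (cnorm A (?y \<oplus> ?x) * cnorm A (?y \<ominus> ?x))"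
    using p_mult[of "?y \<oplus> ?x" "?y \<ominus> ?x"] c by (simp del: rt.simps)
  also have "\<dots> \<le> 1/2 * ((tseq (Suc n) + tseq n) * (tseq (Suc n) - tseq n))"
  proof -
    have "cnorm A (?y \<oplus> ?x) \<le> tseq (Suc n) + tseq n"
      using p_add[of ?y ?x] rt_norm[OF assms, of n] rt_norm[OF assms, of "Suc n"] c by linarith
    then show ?thesis using Suc c tseq_bounds[of n] tseq_bounds[of "Suc n"]
      by (intro mult_left_mono mult_mono) (auto simp del: rt.simps tseq.simps)
  qed
  also have "\<dots> = tseq (Suc (Suc n)) - tseq (Suc n)"
    unfolding tseq.simps(2)[of "Suc n"] using tseq.simps(2)[of n]
    by (simp only: power2_eq_square) (simp add: field_simps)
  finally show ?case .
qed

lemma rt_diff':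
  assumes "a \<in> carrier A" "cnorm A a \<le> 1" "n \<le> m"
  shows "cnorm A (rt a m \<ominus> rt a n) \<le> tseq m - tseq n"
  using assms(3)
proof (induction m rule: dec_induct)
  case base
  then show ?case using assms by simp
next
  case (step m)
  have "cnorm A (rt a (Suc m) \<ominus> rt a n) \<le> cnorm A (rt a (Suc m) \<ominus> rt a m) + cnorm A (rt a m \<ominus> rt a n)"
    using assms by (intro p_tri) (simp_all del: rt.simps)
  then show ?case using step rt_diff[OF assms(1,2), of m] by linarith
qed

lemma rt_Cauchy:
  assumes "a \<in> carrier A" "cnorm A a \<le> 1"
  shows "alg_Cauchy A (rt a)"
  unfolding alg_Cauchy_def
proof (intro allI impI)
  fix e :: real assume "e > 0"
  then obtain N where N: "\<And>m n. m \<ge> N \<Longrightarrow> n \<ge> N \<Longrightarrow> \<bar>tseq m - tseq n\<bar> < e"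
    using tseq_Cauchy unfolding Cauchy_def dist_real_def by meson
  have "cnorm A (rt a m \<ominus> rt a n) < e" if "m \<ge> N" "n \<ge> N" for m n
  proof (cases "n \<le> m")
    case True
    then show ?thesis using rt_diff'[OF assms True] N[OF that] by linarith
  next
    case False
    then show ?thesis
      using rt_diff'[OF assms, of m n] N[OF that] p_diff_commute[of "rt a n" "rt a m"] assms by simp
  qed
  then show "\<exists>N. \<forall>m\<ge>N. \<forall>n\<ge>N. cnorm A (rt a m \<ominus> rt a n) < e" by blast
qed

text \<open>Every property of the iterates passes to the limit y = 1 - sqrt(1 - a). The commutation
  clause takes the place of functional calculus: roots commute with whatever commutes with a, which
  later allows products of roots to be rearranged.\<close>

lemma root_exists:
  assumes "a \<in> carrier A" "cnorm A a \<le> 1"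
  obtains y where "y \<in> carrier A" "cnorm A y \<le> 1" "y \<oplus> y = a \<oplus> y \<otimes> y"
    "star A a = a \<Longrightarrow> star A y = y"
    "\<And>b. \<lbrakk>b \<in> carrier A; a \<otimes> b = b \<otimes> a\<rbrakk> \<Longrightarrow> y \<otimes> b = b \<otimes> y"
proof -
  obtain y where y: "y \<in> carrier A" "asy sequentially (rt a) (\<lambda>_. y)"
    using complete_asy[OF _ rt_Cauchy[OF assms]] assms(1) by auto
  note a = y(2) and F = sequentially_bot
  have b: "bd sequentially (\<lambda>_. b)" if "b \<in> carrier A" for b :: 'a using that by (rule bd_const)
  have r: "asy sequentially (\<lambda>_. b) (\<lambda>_. b)" if "b \<in> carrier A" for b :: 'a using that by (simp add: asy_refl)
  show ?thesis
  proof (rule that)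
    show "y \<in> carrier A" by fact
    have "(\<lambda>n. cnorm A (rt a n \<ominus> y)) \<longlonglongrightarrow> 0" using asy_tendsto[OF a] .
    then have "(\<lambda>n. 1 + cnorm A (rt a n \<ominus> y)) \<longlonglongrightarrow> 1" by (auto intro!: tendsto_eq_intros)
    then show "cnorm A y \<le> 1"
    proof (rule tendsto_lowerbound)
      have "cnorm A y \<le> 1 + cnorm A (rt a n \<ominus> y)" for n
        using p_le_diff[of y "rt a n"] rt_norm[OF assms, of n] tseq_bounds[of n]
          p_diff_commute[of y "rt a n"] y(1) assms(1) by simp
      then show "\<forall>\<^sub>F n in sequentially. cnorm A y \<le> 1 + cnorm A (rt a n \<ominus> y)" by simp
    qed simp
    have "asy sequentially (\<lambda>n. rt a (Suc n)) (\<lambda>_. (1/2) \<odot> (a \<oplus> y \<otimes> y))"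
      using asy_scale[OF asy_add[OF r[OF assms(1)] asy_mult[OF a a b[OF y(1)] b[OF y(1)]]], of "1/2"]
      by simp
    moreover have "asy sequentially (\<lambda>n. rt a (Suc n)) (\<lambda>_. y)"
      using a LIMSEQ_Suc[OF asy_tendsto[OF a]] by (auto simp: asy_def simp del: rt.simps)
    ultimately have "y = (1/2) \<odot> (a \<oplus> y \<otimes> y)" using asy_unique[OF _ _ F] by blast
    then have "y \<oplus> y = (1/2) \<odot> (a \<oplus> y \<otimes> y) \<oplus> (1/2) \<odot> (a \<oplus> y \<otimes> y)" by metis
    then show "y \<oplus> y = a \<oplus> y \<otimes> y" using assms(1) y(1) by (simp add: double_half)
    show "star A y = y" if "star A a = a"
    proof -
      have "asy sequentially (rt a) (\<lambda>_. star A y)"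
        using asy_star[OF a] rt_sa[OF assms(1) that] by simp
      then show ?thesis using asy_unique[OF _ a F] by blast
    qed
    fix c assume c: "c \<in> carrier A" "a \<otimes> c = c \<otimes> a"
    have "asy sequentially (\<lambda>n. rt a n \<otimes> c) (\<lambda>_. y \<otimes> c)"
      by (intro asy_mult a b r y c)
    moreover have "asy sequentially (\<lambda>n. rt a n \<otimes> c) (\<lambda>_. c \<otimes> y)"
      unfolding rt_commute[OF assms(1) c] by (intro asy_mult a b r y c)
    ultimately show "y \<otimes> c = c \<otimes> y" using asy_unique[OF _ _ F] by blast
  qed
qed

text \<open>For \<^term>\<open>x\<close> self-adjoint of norm at most one and \<open>y = 1 - sqrt (1 - x\<^sup>2)\<close>, the element
  \<open>v = x - i y\<close> satisfies \<open>v\<^sup>* v = 2 y = i (v - v\<^sup>*)\<close>; this says that \<open>v + i\<close> is unitary.\<close>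

lemma cstar_seminorm_le_sa:
  assumes p: "cstar_seminorm A p" and x: "x \<in> carrier A" "star A x = x" "cnorm A x \<le> 1"
  shows "p x \<le> 2"
proof -
  interpret P: seminormed_star_algebra A p by unfold_locales fact
  have "cnorm A (x \<otimes> x) \<le> 1"
    using p_mult[of x x] x mult_mono[of "cnorm A x" 1 "cnorm A x" 1] by auto
  then obtain y where y: "y \<in> carrier A" "y \<oplus> y = x \<otimes> x \<oplus> y \<otimes> y" "star A y = y" "y \<otimes> x = x \<otimes> y"
    using root_exists[of "x \<otimes> x"] x by (metis mult_assoc mult_closed star_mult)
  define j where "j = \<i> \<odot> y"
  define v where "v = x \<ominus> j"
  have j: "j \<in> carrier A" "star A j = \<ominus> j" "j \<otimes> j = \<ominus> (y \<otimes> y)" "x \<otimes> j = j \<otimes> x"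
    using x y scale_scale[of "y \<otimes> y" \<i> \<i>]
    by (simp_all add: j_def star_scale scale_minus_left scale_mult_left scale_mult_right scale_minus_one scale_one)
  have sv: "star A v = x \<oplus> j" using x j by (simp add: v_def minus_eq star_add star_minus minus_minus)
  have v: "v \<in> carrier A" using x j by (simp add: v_def)
  have "star A v \<otimes> v = x \<otimes> x \<ominus> j \<otimes> j" unfolding sv unfolding v_def using x(1) j(1,4) by algebra
  then have 1: "star A v \<otimes> v = y \<oplus> y" using x y j by (simp add: minus_eq minus_minus)
  have "v \<ominus> star A v = \<ominus> (j \<oplus> j)" unfolding sv unfolding v_def using x(1) j(1) by algebra
  also have "j \<oplus> j = \<i> \<odot> (y \<oplus> y)" unfolding j_def by (rule scale_add_right[OF y(1) y(1), symmetric])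
  finally have "p (v \<ominus> star A v) = p (y \<oplus> y)" using y x(1) by (simp add: P.p_scale)
  \<comment> \<open>Both \<open>star A v \<otimes> v\<close> and, up to the scalar -i,
    \<open>v \<ominus> star A v\<close> equal 2 y. So the C*-identity bounds the square of
    \<open>p v\<close> by \<open>p (v \<ominus> star A v)\<close>, a quantity linear in
    \<open>p v\<close>, with no continuity of p involved.\<close>
  then have "(p v)\<^sup>2 \<le> 2 * p v"
    using P.p_star_mult[OF v] 1 P.p_diff[of v "star A v"] v by simp
  then have pv: "p v \<le> 2" using P.p_nonneg[OF v]
    by (cases "p v = 0") (auto simp: power2_eq_square)
  have "v \<oplus> star A v = x \<oplus> x" unfolding sv unfolding v_def using x(1) j(1) by algebra
  then have "2 \<odot> x = v \<oplus> star A v" using x by (simp add: scale_two)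
  then have "2 * p x \<le> 2 * p v"
    using P.p_scale[OF x(1), of 2] P.p_add[of v "star A v"] v by simp
  then show ?thesis using pv by simp
qed

text \<open>Scaling gives the self-adjoint case; the general case follows by applying it to star x x
  and using the C*-identities of p and of the norm. The factor 2 stems from the self-adjoint
  estimate; any constant independent of p makes the suprema over all C*-seminorms finite.\<close>

theorem cstar_seminorm_le:
  assumes p: "cstar_seminorm A p" and x: "x \<in> carrier A"
  shows "p x \<le> 2 * cnorm A x"
proof -
  interpret P: seminormed_star_algebra A p by unfold_locales fact
  have sa: "p x \<le> 2 * cnorm A x" if x: "x \<in> carrier A" "star A x = x" for x
  proof (cases "cnorm A x = 0")
    case True
    then show ?thesis using cnorm_definite[OF x(1)] by simp
  next
    case False
    then have n: "cnorm A x > 0" using x p_nonneg[of x] by linarith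
    define c where "c = complex_of_real (1 / cnorm A x)"
    have "p (c \<odot> x) \<le> 2"
      using x n by (intro cstar_seminorm_le_sa[OF p]) (simp_all add: star_scale p_scale c_def norm_divide)
    then show ?thesis using x n by (simp add: P.p_scale c_def norm_divide field_simps)
  qed
  have "(p x)\<^sup>2 \<le> 2 * (cnorm A x)\<^sup>2"
    using sa[of "star A x \<otimes> x"] x by (simp add: star_mult star_star P.p_star_mult p_star_mult)
  also have "\<dots> \<le> (2 * cnorm A x)\<^sup>2" by (simp add: power_mult_distrib)
  finally show ?thesis using x by (auto intro: power2_le_imp_le)
qed

end

subsection \<open>Positivity in unital C*-algebras\<close>

context unital_cstar_algebra
begin

declare one_closed [simp, intro] one_left [simp] one_right [simp]

lemma star_one [simp]: "star A \<one> = \<one>"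
  using star_mult[of "star A \<one>" \<one>] by (simp add: star_star)

lemmas unital_simprules
  [algebra add: star_algebra "zero A" "add A" "a_inv A" "a_minus A" "mult A" "smult A" "star A"] =
  one_closed one_left one_right star_one

lemma norm_one_le: "cnorm A \<one> \<le> 1"
  using p_star_mult[of \<one>] by (auto simp: power2_eq_square)

text \<open>Being the square of a self-adjoint element is the form of positivity in which roots are
  at hand. That every star x x is positive in this sense is the theorem
  \<open>pos_star_mult\<close>, reached only after the order properties below.\<close>

definition pos :: "'a \<Rightarrow> bool" where
  "pos a \<longleftrightarrow> (\<exists>r\<in>carrier A. star A r = r \<and> a = r \<otimes> r)"

lemma posI: "\<lbrakk>r \<in> carrier A; star A r = r\<rbrakk> \<Longrightarrow> pos (r \<otimes> r)"
  unfolding pos_def by blast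

lemma pos_closed [simp]: "pos a \<Longrightarrow> a \<in> carrier A"
  and pos_star: "pos a \<Longrightarrow> star A a = a"
  unfolding pos_def by (auto simp: star_mult)

lemma pos_zero: "pos \<zero>" using posI[of \<zero>] by simp

text \<open>As r and s commute, u = r + i s satisfies star u u = 1 and so has norm at most one, and
  r is the real part of u.\<close>

lemma norm_le_one_if_sum_squares:
  assumes "r \<in> carrier A" "s \<in> carrier A" "star A r = r" "star A s = s" "r \<otimes> s = s \<otimes> r"
    "r \<otimes> r \<oplus> s \<otimes> s = \<one>"
  shows "cnorm A r \<le> 1"
proof -
  define j where "j = \<i> \<odot> s"
  have j: "j \<in> carrier A" "star A j = \<ominus> j" "r \<otimes> j = j \<otimes> r" "j \<otimes> j = \<ominus> (s \<otimes> s)"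
    using assms scale_scale[of "s \<otimes> s" \<i> \<i>]
    by (simp_all add: j_def star_scale scale_minus_left scale_mult_left scale_mult_right
        scale_minus_one scale_one)
  let ?u = "r \<oplus> j"
  have su: "star A ?u = r \<ominus> j" using assms j by (simp add: star_add minus_eq)
  have "star A ?u \<otimes> ?u = r \<otimes> r \<ominus> j \<otimes> j" unfolding su using assms(1) j(1,3) by algebra
  also have "\<dots> = \<one>" using assms j by (simp add: minus_eq minus_minus)
  finally have "(cnorm A ?u)\<^sup>2 \<le> 1" using p_star_mult[of ?u] assms(1) j(1) norm_one_le by simp
  then have u: "cnorm A ?u \<le> 1" using power2_le_imp_le[of "cnorm A ?u" 1] by simp
  have "r \<oplus> r = ?u \<oplus> star A ?u" unfolding su using assms(1) j(1) by algebra
  then have "2 \<odot> r = ?u \<oplus> star A ?u" using assms by (simp add: scale_two)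
  then have "2 * cnorm A r \<le> 2 * cnorm A ?u"
    using p_scale[of r 2] p_add[of ?u "star A ?u"] assms(1) j(1) by simp
  with u show ?thesis by simp
qed

text \<open>Together with \<open>pos_if_bound\<close> this characterises positivity by a norm
  condition, without spectra. For r scaled to x of norm at most one, s = sqrt(1 - x^2) commutes with
  x and s^2 + x^2 = 1, so 1 - x^2 = s^2 has norm at most one.\<close>

lemma pos_bound:
  assumes "pos a"
  obtains t :: real where "t > 0" "cnorm A (t \<odot> \<one> \<ominus> a) \<le> t"
proof -
  obtain r where r: "r \<in> carrier A" "star A r = r" "a = r \<otimes> r" using assms by (auto simp: pos_def)
  \<comment> \<open>The summand 1 keeps c positive when r is zero.\<close>
  define c where "c = cnorm A r + 1"
  have c: "c > 0" unfolding c_def using p_nonneg[OF r(1)] by linarith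
  define x where "x = complex_of_real (1/c) \<odot> r"
  have x: "x \<in> carrier A" "star A x = x" "cnorm A x \<le> 1"
    using r c by (simp_all add: x_def star_scale p_scale norm_divide) (simp add: c_def)
  have "cnorm A (x \<otimes> x) \<le> 1"
    using p_mult[of x x] x mult_mono[of "cnorm A x" 1 "cnorm A x" 1] by auto
  then obtain y where y: "y \<in> carrier A" "y \<oplus> y = x \<otimes> x \<oplus> y \<otimes> y" "star A y = y" "y \<otimes> x = x \<otimes> y"
    using root_exists[of "x \<otimes> x"] x by (metis mult_assoc mult_closed star_mult)
  let ?s = "\<one> \<ominus> y"
  have "?s \<otimes> ?s = \<one> \<oplus> y \<otimes> y \<ominus> (y \<oplus> y)" using y(1) by algebra
  also have "\<dots> = \<one> \<ominus> x \<otimes> x" unfolding y(2) using x(1) y(1) by algebra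
  finally have ss: "?s \<otimes> ?s = \<one> \<ominus> x \<otimes> x" .
  have "cnorm A ?s \<le> 1"
  proof (rule norm_le_one_if_sum_squares[of ?s x])
    show "?s \<otimes> x = x \<otimes> ?s" using y(1,4) x(1) by algebra
    show "?s \<otimes> ?s \<oplus> x \<otimes> x = \<one>" unfolding ss using x(1) by algebra
  qed (use x y in \<open>simp_all add: minus_eq star_add star_minus\<close>)
  then have "cnorm A (\<one> \<ominus> x \<otimes> x) \<le> 1"
    unfolding ss[symmetric] using p_mult[of ?s ?s] y mult_mono[of "cnorm A ?s" 1 "cnorm A ?s" 1] by auto
  moreover have "complex_of_real (c * c) \<odot> \<one> \<ominus> a = complex_of_real (c * c) \<odot> (\<one> \<ominus> x \<otimes> x)"
  proof -
    have "complex_of_real (c * c) \<odot> (x \<otimes> x) = a"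
      using r c scale_scale[of "r \<otimes> r" "complex_of_real (1/c)" "complex_of_real (1/c)"]
        scale_scale[of "r \<otimes> r" "complex_of_real (c*c)" "complex_of_real (1/c) * complex_of_real (1/c)"]
      by (simp add: x_def scale_mult_left scale_mult_right scale_one)
    then show ?thesis using x by (simp add: scale_add_right scale_minus_right minus_eq)
  qed
  ultimately have "cnorm A (complex_of_real (c * c) \<odot> \<one> \<ominus> a) \<le> c * c"
    using x c by (simp add: p_scale norm_mult)
  then show ?thesis using that[of "c * c"] c by simp
qed

text \<open>Writing a = t (1 - h) with h of norm at most one, the root is sqrt t times s = 1 - y for
  the y of \<open>root_exists\<close>. The bound on 1 - s is recorded because it makes s, and with
  it the root, positive by the norm criterion.\<close>

lemma pos_root_aux:
  assumes "a \<in> carrier A" "star A a = a" "t > 0" "cnorm A (complex_of_real t \<odot> \<one> \<ominus> a) \<le> t"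
  obtains r s where "r \<in> carrier A" "star A r = r" "a = r \<otimes> r" "r = complex_of_real (sqrt t) \<odot> s"
    "s \<in> carrier A" "star A s = s" "cnorm A (\<one> \<ominus> s) \<le> 1"
    "\<And>b. \<lbrakk>b \<in> carrier A; a \<otimes> b = b \<otimes> a\<rbrakk> \<Longrightarrow> r \<otimes> b = b \<otimes> r"
proof -
  define x where "x = complex_of_real (1/t) \<odot> a"
  define h where "h = \<one> \<ominus> x"
  have x: "x \<in> carrier A" "star A x = x" using assms by (simp_all add: x_def star_scale)
  have a: "a = complex_of_real t \<odot> x"
    using assms scale_scale[of a "complex_of_real t" "complex_of_real (1/t)"]
    by (simp add: x_def scale_one)
  have h: "h \<in> carrier A" "star A h = h" using x by (simp_all add: h_def minus_eq star_add star_minus)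
  have "complex_of_real t \<odot> \<one> \<ominus> a = complex_of_real t \<odot> h"
    using x by (simp add: h_def a scale_add_right scale_minus_right minus_eq)
  then have nh: "cnorm A h \<le> 1" using assms(3,4) h by (simp add: p_scale)
  obtain y where y: "y \<in> carrier A" "cnorm A y \<le> 1" "y \<oplus> y = h \<oplus> y \<otimes> y" "star A y = y"
    "\<And>b. \<lbrakk>b \<in> carrier A; h \<otimes> b = b \<otimes> h\<rbrakk> \<Longrightarrow> y \<otimes> b = b \<otimes> y"
    using root_exists[OF h(1) nh] h(2) by metis
  define s where "s = \<one> \<ominus> y"
  have s: "s \<in> carrier A" "star A s = s" using y by (simp_all add: s_def minus_eq star_add star_minus)
  have "s \<otimes> s = \<one> \<oplus> y \<otimes> y \<ominus> (y \<oplus> y)" unfolding s_def using y(1) by algebra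
  also have "\<dots> = \<one> \<ominus> h" unfolding y(3) using h(1) y(1) by algebra
  also have "\<dots> = x" unfolding h_def using x(1) by algebra
  finally have ss: "s \<otimes> s = x" .
  define r where "r = complex_of_real (sqrt t) \<odot> s"
  have r: "r \<in> carrier A" "star A r = r" using s by (simp_all add: r_def star_scale)
  have rr: "a = r \<otimes> r"
    using s ss assms(3) scale_scale[of x "complex_of_real (sqrt t)" "complex_of_real (sqrt t)"] x
    by (simp add: r_def a scale_mult_left scale_mult_right flip: of_real_mult)
  have "\<one> \<ominus> s = y" unfolding s_def using y(1) by algebra
  then have n: "cnorm A (\<one> \<ominus> s) \<le> 1" using y by simp
  have "r \<otimes> b = b \<otimes> r" if b: "b \<in> carrier A" "a \<otimes> b = b \<otimes> a" for b
  proof -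
    have "x \<otimes> b = b \<otimes> x" using b assms(1) by (simp add: x_def scale_mult_left scale_mult_right)
    then have "h \<otimes> b = b \<otimes> h" unfolding h_def using x(1) b(1) by algebra
    then have "y \<otimes> b = b \<otimes> y" using y(5) b by blast
    then have "s \<otimes> b = b \<otimes> s" unfolding s_def using y(1) b(1) by algebra
    then show ?thesis using s b by (simp add: r_def scale_mult_left scale_mult_right)
  qed
  then show ?thesis using that[of r s] r rr r_def s n by blast
qed

lemma pos_if_bound:
  "\<lbrakk>a \<in> carrier A; star A a = a; t > 0; cnorm A (complex_of_real t \<odot> \<one> \<ominus> a) \<le> t\<rbrakk> \<Longrightarrow> pos a"
  using pos_root_aux[of a t] posI by metis

lemma pos_scale:
  assumes "pos a" "t \<ge> 0"
  shows "pos (complex_of_real t \<odot> a)"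
proof -
  obtain r where r: "r \<in> carrier A" "star A r = r" "a = r \<otimes> r" using assms by (auto simp: pos_def)
  have "complex_of_real t \<odot> a = (complex_of_real (sqrt t) \<odot> r) \<otimes> (complex_of_real (sqrt t) \<odot> r)"
    using r assms(2) scale_scale[of a "complex_of_real (sqrt t)" "complex_of_real (sqrt t)"]
    by (simp add: scale_mult_left scale_mult_right flip: of_real_mult)
  then show ?thesis using posI[of "complex_of_real (sqrt t) \<odot> r"] r by (simp add: star_scale)
qed

lemma pos_root:
  assumes "pos a"
  obtains r where "pos r" "a = r \<otimes> r"
    "\<And>b. \<lbrakk>b \<in> carrier A; a \<otimes> b = b \<otimes> a\<rbrakk> \<Longrightarrow> r \<otimes> b = b \<otimes> r"
proof -
  obtain t :: real where t: "t > 0" "cnorm A (t \<odot> \<one> \<ominus> a) \<le> t" using pos_bound[OF assms] by blast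
  obtain r s where rs: "r \<in> carrier A" "star A r = r" "a = r \<otimes> r" "r = complex_of_real (sqrt t) \<odot> s"
    "s \<in> carrier A" "star A s = s" "cnorm A (\<one> \<ominus> s) \<le> 1"
    "\<And>b. \<lbrakk>b \<in> carrier A; a \<otimes> b = b \<otimes> a\<rbrakk> \<Longrightarrow> r \<otimes> b = b \<otimes> r"
    using pos_root_aux[OF pos_closed[OF assms] pos_star[OF assms] t] by metis
  have "pos s" using pos_if_bound[of s 1] rs(5-7) by (simp add: scale_one)
  then have "pos r" unfolding rs(4) using t by (intro pos_scale) auto
  then show ?thesis using that rs(3,8) by blast
qed

text \<open>A sum of two squares is not visibly a square, but the norm criterion is additive: bounds
  t for a and s for b give the bound t + s for a + b.\<close>

lemma pos_add:
  assumes "pos a" "pos b"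
  shows "pos (a \<oplus> b)"
proof -
  obtain t :: real where t: "t > 0" "cnorm A (t \<odot> \<one> \<ominus> a) \<le> t" using pos_bound[OF assms(1)] by blast
  obtain s :: real where s: "s > 0" "cnorm A (s \<odot> \<one> \<ominus> b) \<le> s" using pos_bound[OF assms(2)] by blast
  show ?thesis
  proof (rule pos_if_bound[of _ "t + s"])
    show "star A (a \<oplus> b) = a \<oplus> b" using assms pos_star by (simp add: star_add)
    have "cnorm A ((t \<odot> \<one> \<oplus> s \<odot> \<one>) \<ominus> (a \<oplus> b)) \<le> t + s"
      using p_add_diff[of "t \<odot> \<one>" "s \<odot> \<one>" a b] assms t s by simp
    then show "cnorm A (complex_of_real (t + s) \<odot> \<one> \<ominus> (a \<oplus> b)) \<le> t + s"
      by (simp add: scale_add_left)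
  qed (use assms t s in auto)
qed

lemma pos_finsum: "(\<And>i. i \<in> I \<Longrightarrow> pos (f i)) \<Longrightarrow> pos (\<Oplus>i\<in>I. f i)"
proof (induction I rule: infinite_finite_induct)
  case (insert i I)
  then have "f \<in> I \<rightarrow> carrier A" by auto
  with insert show ?case by (simp add: pos_add)
qed (auto simp: pos_zero)

text \<open>The root of a commutes with b, hence the root of b commutes with the root of a, and a b
  is the square of the product of the two roots.\<close>

lemma pos_mult_commute:
  assumes "pos a" "pos b" "a \<otimes> b = b \<otimes> a"
  shows "pos (a \<otimes> b)"
proof -
  note c = pos_closed[OF assms(1)] pos_closed[OF assms(2)]
  obtain r where r: "pos r" "a = r \<otimes> r" "\<And>b. \<lbrakk>b \<in> carrier A; a \<otimes> b = b \<otimes> a\<rbrakk> \<Longrightarrow> r \<otimes> b = b \<otimes> r"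
    using pos_root[OF assms(1)] by blast
  obtain s where s: "pos s" "b = s \<otimes> s" "\<And>a. \<lbrakk>a \<in> carrier A; b \<otimes> a = a \<otimes> b\<rbrakk> \<Longrightarrow> s \<otimes> a = a \<otimes> s"
    using pos_root[OF assms(2)] by blast
  have cc: "r \<in> carrier A" "s \<in> carrier A" using r(1) s(1) by auto
  have "s \<otimes> r = r \<otimes> s" by (rule s(3)[OF cc(1) r(3)[OF c(2) assms(3), symmetric]])
  then have rs: "r \<otimes> s = s \<otimes> r" by simp
  have "r \<otimes> s \<otimes> (r \<otimes> s) = r \<otimes> (s \<otimes> r) \<otimes> s" using cc by (simp add: mult_assoc)
  also have "\<dots> = a \<otimes> b" unfolding rs[symmetric] r(2) s(2) using cc by (simp add: mult_assoc)
  finally show ?thesis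
    using posI[of "r \<otimes> s"] rs cc pos_star[OF r(1)] pos_star[OF s(1)] by (simp add: star_mult)
qed

text \<open>After division by c, both x and 1 - x are squares of commuting self-adjoint r and w with
  r^2 + w^2 = 1, so \<open>norm_le_one_if_sum_squares\<close> bounds r.\<close>

lemma pos_norm_le:
  assumes "pos a" "pos (complex_of_real c \<odot> \<one> \<ominus> a)" "c > 0"
  shows "cnorm A a \<le> c"
proof -
  define x where "x = complex_of_real (1/c) \<odot> a"
  have x: "pos x" using assms pos_scale[of a "1/c"] by (simp add: x_def)
  have "\<one> \<ominus> x = complex_of_real (1/c) \<odot> (complex_of_real c \<odot> \<one> \<ominus> a)"
    using assms scale_scale[of \<one> "complex_of_real (1/c)" "complex_of_real c"]
    by (simp add: x_def minus_eq scale_add_right scale_minus_right scale_one)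
  then have 1: "pos (\<one> \<ominus> x)" using assms pos_scale[OF assms(2), of "1/c"] by simp
  obtain r where r: "r \<in> carrier A" "star A r = r" "x = r \<otimes> r" using x by (auto simp: pos_def)
  obtain w where w: "pos w" "\<one> \<ominus> x = w \<otimes> w"
    "\<And>b. \<lbrakk>b \<in> carrier A; (\<one> \<ominus> x) \<otimes> b = b \<otimes> (\<one> \<ominus> x)\<rbrakk> \<Longrightarrow> w \<otimes> b = b \<otimes> w"
    using pos_root[OF 1] by blast
  have "(\<one> \<ominus> x) \<otimes> r = r \<otimes> (\<one> \<ominus> x)" unfolding r(3) using r(1) by algebra
  then have "r \<otimes> w = w \<otimes> r" using w(3)[OF r(1)] by simp
  moreover have "r \<otimes> r \<oplus> w \<otimes> w = \<one>"
    unfolding w(2)[symmetric] r(3)[symmetric] using pos_closed[OF x] by algebra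
  ultimately have "cnorm A r \<le> 1"
    using norm_le_one_if_sum_squares[of r w] r(1,2) pos_closed[OF w(1)] pos_star[OF w(1)] by blast
  then have "cnorm A x \<le> 1"
    using p_mult[of r r] r mult_mono[of "cnorm A r" 1 "cnorm A r" 1] by auto
  then show ?thesis using assms by (simp add: x_def p_scale norm_divide field_simps)
qed

lemma pos_norm_minus:
  assumes "h \<in> carrier A" "star A h = h" "cnorm A h \<le> t" "t > 0"
  shows "pos (complex_of_real t \<odot> \<one> \<ominus> h)"
proof (rule pos_if_bound[of _ t])
  have "complex_of_real t \<odot> \<one> \<ominus> (complex_of_real t \<odot> \<one> \<ominus> h) = h"
    using assms(1) scale_closed[OF one_closed, of "complex_of_real t"] by algebra
  then show "cnorm A (complex_of_real t \<odot> \<one> \<ominus> (complex_of_real t \<odot> \<one> \<ominus> h)) \<le> t" using assms by simp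
qed (use assms in \<open>auto simp: minus_eq star_add star_minus star_scale\<close>)

text \<open>For t above the norm of b, t - a = (t - b) + (b - a) is positive, so t bounds the norm
  of a; then t decreases to the norm of b.\<close>

lemma norm_mono_diff:
  assumes "pos a" "pos (b \<ominus> a)" "b \<in> carrier A" "star A b = b"
  shows "cnorm A a \<le> cnorm A b"
proof (rule dense_ge)
  fix t assume t: "cnorm A b < t"
  then have "t > 0" using p_nonneg[OF assms(3)] by linarith
  moreover have "pos ((complex_of_real t \<odot> \<one> \<ominus> b) \<oplus> (b \<ominus> a))"
    using assms t \<open>t > 0\<close> by (intro pos_add pos_norm_minus) auto
  moreover have "(complex_of_real t \<odot> \<one> \<ominus> b) \<oplus> (b \<ominus> a) = complex_of_real t \<odot> \<one> \<ominus> a"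
    using assms(3) pos_closed[OF assms(1)] scale_closed[OF one_closed, of "complex_of_real t"] by algebra
  ultimately show "cnorm A a \<le> t" using pos_norm_le[OF assms(1)] by simp
qed

lemma norm_mono_add:
  assumes "pos a" "pos b"
  shows "cnorm A a \<le> cnorm A (a \<oplus> b)"
proof (rule norm_mono_diff[OF assms(1)])
  have "a \<oplus> b \<ominus> a = b" using pos_closed[OF assms(1)] pos_closed[OF assms(2)] by algebra
  then show "pos (a \<oplus> b \<ominus> a)" using assms by simp
qed (use assms pos_star in \<open>auto simp: star_add\<close>)

lemma norm_mono_finsum:
  assumes "finite I" "k \<in> I" "\<And>i. i \<in> I \<Longrightarrow> pos (f i)"
  shows "cnorm A (f k) \<le> cnorm A (\<Oplus>i\<in>I. f i)"
proof -
  have I: "I = insert k (I - {k})" using assms by auto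
  have "(\<Oplus>i\<in>I. f i) = f k \<oplus> (\<Oplus>i\<in>I - {k}. f i)"
    using assms by (subst I, subst finsum_insert) auto
  then show ?thesis using norm_mono_add[OF assms(3)[OF assms(2)] pos_finsum[of "I - {k}" f]] assms by auto
qed

lemma norm_sa_square: "\<lbrakk>z \<in> carrier A; star A z = z\<rbrakk> \<Longrightarrow> cnorm A (z \<otimes> z) = (cnorm A z)\<^sup>2"
  using p_star_mult[of z] by simp

text \<open>If \<open>y\<^sup>* y \<le> 0\<close>, then \<open>y y\<^sup>* \<ge> 0\<close>, and the two elements are compared through
  \<open>f(s) = s - s\<^sup>2\<close>: as \<open>f(y\<^sup>* y)\<^sup>2 = y\<^sup>* (1 - b) f(b) y\<close> for \<open>b = y y\<^sup>*\<close>, the norm of \<open>f(y\<^sup>* y)\<close> is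
  at most one half, whereas \<open>f(s) \<le> s\<close> on the negative axis.\<close>

lemma star_mult_not_negative_aux:
  assumes y: "y \<in> carrier A" and m: "m \<in> carrier A" "star A m = m" and ym: "star A y \<otimes> y = \<ominus> (m \<otimes> m)"
    and n: "cnorm A y = 1"
  shows False
proof -
  define b where "b = y \<otimes> star A y"
  define s where "s = y \<oplus> star A y"
  define d where "d = y \<ominus> star A y"
  define t where "t = \<i> \<odot> d"
  have c: "b \<in> carrier A" "s \<in> carrier A" "t \<in> carrier A" "d \<in> carrier A" "star A y \<in> carrier A"
    using y by (simp_all add: b_def s_def t_def d_def)
  have sa: "star A b = b" "star A s = s" unfolding b_def s_def using y by algebra+
  have sd: "star A d = \<ominus> d" unfolding d_def using y by algebra
  then have st: "star A t = t" using c by (simp add: t_def star_scale scale_minus_left scale_minus_right minus_minus)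
  have tt: "t \<otimes> t = \<ominus> (d \<otimes> d)"
    using c scale_scale[of "d \<otimes> d" \<i> \<i>]
    by (simp add: t_def scale_mult_left scale_mult_right scale_minus_one scale_one)
  \<comment> \<open>Up to sign, s and t are twice the real and imaginary parts of y, so s^2 + t^2 =
    2 (y star y + star y y). Moving star y y = - m^2 to the left exhibits 2 b as a sum of
    squares.\<close>
  have "s \<otimes> s \<oplus> t \<otimes> t = (b \<oplus> star A y \<otimes> y) \<oplus> (b \<oplus> star A y \<otimes> y)"
    unfolding tt s_def d_def b_def using y by algebra
  then have "s \<otimes> s \<oplus> t \<otimes> t \<oplus> (m \<otimes> m \<oplus> m \<otimes> m) = b \<oplus> b"
    unfolding ym using c(1) m(1) by (simp only:) algebra
  moreover have "pos (s \<otimes> s \<oplus> t \<otimes> t \<oplus> (m \<otimes> m \<oplus> m \<otimes> m))"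
    using c m sa st by (intro pos_add posI) auto
  ultimately have "pos (complex_of_real (1/2) \<odot> (b \<oplus> b))" by (intro pos_scale) simp_all
  then have pb: "pos b" using c by (simp add: half_double)
  have nb: "cnorm A b = 1" using p_mult_star[OF y] n by (simp add: b_def)
  have p1b: "pos (\<one> \<ominus> b)" using pos_norm_minus[of b 1] c sa nb by (simp add: scale_one)
  have pbb: "pos (b \<otimes> (\<one> \<ominus> b))" using pb p1b c by (intro pos_mult_commute) (auto simp: minus_eq distr_left distr_right mult_minus_left mult_minus_right)
  have "cnorm A (b \<otimes> (\<one> \<ominus> b)) \<le> 1/4"
  proof (rule pos_norm_le[OF pbb])
    \<comment> \<open>Completing the square: 1/4 - b (1 - b) = (1/2 - b)^2.\<close>
    define e where "e = (1/2) \<odot> \<one>"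
    have e: "e \<in> carrier A" "star A e = e" "e \<otimes> e = (1/4) \<odot> \<one>" "e \<otimes> b = b \<otimes> e" "e \<otimes> b \<oplus> e \<otimes> b = b"
      using scale_scale[of \<one> "1/2" "1/2"] c double_half[of b]
      by (simp_all add: e_def star_scale scale_mult_left scale_mult_right)
    have "(e \<ominus> b) \<otimes> (e \<ominus> b) = e \<otimes> e \<ominus> (e \<otimes> b \<oplus> b \<otimes> e) \<oplus> b \<otimes> b" using e(1) c(1) by algebra
    also have "\<dots> = (1/4) \<odot> \<one> \<ominus> b \<oplus> b \<otimes> b" using e by simp
    also have "\<dots> = (1/4) \<odot> \<one> \<ominus> b \<otimes> (\<one> \<ominus> b)" using c(1) scale_closed[OF one_closed, of "1/4"] by algebra
    finally show "pos (complex_of_real (1/4) \<odot> \<one> \<ominus> b \<otimes> (\<one> \<ominus> b))"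
      using posI[of "e \<ominus> b"] e c sa by (simp add: minus_eq star_add star_minus)
  qed simp
  moreover have n1b: "cnorm A (\<one> \<ominus> b) \<le> 1"
  proof (rule pos_norm_le[OF p1b])
    have "\<one> \<ominus> (\<one> \<ominus> b) = b" using c(1) by algebra
    then show "pos (complex_of_real 1 \<odot> \<one> \<ominus> (\<one> \<ominus> b))" using pb by (simp add: scale_one)
  qed simp
  define z where "z = star A y \<otimes> (\<one> \<ominus> b) \<otimes> y"
  have z: "z \<in> carrier A" "star A z = z" using c sa y by (simp_all add: z_def star_mult star_star minus_eq star_add star_minus mult_assoc)
  have "z \<otimes> z = star A y \<otimes> (\<one> \<ominus> b) \<otimes> (b \<otimes> (\<one> \<ominus> b)) \<otimes> y"
    using c y by (simp add: z_def mult_assoc b_def)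
  then have "(cnorm A z)\<^sup>2 = cnorm A (star A y \<otimes> (\<one> \<ominus> b) \<otimes> (b \<otimes> (\<one> \<ominus> b)) \<otimes> y)"
    using norm_sa_square[OF z] by simp
  also have "\<dots> \<le> cnorm A (star A y \<otimes> (\<one> \<ominus> b) \<otimes> (b \<otimes> (\<one> \<ominus> b)))"
    using p_mult[of "star A y \<otimes> (\<one> \<ominus> b) \<otimes> (b \<otimes> (\<one> \<ominus> b))" y] y c n by simp
  also have "\<dots> \<le> cnorm A (star A y \<otimes> (\<one> \<ominus> b)) * cnorm A (b \<otimes> (\<one> \<ominus> b))"
    using p_mult[of "star A y \<otimes> (\<one> \<ominus> b)" "b \<otimes> (\<one> \<ominus> b)"] y c by simp
  also have "\<dots> \<le> 1 * (1/4)"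
  proof (rule mult_mono)
    show "cnorm A (star A y \<otimes> (\<one> \<ominus> b)) \<le> 1"
      using p_mult[of "star A y" "\<one> \<ominus> b"] n1b y c n by simp
    show "cnorm A (b \<otimes> (\<one> \<ominus> b)) \<le> 1/4" by fact
  qed (use c in auto)
  finally have z4: "(cnorm A z)\<^sup>2 \<le> 1/4" by simp
  \<comment> \<open>On the other hand z = f(- m^2) = - (m^2 + m^4), whose norm is at least that of
    m^2, namely 1. This contradicts the bound 1/4 on the square of the norm.\<close>
  have "z = star A y \<otimes> y \<ominus> (star A y \<otimes> y) \<otimes> (star A y \<otimes> y)"
    unfolding z_def b_def using y by algebra
  also have "\<dots> = \<ominus> (m \<otimes> m \<oplus> (m \<otimes> m) \<otimes> (m \<otimes> m))" unfolding ym using m(1) by algebra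
  finally have "cnorm A z = cnorm A (m \<otimes> m \<oplus> (m \<otimes> m) \<otimes> (m \<otimes> m))" using m by simp
  moreover have "cnorm A (m \<otimes> m) \<le> cnorm A (m \<otimes> m \<oplus> (m \<otimes> m) \<otimes> (m \<otimes> m))"
    using m by (intro norm_mono_add posI) (auto simp: star_mult)
  moreover have "cnorm A (m \<otimes> m) = 1" using p_star_mult[OF y] n m unfolding ym by simp
  ultimately have "1 \<le> cnorm A z" by simp
  then have "1 \<le> (cnorm A z)\<^sup>2" by simp
  with z4 show False by simp
qed

lemma star_mult_not_negative:
  assumes y: "y \<in> carrier A" and m: "m \<in> carrier A" "star A m = m" and ym: "star A y \<otimes> y = \<ominus> (m \<otimes> m)"
  shows "y = \<zero>"
proof (rule ccontr)
  assume "y \<noteq> \<zero>"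
  then have n: "cnorm A y \<noteq> 0" using cnorm_definite[OF y] by blast
  define c where "c = complex_of_real (1 / cnorm A y)"
  have c: "cnj c = c" by (simp add: c_def)
  show False
  proof (rule star_mult_not_negative_aux[of "c \<odot> y" "c \<odot> m"])
    show "star A (c \<odot> y) \<otimes> (c \<odot> y) = \<ominus> ((c \<odot> m) \<otimes> (c \<odot> m))"
      using y m ym c by (simp add: star_scale scale_mult_left scale_mult_right scale_minus_right)
    show "cnorm A (c \<odot> y) = 1" using n y by (simp add: p_scale c_def norm_divide)
  qed (use y m c in \<open>auto simp: star_scale\<close>)
qed

text \<open>For \<open>h = x\<^sup>* x\<close> and \<open>n = \<bar>h\<bar> - h\<close>, the element \<open>y = x n\<close> has \<open>y\<^sup>* y = n h n = - n \<bar>h\<bar> n \<le> 0\<close>,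
  so that \<open>n = 0\<close>.\<close>

theorem pos_star_mult:
  assumes x: "x \<in> carrier A"
  shows "pos (star A x \<otimes> x)"
proof -
  define h where "h = star A x \<otimes> x"
  have h: "h \<in> carrier A" "star A h = h" using x by (simp_all add: h_def star_mult star_star)
  obtain r where r: "pos r" "h \<otimes> h = r \<otimes> r"
    "\<And>b. \<lbrakk>b \<in> carrier A; h \<otimes> h \<otimes> b = b \<otimes> (h \<otimes> h)\<rbrakk> \<Longrightarrow> r \<otimes> b = b \<otimes> r"
    using pos_root[OF posI[OF h]] by blast
  have rc: "r \<in> carrier A" "star A r = r" using r(1) pos_star by auto
  have rh: "r \<otimes> h = h \<otimes> r" using h(1) by (intro r(3)) (simp_all add: mult_assoc)
  define n where "n = r \<ominus> h"
  have n: "n \<in> carrier A" "star A n = n" using rc h by (simp_all add: n_def minus_eq star_add star_minus)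
  obtain q where q: "pos q" "r = q \<otimes> q" "\<And>b. \<lbrakk>b \<in> carrier A; r \<otimes> b = b \<otimes> r\<rbrakk> \<Longrightarrow> q \<otimes> b = b \<otimes> q"
    using pos_root[OF r(1)] by blast
  have qc: "q \<in> carrier A" "star A q = q" using q(1) pos_star by auto
  have "r \<otimes> n = n \<otimes> r" unfolding n_def using rc(1) h(1) rh by algebra
  then have qn: "q \<otimes> n = n \<otimes> q" using n(1) by (rule q(3)[rotated])
  \<comment> \<open>As h^2 = r^2 and h commutes with r, h (r - h) = - r (r - h): on the range of n,
    h acts as - r.\<close>
  have hn: "h \<otimes> n = \<ominus> (r \<otimes> n)"
  proof -
    have "h \<otimes> n = h \<otimes> r \<ominus> h \<otimes> h" unfolding n_def using rc(1) h(1) by algebra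
    also have "\<dots> = \<ominus> (r \<otimes> r \<ominus> r \<otimes> h)" unfolding r(2) rh using rc(1) h(1) by algebra
    also have "\<dots> = \<ominus> (r \<otimes> n)" unfolding n_def using rc(1) h(1) by algebra
    finally show ?thesis .
  qed
  have nrn: "n \<otimes> (r \<otimes> n) = (n \<otimes> q) \<otimes> (n \<otimes> q)"
  proof -
    have "n \<otimes> (r \<otimes> n) = n \<otimes> q \<otimes> (q \<otimes> n)" unfolding q(2) using n(1) qc(1) by (simp add: mult_assoc)
    then show ?thesis unfolding qn .
  qed
  have "star A (x \<otimes> n) \<otimes> (x \<otimes> n) = n \<otimes> (h \<otimes> n)"
    using x n by (simp add: star_mult h_def mult_assoc)
  also have "\<dots> = \<ominus> ((n \<otimes> q) \<otimes> (n \<otimes> q))" unfolding hn using n rc nrn by (simp add: mult_minus_right)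
  finally have "x \<otimes> n = \<zero>"
    using x n qc qn by (intro star_mult_not_negative[of _ "n \<otimes> q"]) (auto simp: star_mult)
  then have "n \<otimes> (h \<otimes> n) = \<zero>" using x n by (simp add: h_def mult_assoc)
  then have 0: "n \<otimes> (r \<otimes> n) = \<zero>" using hn n rc h mult_minus_right[of n "r \<otimes> n"]
    by (metis minus_minus minus_zero_eq mult_closed)
  \<comment> \<open>Since n = r - h, this gives n^3 = 2 n r n = 0. For self-adjoint n the vanishing
    of n^4 forces n = 0 by the C*-identity applied twice.\<close>
  have "n \<otimes> n = r \<otimes> n \<oplus> r \<otimes> n"
  proof -
    have "n \<otimes> n = r \<otimes> n \<ominus> h \<otimes> n" unfolding n_def using rc(1) h(1) by algebra
    then show ?thesis unfolding hn using rc n by (simp add: minus_eq minus_minus)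
  qed
  then have "n \<otimes> (n \<otimes> n) = \<zero>" using 0 n rc by (simp add: distr_left)
  then have "(n \<otimes> n) \<otimes> (n \<otimes> n) = \<zero>" using n by (simp add: mult_assoc)
  then have "((cnorm A n)\<^sup>2)\<^sup>2 = 0" using norm_sa_square[of "n \<otimes> n"] norm_sa_square[OF n] n
    by (simp add: star_mult)
  then have "n = \<zero>" using n cnorm_definite by simp
  then have "r = h" by (intro eq_if_minus_zero[OF rc(1) h(1)]) (simp add: n_def)
  then show ?thesis using r(1) h_def by simp
qed

lemma pos_conj:
  assumes "pos a" "x \<in> carrier A"
  shows "pos (star A x \<otimes> a \<otimes> x)"
proof -
  obtain r where r: "r \<in> carrier A" "star A r = r" "a = r \<otimes> r" using assms by (auto simp: pos_def)
  have "star A x \<otimes> a \<otimes> x = star A (r \<otimes> x) \<otimes> (r \<otimes> x)" using r assms by (simp add: star_mult mult_assoc)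
  then show ?thesis using pos_star_mult[of "r \<otimes> x"] r assms by simp
qed

text \<open>The Cauchy--Schwarz inequality, with \<open>P = \<langle>v,v\<rangle>\<close>, \<open>Q = \<langle>w,w\<rangle>\<close> and \<open>a = \<langle>v,w\<rangle>\<close>; the element
  assumed to be positive is \<open>\<langle>v a - c w, v a - c w\<rangle>\<close>.\<close>

lemma Cauchy_Schwarz_aux:
  assumes "P \<in> carrier A" "star A P = P" "cnorm A P \<le> c" "c > 0" "pos Q" "a \<in> carrier A"
    and p: "pos (star A a \<otimes> P \<otimes> a \<ominus> complex_of_real c \<odot> (star A a \<otimes> a) \<ominus> complex_of_real c \<odot> (star A a \<otimes> a)
      \<oplus> complex_of_real (c * c) \<odot> Q)"
  shows "(cnorm A a)\<^sup>2 \<le> c * cnorm A Q"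
proof -
  let ?c = "complex_of_real c"
  note cl = assms(1,6) pos_closed[OF assms(5)]
  define X where "X = star A a \<otimes> P \<otimes> a"
  define Y where "Y = ?c \<odot> (star A a \<otimes> a)"
  define Z where "Z = ?c \<odot> (?c \<odot> Q)"
  have XYZ: "X \<in> carrier A" "Y \<in> carrier A" "Z \<in> carrier A" using cl by (simp_all add: X_def Y_def Z_def)
  \<comment> \<open>c - P is positive because the norm of P is at most c, hence so is Y - X. Adding
    it to the assumed positive element cancels X and leaves c (c Q - star a a).\<close>
  have "star A a \<otimes> (?c \<odot> \<one> \<ominus> P) \<otimes> a = Y \<ominus> X"
    using cl by (simp add: X_def Y_def minus_eq distr_left distr_right mult_minus_left mult_minus_right
        scale_mult_left scale_mult_right mult_assoc)
  then have "pos (Y \<ominus> X)"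
    using pos_conj[OF pos_norm_minus[OF assms(1-4)] assms(6)] by simp
  moreover have "pos (X \<ominus> Y \<ominus> Y \<oplus> Z)"
    using p cl scale_scale[of Q ?c ?c] by (simp add: X_def Y_def Z_def)
  ultimately have "pos ((Y \<ominus> X) \<oplus> (X \<ominus> Y \<ominus> Y \<oplus> Z))" by (rule pos_add)
  also have "(Y \<ominus> X) \<oplus> (X \<ominus> Y \<ominus> Y \<oplus> Z) = Z \<ominus> Y" using XYZ by algebra
  also have "\<dots> = ?c \<odot> (?c \<odot> Q \<ominus> star A a \<otimes> a)"
    using cl by (simp add: Z_def Y_def minus_eq scale_add_right scale_minus_right)
  finally have "pos (complex_of_real (1/c) \<odot> (?c \<odot> (?c \<odot> Q \<ominus> star A a \<otimes> a)))"
    by (rule pos_scale) (use assms in simp)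
  then have "pos (?c \<odot> Q \<ominus> star A a \<otimes> a)"
    using cl assms scale_scale[of "?c \<odot> Q \<ominus> star A a \<otimes> a" "complex_of_real (1/c)" ?c]
    by (simp add: scale_one)
  then have "cnorm A (star A a \<otimes> a) \<le> cnorm A (?c \<odot> Q)"
    using cl assms pos_star by (intro norm_mono_diff pos_star_mult) (auto simp: star_scale)
  then show ?thesis using cl assms by (simp add: p_star_mult p_scale)
qed

end

subsection \<open>Enveloping norms and matrix algebras\<close>

lemma with_enveloping_norm_simps [simp]:
  "carrier (with_enveloping_norm X) = carrier X"
  "mult (with_enveloping_norm X) = mult X"
  "one (with_enveloping_norm X) = one X"
  "zero (with_enveloping_norm X) = zero X"
  "add (with_enveloping_norm X) = add X"
  "smult (with_enveloping_norm X) = smult X"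
  "star (with_enveloping_norm X) = star X"
  "cnorm (with_enveloping_norm X) = enveloping_norm X"
  by (simp_all add: with_enveloping_norm_def star_alg.extend_def cstar_alg.fields_def)

lemma cstar_seminorm_with_enveloping_norm:
  "cstar_seminorm (with_enveloping_norm X) p \<longleftrightarrow> cstar_seminorm X p"
  by (simp add: cstar_seminorm_def)

lemma cstar_seminorm_zero: "star_algebra A \<Longrightarrow> cstar_seminorm A (\<lambda>_. 0)"
  by (simp add: cstar_seminorm_def)

text \<open>Common to the matrix algebras and the crossed product. Finiteness \<open>bdd\<close> is
  the substantial requirement, since the supremum of an unbounded set of reals carries no
  information.\<close>

locale enveloping_star_algebra = star_algebra A for A :: "('a, 'm) cstar_alg_scheme" (structure) +
  assumes cnorm_eq: "x \<in> carrier A \<Longrightarrow> cnorm A x = Sup {p x | p. cstar_seminorm A p}"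
    and bdd: "x \<in> carrier A \<Longrightarrow> bdd_above {p x | p. cstar_seminorm A p}"
begin

lemma seminorm_le: "\<lbrakk>cstar_seminorm A p; x \<in> carrier A\<rbrakk> \<Longrightarrow> p x \<le> cnorm A x"
  unfolding cnorm_eq by (rule cSup_upper[OF _ bdd]) auto

lemma cnorm_leI:
  assumes "x \<in> carrier A" "\<And>p. cstar_seminorm A p \<Longrightarrow> p x \<le> c"
  shows "cnorm A x \<le> c"
  unfolding cnorm_eq[OF assms(1)] using cstar_seminorm_zero[OF star_algebra_axioms] assms(2)
  by (intro cSup_least) auto

end

text \<open>Upper bounds uniform in p survive the supremum. For the C*-identity the uniform bound is
  p(x) \<le> sqrt of the norm of star x x.\<close>

sublocale enveloping_star_algebra \<subseteq> seminormed_star_algebra A "cnorm A"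
proof unfold_locales
  have nn: "0 \<le> cnorm A x" if "x \<in> carrier A" for x
    using seminorm_le[OF cstar_seminorm_zero[OF star_algebra_axioms] that] by simp
  show "cstar_seminorm A (cnorm A)"
  proof (rule cstar_seminormI[OF star_algebra_axioms nn])
    fix x y assume xy: "x \<in> carrier A" "y \<in> carrier A"
    show "cnorm A (x \<oplus> y) \<le> cnorm A x + cnorm A y"
    proof (rule cnorm_leI)
      fix p assume p: "cstar_seminorm A p"
      then interpret P: seminormed_star_algebra A p by unfold_locales
      show "p (x \<oplus> y) \<le> cnorm A x + cnorm A y"
        using P.p_add[OF xy] seminorm_le[OF p] xy by (meson add_mono order_trans)
    qed (use xy in simp)
    show "cnorm A (x \<otimes> y) \<le> cnorm A x * cnorm A y"
    proof (rule cnorm_leI)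
      fix p assume p: "cstar_seminorm A p"
      then interpret P: seminormed_star_algebra A p by unfold_locales
      show "p (x \<otimes> y) \<le> cnorm A x * cnorm A y"
        using P.p_mult[OF xy] mult_mono[OF seminorm_le[OF p xy(1)] seminorm_le[OF p xy(2)]] nn xy
        by (meson P.p_nonneg order_trans)
    qed (use xy in simp)
    show "cnorm A (c \<odot> x) \<le> cmod c * cnorm A x" for c
    proof (rule cnorm_leI)
      fix p assume p: "cstar_seminorm A p"
      then interpret P: seminormed_star_algebra A p by unfold_locales
      show "p (c \<odot> x) \<le> cmod c * cnorm A x"
        using P.p_scale[OF xy(1)] seminorm_le[OF p xy(1)] by (simp add: mult_left_mono)
    qed (use xy in simp)
    have "cnorm A x \<le> sqrt (cnorm A (star A x \<otimes> x))"
    proof (rule cnorm_leI)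
      fix p assume p: "cstar_seminorm A p"
      then interpret P: seminormed_star_algebra A p by unfold_locales
      have "(p x)\<^sup>2 \<le> cnorm A (star A x \<otimes> x)"
        using P.p_star_mult[OF xy(1)] seminorm_le[OF p, of "star A x \<otimes> x"] xy by simp
      then show "p x \<le> sqrt (cnorm A (star A x \<otimes> x))" by (rule real_le_rsqrt)
    qed (use xy in simp)
    then show "(cnorm A x)\<^sup>2 \<le> cnorm A (star A x \<otimes> x)"
      using nn[OF xy(1)] nn[of "star A x \<otimes> x"] xy power_mono[of "cnorm A x" "sqrt (cnorm A (star A x \<otimes> x))" 2]
      by simp
  qed
qed

lemma star_homD:
  assumes "\<phi> \<in> star_hom A B"
  shows "x \<in> carrier A \<Longrightarrow> \<phi> x \<in> carrier B"
    and "\<lbrakk>x \<in> carrier A; y \<in> carrier A\<rbrakk> \<Longrightarrow> \<phi> (x \<oplus>\<^bsub>A\<^esub> y) = \<phi> x \<oplus>\<^bsub>B\<^esub> \<phi> y"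
    and "x \<in> carrier A \<Longrightarrow> \<phi> (c \<odot>\<^bsub>A\<^esub> x) = c \<odot>\<^bsub>B\<^esub> \<phi> x"
    and "\<lbrakk>x \<in> carrier A; y \<in> carrier A\<rbrakk> \<Longrightarrow> \<phi> (x \<otimes>\<^bsub>A\<^esub> y) = \<phi> x \<otimes>\<^bsub>B\<^esub> \<phi> y"
    and "x \<in> carrier A \<Longrightarrow> \<phi> (star A x) = star B (\<phi> x)"
  using assms by (auto simp: star_hom_def)

lemma star_homI:
  assumes "\<And>x. x \<in> carrier A \<Longrightarrow> \<phi> x \<in> carrier B"
    and "\<And>x y. \<lbrakk>x \<in> carrier A; y \<in> carrier A\<rbrakk> \<Longrightarrow> \<phi> (x \<oplus>\<^bsub>A\<^esub> y) = \<phi> x \<oplus>\<^bsub>B\<^esub> \<phi> y"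
    and "\<And>c x. x \<in> carrier A \<Longrightarrow> \<phi> (c \<odot>\<^bsub>A\<^esub> x) = c \<odot>\<^bsub>B\<^esub> \<phi> x"
    and "\<And>x y. \<lbrakk>x \<in> carrier A; y \<in> carrier A\<rbrakk> \<Longrightarrow> \<phi> (x \<otimes>\<^bsub>A\<^esub> y) = \<phi> x \<otimes>\<^bsub>B\<^esub> \<phi> y"
    and "\<And>x. x \<in> carrier A \<Longrightarrow> \<phi> (star A x) = star B (\<phi> x)"
  shows "\<phi> \<in> star_hom A B"
  using assms by (auto simp: star_hom_def)

lemma cstar_seminorm_pullback:
  assumes "star_algebra A" "\<phi> \<in> star_hom A B" "cstar_seminorm B p"
  shows "cstar_seminorm A (\<lambda>x. p (\<phi> x))"
proof -
  interpret star_algebra A by fact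
  show ?thesis using assms(3) unfolding cstar_seminorm_def
    by (simp add: star_homD[OF assms(2)])
qed

text \<open>The pullback of p is one of the seminorms in the supremum. This universal property
  supplies the contractivity of amplified homomorphisms, of diagonal shifts and of the flattening of
  matrices over the crossed product.\<close>

lemma enveloping_contraction:
  assumes "enveloping_star_algebra A" "\<phi> \<in> star_hom A B" "cstar_seminorm B p" "x \<in> carrier A"
  shows "p (\<phi> x) \<le> cnorm A x"
proof -
  interpret enveloping_star_algebra A by fact
  show ?thesis
    using seminorm_le[OF cstar_seminorm_pullback[OF star_algebra_axioms assms(2,3)] assms(4)] .
qed

text \<open>The hypothesis holds for \<open>e = P x\<close> whenever \<open>P\<close> is a projection in the multiplier algebra;
  cutting a matrix down to some of its rows is of this form.\<close>

lemma (in seminormed_star_algebra) p_compress: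
  assumes "x \<in> carrier A" "e \<in> carrier A" "star A e \<otimes> e = star A x \<otimes> e"
  shows "p e \<le> p x"
proof (cases "p e = 0")
  case False
  have "p e * p e \<le> p x * p e"
    using p_star_mult[OF assms(2)] p_mult[of "star A x" e] assms by (simp add: power2_eq_square)
  then show ?thesis using False p_nonneg[OF assms(2)] by (simp add: mult_le_cancel_right)
qed (use assms in simp)

section \<open>Finitely supported matrices: matrix units, cuts and the *-algebra structure\<close>

definition mat_unit :: "('a, 'm) star_alg_scheme \<Rightarrow> nat \<Rightarrow> nat \<Rightarrow> 'a \<Rightarrow> nat \<Rightarrow> nat \<Rightarrow> 'a" where
  "mat_unit A i j d = (\<lambda>k l. if k = i \<and> l = j then d else \<zero>\<^bsub>A\<^esub>)"

definition row_cut :: "('a, 'm) star_alg_scheme \<Rightarrow> nat set \<Rightarrow> (nat \<Rightarrow> nat \<Rightarrow> 'a) \<Rightarrow> nat \<Rightarrow> nat \<Rightarrow> 'a" where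
  "row_cut A S x = (\<lambda>i j. if i \<in> S then x i j else \<zero>\<^bsub>A\<^esub>)"

definition col_cut :: "('a, 'm) star_alg_scheme \<Rightarrow> nat set \<Rightarrow> (nat \<Rightarrow> nat \<Rightarrow> 'a) \<Rightarrow> nat \<Rightarrow> nat \<Rightarrow> 'a" where
  "col_cut A S x = (\<lambda>i j. if j \<in> S then x i j else \<zero>\<^bsub>A\<^esub>)"

lemma corner_eq: "corner A n x = col_cut A {..<n} (row_cut A {..<n} x)"
  by (auto simp: corner_def col_cut_def row_cut_def fun_eq_iff)

lemma Minf_simps:
  "carrier (Minf A) = (\<Union>n. matrices A n)"
  "zero (Minf A) = (\<lambda>i j. \<zero>\<^bsub>A\<^esub>)"
  "add (Minf A) = (\<lambda>x y i j. x i j \<oplus>\<^bsub>A\<^esub> y i j)"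
  "smult (Minf A) = (\<lambda>c x i j. c \<odot>\<^bsub>A\<^esub> x i j)"
  "star (Minf A) = (\<lambda>x i j. star A (x j i))"
  by (simp_all add: Minf_def Minf_star_alg_def)

lemma Minf_mult: "mult (Minf A) = (\<lambda>x y i j. \<Oplus>\<^bsub>A\<^esub>k\<in>{k. x i k \<noteq> \<zero>\<^bsub>A\<^esub>}. x i k \<otimes>\<^bsub>A\<^esub> y k j)"
  by (simp add: Minf_def Minf_star_alg_def)

lemma matrices_mono: "\<lbrakk>x \<in> matrices A n; n \<le> m\<rbrakk> \<Longrightarrow> x \<in> matrices A m"
  by (auto simp: matrices_def)

lemma MinfI: "x \<in> matrices A n \<Longrightarrow> x \<in> carrier (Minf A)"
  by (auto simp: Minf_simps)

lemma MinfE: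
  assumes "x \<in> carrier (Minf A)"
  obtains n where "x \<in> matrices A n"
  using assms by (auto simp: Minf_simps)

lemma MinfE2:
  assumes "x \<in> carrier (Minf A)" "y \<in> carrier (Minf A)"
  obtains n where "x \<in> matrices A n" "y \<in> matrices A n"
proof -
  obtain k l where "x \<in> matrices A k" "y \<in> matrices A l" using assms by (auto elim!: MinfE)
  then have "x \<in> matrices A (max k l)" "y \<in> matrices A (max k l)"
    by (auto elim!: matrices_mono)
  then show ?thesis by (rule that)
qed

lemma Minf_entry: "x \<in> carrier (Minf A) \<Longrightarrow> x i j \<in> carrier A"
  by (auto simp: Minf_simps matrices_def)

lemma matrices_entry: "x \<in> matrices A n \<Longrightarrow> x i j \<in> carrier A"
  and matrices_zero: "x \<in> matrices A n \<Longrightarrow> n \<le> i \<or> n \<le> j \<Longrightarrow> x i j = \<zero>\<^bsub>A\<^esub>"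
  by (auto simp: matrices_def)

lemma corner_matrices: "x \<in> matrices A n \<Longrightarrow> corner A n x = x"
  by (auto simp: corner_def matrices_def fun_eq_iff)

context star_algebra
begin

abbreviation "M \<equiv> Minf A"

lemma corner_in_matrices: "(\<And>i j. x i j \<in> carrier A) \<Longrightarrow> corner A n x \<in> matrices A n"
  by (auto simp: corner_def matrices_def)

text \<open>The defining sum runs over the support of a row of x, a set that moves with x and i.
  Here it becomes an initial segment beyond which all terms vanish, be it because of x or because of
  y.\<close>

lemma Minf_mult_eq_aux:
  assumes "x \<in> carrier M" "y \<in> carrier M" "\<And>k. k \<ge> n \<Longrightarrow> x i k = \<zero> \<or> y k j = \<zero>"
  shows "(x \<otimes>\<^bsub>M\<^esub> y) i j = (\<Oplus>k\<in>{..<n}. x i k \<otimes> y k j)"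
proof -
  obtain m where m: "x \<in> matrices A m" using assms(1) by (rule MinfE)
  let ?S = "{k. x i k \<noteq> \<zero>}" and ?f = "\<lambda>k. x i k \<otimes> y k j"
  have S: "?S \<subseteq> {..<m}" using matrices_zero[OF m] by (metis (mono_tags, lifting) lessThan_iff linorder_not_less mem_Collect_eq subsetI)
  have f: "\<And>k. ?f k \<in> carrier A" using Minf_entry[OF assms(1)] Minf_entry[OF assms(2)] by simp
  note [simp] = Minf_entry[OF assms(1)] Minf_entry[OF assms(2)]
  have "finsum A ?f ?S = finsum A ?f {..<max m n}"
    using S f assms by (intro add.finprod_mono_neutral_cong_left) auto
  moreover have "finsum A ?f {..<n} = finsum A ?f {..<max m n}"
    using f assms(1,2) assms(3) by (intro add.finprod_mono_neutral_cong_left) (auto, fastforce)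
  ultimately show ?thesis by (simp add: Minf_mult)
qed

lemma Minf_mult_eq:
  assumes "x \<in> carrier M" "y \<in> carrier M" "x \<in> matrices A n \<or> y \<in> matrices A n"
  shows "(x \<otimes>\<^bsub>M\<^esub> y) i j = (\<Oplus>k\<in>{..<n}. x i k \<otimes> y k j)"
  using assms by (intro Minf_mult_eq_aux) (auto simp: matrices_zero)

lemma mult_in_matrices:
  assumes "x \<in> matrices A n" "y \<in> matrices A n"
  shows "x \<otimes>\<^bsub>M\<^esub> y \<in> matrices A n"
proof -
  note [simp] = matrices_entry[OF assms(1)] matrices_entry[OF assms(2)]
    matrices_zero[OF assms(1)] matrices_zero[OF assms(2)]
  have e: "(x \<otimes>\<^bsub>M\<^esub> y) i j = (\<Oplus>k\<in>{..<n}. x i k \<otimes> y k j)" for i j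
    using Minf_mult_eq[of x y n] assms MinfI by blast
  show ?thesis unfolding matrices_def mem_Collect_eq e
    by (auto intro!: finsum_closed add.finprod_one_eqI)
qed

lemma Minf_star_algebra: "star_algebra M"
proof (intro star_algebra.intro star_algebra_axioms.intro abelian_groupI)
  note s = Minf_simps
  fix x y assume x: "x \<in> carrier M" and y: "y \<in> carrier M"
  obtain n where n: "x \<in> matrices A n" "y \<in> matrices A n" using x y by (rule MinfE2)
  note [simp] = Minf_entry[OF x] Minf_entry[OF y]
  show "x \<oplus>\<^bsub>M\<^esub> y \<in> carrier M" using n by (intro MinfI[of _ _ n]) (auto simp: s(2-) matrices_def)
  show "x \<oplus>\<^bsub>M\<^esub> y = y \<oplus>\<^bsub>M\<^esub> x" using x y by (auto simp: s(2-) a_comm)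
  show "x \<otimes>\<^bsub>M\<^esub> y \<in> carrier M" using mult_in_matrices[OF n] by (rule MinfI)
  show "star M (x \<oplus>\<^bsub>M\<^esub> y) = star M x \<oplus>\<^bsub>M\<^esub> star M y" using x y by (auto simp: s(2-) star_add)
  show "c \<odot>\<^bsub>M\<^esub> (x \<oplus>\<^bsub>M\<^esub> y) = c \<odot>\<^bsub>M\<^esub> x \<oplus>\<^bsub>M\<^esub> c \<odot>\<^bsub>M\<^esub> y" for c
    using x y by (auto simp: s(2-) scale_add_right)
  have cx: "c \<odot>\<^bsub>M\<^esub> x \<in> matrices A n" "c \<odot>\<^bsub>M\<^esub> y \<in> matrices A n" for c
    using n by (auto simp: s(2-) matrices_def)
  have sx: "star M x \<in> matrices A n" "star M y \<in> matrices A n"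
    using n by (auto simp: s(2-) matrices_def)
  show "c \<odot>\<^bsub>M\<^esub> x \<otimes>\<^bsub>M\<^esub> y = c \<odot>\<^bsub>M\<^esub> (x \<otimes>\<^bsub>M\<^esub> y)" for c
  proof (intro ext)
    fix i j
    have "(c \<odot>\<^bsub>M\<^esub> x \<otimes>\<^bsub>M\<^esub> y) i j = (\<Oplus>k\<in>{..<n}. (c \<odot>\<^bsub>M\<^esub> x) i k \<otimes> y k j)"
      using cx n MinfI by (intro Minf_mult_eq) blast+
    also have "\<dots> = (\<Oplus>k\<in>{..<n}. c \<odot> (x i k \<otimes> y k j))" using n by (simp add: s(2-) scale_mult_left)
    also have "\<dots> = (c \<odot>\<^bsub>M\<^esub> (x \<otimes>\<^bsub>M\<^esub> y)) i j"
      using n x y by (subst finsum_scale[symmetric]) (auto simp: s(2-) Minf_mult_eq[OF x y, of n])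
    finally show "(c \<odot>\<^bsub>M\<^esub> x \<otimes>\<^bsub>M\<^esub> y) i j = (c \<odot>\<^bsub>M\<^esub> (x \<otimes>\<^bsub>M\<^esub> y)) i j" .
  qed
  show "x \<otimes>\<^bsub>M\<^esub> (c \<odot>\<^bsub>M\<^esub> y) = c \<odot>\<^bsub>M\<^esub> (x \<otimes>\<^bsub>M\<^esub> y)" for c
  proof (intro ext)
    fix i j
    have "(x \<otimes>\<^bsub>M\<^esub> (c \<odot>\<^bsub>M\<^esub> y)) i j = (\<Oplus>k\<in>{..<n}. x i k \<otimes> (c \<odot>\<^bsub>M\<^esub> y) k j)"
      using cx n MinfI by (intro Minf_mult_eq) blast+
    also have "\<dots> = (\<Oplus>k\<in>{..<n}. c \<odot> (x i k \<otimes> y k j))" using n by (simp add: s(2-) scale_mult_right)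
    also have "\<dots> = (c \<odot>\<^bsub>M\<^esub> (x \<otimes>\<^bsub>M\<^esub> y)) i j"
      using n x y by (subst finsum_scale[symmetric]) (auto simp: s(2-) Minf_mult_eq[OF x y, of n])
    finally show "(x \<otimes>\<^bsub>M\<^esub> (c \<odot>\<^bsub>M\<^esub> y)) i j = (c \<odot>\<^bsub>M\<^esub> (x \<otimes>\<^bsub>M\<^esub> y)) i j" .
  qed
  show "star M (x \<otimes>\<^bsub>M\<^esub> y) = star M y \<otimes>\<^bsub>M\<^esub> star M x"
  proof (intro ext)
    fix i j
    have "(star M y \<otimes>\<^bsub>M\<^esub> star M x) i j = (\<Oplus>k\<in>{..<n}. star M y i k \<otimes> star M x k j)"
      using sx MinfI by (intro Minf_mult_eq) blast+
    also have "\<dots> = (\<Oplus>k\<in>{..<n}. star A (x j k \<otimes> y k i))" using n by (simp add: s(2-) star_mult)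
    also have "\<dots> = star M (x \<otimes>\<^bsub>M\<^esub> y) i j"
      using n x y by (subst finsum_star[symmetric]) (auto simp: s(2-) Minf_mult_eq[OF x y, of n])
    finally show "star M (x \<otimes>\<^bsub>M\<^esub> y) i j = (star M y \<otimes>\<^bsub>M\<^esub> star M x) i j" by simp
  qed
  fix z assume z: "z \<in> carrier M"
  note [simp] = Minf_entry[OF z]
  obtain m where m: "x \<oplus>\<^bsub>M\<^esub> y \<in> matrices A m" "z \<in> matrices A m"
    using \<open>x \<oplus>\<^bsub>M\<^esub> y \<in> carrier M\<close> z by (rule MinfE2)
  obtain m' where "x \<in> matrices A m'" "y \<in> matrices A m'" "z \<in> matrices A m'"
    using matrices_mono[OF n(1), of "max n m"] matrices_mono[OF n(2), of "max n m"]
      matrices_mono[OF m(2), of "max n m"] by auto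
  then obtain m where m: "x \<in> matrices A m" "y \<in> matrices A m" "z \<in> matrices A m" by blast
  have xy: "x \<oplus>\<^bsub>M\<^esub> y \<in> matrices A m" using m by (auto simp: s(2-) matrices_def)
  show "x \<oplus>\<^bsub>M\<^esub> y \<oplus>\<^bsub>M\<^esub> z = x \<oplus>\<^bsub>M\<^esub> (y \<oplus>\<^bsub>M\<^esub> z)" using x y z by (auto simp: s(2-) a_assoc)
  show "(x \<oplus>\<^bsub>M\<^esub> y) \<otimes>\<^bsub>M\<^esub> z = x \<otimes>\<^bsub>M\<^esub> z \<oplus>\<^bsub>M\<^esub> y \<otimes>\<^bsub>M\<^esub> z"
  proof (intro ext)
    fix i j
    have "((x \<oplus>\<^bsub>M\<^esub> y) \<otimes>\<^bsub>M\<^esub> z) i j = (\<Oplus>k\<in>{..<m}. (x \<oplus>\<^bsub>M\<^esub> y) i k \<otimes> z k j)"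
      using xy m MinfI by (intro Minf_mult_eq) blast+
    also have "\<dots> = (\<Oplus>k\<in>{..<m}. x i k \<otimes> z k j \<oplus> y i k \<otimes> z k j)" using m by (simp add: s(2-) distr_right)
    also have "\<dots> = (x \<otimes>\<^bsub>M\<^esub> z \<oplus>\<^bsub>M\<^esub> y \<otimes>\<^bsub>M\<^esub> z) i j"
      using m by (subst finsum_addf) (auto simp: s(2-) Minf_mult_eq[OF x z, of m] Minf_mult_eq[OF y z, of m])
    finally show "((x \<oplus>\<^bsub>M\<^esub> y) \<otimes>\<^bsub>M\<^esub> z) i j = (x \<otimes>\<^bsub>M\<^esub> z \<oplus>\<^bsub>M\<^esub> y \<otimes>\<^bsub>M\<^esub> z) i j" .
  qed
  show "z \<otimes>\<^bsub>M\<^esub> (x \<oplus>\<^bsub>M\<^esub> y) = z \<otimes>\<^bsub>M\<^esub> x \<oplus>\<^bsub>M\<^esub> z \<otimes>\<^bsub>M\<^esub> y"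
  proof (intro ext)
    fix i j
    have "(z \<otimes>\<^bsub>M\<^esub> (x \<oplus>\<^bsub>M\<^esub> y)) i j = (\<Oplus>k\<in>{..<m}. z i k \<otimes> (x \<oplus>\<^bsub>M\<^esub> y) k j)"
      using xy m MinfI by (intro Minf_mult_eq) blast+
    also have "\<dots> = (\<Oplus>k\<in>{..<m}. z i k \<otimes> x k j \<oplus> z i k \<otimes> y k j)" using m by (simp add: s(2-) distr_left)
    also have "\<dots> = (z \<otimes>\<^bsub>M\<^esub> x \<oplus>\<^bsub>M\<^esub> z \<otimes>\<^bsub>M\<^esub> y) i j"
      using m by (subst finsum_addf) (auto simp: s(2-) Minf_mult_eq[OF z x, of m] Minf_mult_eq[OF z y, of m])
    finally show "(z \<otimes>\<^bsub>M\<^esub> (x \<oplus>\<^bsub>M\<^esub> y)) i j = (z \<otimes>\<^bsub>M\<^esub> x \<oplus>\<^bsub>M\<^esub> z \<otimes>\<^bsub>M\<^esub> y) i j" .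
  qed
  show "(x \<otimes>\<^bsub>M\<^esub> y) \<otimes>\<^bsub>M\<^esub> z = x \<otimes>\<^bsub>M\<^esub> (y \<otimes>\<^bsub>M\<^esub> z)"
  proof (intro ext)
    fix i j
    have xy: "x \<otimes>\<^bsub>M\<^esub> y \<in> matrices A m" "y \<otimes>\<^bsub>M\<^esub> z \<in> matrices A m" using m by (auto intro: mult_in_matrices)
    have "((x \<otimes>\<^bsub>M\<^esub> y) \<otimes>\<^bsub>M\<^esub> z) i j = (\<Oplus>k\<in>{..<m}. (x \<otimes>\<^bsub>M\<^esub> y) i k \<otimes> z k j)"
      using xy m MinfI by (intro Minf_mult_eq) blast+
    also have "\<dots> = (\<Oplus>k\<in>{..<m}. \<Oplus>l\<in>{..<m}. x i l \<otimes> y l k \<otimes> z k j)"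
      using m by (intro finsum_cong') (auto simp: Minf_mult_eq[OF x y, of m] finsum_mult_right intro!: finsum_closed)
    also have "\<dots> = (\<Oplus>l\<in>{..<m}. \<Oplus>k\<in>{..<m}. x i l \<otimes> (y l k \<otimes> z k j))"
      using m by (subst finsum_swap) (auto simp: mult_assoc)
    also have "\<dots> = (\<Oplus>l\<in>{..<m}. x i l \<otimes> (y \<otimes>\<^bsub>M\<^esub> z) l j)"
      using m by (intro finsum_cong') (auto simp: Minf_mult_eq[OF y z, of m] finsum_mult_left intro!: finsum_closed)
    also have "\<dots> = (x \<otimes>\<^bsub>M\<^esub> (y \<otimes>\<^bsub>M\<^esub> z)) i j"
      using xy m MinfI by (intro Minf_mult_eq[symmetric]) blast+
    finally show "((x \<otimes>\<^bsub>M\<^esub> y) \<otimes>\<^bsub>M\<^esub> z) i j = (x \<otimes>\<^bsub>M\<^esub> (y \<otimes>\<^bsub>M\<^esub> z)) i j" .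
  qed
next
  note s = Minf_simps
  show "\<zero>\<^bsub>M\<^esub> \<in> carrier M" by (intro MinfI[of _ _ 0]) (auto simp: matrices_def s)
  fix x assume x: "x \<in> carrier M"
  note [simp] = Minf_entry[OF x]
  obtain n where n: "x \<in> matrices A n" using x by (rule MinfE)
  have sc: "c \<odot>\<^bsub>M\<^esub> x \<in> matrices A n" for c using n by (auto simp: s(2-) matrices_def)
  show "\<zero>\<^bsub>M\<^esub> \<oplus>\<^bsub>M\<^esub> x = x" using x by (auto simp: s(2-))
  show "\<exists>y\<in>carrier M. y \<oplus>\<^bsub>M\<^esub> x = \<zero>\<^bsub>M\<^esub>"
    using MinfI[OF sc[of "-1"]] x
    by (intro bexI[of _ "(-1) \<odot>\<^bsub>M\<^esub> x"]) (auto simp: s(2-) scale_minus_one l_neg)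
  show "c \<odot>\<^bsub>M\<^esub> x \<in> carrier M" for c using sc by (rule MinfI)
  show "(c + d) \<odot>\<^bsub>M\<^esub> x = c \<odot>\<^bsub>M\<^esub> x \<oplus>\<^bsub>M\<^esub> d \<odot>\<^bsub>M\<^esub> x" for c d using x by (auto simp: s(2-) scale_add_left)
  show "(c * d) \<odot>\<^bsub>M\<^esub> x = c \<odot>\<^bsub>M\<^esub> (d \<odot>\<^bsub>M\<^esub> x)" for c d using x by (auto simp: s(2-) scale_scale)
  show "1 \<odot>\<^bsub>M\<^esub> x = x" using x by (auto simp: s(2-) scale_one)
  show "star M x \<in> carrier M" using n by (intro MinfI[of _ _ n]) (auto simp: s(2-) matrices_def)
  show "star M (star M x) = x" using x by (auto simp: s(2-) star_star)
  show "star M (c \<odot>\<^bsub>M\<^esub> x) = cnj c \<odot>\<^bsub>M\<^esub> star M x" for c using x by (auto simp: s(2-) star_scale)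
qed

end

subsection \<open>The norm of matrix algebras\<close>

lemma Minf_entries:
  "\<zero>\<^bsub>Minf A\<^esub> i j = \<zero>\<^bsub>A\<^esub>"
  "(x \<oplus>\<^bsub>Minf A\<^esub> y) i j = x i j \<oplus>\<^bsub>A\<^esub> y i j"
  "(c \<odot>\<^bsub>Minf A\<^esub> x) i j = c \<odot>\<^bsub>A\<^esub> x i j"
  "star (Minf A) x i j = star A (x j i)"
  by (simp_all add: Minf_simps)

context star_algebra
begin

interpretation M: star_algebra M by (rule Minf_star_algebra)

lemma Minf_minus_entries:
  assumes "x \<in> carrier M" "y \<in> carrier M"
  shows "(x \<ominus>\<^bsub>M\<^esub> y) i j = x i j \<ominus> y i j"
  using assms Minf_entry[OF assms(2)]
  by (simp add: M.minus_eq minus_eq Minf_entries scale_minus_one flip: M.scale_minus_one)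

lemma mat_unit_in_matrices: "d \<in> carrier A \<Longrightarrow> mat_unit A i j d \<in> matrices A (Suc (max i j))"
  by (auto simp: mat_unit_def matrices_def)

lemma mat_unit_closed: "d \<in> carrier A \<Longrightarrow> mat_unit A i j d \<in> carrier M"
  by (rule MinfI[OF mat_unit_in_matrices])

lemma mat_unit_star: "star M (mat_unit A i j d) = mat_unit A j i (star A d)"
  by (auto simp: mat_unit_def Minf_simps fun_eq_iff)

lemma finsum_single:
  assumes "k \<in> I" "finite I" "f k \<in> carrier A" "\<And>i. \<lbrakk>i \<in> I; i \<noteq> k\<rbrakk> \<Longrightarrow> f i = \<zero>"
  shows "(\<Oplus>i\<in>I. f i) = f k"
proof -
  have "f i \<in> carrier A" if "i \<in> I" for i using assms that by (cases "i = k") auto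
  then have "finsum A f I = finsum A f {k}"
    using assms by (intro add.finprod_mono_neutral_cong_right) auto
  then show ?thesis using assms by simp
qed

lemma mat_unit_mult_left:
  assumes "d \<in> carrier A" "x \<in> carrier M"
  shows "(mat_unit A i j d \<otimes>\<^bsub>M\<^esub> x) k l = (if k = i then d \<otimes> x j l else \<zero>)"
proof -
  note [simp] = Minf_entry[OF assms(2)]
  have "(mat_unit A i j d \<otimes>\<^bsub>M\<^esub> x) k l = (\<Oplus>m\<in>{..<Suc (max i j)}. mat_unit A i j d k m \<otimes> x m l)"
    by (rule Minf_mult_eq[OF mat_unit_closed[OF assms(1)] assms(2)])
      (use mat_unit_in_matrices[OF assms(1)] in blast)
  also have "\<dots> = (if k = i then d \<otimes> x j l else \<zero>)"
  proof (cases "k = i")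
    case True
    then show ?thesis using assms(1)
      by (subst finsum_single[of j]) (auto simp: mat_unit_def)
  next
    case False
    then show ?thesis using assms(1) by (auto simp: mat_unit_def intro!: add.finprod_one_eqI)
  qed
  finally show ?thesis .
qed

lemma mat_unit_mult_right:
  assumes "d \<in> carrier A" "x \<in> carrier M"
  shows "(x \<otimes>\<^bsub>M\<^esub> mat_unit A i j d) k l = (if l = j then x k i \<otimes> d else \<zero>)"
proof -
  note [simp] = Minf_entry[OF assms(2)]
  have "(x \<otimes>\<^bsub>M\<^esub> mat_unit A i j d) k l = (\<Oplus>m\<in>{..<Suc (max i j)}. x k m \<otimes> mat_unit A i j d m l)"
    by (rule Minf_mult_eq[OF assms(2) mat_unit_closed[OF assms(1)]])
      (use mat_unit_in_matrices[OF assms(1)] in blast)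
  also have "\<dots> = (if l = j then x k i \<otimes> d else \<zero>)"
  proof (cases "l = j")
    case True
    then show ?thesis using assms(1)
      by (subst finsum_single[of i]) (auto simp: mat_unit_def)
  next
    case False
    then show ?thesis using assms(1) by (auto simp: mat_unit_def intro!: add.finprod_one_eqI)
  qed
  finally show ?thesis .
qed

lemma mat_unit_mult:
  assumes "a \<in> carrier A" "b \<in> carrier A"
  shows "mat_unit A i j a \<otimes>\<^bsub>M\<^esub> mat_unit A j l b = mat_unit A i l (a \<otimes> b)"
  using assms
  by (intro ext) (simp add: mat_unit_mult_left mat_unit_closed, simp add: mat_unit_def)

lemma mat_unit_star_hom: "mat_unit A i i \<in> star_hom A M"
proof (rule star_homI)
  fix x y assume "x \<in> carrier A" "y \<in> carrier A"
  then show "mat_unit A i i (x \<otimes> y) = mat_unit A i i x \<otimes>\<^bsub>M\<^esub> mat_unit A i i y"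
    by (simp add: mat_unit_mult)
qed (auto simp: mat_unit_closed mat_unit_star, auto simp: mat_unit_def Minf_simps fun_eq_iff)

lemma subadditive_le_sum:
  assumes "finite S"
    and "x \<in> carrier M" "\<And>i j. (i, j) \<notin> S \<Longrightarrow> x i j = \<zero>"
    and f0: "f \<zero>\<^bsub>M\<^esub> \<le> (0::real)"
    and f: "\<And>x y. \<lbrakk>x \<in> carrier M; y \<in> carrier M\<rbrakk> \<Longrightarrow> f (x \<oplus>\<^bsub>M\<^esub> y) \<le> f x + f y"
    and u: "\<And>i j d. d \<in> carrier A \<Longrightarrow> f (mat_unit A i j d) \<le> g d"
  shows "f x \<le> (\<Sum>(i,j)\<in>S. g (x i j))"
  using assms(1-3)
proof (induction S arbitrary: x)
  case empty
  then have "x = \<zero>\<^bsub>M\<^esub>" by (auto simp: Minf_simps)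
  then show ?case using f0 by simp
next
  case (insert ij S)
  obtain i j where ij: "ij = (i, j)" by force
  note [simp] = Minf_entry[OF insert.prems(1)]
  define y where "y = (\<lambda>k l. if k = i \<and> l = j then \<zero> else x k l)"
  obtain n where "x \<in> matrices A n" using insert.prems(1) by (rule MinfE)
  then have "y \<in> matrices A n" by (auto simp: matrices_def y_def)
  then have y: "y \<in> carrier M" by (rule MinfI)
  have "x = y \<oplus>\<^bsub>M\<^esub> mat_unit A i j (x i j)"
    by (auto simp: y_def mat_unit_def Minf_simps fun_eq_iff)
  then have "f x \<le> f y + f (mat_unit A i j (x i j))"
    using f[OF y mat_unit_closed, of "x i j" i j] by simp
  also have "f y \<le> (\<Sum>(i,j)\<in>S. g (y i j))"
    using insert.prems insert.hyps by (intro insert.IH y) (auto simp: y_def ij)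
  also have "(\<Sum>(i,j)\<in>S. g (y i j)) = (\<Sum>(i,j)\<in>S. g (x i j))"
    using insert.hyps by (intro sum.cong) (auto simp: y_def ij)
  also have "f (mat_unit A i j (x i j)) \<le> g (x i j)" by (rule u) simp
  finally show ?case using insert.hyps by (simp add: ij)
qed

lemma matrices_subadditive_le_sum:
  assumes "x \<in> matrices A n"
    and f0: "f \<zero>\<^bsub>M\<^esub> \<le> (0::real)"
    and f: "\<And>x y. \<lbrakk>x \<in> carrier M; y \<in> carrier M\<rbrakk> \<Longrightarrow> f (x \<oplus>\<^bsub>M\<^esub> y) \<le> f x + f y"
    and u: "\<And>i j d. d \<in> carrier A \<Longrightarrow> f (mat_unit A i j d) \<le> g d"
  shows "f x \<le> (\<Sum>i<n. \<Sum>j<n. g (x i j))"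
proof -
  have "f x \<le> (\<Sum>(i,j)\<in>{..<n}\<times>{..<n}. g (x i j))"
    using assms matrices_zero[OF assms(1)] MinfI
    by (intro subadditive_le_sum) (auto simp: not_less)
  then show ?thesis by (simp add: sum.cartesian_product)
qed

lemma row_cut_closed: 
  assumes "x \<in> carrier M"
  shows "row_cut A S x \<in> carrier M"
proof -
  obtain n where "x \<in> matrices A n" using assms by (rule MinfE)
  then show ?thesis by (intro MinfI[of _ _ n]) (auto simp: matrices_def row_cut_def)
qed

lemma col_cut_star: "x \<in> carrier M \<Longrightarrow> col_cut A S x = star M (row_cut A S (star M x))"
  using Minf_entry[of x A]
  by (auto simp: col_cut_def row_cut_def Minf_simps star_star fun_eq_iff)

text \<open>This is the hypothesis of \<open>p_compress\<close> for the projection onto the rows in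
  S: the other rows contribute nothing because the right factor vanishes there.\<close>

lemma row_cut_compress:
  assumes "x \<in> carrier M"
  shows "star M (row_cut A S x) \<otimes>\<^bsub>M\<^esub> row_cut A S x = star M x \<otimes>\<^bsub>M\<^esub> row_cut A S x"
proof (intro ext)
  fix i j
  note [simp] = Minf_entry[OF assms]
  obtain n where n: "x \<in> matrices A n" using assms by (rule MinfE)
  then have r: "row_cut A S x \<in> matrices A n" by (auto simp: matrices_def row_cut_def)
  note c = row_cut_closed[OF assms, of S]
  show "(star M (row_cut A S x) \<otimes>\<^bsub>M\<^esub> row_cut A S x) i j = (star M x \<otimes>\<^bsub>M\<^esub> row_cut A S x) i j"
    using assms c r by (subst (1 2) Minf_mult_eq[of _ _ n])
      (auto intro!: finsum_cong' simp: Minf_entries row_cut_def)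
qed

lemma p_row_cut:
  assumes "cstar_seminorm M q" "x \<in> carrier M"
  shows "q (row_cut A S x) \<le> q x"
proof -
  interpret Q: seminormed_star_algebra M q
    using assms(1) Minf_star_algebra by (simp add: seminormed_star_algebra.intro seminormed_star_algebra_axioms.intro)
  show ?thesis using Q.p_compress row_cut_compress[OF assms(2)] row_cut_closed assms(2) by blast
qed

end

context cstar_algebra
begin

text \<open>Restricted to a diagonal position, p is a C*-seminorm on A, to which automatic
  continuity applies. An off-diagonal unit with entry d reduces to the diagonal one with entry star
  d d by the C*-identity.\<close>

lemma p_mat_unit_le:
  assumes "cstar_seminorm M p" "d \<in> carrier A"
  shows "p (mat_unit A i j d) \<le> 2 * cnorm A d"
proof -
  interpret P: seminormed_star_algebra M p
    using assms(1) Minf_star_algebra by (simp add: seminormed_star_algebra.intro seminormed_star_algebra_axioms.intro)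
  have "(p (mat_unit A i j d))\<^sup>2 = p (mat_unit A j j (star A d \<otimes> d))"
    using P.p_star_mult[OF mat_unit_closed[OF assms(2)], of i j] assms(2)
    by (simp add: mat_unit_star mat_unit_mult)
  also have "\<dots> \<le> 2 * cnorm A (star A d \<otimes> d)"
    using cstar_seminorm_le[OF cstar_seminorm_pullback[OF star_algebra_axioms mat_unit_star_hom assms(1)]]
      assms(2) by simp
  also have "\<dots> \<le> (2 * cnorm A d)\<^sup>2" using assms(2) by (simp add: p_star_mult power_mult_distrib)
  finally show ?thesis using assms(2) by (auto intro: power2_le_imp_le)
qed

lemma p_matrices_le:
  assumes "cstar_seminorm M p" "x \<in> matrices A n"
  shows "p x \<le> (\<Sum>i<n. \<Sum>j<n. 2 * cnorm A (x i j))"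
proof -
  interpret P: seminormed_star_algebra M p
    using assms(1) Minf_star_algebra by (simp add: seminormed_star_algebra.intro seminormed_star_algebra_axioms.intro)
  show ?thesis
    by (rule matrices_subadditive_le_sum[OF assms(2)]) (simp_all add: P.p_add p_mat_unit_le[OF assms(1)])
qed

text \<open>The bound of \<open>p_matrices_le\<close> depends on the size and the entries of x but
  not on the seminorm, so the supremum is finite.\<close>

lemma Minf_enveloping: "enveloping_star_algebra M"
proof (intro enveloping_star_algebra.intro enveloping_star_algebra_axioms.intro Minf_star_algebra)
  fix x assume x: "x \<in> carrier M"
  show "cnorm M x = Sup {p x |p. cstar_seminorm M p}"
    unfolding Minf_def by (simp add: enveloping_norm_def cstar_seminorm_with_enveloping_norm)
  obtain n where "x \<in> matrices A n" using x by (rule MinfE)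
  then show "bdd_above {p x |p. cstar_seminorm M p}"
    using p_matrices_le by (intro bdd_aboveI) blast
qed

interpretation N: enveloping_star_algebra M by (rule Minf_enveloping)

lemma Minf_norm_le_sum: "x \<in> matrices A n \<Longrightarrow> cnorm M x \<le> (\<Sum>i<n. \<Sum>j<n. 2 * cnorm A (x i j))"
  by (intro p_matrices_le N.seminorm)

lemma Minf_norm_row_cut: "x \<in> carrier M \<Longrightarrow> cnorm M (row_cut A S x) \<le> cnorm M x"
  by (intro p_row_cut N.seminorm)

lemma Minf_norm_col_cut:
  assumes "x \<in> carrier M" 
  shows "col_cut A S x \<in> carrier M" "cnorm M (col_cut A S x) \<le> cnorm M x"
proof -
  show "col_cut A S x \<in> carrier M" using assms by (simp add: col_cut_star row_cut_closed)
  show "cnorm M (col_cut A S x) \<le> cnorm M x"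
    using assms Minf_norm_row_cut[of "star M x" S] by (simp add: col_cut_star row_cut_closed)
qed

lemma Minf_norm_corner:
  assumes "x \<in> carrier M" 
  shows "cnorm M (corner A n x) \<le> cnorm M x"
  unfolding corner_eq
  using Minf_norm_col_cut[OF row_cut_closed[OF assms], of "{..<n}" "{..<n}"] Minf_norm_row_cut[OF assms, of "{..<n}"] by simp

end

text \<open>The columns with finitely many entries form a Hilbert module over \<open>A\<close>; it is represented here
  by the first columns of the elements of \<open>M\<close>.\<close>

context unital_cstar_algebra
begin

interpretation M: star_algebra M by (rule Minf_star_algebra)

definition ip :: "(nat \<Rightarrow> nat \<Rightarrow> 'a) \<Rightarrow> (nat \<Rightarrow> nat \<Rightarrow> 'a) \<Rightarrow> 'a" where
  "ip v w = (star M v \<otimes>\<^bsub>M\<^esub> w) 0 0"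

definition vnorm :: "(nat \<Rightarrow> nat \<Rightarrow> 'a) \<Rightarrow> real" where
  "vnorm v = sqrt (cnorm A (ip v v))"

lemma ip_closed: "\<lbrakk>v \<in> carrier M; w \<in> carrier M\<rbrakk> \<Longrightarrow> ip v w \<in> carrier A"
proof -
  assume "v \<in> carrier M" "w \<in> carrier M"
  then show ?thesis unfolding ip_def by (simp add: Minf_entry[of _ A])
qed

lemma ip_sum:
  assumes "v \<in> matrices A n" "w \<in> matrices A n"
  shows "ip v w = (\<Oplus>k\<in>{..<n}. star A (v k 0) \<otimes> w k 0)"
proof -
  show ?thesis unfolding ip_def using assms MinfI
    by (subst Minf_mult_eq[of _ _ n]) (auto simp: Minf_entries)
qed

lemma ip_star:
  assumes "v \<in> carrier M" "w \<in> carrier M"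
  shows "star A (ip v w) = ip w v"
proof -
  have "star A (ip v w) = star M (star M v \<otimes>\<^bsub>M\<^esub> w) 0 0" by (simp add: ip_def Minf_entries)
  then show ?thesis using assms by (simp add: M.star_mult M.star_star ip_def)
qed

lemma ip_pos:
  assumes "v \<in> carrier M"
  shows "pos (ip v v)"
proof -
  obtain n where n: "v \<in> matrices A n" using assms by (rule MinfE)
  show ?thesis unfolding ip_sum[OF n n]
    using matrices_entry[OF n] by (intro pos_finsum pos_star_mult)
qed

text \<open>\<open>star A (v k 0) \<otimes> v k 0\<close> is one summand of the positive sum
  \<open>ip v v\<close>, and the norm is monotone on positive elements. The size is enlarged to
  \<open>max n (Suc k)\<close> so that k occurs in the sum.\<close>

lemma entry_le_vnorm:
  assumes "v \<in> carrier M"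
  shows "cnorm A (v k 0) \<le> vnorm v"
proof -
  obtain n where n: "v \<in> matrices A n" using assms by (rule MinfE)
  have n': "v \<in> matrices A (max n (Suc k))" using n by (rule matrices_mono) simp
  have "cnorm A (star A (v k 0) \<otimes> v k 0) \<le> cnorm A (ip v v)"
    unfolding ip_sum[OF n' n'] using matrices_entry[OF n]
    by (intro norm_mono_finsum[of "{..<max n (Suc k)}" k "\<lambda>k. star A (v k 0) \<otimes> v k 0"] pos_star_mult) auto
  then have "(cnorm A (v k 0))\<^sup>2 \<le> cnorm A (ip v v)" using matrices_entry[OF n] by (simp add: p_star_mult)
  then show ?thesis unfolding vnorm_def by (rule real_le_rsqrt)
qed

lemma vnorm_square: "v \<in> carrier M \<Longrightarrow> (vnorm v)\<^sup>2 = cnorm A (ip v v)"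
  by (simp add: vnorm_def ip_closed)

lemma vnorm_nonneg: "v \<in> carrier M \<Longrightarrow> 0 \<le> vnorm v"
  by (simp add: vnorm_def ip_closed)

lemma Cauchy_Schwarz:
  assumes "v \<in> carrier M" "w \<in> carrier M"
  shows "cnorm A (ip v w) \<le> vnorm v * vnorm w"
proof -
  define P Q a where "P = ip v v" and "Q = ip w w" and "a = ip v w"
  have cl: "P \<in> carrier A" "Q \<in> carrier A" "a \<in> carrier A"
    using assms by (simp_all add: P_def Q_def a_def ip_closed)
  \<comment> \<open>\<open>Cauchy_Schwarz_aux\<close> asks for c > 0, so c stays strictly above the
    norm of P, which may vanish; the infimum over c is taken at the end.\<close>
  have *: "(cnorm A a)\<^sup>2 \<le> c * cnorm A Q" if c: "cnorm A P < c" for c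
  proof (rule Cauchy_Schwarz_aux[of P])
    show "c > 0" using p_nonneg[OF cl(1)] c by linarith
    show "star A P = P" unfolding P_def using assms by (simp add: ip_star)
    show "pos Q" unfolding Q_def using assms by (intro ip_pos)
    let ?c = "complex_of_real c"
    define e where "e = mat_unit A 0 0 a"
    have e: "e \<in> carrier M" "star M e = mat_unit A 0 0 (star A a)"
      using cl by (simp_all add: e_def mat_unit_closed mat_unit_star)
    \<comment> \<open>In its first column u is v a - c w: multiplying the column v by a from the
      right is multiplication by the matrix unit with a at position (0, 0).\<close>
    define u where "u = v \<otimes>\<^bsub>M\<^esub> e \<ominus>\<^bsub>M\<^esub> ?c \<odot>\<^bsub>M\<^esub> w"
    have u: "u \<in> carrier M" using assms e by (simp add: u_def)
    define X Y Y' Z where "X = star M e \<otimes>\<^bsub>M\<^esub> (star M v \<otimes>\<^bsub>M\<^esub> v) \<otimes>\<^bsub>M\<^esub> e"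
      and "Y = star M e \<otimes>\<^bsub>M\<^esub> (star M v \<otimes>\<^bsub>M\<^esub> w)" and "Y' = star M w \<otimes>\<^bsub>M\<^esub> v \<otimes>\<^bsub>M\<^esub> e"
      and "Z = star M w \<otimes>\<^bsub>M\<^esub> w"
    have XYZ: "X \<in> carrier M" "Y \<in> carrier M" "Y' \<in> carrier M" "Z \<in> carrier M"
      using assms e(1) by (simp_all add: X_def Y_def Y'_def Z_def)
    have "star M u \<otimes>\<^bsub>M\<^esub> u = X \<ominus>\<^bsub>M\<^esub> ?c \<odot>\<^bsub>M\<^esub> Y \<ominus>\<^bsub>M\<^esub> ?c \<odot>\<^bsub>M\<^esub> Y' \<oplus>\<^bsub>M\<^esub> ?c \<odot>\<^bsub>M\<^esub> (?c \<odot>\<^bsub>M\<^esub> Z)"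
    proof -
      have "star M (?c \<odot>\<^bsub>M\<^esub> w) = ?c \<odot>\<^bsub>M\<^esub> star M w" using assms by (simp add: M.star_scale)
      then have su: "star M u = star M e \<otimes>\<^bsub>M\<^esub> star M v \<ominus>\<^bsub>M\<^esub> ?c \<odot>\<^bsub>M\<^esub> star M w"
        using assms e(1) by (simp add: u_def M.star_add M.star_minus M.star_mult M.minus_eq)
      show ?thesis unfolding su unfolding u_def X_def Y_def Y'_def Z_def using assms e(1) by algebra
    qed
    then have "ip u u = X 0 0 \<ominus> ?c \<odot> Y 0 0 \<ominus> ?c \<odot> Y' 0 0 \<oplus> ?c \<odot> (?c \<odot> Z 0 0)"
      using XYZ Minf_entry[of _ A 0 0]
      by (simp add: ip_def M.minus_eq minus_eq Minf_entries scale_minus_one flip: M.scale_minus_one)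
    moreover have "X 0 0 = star A a \<otimes> P \<otimes> a"
      unfolding X_def e(2) unfolding e_def using assms cl
      by (simp add: mat_unit_mult_left mat_unit_mult_right mat_unit_closed P_def ip_def)
    moreover have "Y 0 0 = star A a \<otimes> a"
      unfolding Y_def e(2) using assms cl by (simp add: mat_unit_mult_left a_def ip_def)
    moreover have "Y' 0 0 = star A a \<otimes> a"
    proof -
      have "Y' = star M Y" unfolding Y_def Y'_def using assms e(1) by algebra
      then have "Y' 0 0 = star A (Y 0 0)" by (simp add: Minf_entries)
      then show ?thesis using cl calculation(3) by (simp add: star_mult star_star)
    qed
    moreover have "Z 0 0 = Q" by (simp add: Z_def Q_def ip_def)
    ultimately have "ip u u = star A a \<otimes> P \<otimes> a \<ominus> ?c \<odot> (star A a \<otimes> a) \<ominus> ?c \<odot> (star A a \<otimes> a) \<oplus> complex_of_real (c * c) \<odot> Q"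
      using cl by (simp add: scale_scale)
    then show "pos (star A a \<otimes> P \<otimes> a \<ominus> ?c \<odot> (star A a \<otimes> a) \<ominus> ?c \<odot> (star A a \<otimes> a) \<oplus> complex_of_real (c * c) \<odot> Q)"
      using ip_pos[OF u] by simp
  qed (use c cl in auto)
  have "(cnorm A a)\<^sup>2 \<le> cnorm A P * cnorm A Q"
  proof (cases "cnorm A Q = 0")
    case True
    then show ?thesis using *[of "cnorm A P + 1"] by simp
  next
    case False
    then have Q: "cnorm A Q > 0" using p_nonneg[OF cl(2)] by linarith
    have "(cnorm A a)\<^sup>2 / cnorm A Q \<le> cnorm A P"
    proof (rule dense_ge)
      fix c assume "cnorm A P < c"
      then show "(cnorm A a)\<^sup>2 / cnorm A Q \<le> c" using * Q by (simp add: pos_divide_le_eq)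
    qed
    then show ?thesis using Q by (simp add: pos_divide_le_eq)
  qed
  then have "(cnorm A a)\<^sup>2 \<le> (vnorm v * vnorm w)\<^sup>2"
    using assms by (simp add: power_mult_distrib vnorm_square P_def Q_def)
  then show ?thesis unfolding a_def using assms by (auto intro!: vnorm_nonneg add_nonneg_nonneg mult_nonneg_nonneg elim!: power2_le_imp_le)
qed

lemma ip_mult_left:
  assumes "x \<in> carrier M" "v \<in> carrier M" "w \<in> carrier M"
  shows "ip (x \<otimes>\<^bsub>M\<^esub> v) w = ip v (star M x \<otimes>\<^bsub>M\<^esub> w)"
proof -
  show ?thesis using assms by (simp add: ip_def M.star_mult M.mult_assoc)
qed

lemma vnorm_add:
  assumes "v \<in> carrier M" "w \<in> carrier M"
  shows "vnorm (v \<oplus>\<^bsub>M\<^esub> w) \<le> vnorm v + vnorm w"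
proof -
  note [simp] = ip_closed[OF assms] ip_closed[OF assms(2,1)] ip_closed[OF assms(1,1)] ip_closed[OF assms(2,2)]
  have "star M (v \<oplus>\<^bsub>M\<^esub> w) \<otimes>\<^bsub>M\<^esub> (v \<oplus>\<^bsub>M\<^esub> w)
    = (star M v \<otimes>\<^bsub>M\<^esub> v \<oplus>\<^bsub>M\<^esub> star M w \<otimes>\<^bsub>M\<^esub> w) \<oplus>\<^bsub>M\<^esub> (star M v \<otimes>\<^bsub>M\<^esub> w \<oplus>\<^bsub>M\<^esub> star M w \<otimes>\<^bsub>M\<^esub> v)"
    using assms by algebra
  then have "ip (v \<oplus>\<^bsub>M\<^esub> w) (v \<oplus>\<^bsub>M\<^esub> w) = (ip v v \<oplus> ip w w) \<oplus> (ip v w \<oplus> ip w v)"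
    by (simp add: ip_def Minf_entries)
  then have "cnorm A (ip (v \<oplus>\<^bsub>M\<^esub> w) (v \<oplus>\<^bsub>M\<^esub> w))
    \<le> (cnorm A (ip v v) + cnorm A (ip w w)) + (cnorm A (ip v w) + cnorm A (ip w v))"
    using p_add[of "ip v v \<oplus> ip w w" "ip v w \<oplus> ip w v"] p_add[of "ip v v" "ip w w"]
      p_add[of "ip v w" "ip w v"] by simp
  also have "\<dots> \<le> (vnorm v)\<^sup>2 + (vnorm w)\<^sup>2 + (vnorm v * vnorm w + vnorm v * vnorm w)"
    using Cauchy_Schwarz[OF assms] Cauchy_Schwarz[OF assms(2,1)] assms
    by (simp add: vnorm_square mult.commute)
  also have "\<dots> = (vnorm v + vnorm w)\<^sup>2" by (simp add: power2_eq_square algebra_simps)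
  finally have "(vnorm (v \<oplus>\<^bsub>M\<^esub> w))\<^sup>2 \<le> (vnorm v + vnorm w)\<^sup>2" using assms by (simp add: vnorm_square)
  then show ?thesis using assms by (auto intro!: vnorm_nonneg add_nonneg_nonneg mult_nonneg_nonneg elim!: power2_le_imp_le)
qed

lemma vnorm_scale:
  assumes "v \<in> carrier M"
  shows "vnorm (c \<odot>\<^bsub>M\<^esub> v) = cmod c * vnorm v"
proof -
  have "ip (c \<odot>\<^bsub>M\<^esub> v) (c \<odot>\<^bsub>M\<^esub> v) = (c * cnj c) \<odot> ip v v"
    using assms ip_closed[OF assms assms] 
    by (simp add: ip_def M.star_scale M.scale_mult_left M.scale_mult_right, simp add: Minf_entries scale_scale)
  then have "(vnorm (c \<odot>\<^bsub>M\<^esub> v))\<^sup>2 = (cmod c * vnorm v)\<^sup>2"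
    using assms ip_closed[OF assms assms] vnorm_square[OF assms]
    by (simp add: vnorm_square p_scale norm_mult power_mult_distrib) (simp add: power2_eq_square)
  then show ?thesis using assms by (simp add: power2_eq_iff_nonneg vnorm_nonneg)
qed

lemma vnorm_zero: "vnorm \<zero>\<^bsub>M\<^esub> = 0"
proof -
  show ?thesis by (simp add: vnorm_def ip_def, simp add: Minf_simps)
qed

lemma vnorm_mat_unit_mult:
  assumes "d \<in> carrier A" "v \<in> carrier M"
  shows "vnorm (mat_unit A i j d \<otimes>\<^bsub>M\<^esub> v) \<le> cnorm A d * vnorm v"
proof -
  note [simp] = Minf_entry[OF assms(2)]
  let ?w = "mat_unit A i j d \<otimes>\<^bsub>M\<^esub> v"
  have w: "?w \<in> carrier M" using assms by (simp add: mat_unit_closed)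
  then obtain n where n: "?w \<in> matrices A n" by (rule MinfE)
  then have n': "?w \<in> matrices A (max n (Suc i))" by (rule matrices_mono) simp
  have "ip ?w ?w = star A (d \<otimes> v j 0) \<otimes> (d \<otimes> v j 0)"
    unfolding ip_sum[OF n' n'] using assms
    by (subst finsum_single[of i]) (auto simp: mat_unit_mult_left)
  then have "(vnorm ?w)\<^sup>2 = (cnorm A (d \<otimes> v j 0))\<^sup>2" using assms w by (simp only: vnorm_square) (simp add: p_star_mult)
  then have "vnorm ?w = cnorm A (d \<otimes> v j 0)" using assms w vnorm_nonneg by (simp add: power2_eq_iff_nonneg)
  also have "\<dots> \<le> cnorm A d * cnorm A (v j 0)" using assms by (simp add: p_mult)
  also have "\<dots> \<le> cnorm A d * vnorm v" using assms by (intro mult_left_mono entry_le_vnorm) auto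
  finally show ?thesis .
qed

text \<open>The operator norm of left multiplication by x on the Hilbert module of columns, with
  \<open>star M x\<close> as adjoint by \<open>ip_mult_left\<close>. It is the concrete seminorm
  that bounds the enveloping norm from below.\<close>

definition opnorm :: "(nat \<Rightarrow> nat \<Rightarrow> 'a) \<Rightarrow> real" where
  "opnorm x = (SUP v\<in>{v \<in> carrier M. vnorm v \<le> 1}. vnorm (x \<otimes>\<^bsub>M\<^esub> v))"

lemma vnorm_mult_bound:
  assumes "x \<in> carrier M"
  obtains K where "\<And>v. v \<in> carrier M \<Longrightarrow> vnorm (x \<otimes>\<^bsub>M\<^esub> v) \<le> K * vnorm v" "K \<ge> 0"
proof -
  obtain n where n: "x \<in> matrices A n" using assms by (rule MinfE)
  have "vnorm (x \<otimes>\<^bsub>M\<^esub> v) \<le> (\<Sum>i<n. \<Sum>j<n. cnorm A (x i j)) * vnorm v" if v: "v \<in> carrier M" for v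
  proof -
    have "vnorm (x \<otimes>\<^bsub>M\<^esub> v) \<le> (\<Sum>i<n. \<Sum>j<n. cnorm A (x i j) * vnorm v)"
      by (rule matrices_subadditive_le_sum[OF n])
        (use v in \<open>simp_all add: vnorm_zero M.distr_right vnorm_add vnorm_mat_unit_mult\<close>)
    then show ?thesis by (simp add: sum_distrib_right)
  qed
  then show ?thesis using that[of "\<Sum>i<n. \<Sum>j<n. cnorm A (x i j)"] matrices_entry[OF n]
    by (simp add: sum_nonneg)
qed

lemma opnorm_bdd:
  assumes "x \<in> carrier M"
  shows "bdd_above ((\<lambda>v. vnorm (x \<otimes>\<^bsub>M\<^esub> v)) ` {v \<in> carrier M. vnorm v \<le> 1})"
proof -
  obtain K where K: "\<And>v. v \<in> carrier M \<Longrightarrow> vnorm (x \<otimes>\<^bsub>M\<^esub> v) \<le> K * vnorm v" "K \<ge> 0"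
    using vnorm_mult_bound[OF assms] by blast
  show ?thesis
  proof (rule bdd_aboveI2)
    fix v assume "v \<in> {v \<in> carrier M. vnorm v \<le> 1}"
    then show "vnorm (x \<otimes>\<^bsub>M\<^esub> v) \<le> K" using K(1)[of v] mult_left_mono[of "vnorm v" 1 K] K(2) by simp
  qed
qed

lemma opnorm_bound:
  assumes "x \<in> carrier M" "v \<in> carrier M"
  shows "vnorm (x \<otimes>\<^bsub>M\<^esub> v) \<le> opnorm x * vnorm v"
proof -
  obtain K where K: "\<And>v. v \<in> carrier M \<Longrightarrow> vnorm (x \<otimes>\<^bsub>M\<^esub> v) \<le> K * vnorm v" "K \<ge> 0"
    using vnorm_mult_bound[OF assms(1)] by blast
  show ?thesis
  proof (cases "vnorm v = 0")
    case True
    then show ?thesis using K(1)[OF assms(2)] by simp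
  next
    case False
    then have p: "vnorm v > 0" using vnorm_nonneg[OF assms(2)] by linarith
    define c where "c = complex_of_real (1 / vnorm v)"
    have c: "cmod c = 1 / vnorm v" using p by (simp add: c_def norm_divide)
    have "vnorm (x \<otimes>\<^bsub>M\<^esub> (c \<odot>\<^bsub>M\<^esub> v)) \<le> opnorm x"
      unfolding opnorm_def using assms p by (intro cSUP_upper[OF _ opnorm_bdd]) (auto simp: vnorm_scale c)
    then show ?thesis using assms p by (simp add: M.scale_mult_right vnorm_scale c field_simps)
  qed
qed

lemma opnorm_leI:
  assumes "\<And>v. \<lbrakk>v \<in> carrier M; vnorm v \<le> 1\<rbrakk> \<Longrightarrow> vnorm (x \<otimes>\<^bsub>M\<^esub> v) \<le> c"
  shows "opnorm x \<le> c"
proof -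
  show ?thesis unfolding opnorm_def
  proof (rule cSUP_least)
    have "\<zero>\<^bsub>M\<^esub> \<in> {v \<in> carrier M. vnorm v \<le> 1}" using vnorm_zero by simp
    then show "{v \<in> carrier M. vnorm v \<le> 1} \<noteq> {}" by blast
  qed (use assms in auto)
qed

lemma opnorm_nonneg: "x \<in> carrier M \<Longrightarrow> 0 \<le> opnorm x"
  using cSUP_upper[OF _ opnorm_bdd, of "\<zero>\<^bsub>M\<^esub>" x] by (simp add: opnorm_def vnorm_zero)

lemma opnorm_seminorm: "cstar_seminorm M opnorm"
proof (rule cstar_seminormI[OF Minf_star_algebra opnorm_nonneg])
  fix x y assume xy: "x \<in> carrier M" "y \<in> carrier M"
  have b: "vnorm (x \<otimes>\<^bsub>M\<^esub> v) \<le> opnorm x" if "x \<in> carrier M" "v \<in> carrier M" "vnorm v \<le> 1" for x v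
    using opnorm_bound[OF that(1,2)] mult_left_mono[OF that(3) opnorm_nonneg[OF that(1)]] by simp
  show "opnorm (x \<oplus>\<^bsub>M\<^esub> y) \<le> opnorm x + opnorm y"
  proof (rule opnorm_leI)
    fix v assume v: "v \<in> carrier M" "vnorm v \<le> 1"
    show "vnorm ((x \<oplus>\<^bsub>M\<^esub> y) \<otimes>\<^bsub>M\<^esub> v) \<le> opnorm x + opnorm y"
      using vnorm_add[of "x \<otimes>\<^bsub>M\<^esub> v" "y \<otimes>\<^bsub>M\<^esub> v"] b[OF xy(1) v] b[OF xy(2) v] xy v
      by (simp add: M.distr_right)
  qed
  show "opnorm (c \<odot>\<^bsub>M\<^esub> x) \<le> cmod c * opnorm x" for c
    using xy b by (intro opnorm_leI) (simp add: M.scale_mult_left vnorm_scale mult_left_mono)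
  show "opnorm (x \<otimes>\<^bsub>M\<^esub> y) \<le> opnorm x * opnorm y"
  proof (rule opnorm_leI)
    fix v assume v: "v \<in> carrier M" "vnorm v \<le> 1"
    have "vnorm (x \<otimes>\<^bsub>M\<^esub> (y \<otimes>\<^bsub>M\<^esub> v)) \<le> opnorm x * vnorm (y \<otimes>\<^bsub>M\<^esub> v)" using xy v by (intro opnorm_bound) auto
    also have "\<dots> \<le> opnorm x * opnorm y" using b[OF xy(2) v] opnorm_nonneg[OF xy(1)] by (intro mult_left_mono)
    finally show "vnorm ((x \<otimes>\<^bsub>M\<^esub> y) \<otimes>\<^bsub>M\<^esub> v) \<le> opnorm x * opnorm y" using xy v by (simp add: M.mult_assoc)
  qed
  have "opnorm x \<le> sqrt (opnorm (star M x \<otimes>\<^bsub>M\<^esub> x))"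
  proof (rule opnorm_leI)
    fix v assume v: "v \<in> carrier M" "vnorm v \<le> 1"
    have "(vnorm (x \<otimes>\<^bsub>M\<^esub> v))\<^sup>2 = cnorm A (ip v (star M x \<otimes>\<^bsub>M\<^esub> x \<otimes>\<^bsub>M\<^esub> v))"
      using xy v by (simp add: vnorm_square ip_mult_left M.mult_assoc)
    also have "\<dots> \<le> vnorm v * vnorm (star M x \<otimes>\<^bsub>M\<^esub> x \<otimes>\<^bsub>M\<^esub> v)" using xy v by (intro Cauchy_Schwarz) auto
    also have "\<dots> \<le> 1 * opnorm (star M x \<otimes>\<^bsub>M\<^esub> x)"
      using xy v by (intro mult_mono b) (auto simp: vnorm_nonneg)
    finally show "vnorm (x \<otimes>\<^bsub>M\<^esub> v) \<le> sqrt (opnorm (star M x \<otimes>\<^bsub>M\<^esub> x))" by (intro real_le_rsqrt) simp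
  qed
  then show "(opnorm x)\<^sup>2 \<le> opnorm (star M x \<otimes>\<^bsub>M\<^esub> x)"
    using opnorm_nonneg[OF xy(1)] opnorm_nonneg[of "star M x \<otimes>\<^bsub>M\<^esub> x"] xy
      power_mono[of "opnorm x" "sqrt (opnorm (star M x \<otimes>\<^bsub>M\<^esub> x))" 2] by simp
qed

interpretation N: enveloping_star_algebra M by (rule Minf_enveloping)

text \<open>Applying x to the j-th basis column and reading off coordinate i bounds the entry by
  \<open>opnorm x\<close>. This lower bound yields definiteness of the norm and turns Cauchy
  sequences of matrices into Cauchy sequences of entries.\<close>

theorem entry_le_Minf_norm:
  assumes "x \<in> carrier M"
  shows "cnorm A (x i j) \<le> cnorm M x"
proof -
  let ?v = "mat_unit A j 0 \<one>"
  note [simp] = Minf_entry[OF assms]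
  have v: "?v \<in> carrier M" by (simp add: mat_unit_closed)
  have "ip ?v ?v = \<one>" by (simp add: ip_def mat_unit_star mat_unit_mult, simp add: mat_unit_def)
  then have nv: "vnorm ?v \<le> 1" using norm_one_le by (simp add: vnorm_def)
  obtain n where n: "x \<in> matrices A n" using assms by (rule MinfE)
  then have n': "x \<in> matrices A (max n (Suc j))" by (rule matrices_mono) simp
  have "(x \<otimes>\<^bsub>M\<^esub> ?v) i 0 = (\<Oplus>k\<in>{..<max n (Suc j)}. x i k \<otimes> ?v k 0)"
    using assms v n' by (intro Minf_mult_eq) auto
  also have "\<dots> = x i j" by (subst finsum_single[of j]) (auto simp: mat_unit_def)
  finally have "cnorm A (x i j) \<le> vnorm (x \<otimes>\<^bsub>M\<^esub> ?v)" using entry_le_vnorm[of "x \<otimes>\<^bsub>M\<^esub> ?v" i] assms v by simp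
  also have "\<dots> \<le> opnorm x * vnorm ?v" using assms v by (intro opnorm_bound)
  also have "\<dots> \<le> opnorm x" using nv opnorm_nonneg[OF assms] mult_left_mono[of "vnorm ?v" 1 "opnorm x"] by simp
  also have "\<dots> \<le> cnorm M x" by (rule N.seminorm_le[OF opnorm_seminorm assms])
  finally show ?thesis .
qed

end

subsection \<open>The stabilisation\<close>

lemma filterlim_fst: "filterlim fst F (F \<times>\<^sub>F G)"
  and filterlim_snd: "filterlim snd G (F \<times>\<^sub>F G)"
  by (simp_all add: filterlim_def filtermap_fst_prod_filter filtermap_snd_prod_filter)

text \<open>Differs from \<open>alg_Cauchy\<close> in naming the seminorm, so that it also covers
  \<open>regnorm\<close>, and in including membership in the carrier.\<close>

definition Cauchy_seq :: "('a, 'm) star_alg_scheme \<Rightarrow> ('a \<Rightarrow> real) \<Rightarrow> (nat \<Rightarrow> 'a) \<Rightarrow> bool" where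
  "Cauchy_seq A p s \<longleftrightarrow> (\<forall>i. s i \<in> carrier A) \<and> (\<forall>e>0. \<exists>N. \<forall>m\<ge>N. \<forall>n\<ge>N. p (s m \<ominus>\<^bsub>A\<^esub> s n) < e)"

context seminormed_star_algebra
begin

lemma asy_compose: "\<lbrakk>asy F s t; filterlim f F G\<rbrakk> \<Longrightarrow> asy G (\<lambda>i. s (f i)) (\<lambda>i. t (f i))"
  unfolding asy_def by (auto intro: filterlim_compose)

lemma bd_compose: "\<lbrakk>bd F s; filterlim f F G\<rbrakk> \<Longrightarrow> bd G (\<lambda>i. s (f i))"
  unfolding bd_def by (blast dest: eventually_compose_filterlim)

text \<open>Being Cauchy is asymptotic equality of the two coordinate families along the product
  filter, so the closure of Cauchy sequences under the operations is an instance of the calculus of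
  \<open>asy\<close>.\<close>

lemma Cauchy_seq_iff:
  "Cauchy_seq A p s \<longleftrightarrow> asy (sequentially \<times>\<^sub>F sequentially) (\<lambda>i. s (fst i)) (\<lambda>i. s (snd i))"
proof -
  have "((\<lambda>i. p (s (fst i) \<ominus> s (snd i))) \<longlongrightarrow> 0) (sequentially \<times>\<^sub>F sequentially)
    \<longleftrightarrow> (\<forall>e>0. \<exists>N. \<forall>m\<ge>N. \<forall>n\<ge>N. p (s m \<ominus> s n) < e)" if "\<forall>i. s i \<in> carrier A"
    using that by (auto simp: tendsto_iff eventually_prod_sequentially dist_real_def) blast+
  then show ?thesis unfolding Cauchy_seq_def asy_def by auto
qed

lemma Cauchy_seq_asy:
  assumes "asy sequentially s t" "Cauchy_seq A p t"
  shows "Cauchy_seq A p s"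
proof -
  have "asy (sequentially \<times>\<^sub>F sequentially) (\<lambda>i. s (fst i)) (\<lambda>i. t (fst i))"
    "asy (sequentially \<times>\<^sub>F sequentially) (\<lambda>i. s (snd i)) (\<lambda>i. t (snd i))"
    using assms(1) by (auto intro: asy_compose[OF _ filterlim_fst] asy_compose[OF _ filterlim_snd])
  then show ?thesis using assms(2) unfolding Cauchy_seq_iff by (meson asy_sym asy_trans)
qed

lemma Cauchy_seq_bd:
  assumes "Cauchy_seq A p s"
  shows "bd sequentially s"
proof -
  obtain N where N: "\<And>m n. m \<ge> N \<Longrightarrow> n \<ge> N \<Longrightarrow> p (s m \<ominus> s n) < 1" and s: "\<And>i. s i \<in> carrier A"
    using assms unfolding Cauchy_seq_def by (meson zero_less_one)
  have "p (s n) \<le> p (s N) + 1" if "n \<ge> N" for n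
    using p_le_diff[OF s[of n] s[of N]] N[OF that, of N] by simp
  then show ?thesis using s unfolding bd_def eventually_sequentially by blast
qed

lemma Cauchy_seq_add: "\<lbrakk>Cauchy_seq A p s; Cauchy_seq A p t\<rbrakk> \<Longrightarrow> Cauchy_seq A p (\<lambda>i. s i \<oplus> t i)"
  unfolding Cauchy_seq_iff by (rule asy_add)

lemma Cauchy_seq_scale: "\<lbrakk>Cauchy_seq A p s\<rbrakk> \<Longrightarrow> Cauchy_seq A p (\<lambda>i. c \<odot> s i)"
  unfolding Cauchy_seq_iff by (rule asy_scale)

lemma Cauchy_seq_star: "\<lbrakk>Cauchy_seq A p s\<rbrakk> \<Longrightarrow> Cauchy_seq A p (\<lambda>i. star A (s i))"
  unfolding Cauchy_seq_iff by (rule asy_star)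

lemma Cauchy_seq_mult: "\<lbrakk>Cauchy_seq A p s; Cauchy_seq A p t\<rbrakk> \<Longrightarrow> Cauchy_seq A p (\<lambda>i. s i \<otimes> t i)"
  using Cauchy_seq_bd[of s] Cauchy_seq_bd[of t] unfolding Cauchy_seq_iff
  by (intro asy_mult) (auto intro: bd_compose[OF _ filterlim_snd])

lemma Cauchy_seq_const: "x \<in> carrier A \<Longrightarrow> Cauchy_seq A p (\<lambda>i. x)"
  unfolding Cauchy_seq_iff by (simp add: asy_refl)

lemma Cauchy_seq_norm_convergent:
  assumes "Cauchy_seq A p s"
  shows "convergent (\<lambda>n. p (s n))"
proof (rule Cauchy_convergent, rule metric_CauchyI)
  fix e :: real assume "e > 0"
  then obtain N where N: "\<And>m n. m \<ge> N \<Longrightarrow> n \<ge> N \<Longrightarrow> p (s m \<ominus> s n) < e" and s: "\<And>i. s i \<in> carrier A"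
    using assms unfolding Cauchy_seq_def by meson
  have "dist (p (s m)) (p (s n)) < e" if "m \<ge> N" "n \<ge> N" for m n
    using p_le_diff[OF s[of n] s[of m]] p_le_diff[OF s[of m] s[of n]] N[OF that] N[OF that(2,1)]
    by (auto simp: dist_real_def abs_less_iff)
  then show "\<exists>N. \<forall>m\<ge>N. \<forall>n\<ge>N. dist (p (s m)) (p (s n)) < e" by blast
qed

end

lemma compacts_tensor_simps:
  "carrier (compacts_tensor A)
    = {x. (\<forall>i j. x i j \<in> carrier A) \<and> alg_Cauchy (Minf A) (\<lambda>n. corner A n x)}"
  "mult (compacts_tensor A) = (\<lambda>x y i j. alg_lim A (\<lambda>n. \<Oplus>\<^bsub>A\<^esub>k\<in>{..<n}. x i k \<otimes>\<^bsub>A\<^esub> y k j))"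
  "cnorm (compacts_tensor A) = (\<lambda>x. lim (\<lambda>n. cnorm (Minf A) (corner A n x)))"
  "zero (compacts_tensor A) = zero (Minf A)"
  "add (compacts_tensor A) = add (Minf A)"
  "smult (compacts_tensor A) = smult (Minf A)"
  "star (compacts_tensor A) = star (Minf A)"
  by (simp_all add: compacts_tensor_def)

context unital_cstar_algebra
begin

section \<open>Infinite matrices as limits of finite ones\<close>

abbreviation "D \<equiv> compacts_tensor A"

interpretation N: enveloping_star_algebra M by (rule Minf_enveloping)

definition entries :: "(nat \<Rightarrow> nat \<Rightarrow> 'a) \<Rightarrow> bool" where
  "entries x \<longleftrightarrow> (\<forall>i j. x i j \<in> carrier A)"

lemma entriesD: "entries x \<Longrightarrow> x i j \<in> carrier A"
  by (simp add: entries_def)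

lemma corner_closed: "entries x \<Longrightarrow> corner A n x \<in> carrier M"
  using corner_in_matrices[of x n] by (intro MinfI) (auto simp: entries_def)

lemma D_carrier: "x \<in> carrier D \<longleftrightarrow> entries x \<and> Cauchy_seq M (cnorm M) (\<lambda>n. corner A n x)"
  unfolding compacts_tensor_simps Cauchy_seq_def alg_Cauchy_def entries_def[symmetric]
  using corner_closed by auto

lemma entry_diff_le:
  assumes "x \<in> carrier M" "y \<in> carrier M"
  shows "cnorm A (x i j \<ominus> y i j) \<le> cnorm M (x \<ominus>\<^bsub>M\<^esub> y)"
  using entry_le_Minf_norm[of "x \<ominus>\<^bsub>M\<^esub> y" i j] assms by (simp add: Minf_minus_entries)

lemma corner_add: "\<lbrakk>entries x; entries y\<rbrakk> \<Longrightarrow> corner A n (x \<oplus>\<^bsub>M\<^esub> y) = corner A n x \<oplus>\<^bsub>M\<^esub> corner A n y"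
  and corner_scale: "\<lbrakk>entries x\<rbrakk> \<Longrightarrow> corner A n (c \<odot>\<^bsub>M\<^esub> x) = c \<odot>\<^bsub>M\<^esub> corner A n x"
  and corner_star: "\<lbrakk>entries x\<rbrakk> \<Longrightarrow> corner A n (star M x) = star M (corner A n x)"
  by (auto simp: corner_def Minf_entries entries_def fun_eq_iff)

lemma corner_minus: "\<lbrakk>x \<in> carrier M; y \<in> carrier M\<rbrakk> \<Longrightarrow> corner A n (x \<ominus>\<^bsub>M\<^esub> y) = corner A n x \<ominus>\<^bsub>M\<^esub> corner A n y"
  using corner_add[of x "(-1) \<odot>\<^bsub>M\<^esub> y" n] corner_scale[of y n "-1"] Minf_entry[of _ A]
    corner_closed[of y n]
  by (simp add: entries_def N.minus_eq Minf_entries flip: N.scale_minus_one)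

text \<open>Convergence to an infinite matrix x expressed inside M alone. It is available before D
  is known to be an algebra, and the operations of D are handled through it.\<close>

definition conv :: "(nat \<Rightarrow> nat \<Rightarrow> nat \<Rightarrow> 'a) \<Rightarrow> (nat \<Rightarrow> nat \<Rightarrow> 'a) \<Rightarrow> bool" where
  "conv s x \<longleftrightarrow> entries x \<and> N.asy sequentially s (\<lambda>n. corner A n x)"

lemma conv_entries: "conv s x \<Longrightarrow> entries x"
  and conv_asy: "conv s x \<Longrightarrow> N.asy sequentially s (\<lambda>n. corner A n x)"
  and conv_closed: "conv s x \<Longrightarrow> s n \<in> carrier M"
  by (auto simp: conv_def N.asy_closed)

lemma conv_entry:
  assumes "conv s x"
  shows "asy sequentially (\<lambda>n. s n i j) (\<lambda>_. x i j)"
proof -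
  note a = conv_asy[OF assms] and e = entriesD[OF conv_entries[OF assms]]
  have s: "s n i j \<in> carrier A" for n using conv_closed[OF assms] by (rule Minf_entry)
  have c: "corner A n x i j \<in> carrier A" for n using e by (auto simp: corner_def)
  have "asy sequentially (\<lambda>n. s n i j) (\<lambda>n. corner A n x i j)"
    by (rule asyI[OF _ _ _ N.asy_tendsto[OF a]])
      (use s c N.asy_closed[OF a] in \<open>auto intro: entry_diff_le\<close>)
  moreover have "asy sequentially (\<lambda>n. corner A n x i j) (\<lambda>_. x i j)"
    unfolding asy_def
  proof (intro conjI allI)
    have "\<forall>\<^sub>F n in sequentially. cnorm A (corner A n x i j \<ominus> x i j) = 0"
      using eventually_gt_at_top[of "max i j"]
      by eventually_elim (use e in \<open>auto simp: corner_def\<close>)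
    then show "(\<lambda>n. cnorm A (corner A n x i j \<ominus> x i j)) \<longlonglongrightarrow> 0" by (rule tendsto_eventually)
  qed (use c e in auto)
  ultimately show ?thesis by (rule asy_trans)
qed

lemma conv_unique: "\<lbrakk>conv s x; conv s y\<rbrakk> \<Longrightarrow> x = y"
  by (intro ext asy_unique[OF conv_entry conv_entry]) simp_all

lemma conv_in_D: "\<lbrakk>conv s x; Cauchy_seq M (cnorm M) s\<rbrakk> \<Longrightarrow> x \<in> carrier D"
  unfolding D_carrier using N.Cauchy_seq_asy[OF N.asy_sym[OF conv_asy]] conv_entries by blast

lemma conv_Cauchy: "\<lbrakk>conv s x; x \<in> carrier D\<rbrakk> \<Longrightarrow> Cauchy_seq M (cnorm M) s"
  unfolding D_carrier using N.Cauchy_seq_asy[OF conv_asy] by blast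

lemma conv_corner: "x \<in> carrier D \<Longrightarrow> conv (\<lambda>n. corner A n x) x"
  unfolding D_carrier conv_def by (auto intro: N.asy_refl corner_closed)

lemma conv_const:
  assumes "x \<in> carrier M"
  shows "conv (\<lambda>n. x) x"
proof -
  obtain m where m: "x \<in> matrices A m" using assms by (rule MinfE)
  have e: "entries x" using Minf_entry[OF assms] by (simp add: entries_def)
  have "\<forall>\<^sub>F n in sequentially. cnorm M (x \<ominus>\<^bsub>M\<^esub> corner A n x) = 0"
    using eventually_ge_at_top[of m]
    by eventually_elim (use assms corner_matrices[OF matrices_mono[OF m]] in simp)
  then have "(\<lambda>n. cnorm M (x \<ominus>\<^bsub>M\<^esub> corner A n x)) \<longlonglongrightarrow> 0" by (rule tendsto_eventually)
  then show ?thesis using assms e by (auto simp: conv_def N.asy_def corner_closed)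
qed

text \<open>The entrywise limits form the only candidate x. The difficulty is to get from entries,
  which control each fixed corner, to the norm distance between s n and the growing corner
  \<open>corner A n x\<close>.\<close>

lemma conv_exists:
  assumes s: "Cauchy_seq M (cnorm M) s"
  obtains x where "conv s x" "x \<in> carrier D"
proof -
  have sc: "s n \<in> carrier M" for n using s by (simp add: Cauchy_seq_def)
  have "\<exists>l\<in>carrier A. asy sequentially (\<lambda>n. s n i j) (\<lambda>_. l)" for i j
  proof (rule complete_asy)
    show "s n i j \<in> carrier A" for n by (rule Minf_entry[OF sc])
    show "alg_Cauchy A (\<lambda>n. s n i j)" unfolding alg_Cauchy_def
    proof (intro allI impI)
      fix e :: real assume "e > 0"
      then obtain K where "\<And>m n. m \<ge> K \<Longrightarrow> n \<ge> K \<Longrightarrow> cnorm M (s m \<ominus>\<^bsub>M\<^esub> s n) < e"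
        using s unfolding Cauchy_seq_def by meson
      then show "\<exists>K. \<forall>m\<ge>K. \<forall>n\<ge>K. cnorm A (s m i j \<ominus> s n i j) < e"
        using entry_diff_le[OF sc sc] by (meson le_less_trans)
    qed
  qed
  then obtain x where xc: "\<And>i j. x i j \<in> carrier A"
    and x: "\<And>i j. asy sequentially (\<lambda>n. s n i j) (\<lambda>_. x i j)" by metis
  have e: "entries x" using xc by (simp add: entries_def)
  have se: "entries (s n)" for n using Minf_entry[OF sc] by (simp add: entries_def)
  have cc: "corner A m x \<in> carrier M" "corner A m (s n) \<in> carrier M" for m n
    using e se by (auto intro: corner_closed)
  \<comment> \<open>In a corner of fixed size the norm is bounded by a finite sum of entry norms, so
    entrywise convergence is norm convergence there.\<close>
  have lim: "(\<lambda>k. cnorm M (corner A m (s k) \<ominus>\<^bsub>M\<^esub> corner A m x)) \<longlonglongrightarrow> 0" for m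
  proof (rule tendsto_sandwich[OF _ _ tendsto_const])
    have "(\<lambda>k. \<Sum>i<m. \<Sum>j<m. 2 * cnorm A (s k i j \<ominus> x i j)) \<longlonglongrightarrow> (\<Sum>i<m. \<Sum>j<m. 2 * 0)"
      by (intro tendsto_intros asy_tendsto x)
    then show "(\<lambda>k. \<Sum>i<m. \<Sum>j<m. 2 * cnorm A (s k i j \<ominus> x i j)) \<longlonglongrightarrow> 0" by simp
    have "cnorm M (corner A m (s k) \<ominus>\<^bsub>M\<^esub> corner A m x) \<le> (\<Sum>i<m. \<Sum>j<m. 2 * cnorm A (s k i j \<ominus> x i j))" for k
    proof -
      let ?d = "corner A m (s k) \<ominus>\<^bsub>M\<^esub> corner A m x"
      have d: "?d i j = (if i < m \<and> j < m then s k i j \<ominus> x i j else \<zero>)" for i j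
        using cc by (simp add: Minf_minus_entries, simp add: corner_def)
      then have "?d \<in> matrices A m" using xc Minf_entry[OF sc] by (auto simp: matrices_def d)
      from Minf_norm_le_sum[OF this] show ?thesis by (simp add: d)
    qed
    then show "\<forall>\<^sub>F k in sequentially. cnorm M (corner A m (s k) \<ominus>\<^bsub>M\<^esub> corner A m x)
      \<le> (\<Sum>i<m. \<Sum>j<m. 2 * cnorm A (s k i j \<ominus> x i j))" by simp
    show "\<forall>\<^sub>F k in sequentially. 0 \<le> cnorm M (corner A m (s k) \<ominus>\<^bsub>M\<^esub> corner A m x)" using cc by simp
  qed
  \<comment> \<open>Compression to a corner is contractive, so the Cauchy estimate for s holds in
    every corner from the same index on; letting k tend to infinity makes the convergence uniform in
    m.\<close>
  have unif: "\<exists>K. \<forall>n\<ge>K. \<forall>m. cnorm M (corner A m (s n) \<ominus>\<^bsub>M\<^esub> corner A m x) \<le> e" if "e > 0" for e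
  proof -
    obtain K where K: "\<And>m n. m \<ge> K \<Longrightarrow> n \<ge> K \<Longrightarrow> cnorm M (s m \<ominus>\<^bsub>M\<^esub> s n) < e"
      using s \<open>e > 0\<close> unfolding Cauchy_seq_def by meson
    have "cnorm M (corner A m (s n) \<ominus>\<^bsub>M\<^esub> corner A m x) \<le> e" if "n \<ge> K" for n m
    proof (rule tendsto_lowerbound)
      show "(\<lambda>k. e + cnorm M (corner A m (s k) \<ominus>\<^bsub>M\<^esub> corner A m x)) \<longlonglongrightarrow> e"
        using tendsto_add[OF tendsto_const lim, of e] by simp
      show "\<forall>\<^sub>F k in sequentially. cnorm M (corner A m (s n) \<ominus>\<^bsub>M\<^esub> corner A m x)
        \<le> e + cnorm M (corner A m (s k) \<ominus>\<^bsub>M\<^esub> corner A m x)"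
        using eventually_ge_at_top[of K]
      proof eventually_elim
        case (elim k)
        have "cnorm M (corner A m (s n) \<ominus>\<^bsub>M\<^esub> corner A m (s k)) \<le> cnorm M (s n \<ominus>\<^bsub>M\<^esub> s k)"
          using Minf_norm_corner[of "s n \<ominus>\<^bsub>M\<^esub> s k" m] sc by (simp add: corner_minus)
        then show ?case
          using N.p_tri[of "corner A m (s n)" "corner A m (s k)" "corner A m x"] cc K[OF that elim] by simp
      qed
    qed simp
    then show ?thesis by blast
  qed
  have "(\<lambda>n. cnorm M (s n \<ominus>\<^bsub>M\<^esub> corner A n x)) \<longlonglongrightarrow> 0"
  proof (rule LIMSEQ_I)
    fix r :: real assume "r > 0"
    then have r: "r / 4 > 0" by simp
    obtain K where K: "\<And>m n. m \<ge> K \<Longrightarrow> n \<ge> K \<Longrightarrow> cnorm M (s m \<ominus>\<^bsub>M\<^esub> s n) < r / 4"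
      using s r unfolding Cauchy_seq_def by meson
    obtain L where L: "\<And>n m. n \<ge> L \<Longrightarrow> cnorm M (corner A m (s n) \<ominus>\<^bsub>M\<^esub> corner A m x) \<le> r / 4"
      using unif[OF r] by blast
    \<comment> \<open>The fixed matrix s k has a finite size m, so for n \<ge> m it is its own n-th
      corner. Thus s n is within r / 4 of s k, and s k within r / 4 of
      \<open>corner A n x\<close>.\<close>
    define k where "k = max K L"
    obtain m where m: "s k \<in> matrices A m" using sc by (rule MinfE)
    have "norm (cnorm M (s n \<ominus>\<^bsub>M\<^esub> corner A n x) - 0) < r" if n: "n \<ge> max k m" for n
    proof -
      have "corner A n (s k) = s k" using n corner_matrices[OF matrices_mono[OF m]] by simp
      then have "cnorm M (s k \<ominus>\<^bsub>M\<^esub> corner A n x) \<le> r / 4" using L[of k n] by (simp add: k_def)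
      moreover have "cnorm M (s n \<ominus>\<^bsub>M\<^esub> s k) < r / 4" using K[of n k] n by (simp add: k_def)
      moreover have "0 \<le> cnorm M (s n \<ominus>\<^bsub>M\<^esub> corner A n x)" using sc cc by simp
      ultimately show ?thesis using N.p_tri[of "s n" "s k" "corner A n x"] sc cc \<open>r > 0\<close> by simp
    qed
    then show "\<exists>no. \<forall>n\<ge>no. norm (cnorm M (s n \<ominus>\<^bsub>M\<^esub> corner A n x) - 0) < r" by blast
  qed
  then have "conv s x" using e sc cc by (auto simp: conv_def N.asy_def)
  then show ?thesis using that conv_in_D s by blast
qed

lemma conv_add: "\<lbrakk>conv s x; conv t y\<rbrakk> \<Longrightarrow> conv (\<lambda>n. s n \<oplus>\<^bsub>M\<^esub> t n) (x \<oplus>\<^bsub>M\<^esub> y)"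
  using N.asy_add[of sequentially s "\<lambda>n. corner A n x" t "\<lambda>n. corner A n y"]
  by (auto simp: conv_def corner_add, auto simp: entries_def Minf_entries)

lemma conv_scale: "\<lbrakk>conv s x\<rbrakk> \<Longrightarrow> conv (\<lambda>n. c \<odot>\<^bsub>M\<^esub> s n) (c \<odot>\<^bsub>M\<^esub> x)"
  using N.asy_scale[of sequentially s "\<lambda>n. corner A n x" c]
  by (auto simp: conv_def corner_scale, auto simp: entries_def Minf_entries)

lemma conv_star: "\<lbrakk>conv s x\<rbrakk> \<Longrightarrow> conv (\<lambda>n. star M (s n)) (star M x)"
  using N.asy_star[of sequentially s "\<lambda>n. corner A n x"]
  by (auto simp: conv_def corner_star, auto simp: entries_def Minf_entries)

text \<open>The product in D is an entrywise limit of partial sums. For n beyond i and j the partial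
  sum is entry (i, j) of the product of the n-th corners; these products are Cauchy in norm, which
  proves convergence of the series and identifies its sum.\<close>

lemma conv_mult:
  assumes s: "conv s x" and t: "conv t y" and x: "x \<in> carrier D" and y: "y \<in> carrier D"
  shows "conv (\<lambda>n. s n \<otimes>\<^bsub>M\<^esub> t n) (x \<otimes>\<^bsub>D\<^esub> y)"
proof -
  let ?X = "\<lambda>n. corner A n x" and ?Y = "\<lambda>n. corner A n y"
  have C: "Cauchy_seq M (cnorm M) ?X" "Cauchy_seq M (cnorm M) ?Y" and e: "entries x" "entries y"
    using x y by (auto simp: D_carrier)
  obtain z where z: "conv (\<lambda>n. ?X n \<otimes>\<^bsub>M\<^esub> ?Y n) z" "z \<in> carrier D"
    using conv_exists[OF N.Cauchy_seq_mult[OF C]] by blast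
  have "x \<otimes>\<^bsub>D\<^esub> y = z"
  proof (intro ext)
    fix i j
    let ?S = "\<lambda>n. \<Oplus>k\<in>{..<n}. x i k \<otimes> y k j"
    have Sc: "?S n \<in> carrier A" for n using e by (auto intro!: finsum_closed dest: entriesD)
    have eq: "(?X n \<otimes>\<^bsub>M\<^esub> ?Y n) i j = ?S n" if "n > i" "n > j" for n
    proof -
      have "(?X n \<otimes>\<^bsub>M\<^esub> ?Y n) i j = (\<Oplus>k\<in>{..<n}. ?X n i k \<otimes> ?Y n k j)"
        using e corner_in_matrices[of x n] by (intro Minf_mult_eq corner_closed) (auto simp: entries_def)
      also have "\<dots> = ?S n"
        using that e by (intro finsum_cong') (auto simp: corner_def entries_def)
      finally show ?thesis .
    qed
    have "asy sequentially ?S (\<lambda>_. z i j)"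
      unfolding asy_def
    proof (intro conjI allI)
      note a = conv_entry[OF z(1), of i j]
      show zc: "z i j \<in> carrier A" using conv_entries[OF z(1)] by (rule entriesD)
      have "\<forall>\<^sub>F n in sequentially. cnorm A ((?X n \<otimes>\<^bsub>M\<^esub> ?Y n) i j \<ominus> z i j) = cnorm A (?S n \<ominus> z i j)"
        using eventually_gt_at_top[of "max i j"] by eventually_elim (use eq in auto)
      then show "(\<lambda>n. cnorm A (?S n \<ominus> z i j)) \<longlonglongrightarrow> 0"
        using asy_tendsto[OF a] by (rule Lim_transform_eventually[rotated])
    qed (rule Sc)
    note S = this
    have "alg_lim A ?S = z i j" unfolding alg_lim_def
    proof (rule the_equality)
      show "z i j \<in> carrier A \<and> alg_tendsto A ?S (z i j)"
        using S by (auto simp: asy_def alg_tendsto_def)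
      fix l assume "l \<in> carrier A \<and> alg_tendsto A ?S l"
      then have "asy sequentially ?S (\<lambda>_. l)" using Sc by (auto simp: asy_def alg_tendsto_def)
      then show "l = z i j" using asy_unique[OF _ S] by simp
    qed
    then show "(x \<otimes>\<^bsub>D\<^esub> y) i j = z i j" by (simp add: compacts_tensor_simps)
  qed
  moreover have "N.asy sequentially (\<lambda>n. s n \<otimes>\<^bsub>M\<^esub> t n) (\<lambda>n. ?X n \<otimes>\<^bsub>M\<^esub> ?Y n)"
    by (rule N.asy_mult[OF conv_asy[OF s] conv_asy[OF t] N.Cauchy_seq_bd[OF C(1)] N.Cauchy_seq_bd[OF C(2)]])
  ultimately show ?thesis using z N.asy_trans unfolding conv_def by blast
qed

lemma D_ops_closed:
  assumes "x \<in> carrier D" "y \<in> carrier D"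
  shows "x \<oplus>\<^bsub>M\<^esub> y \<in> carrier D" "c \<odot>\<^bsub>M\<^esub> x \<in> carrier D" "star M x \<in> carrier D" "x \<otimes>\<^bsub>D\<^esub> y \<in> carrier D"
proof -
  note a = conv_corner[OF assms(1)] and b = conv_corner[OF assms(2)]
  note C = conv_Cauchy[OF a assms(1)] conv_Cauchy[OF b assms(2)]
  show "x \<oplus>\<^bsub>M\<^esub> y \<in> carrier D" by (rule conv_in_D[OF conv_add[OF a b] N.Cauchy_seq_add[OF C]])
  show "c \<odot>\<^bsub>M\<^esub> x \<in> carrier D" by (rule conv_in_D[OF conv_scale[OF a] N.Cauchy_seq_scale[OF C(1)]])
  show "star M x \<in> carrier D" by (rule conv_in_D[OF conv_star[OF a] N.Cauchy_seq_star[OF C(1)]])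
  show "x \<otimes>\<^bsub>D\<^esub> y \<in> carrier D"
    by (rule conv_in_D[OF conv_mult[OF a b assms] N.Cauchy_seq_mult[OF C]])
qed

lemma Minf_subset_D: "x \<in> carrier M \<Longrightarrow> x \<in> carrier D"
  using conv_in_D[OF conv_const N.Cauchy_seq_const] .

text \<open>Laws of addition, scalars and involution alone hold entrywise. Where products occur,
  both sides are limits of sequences of finite matrices that agree by the corresponding law in M,
  and \<open>conv_unique\<close> identifies the limits.\<close>

lemma D_star_algebra: "star_algebra D"
proof (intro star_algebra.intro star_algebra_axioms.intro abelian_groupI)
  note s = compacts_tensor_simps(4-)
  fix x y assume x: "x \<in> carrier D" and y: "y \<in> carrier D"
  let ?X = "\<lambda>n. corner A n x" and ?Y = "\<lambda>n. corner A n y"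
  note X = conv_corner[OF x] and Y = conv_corner[OF y]
  note c = D_ops_closed
  note ce = conv_closed[OF X] conv_closed[OF Y]
  have e: "x i j \<in> carrier A" "y i j \<in> carrier A" for i j
    using conv_entries[OF X] conv_entries[OF Y] by (auto simp: entries_def)
  note [simp] = e
  show "x \<oplus>\<^bsub>D\<^esub> y \<in> carrier D" "x \<otimes>\<^bsub>D\<^esub> y \<in> carrier D" using c[OF x y] by (simp_all add: s)
  show "x \<oplus>\<^bsub>D\<^esub> y = y \<oplus>\<^bsub>D\<^esub> x" by (intro ext) (simp add: s Minf_entries a_comm)
  show "star D (x \<oplus>\<^bsub>D\<^esub> y) = star D x \<oplus>\<^bsub>D\<^esub> star D y" by (intro ext) (simp add: s Minf_entries star_add)
  show "k \<odot>\<^bsub>D\<^esub> (x \<oplus>\<^bsub>D\<^esub> y) = k \<odot>\<^bsub>D\<^esub> x \<oplus>\<^bsub>D\<^esub> k \<odot>\<^bsub>D\<^esub> y" for k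
    by (intro ext) (simp add: s Minf_entries scale_add_right)
  show "k \<odot>\<^bsub>D\<^esub> x \<otimes>\<^bsub>D\<^esub> y = k \<odot>\<^bsub>D\<^esub> (x \<otimes>\<^bsub>D\<^esub> y)" for k
    using conv_mult[OF conv_scale[OF X] Y c(2)[OF x y] y, of k] conv_scale[OF conv_mult[OF X Y x y], of k]
    by (intro conv_unique) (simp_all add: s N.scale_mult_left ce)
  show "x \<otimes>\<^bsub>D\<^esub> (k \<odot>\<^bsub>D\<^esub> y) = k \<odot>\<^bsub>D\<^esub> (x \<otimes>\<^bsub>D\<^esub> y)" for k
    using conv_mult[OF X conv_scale[OF Y] x c(2)[OF y x], of k] conv_scale[OF conv_mult[OF X Y x y], of k]
    by (intro conv_unique) (simp_all add: s N.scale_mult_right ce)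
  show "star D (x \<otimes>\<^bsub>D\<^esub> y) = star D y \<otimes>\<^bsub>D\<^esub> star D x"
    using conv_star[OF conv_mult[OF X Y x y]] conv_mult[OF conv_star[OF Y] conv_star[OF X] c(3)[OF y x] c(3)[OF x y]]
    by (intro conv_unique) (simp_all add: s N.star_mult ce)
  fix z assume z: "z \<in> carrier D"
  let ?Z = "\<lambda>n. corner A n z"
  note Z = conv_corner[OF z]
  note ce = ce conv_closed[OF Z]
  have "z i j \<in> carrier A" for i j using conv_entries[OF Z] by (auto simp: entries_def)
  note [simp] = this
  show "x \<oplus>\<^bsub>D\<^esub> y \<oplus>\<^bsub>D\<^esub> z = x \<oplus>\<^bsub>D\<^esub> (y \<oplus>\<^bsub>D\<^esub> z)" by (intro ext) (simp add: s Minf_entries a_assoc)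
  show "(x \<oplus>\<^bsub>D\<^esub> y) \<otimes>\<^bsub>D\<^esub> z = x \<otimes>\<^bsub>D\<^esub> z \<oplus>\<^bsub>D\<^esub> y \<otimes>\<^bsub>D\<^esub> z"
    using conv_mult[OF conv_add[OF X Y] Z c(1)[OF x y] z]
      conv_add[OF conv_mult[OF X Z x z] conv_mult[OF Y Z y z]]
    by (intro conv_unique) (simp_all add: s N.distr_right ce)
  show "z \<otimes>\<^bsub>D\<^esub> (x \<oplus>\<^bsub>D\<^esub> y) = z \<otimes>\<^bsub>D\<^esub> x \<oplus>\<^bsub>D\<^esub> z \<otimes>\<^bsub>D\<^esub> y"
    using conv_mult[OF Z conv_add[OF X Y] z c(1)[OF x y]]
      conv_add[OF conv_mult[OF Z X z x] conv_mult[OF Z Y z y]]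
    by (intro conv_unique) (simp_all add: s N.distr_left ce)
  show "(x \<otimes>\<^bsub>D\<^esub> y) \<otimes>\<^bsub>D\<^esub> z = x \<otimes>\<^bsub>D\<^esub> (y \<otimes>\<^bsub>D\<^esub> z)"
    using conv_mult[OF conv_mult[OF X Y x y] Z c(4)[OF x y] z]
      conv_mult[OF X conv_mult[OF Y Z y z] x c(4)[OF y z]]
    by (intro conv_unique) (simp_all add: N.mult_assoc ce)
next
  note s = compacts_tensor_simps(4-)
  show "\<zero>\<^bsub>D\<^esub> \<in> carrier D" by (simp add: s Minf_subset_D)
  fix x assume x: "x \<in> carrier D"
  have e: "x i j \<in> carrier A" for i j using x by (auto simp: D_carrier entries_def)
  note [simp] = e
  note c = D_ops_closed[OF x x]
  show "\<zero>\<^bsub>D\<^esub> \<oplus>\<^bsub>D\<^esub> x = x" by (intro ext) (simp add: s Minf_entries)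
  show "\<exists>y\<in>carrier D. y \<oplus>\<^bsub>D\<^esub> x = \<zero>\<^bsub>D\<^esub>"
  proof
    show "(-1) \<odot>\<^bsub>M\<^esub> x \<in> carrier D" by (rule c)
    show "(-1) \<odot>\<^bsub>M\<^esub> x \<oplus>\<^bsub>D\<^esub> x = \<zero>\<^bsub>D\<^esub>" by (intro ext) (simp add: s Minf_entries scale_minus_one l_neg)
  qed
  show "k \<odot>\<^bsub>D\<^esub> x \<in> carrier D" for k using c by (simp add: s)
  show "(k + d) \<odot>\<^bsub>D\<^esub> x = k \<odot>\<^bsub>D\<^esub> x \<oplus>\<^bsub>D\<^esub> d \<odot>\<^bsub>D\<^esub> x" for k d by (intro ext) (simp add: s Minf_entries scale_add_left)
  show "(k * d) \<odot>\<^bsub>D\<^esub> x = k \<odot>\<^bsub>D\<^esub> (d \<odot>\<^bsub>D\<^esub> x)" for k d by (intro ext) (simp add: s Minf_entries scale_scale)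
  show "1 \<odot>\<^bsub>D\<^esub> x = x" by (intro ext) (simp add: s Minf_entries scale_one)
  show "star D x \<in> carrier D" using c by (simp add: s)
  show "star D (star D x) = x" by (intro ext) (simp add: s Minf_entries star_star)
  show "star D (k \<odot>\<^bsub>D\<^esub> x) = cnj k \<odot>\<^bsub>D\<^esub> star D x" for k by (intro ext) (simp add: s Minf_entries star_scale)
qed

section \<open>The norm of the stabilisation, density of the finite matrices and
  completeness\<close>

lemma conv_norm:
  assumes "conv s x" "x \<in> carrier D"
  shows "(\<lambda>n. cnorm M (s n)) \<longlonglongrightarrow> cnorm D x"
proof (rule N.asy_norm[OF conv_asy[OF assms(1)]])
  show "(\<lambda>n. cnorm M (corner A n x)) \<longlonglongrightarrow> cnorm D x"
    using N.Cauchy_seq_norm_convergent[of "\<lambda>n. corner A n x"] assms(2)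
    by (simp add: compacts_tensor_simps(3) D_carrier convergent_LIMSEQ_iff)
qed

lemma cnorm_D_Minf: "x \<in> carrier M \<Longrightarrow> cnorm D x = cnorm M x"
  using LIMSEQ_unique[OF conv_norm[OF conv_const Minf_subset_D] tendsto_const] .

lemma D_seminorm: "cstar_seminorm D (cnorm D)"
proof (rule cstar_seminormI[OF D_star_algebra])
  note s = compacts_tensor_simps(4-)
  fix x assume x: "x \<in> carrier D"
  note X = conv_corner[OF x]
  note nX = conv_norm[OF X x] and cX = conv_closed[OF X]
  show "0 \<le> cnorm D x" by (rule LIMSEQ_le_const[OF nX]) (simp add: cX)
  show "cnorm D (c \<odot>\<^bsub>D\<^esub> x) \<le> cmod c * cnorm D x" for c
    unfolding s by (rule LIMSEQ_le[OF conv_norm[OF conv_scale[OF X]] tendsto_mult[OF tendsto_const nX]])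
      (simp_all add: D_ops_closed[OF x x] x s N.p_scale cX)
  show "(cnorm D x)\<^sup>2 \<le> cnorm D (star D x \<otimes>\<^bsub>D\<^esub> x)"
    unfolding s by (rule LIMSEQ_le[OF tendsto_power[OF nX] conv_norm[OF conv_mult[OF conv_star[OF X] X]]])
      (simp_all add: D_ops_closed[OF D_ops_closed(3)[OF x x] x] D_ops_closed[OF x x] x s N.p_star_mult cX)
  fix y assume y: "y \<in> carrier D"
  note Y = conv_corner[OF y]
  note nY = conv_norm[OF Y y] and cY = conv_closed[OF Y]
  show "cnorm D (x \<oplus>\<^bsub>D\<^esub> y) \<le> cnorm D x + cnorm D y"
    unfolding s by (rule LIMSEQ_le[OF conv_norm[OF conv_add[OF X Y]] tendsto_add[OF nX nY]])
      (simp_all add: D_ops_closed x y s N.p_add cX cY)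
  show "cnorm D (x \<otimes>\<^bsub>D\<^esub> y) \<le> cnorm D x * cnorm D y"
    unfolding s by (rule LIMSEQ_le[OF conv_norm[OF conv_mult[OF X Y x y]] tendsto_mult[OF nX nY]])
      (simp_all add: D_ops_closed x y N.p_mult cX cY)
qed

lemma D_minus_eq:
  assumes "x \<in> carrier D" "y \<in> carrier D"
  shows "x \<ominus>\<^bsub>D\<^esub> y = x \<oplus>\<^bsub>M\<^esub> (-1) \<odot>\<^bsub>M\<^esub> y"
proof -
  interpret D: star_algebra D by (rule D_star_algebra)
  show ?thesis using assms by (simp add: D.minus_eq compacts_tensor_simps(4-) flip: D.scale_minus_one)
qed

lemma conv_minus:
  assumes "conv s x" "conv t y" "x \<in> carrier D" "y \<in> carrier D"
  shows "conv (\<lambda>n. s n \<ominus>\<^bsub>M\<^esub> t n) (x \<ominus>\<^bsub>D\<^esub> y)"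
  using conv_add[OF assms(1) conv_scale[OF assms(2), of "-1"]] assms conv_closed[OF assms(2)]
  by (simp add: D_minus_eq N.minus_eq N.scale_minus_one)

lemma Minf_minus_eq_D: "\<lbrakk>x \<in> carrier M; y \<in> carrier M\<rbrakk> \<Longrightarrow> x \<ominus>\<^bsub>D\<^esub> y = x \<ominus>\<^bsub>M\<^esub> y"
  by (simp add: D_minus_eq Minf_subset_D N.minus_eq N.scale_minus_one)

text \<open>The norm of s n - x in D is the limit over k of the norms of s n - s k in M, which the
  Cauchy property of s makes small.\<close>

lemma conv_tendsto_D:
  assumes "conv s x" "x \<in> carrier D"
  shows "(\<lambda>n. cnorm D (s n \<ominus>\<^bsub>D\<^esub> x)) \<longlonglongrightarrow> 0"
proof (rule LIMSEQ_I)
  interpret D: seminormed_star_algebra D "cnorm D"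
    using D_star_algebra D_seminorm by (simp add: seminormed_star_algebra.intro seminormed_star_algebra_axioms.intro)
  fix r :: real assume "r > 0"
  then have "r / 2 > 0" by simp
  then obtain K where K: "\<And>m n. m \<ge> K \<Longrightarrow> n \<ge> K \<Longrightarrow> cnorm M (s m \<ominus>\<^bsub>M\<^esub> s n) < r / 2"
    using conv_Cauchy[OF assms] unfolding Cauchy_seq_def by meson
  have "norm (cnorm D (s n \<ominus>\<^bsub>D\<^esub> x) - 0) < r" if n: "n \<ge> K" for n
  proof -
    note sn = conv_closed[OF assms(1), of n]
    have "conv (\<lambda>k. s n \<ominus>\<^bsub>M\<^esub> s k) (s n \<ominus>\<^bsub>D\<^esub> x)"
      by (rule conv_minus[OF conv_const[OF sn] assms(1) Minf_subset_D[OF sn] assms(2)])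
    then have "(\<lambda>k. cnorm M (s n \<ominus>\<^bsub>M\<^esub> s k)) \<longlonglongrightarrow> cnorm D (s n \<ominus>\<^bsub>D\<^esub> x)"
      by (rule conv_norm) (simp add: Minf_subset_D sn assms(2))
    then have "cnorm D (s n \<ominus>\<^bsub>D\<^esub> x) \<le> r / 2"
      by (rule LIMSEQ_le_const2) (meson K n less_imp_le)
    moreover have "0 \<le> cnorm D (s n \<ominus>\<^bsub>D\<^esub> x)" using sn assms(2) by (simp add: Minf_subset_D)
    ultimately show ?thesis using \<open>r > 0\<close> by simp
  qed
  then show "\<exists>no. \<forall>n\<ge>no. norm (cnorm D (s n \<ominus>\<^bsub>D\<^esub> x) - 0) < r" by blast
qed

lemma D_dense:
  assumes "x \<in> carrier D" "e > 0"
  obtains y where "y \<in> carrier M" "cnorm D (y \<ominus>\<^bsub>D\<^esub> x) < e"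
proof -
  have "\<forall>\<^sub>F n in sequentially. cnorm D (corner A n x \<ominus>\<^bsub>D\<^esub> x) < e"
    using order_tendstoD(2)[OF conv_tendsto_D[OF conv_corner[OF assms(1)] assms(1)] assms(2)] .
  then obtain n where "cnorm D (corner A n x \<ominus>\<^bsub>D\<^esub> x) < e" by (auto simp: eventually_sequentially)
  then show ?thesis using that conv_closed[OF conv_corner[OF assms(1)]] by blast
qed

text \<open>Definiteness comes from the entries. For completeness a Cauchy sequence in D is replaced
  by one in M at distance less than 1/(n+1), to which \<open>conv_exists\<close> applies.\<close>

theorem compacts_tensor_cstar_algebra: "cstar_algebra D"
proof (intro cstar_algebra.intro cstar_algebra_axioms.intro D_star_algebra D_seminorm)
  fix x assume x: "x \<in> carrier D" and 0: "cnorm D x = 0"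
  have e: "x i j \<in> carrier A" for i j using x by (auto simp: D_carrier entries_def)
  have "cnorm A (x i j) \<le> 0" for i j
  proof (rule LIMSEQ_le_const)
    show "(\<lambda>n. cnorm M (corner A n x)) \<longlonglongrightarrow> 0" using conv_norm[OF conv_corner[OF x] x] 0 by simp
    have "cnorm A (x i j) \<le> cnorm M (corner A n x)" if "n \<ge> Suc (max i j)" for n
    proof -
      have "corner A n x i j = x i j" using that by (auto simp: corner_def)
      then show ?thesis using entry_le_Minf_norm[OF conv_closed[OF conv_corner[OF x]], of n i j] by simp
    qed
    then show "\<exists>K. \<forall>n\<ge>K. cnorm A (x i j) \<le> cnorm M (corner A n x)" by blast
  qed
  then have "x i j = \<zero>" for i j using cnorm_definite[OF e] p_nonneg[OF e] by (meson order_antisym)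
  then show "x = \<zero>\<^bsub>D\<^esub>" by (intro ext) (simp add: compacts_tensor_simps(4) Minf_entries)
next
  interpret D: seminormed_star_algebra D "cnorm D"
    using D_star_algebra D_seminorm by (simp add: seminormed_star_algebra.intro seminormed_star_algebra_axioms.intro)
  fix s :: "nat \<Rightarrow> nat \<Rightarrow> nat \<Rightarrow> 'a" assume s: "\<And>n. s n \<in> carrier D" "alg_Cauchy D s"
  have "\<exists>y\<in>carrier M. cnorm D (y \<ominus>\<^bsub>D\<^esub> s n) < inverse (real (Suc n))" for n
    using D_dense[OF s(1), of "inverse (real (Suc n))" n] by auto
  then obtain t where t: "\<And>n. t n \<in> carrier M" "\<And>n. cnorm D (t n \<ominus>\<^bsub>D\<^esub> s n) < inverse (real (Suc n))"
    by metis
  have st: "D.asy sequentially t s"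
    by (rule D.asyI[OF _ _ _ LIMSEQ_inverse_real_of_nat]) (use s t Minf_subset_D in \<open>auto intro: less_imp_le\<close>)
  have "Cauchy_seq D (cnorm D) t"
    using D.Cauchy_seq_asy[OF st] s by (auto simp: Cauchy_seq_def alg_Cauchy_def)
  then have "Cauchy_seq M (cnorm M) t"
    using t by (simp add: Cauchy_seq_def Minf_minus_eq_D cnorm_D_Minf)
  then obtain x where x: "conv t x" "x \<in> carrier D" using conv_exists by blast
  have "D.asy sequentially t (\<lambda>_. x)"
    using conv_tendsto_D[OF x] x t by (auto simp: D.asy_def Minf_subset_D)
  then have "D.asy sequentially s (\<lambda>_. x)" using D.asy_trans[OF D.asy_sym[OF st]] by blast
  then show "\<exists>l\<in>carrier D. alg_tendsto D s l" using x by (auto simp: D.asy_def alg_tendsto_def)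
qed

end

subsection \<open>Amplifications and approximate units\<close>

text \<open>The maps \<theta> i of the proof are linear but only approximately multiplicative, so
  amplification is set up for linear maps, with *-homomorphisms as a special case.\<close>

definition linear_map :: "('a, 'm) star_alg_scheme \<Rightarrow> ('b, 'n) star_alg_scheme \<Rightarrow> ('a \<Rightarrow> 'b) \<Rightarrow> bool" where
  "linear_map A B \<theta> \<longleftrightarrow> (\<forall>x\<in>carrier A. \<theta> x \<in> carrier B) \<and>
     (\<forall>x\<in>carrier A. \<forall>y\<in>carrier A. \<theta> (x \<oplus>\<^bsub>A\<^esub> y) = \<theta> x \<oplus>\<^bsub>B\<^esub> \<theta> y) \<and>
     (\<forall>c. \<forall>x\<in>carrier A. \<theta> (c \<odot>\<^bsub>A\<^esub> x) = c \<odot>\<^bsub>B\<^esub> \<theta> x)"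

lemma linear_mapD:
  assumes "linear_map A B \<theta>"
  shows "x \<in> carrier A \<Longrightarrow> \<theta> x \<in> carrier B"
    and "\<lbrakk>x \<in> carrier A; y \<in> carrier A\<rbrakk> \<Longrightarrow> \<theta> (x \<oplus>\<^bsub>A\<^esub> y) = \<theta> x \<oplus>\<^bsub>B\<^esub> \<theta> y"
    and "x \<in> carrier A \<Longrightarrow> \<theta> (c \<odot>\<^bsub>A\<^esub> x) = c \<odot>\<^bsub>B\<^esub> \<theta> x"
  using assms by (auto simp: linear_map_def)

lemma star_hom_linear: "\<psi> \<in> star_hom A B \<Longrightarrow> linear_map A B \<psi>"
  by (auto simp: linear_map_def star_homD)

locale linear_map_pair = A: star_algebra A + B: star_algebra B
  for A :: "('a, 'm) star_alg_scheme" and B :: "('b, 'n) star_alg_scheme" +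
  fixes \<theta> :: "'a \<Rightarrow> 'b"
  assumes lin: "linear_map A B \<theta>"
begin

lemma map_zero [simp]: "\<theta> \<zero>\<^bsub>A\<^esub> = \<zero>\<^bsub>B\<^esub>"
  using linear_mapD(3)[OF lin A.zero_closed, of 0] linear_mapD(1)[OF lin A.zero_closed] by simp

lemma map_minus: "\<lbrakk>x \<in> carrier A; y \<in> carrier A\<rbrakk> \<Longrightarrow> \<theta> (x \<ominus>\<^bsub>A\<^esub> y) = \<theta> x \<ominus>\<^bsub>B\<^esub> \<theta> y"
  by (simp add: A.minus_eq B.minus_eq linear_mapD[OF lin]
      flip: A.scale_minus_one B.scale_minus_one)

lemma map_finsum: "f \<in> I \<rightarrow> carrier A \<Longrightarrow> \<theta> (\<Oplus>\<^bsub>A\<^esub>i\<in>I. f i) = (\<Oplus>\<^bsub>B\<^esub>i\<in>I. \<theta> (f i))"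
proof (induction I rule: infinite_finite_induct)
  case (insert i I)
  then have "f i \<in> carrier A" "f \<in> I \<rightarrow> carrier A" "(\<lambda>i. \<theta> (f i)) \<in> I \<rightarrow> carrier B"
    by (auto intro!: linear_mapD(1)[OF lin])
  with insert show ?case by (simp add: linear_mapD[OF lin])
qed simp_all

lemma amplify_matrices: "x \<in> matrices A n \<Longrightarrow> amplify \<theta> x \<in> matrices B n"
  by (auto simp: amplify_def matrices_def linear_mapD[OF lin])

lemma amplify_linear: "linear_map (Minf A) (Minf B) (amplify \<theta>)"
  unfolding linear_map_def
proof (intro conjI ballI allI)
  fix x assume x: "x \<in> carrier (Minf A)"
  note e = Minf_entry[OF x]
  show "amplify \<theta> x \<in> carrier (Minf B)"
    using x amplify_matrices by (blast elim: MinfE intro: MinfI)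
  show "amplify \<theta> (c \<odot>\<^bsub>Minf A\<^esub> x) = c \<odot>\<^bsub>Minf B\<^esub> amplify \<theta> x" for c
    using e by (intro ext) (simp add: amplify_def Minf_entries linear_mapD[OF lin])
  fix y assume y: "y \<in> carrier (Minf A)"
  show "amplify \<theta> (x \<oplus>\<^bsub>Minf A\<^esub> y) = amplify \<theta> x \<oplus>\<^bsub>Minf B\<^esub> amplify \<theta> y"
    using e Minf_entry[OF y]
    by (intro ext) (simp add: amplify_def Minf_entries linear_mapD[OF lin])
qed

lemma corner_amplify: "corner B n (amplify \<theta> x) = amplify \<theta> (corner A n x)"
  by (auto simp: corner_def amplify_def fun_eq_iff)

end

lemma amplify_star_hom:
  assumes "star_algebra A" "star_algebra B" "\<psi> \<in> star_hom A B"
  shows "amplify \<psi> \<in> star_hom (Minf A) (Minf B)"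
proof -
  interpret linear_map_pair A B \<psi>
    using assms by (simp add: linear_map_pair_def linear_map_pair_axioms_def star_hom_linear)
  note L = linear_mapD[OF amplify_linear]
  show ?thesis
  proof (rule star_homI)
    fix x assume x: "x \<in> carrier (Minf A)"
    show "amplify \<psi> (star (Minf A) x) = star (Minf B) (amplify \<psi> x)"
      using Minf_entry[OF x] by (intro ext) (simp add: amplify_def Minf_entries star_homD[OF assms(3)])
    fix y assume y: "y \<in> carrier (Minf A)"
    obtain n where n: "x \<in> matrices A n" "y \<in> matrices A n" using x y by (rule MinfE2)
    show "amplify \<psi> (x \<otimes>\<^bsub>Minf A\<^esub> y) = amplify \<psi> x \<otimes>\<^bsub>Minf B\<^esub> amplify \<psi> y"
    proof (intro ext)
      fix i j
      have "(amplify \<psi> x \<otimes>\<^bsub>Minf B\<^esub> amplify \<psi> y) i j = (\<Oplus>\<^bsub>B\<^esub>k\<in>{..<n}. amplify \<psi> x i k \<otimes>\<^bsub>B\<^esub> amplify \<psi> y k j)"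
        using n by (intro B.Minf_mult_eq L(1) x y) (simp add: amplify_matrices)
      also have "\<dots> = (\<Oplus>\<^bsub>B\<^esub>k\<in>{..<n}. \<psi> (x i k \<otimes>\<^bsub>A\<^esub> y k j))"
        using Minf_entry[OF x] Minf_entry[OF y] by (simp add: amplify_def star_homD[OF assms(3)])
      also have "\<dots> = amplify \<psi> (x \<otimes>\<^bsub>Minf A\<^esub> y) i j"
        using Minf_entry[OF x] Minf_entry[OF y] n
        by (simp add: amplify_def A.Minf_mult_eq[OF x y, of n] map_finsum)
      finally show "amplify \<psi> (x \<otimes>\<^bsub>Minf A\<^esub> y) i j = (amplify \<psi> x \<otimes>\<^bsub>Minf B\<^esub> amplify \<psi> y) i j" by simp
    qed
  qed (use L in auto)
qed

text \<open>One constant bounds the amplifications to all matrix sizes; this is what extends them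
  from M to its completion. From a bound on A alone the constants could grow with the size.\<close>

locale bounded_amplification =
  linear_map_pair A B \<theta> + A: unital_cstar_algebra A + B: unital_cstar_algebra B
  for A :: "('a, 'm) cstar_alg_scheme" and B :: "('b, 'n) cstar_alg_scheme" and \<theta> +
  fixes C :: real
  assumes bound: "x \<in> carrier (Minf A) \<Longrightarrow> cnorm (Minf B) (amplify \<theta> x) \<le> C * cnorm (Minf A) x"
begin

interpretation NA: enveloping_star_algebra "Minf A" by (rule A.Minf_enveloping)
interpretation NB: enveloping_star_algebra "Minf B" by (rule B.Minf_enveloping)

lemma amplify_pair: "linear_map_pair (Minf A) (Minf B) (amplify \<theta>)"
  using NA.star_algebra_axioms NB.star_algebra_axioms amplify_linear
  by (simp add: linear_map_pair_def linear_map_pair_axioms_def)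

interpretation L: linear_map_pair "Minf A" "Minf B" "amplify \<theta>" by (rule amplify_pair)

lemma amplify_asy:
  assumes "NA.asy F s t"
  shows "NB.asy F (\<lambda>i. amplify \<theta> (s i)) (\<lambda>i. amplify \<theta> (t i))"
proof (rule NB.asyI)
  note c = NA.asy_closed[OF assms]
  show "amplify \<theta> (s i) \<in> carrier (Minf B)" "amplify \<theta> (t i) \<in> carrier (Minf B)" for i
    using linear_mapD(1)[OF amplify_linear] c by auto
  show "cnorm (Minf B) (amplify \<theta> (s i) \<ominus>\<^bsub>Minf B\<^esub> amplify \<theta> (t i)) \<le> C * cnorm (Minf A) (s i \<ominus>\<^bsub>Minf A\<^esub> t i)" for i
    using bound[of "s i \<ominus>\<^bsub>Minf A\<^esub> t i"] c by (simp add: L.map_minus)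
  show "((\<lambda>i. C * cnorm (Minf A) (s i \<ominus>\<^bsub>Minf A\<^esub> t i)) \<longlongrightarrow> 0) F"
    using tendsto_mult[OF tendsto_const NA.asy_tendsto[OF assms], of C] by simp
qed

lemma amplify_conv:
  assumes "A.conv s x"
  shows "B.conv (\<lambda>n. amplify \<theta> (s n)) (amplify \<theta> x)"
  using amplify_asy[OF A.conv_asy[OF assms]] A.conv_entries[OF assms]
  by (simp add: B.conv_def corner_amplify, simp add: A.entries_def B.entries_def amplify_def linear_mapD[OF lin])

lemma amplify_Cauchy:
  assumes "Cauchy_seq (Minf A) (cnorm (Minf A)) s"
  shows "Cauchy_seq (Minf B) (cnorm (Minf B)) (\<lambda>n. amplify \<theta> (s n))"
  using assms unfolding NA.Cauchy_seq_iff NB.Cauchy_seq_iff by (rule amplify_asy)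

lemma amplify_closed:
  assumes "x \<in> carrier (compacts_tensor A)"
  shows "amplify \<theta> x \<in> carrier (compacts_tensor B)"
  using B.conv_in_D[OF amplify_conv[OF A.conv_corner[OF assms]]
      amplify_Cauchy[OF A.conv_Cauchy[OF A.conv_corner[OF assms] assms]]] .

lemma amplify_bound:
  assumes "x \<in> carrier (compacts_tensor A)"
  shows "cnorm (compacts_tensor B) (amplify \<theta> x) \<le> C * cnorm (compacts_tensor A) x"
proof (rule LIMSEQ_le)
  note X = A.conv_corner[OF assms]
  show "(\<lambda>n. cnorm (Minf B) (amplify \<theta> (corner A n x))) \<longlonglongrightarrow> cnorm (compacts_tensor B) (amplify \<theta> x)"
    by (rule B.conv_norm[OF amplify_conv[OF X] amplify_closed[OF assms]])
  show "(\<lambda>n. C * cnorm (Minf A) (corner A n x)) \<longlonglongrightarrow> C * cnorm (compacts_tensor A) x"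
    by (rule tendsto_mult[OF tendsto_const A.conv_norm[OF X assms]])
  show "\<exists>N. \<forall>n\<ge>N. cnorm (Minf B) (amplify \<theta> (corner A n x)) \<le> C * cnorm (Minf A) (corner A n x)"
    using bound[OF A.conv_closed[OF X]] by blast
qed

lemma amplify_linear_compacts: "linear_map (compacts_tensor A) (compacts_tensor B) (amplify \<theta>)"
  unfolding linear_map_def
proof (intro conjI ballI allI)
  fix x assume x: "x \<in> carrier (compacts_tensor A)"
  have e: "x i j \<in> carrier A" for i j using x by (simp add: A.D_carrier A.entries_def)
  show "amplify \<theta> x \<in> carrier (compacts_tensor B)" by (rule amplify_closed[OF x])
  show "amplify \<theta> (c \<odot>\<^bsub>compacts_tensor A\<^esub> x) = c \<odot>\<^bsub>compacts_tensor B\<^esub> amplify \<theta> x" for c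
    using e by (intro ext) (simp add: amplify_def compacts_tensor_simps Minf_entries linear_mapD[OF lin])
  fix y assume y: "y \<in> carrier (compacts_tensor A)"
  have "y i j \<in> carrier A" for i j using y by (simp add: A.D_carrier A.entries_def)
  then show "amplify \<theta> (x \<oplus>\<^bsub>compacts_tensor A\<^esub> y) = amplify \<theta> x \<oplus>\<^bsub>compacts_tensor B\<^esub> amplify \<theta> y"
    using e by (intro ext) (simp add: amplify_def compacts_tensor_simps Minf_entries linear_mapD[OF lin])
qed

end

lemma star_hom_bounded_amplification:
  assumes "unital_cstar_algebra A" "unital_cstar_algebra B" "\<psi> \<in> star_hom A B"
  shows "bounded_amplification A B \<psi> 1"
proof -
  interpret A: unital_cstar_algebra A by fact
  interpret B: unital_cstar_algebra B by fact
  interpret NB: enveloping_star_algebra "Minf B" by (rule B.Minf_enveloping)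
  show ?thesis
    using assms A.star_algebra_axioms B.star_algebra_axioms star_hom_linear[OF assms(3)]
      enveloping_contraction[OF A.Minf_enveloping amplify_star_hom[OF _ _ assms(3)] NB.seminorm]
    by (simp add: bounded_amplification_def bounded_amplification_axioms_def linear_map_pair_def
        linear_map_pair_axioms_def)
qed

lemma amplify_star_hom_compacts:
  assumes "unital_cstar_algebra A" "unital_cstar_algebra B" "\<psi> \<in> star_hom A B"
  shows "amplify \<psi> \<in> star_hom (compacts_tensor A) (compacts_tensor B)"
proof -
  interpret bounded_amplification A B \<psi> 1 by (rule star_hom_bounded_amplification[OF assms])
  note h = star_homD[OF amplify_star_hom[OF A.star_algebra_axioms B.star_algebra_axioms assms(3)]]
  note L = linear_mapD[OF amplify_linear_compacts]
  show ?thesis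
  proof (rule star_homI)
    fix x assume x: "x \<in> carrier (compacts_tensor A)"
    have e: "x i j \<in> carrier A" for i j using x by (simp add: A.D_carrier A.entries_def)
    show "amplify \<psi> (star (compacts_tensor A) x) = star (compacts_tensor B) (amplify \<psi> x)"
      using e by (intro ext) (simp add: amplify_def compacts_tensor_simps Minf_entries star_homD[OF assms(3)])
    fix y assume y: "y \<in> carrier (compacts_tensor A)"
    note X = A.conv_corner[OF x] and Y = A.conv_corner[OF y]
    show "amplify \<psi> (x \<otimes>\<^bsub>compacts_tensor A\<^esub> y) = amplify \<psi> x \<otimes>\<^bsub>compacts_tensor B\<^esub> amplify \<psi> y"
      using amplify_conv[OF A.conv_mult[OF X Y x y]]
        B.conv_mult[OF amplify_conv[OF X] amplify_conv[OF Y] L(1)[OF x] L(1)[OF y]]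
      by (intro B.conv_unique) (simp_all add: h A.conv_closed[OF X] A.conv_closed[OF Y])
  qed (use L in auto)
qed

text \<open>The stabilisation has no unit. Its substitute is a contraction that almost fixes
  finitely many given elements from the left, which is what makes Cuntz comparison
  reflexive.\<close>

locale cuntz_algebra = cstar_algebra A for A :: "('a, 'm) cstar_alg_scheme" (structure) +
  assumes approx_unit: "\<lbrakk>finite F; F \<subseteq> carrier A; e > 0\<rbrakk>
    \<Longrightarrow> \<exists>u\<in>carrier A. cnorm A u \<le> 1 \<and> (\<forall>d\<in>F. cnorm A (u \<otimes> d \<ominus> d) < e)"

sublocale unital_cstar_algebra \<subseteq> cuntz_algebra
proof
  fix F and e :: real assume "F \<subseteq> carrier A" "e > 0"
  then show "\<exists>u\<in>carrier A. cnorm A u \<le> 1 \<and> (\<forall>d\<in>F. cnorm A (u \<otimes> d \<ominus> d) < e)"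
    using norm_one_le by (intro bexI[of _ \<one>]) (auto simp: subset_iff)
qed

context unital_cstar_algebra
begin

definition corner_unit :: "nat \<Rightarrow> nat \<Rightarrow> nat \<Rightarrow> 'a" where
  "corner_unit n = (\<lambda>i j. if i = j \<and> i < n then \<one> else \<zero>)"

lemma corner_unit_matrices: "corner_unit n \<in> matrices A n"
  by (auto simp: corner_unit_def matrices_def)

lemma corner_unit_mult:
  assumes "x \<in> carrier M"
  shows "corner_unit n \<otimes>\<^bsub>M\<^esub> x = row_cut A {..<n} x"
proof (intro ext)
  fix i j
  note [simp] = Minf_entry[OF assms]
  have "(corner_unit n \<otimes>\<^bsub>M\<^esub> x) i j = (\<Oplus>k\<in>{..<n}. corner_unit n i k \<otimes> x k j)"
    using assms corner_unit_matrices MinfI by (intro Minf_mult_eq) blast+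
  also have "\<dots> = row_cut A {..<n} x i j"
  proof (cases "i < n")
    case True
    then show ?thesis by (subst finsum_single[of i]) (auto simp: corner_unit_def row_cut_def)
  next
    case False
    then show ?thesis by (auto simp: corner_unit_def row_cut_def intro!: add.finprod_one_eqI)
  qed
  finally show "(corner_unit n \<otimes>\<^bsub>M\<^esub> x) i j = row_cut A {..<n} x i j" .
qed

lemma corner_unit_norm: "cnorm M (corner_unit n) \<le> 1"
proof -
  interpret N: enveloping_star_algebra M by (rule Minf_enveloping)
  have c: "corner_unit n \<in> carrier M" by (rule MinfI[OF corner_unit_matrices])
  have "star M (corner_unit n) \<otimes>\<^bsub>M\<^esub> corner_unit n = corner_unit n \<otimes>\<^bsub>M\<^esub> corner_unit n"
    by (rule arg_cong[where f = "\<lambda>x. x \<otimes>\<^bsub>M\<^esub> _"]) (auto simp: corner_unit_def Minf_entries fun_eq_iff)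
  also have "\<dots> = corner_unit n"
    unfolding corner_unit_mult[OF c] by (auto simp: row_cut_def corner_unit_def fun_eq_iff)
  finally have "(cnorm M (corner_unit n))\<^sup>2 = cnorm M (corner_unit n)" using N.p_star_mult[OF c] by simp
  then show ?thesis by (auto simp: power2_eq_square)
qed

text \<open>A corner unit fixes every finite matrix of at most its size; such matrices are dense and
  the corner units are contractions, so they form an approximate unit of D.\<close>

theorem compacts_tensor_cuntz_algebra: "cuntz_algebra D"
proof -
  interpret D: cstar_algebra D by (rule compacts_tensor_cstar_algebra)
  interpret N: enveloping_star_algebra M by (rule Minf_enveloping)
  note c = Minf_subset_D[OF MinfI[OF corner_unit_matrices]]
  have lim: "\<forall>\<^sub>F n in sequentially. cnorm D (corner_unit n \<otimes>\<^bsub>D\<^esub> d \<ominus>\<^bsub>D\<^esub> d) < e"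
    if d: "d \<in> carrier D" and e: "e > 0" for d e
  proof -
    obtain y where y: "y \<in> carrier M" "cnorm D (y \<ominus>\<^bsub>D\<^esub> d) < e / 2" using D_dense[OF d, of "e/2"] e by auto
    obtain m where m: "y \<in> matrices A m" using y(1) by (rule MinfE)
    note yD = Minf_subset_D[OF y(1)]
    show ?thesis using eventually_ge_at_top[of m]
    proof eventually_elim
      case (elim n)
      have u: "corner_unit n \<otimes>\<^bsub>M\<^esub> y = y" unfolding corner_unit_mult[OF y(1)]
        using matrices_zero[OF matrices_mono[OF m elim]] by (auto simp: row_cut_def fun_eq_iff)
      have MD: "corner_unit n \<otimes>\<^bsub>D\<^esub> y = corner_unit n \<otimes>\<^bsub>M\<^esub> y"
        by (rule conv_unique[OF conv_mult[OF conv_const conv_const] conv_const])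
          (simp_all add: c yD y MinfI[OF corner_unit_matrices])
      then have uD: "corner_unit n \<otimes>\<^bsub>D\<^esub> y = y" using u by simp
      have "cnorm D (corner_unit n \<otimes>\<^bsub>D\<^esub> d \<ominus>\<^bsub>D\<^esub> corner_unit n \<otimes>\<^bsub>D\<^esub> y)
        \<le> cnorm D (corner_unit n \<ominus>\<^bsub>D\<^esub> corner_unit n) * cnorm D d + cnorm D (corner_unit n) * cnorm D (d \<ominus>\<^bsub>D\<^esub> y)"
        using c d yD by (intro D.p_mult_diff)
      also have "\<dots> \<le> 1 * cnorm D (y \<ominus>\<^bsub>D\<^esub> d)"
        using c d yD corner_unit_norm[of n] D.p_diff_commute[of d y]
        by (simp add: cnorm_D_Minf MinfI[OF corner_unit_matrices] mult_right_mono del: mult_1 mult_1_left)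
      finally have "cnorm D (corner_unit n \<otimes>\<^bsub>D\<^esub> d \<ominus>\<^bsub>D\<^esub> y) < e / 2" using y uD by simp
      then show ?case
        using D.p_tri[of "corner_unit n \<otimes>\<^bsub>D\<^esub> d" y d] y(2) c d yD by simp
    qed
  qed
  show ?thesis
  proof
    fix F and e :: real assume F: "finite F" "F \<subseteq> carrier D" "e > 0"
    then have "\<forall>\<^sub>F n in sequentially. \<forall>d\<in>F. cnorm D (corner_unit n \<otimes>\<^bsub>D\<^esub> d \<ominus>\<^bsub>D\<^esub> d) < e"
      using lim by (intro eventually_ball_finite) auto
    then obtain n where "\<forall>d\<in>F. cnorm D (corner_unit n \<otimes>\<^bsub>D\<^esub> d \<ominus>\<^bsub>D\<^esub> d) < e"
      by (auto simp: eventually_sequentially)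
    then show "\<exists>u\<in>carrier D. cnorm D u \<le> 1 \<and> (\<forall>d\<in>F. cnorm D (u \<otimes>\<^bsub>D\<^esub> d \<ominus>\<^bsub>D\<^esub> d) < e)"
      using c[of n] corner_unit_norm[of n]
      by (intro bexI[of _ "corner_unit n"]) (simp_all add: cnorm_D_Minf MinfI[OF corner_unit_matrices])
  qed
qed

end

subsection \<open>Cuntz comparison and the Cuntz semigroup\<close>

text \<open>The first block is allowed to be rectangular because a witness comparing a of size n
  with a' of size n' is an n by n' matrix.\<close>

definition block_sum :: "('a, 'm) star_alg_scheme \<Rightarrow> nat \<Rightarrow> nat \<Rightarrow> (nat \<Rightarrow> nat \<Rightarrow> 'a) \<Rightarrow> (nat \<Rightarrow> nat \<Rightarrow> 'a) \<Rightarrow> nat \<Rightarrow> nat \<Rightarrow> 'a" where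
  "block_sum A m n x y = (\<lambda>i j. if i < m \<and> j < n then x i j
     else if m \<le> i \<and> n \<le> j then y (i - m) (j - n) else \<zero>\<^bsub>A\<^esub>)"

lemma direct_sum_eq: "direct_sum A n = block_sum A n n"
  by (simp add: direct_sum_def block_sum_def fun_eq_iff)

context star_algebra
begin

lemma block_sum_closed:
  assumes "x \<in> carrier M" "y \<in> carrier M"
  shows "block_sum A m n x y \<in> carrier M"
proof -
  obtain k where k: "x \<in> matrices A k" "y \<in> matrices A k" using assms by (rule MinfE2)
  have "block_sum A m n x y i j = \<zero>" if "k + m + n \<le> i \<or> k + m + n \<le> j" for i j
  proof (cases "m \<le> i \<and> n \<le> j")
    case True
    then have "k \<le> i - m \<or> k \<le> j - n" using that by linarith
    then show ?thesis using matrices_zero[OF k(2)] True by (auto simp: block_sum_def)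
  next
    case False
    then show ?thesis using matrices_zero[OF k(1)] that by (auto simp: block_sum_def)
  qed
  then have "block_sum A m n x y \<in> matrices A (k + m + n)"
    using matrices_entry[OF k(1)] matrices_entry[OF k(2)] by (auto simp: matrices_def) (auto simp: block_sum_def)
  then show ?thesis by (rule MinfI)
qed

lemma block_sum_star:
  "\<lbrakk>x \<in> carrier M; y \<in> carrier M\<rbrakk> \<Longrightarrow> star M (block_sum A m n x y) = block_sum A n m (star M x) (star M y)"
  by (auto simp: block_sum_def Minf_entries fun_eq_iff)

text \<open>Both factors are cut along the same inner index n, and the condition on x ensures that
  truncating its columns at n drops nothing from x x'. Rows of x beyond m and columns of x' beyond k
  fall outside the first block of the result.\<close>

lemma block_sum_mult:
  assumes c: "x \<in> carrier M" "y \<in> carrier M" "x' \<in> carrier M" "y' \<in> carrier M"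
    and x: "\<And>i l. n \<le> l \<Longrightarrow> x i l = \<zero>"
  shows "block_sum A m n x y \<otimes>\<^bsub>M\<^esub> block_sum A n k x' y' = block_sum A m k (x \<otimes>\<^bsub>M\<^esub> x') (y \<otimes>\<^bsub>M\<^esub> y')"
proof (intro ext)
  fix i j
  let ?P = "block_sum A m n x y" and ?Q = "block_sum A n k x' y'"
  note [simp] = Minf_entry[OF c(1)] Minf_entry[OF c(2)] Minf_entry[OF c(3)] Minf_entry[OF c(4)]
  obtain r where r: "y \<in> matrices A r" using c(2) by (rule MinfE)
  have P: "?P \<in> carrier M" "?Q \<in> carrier M" by (rule block_sum_closed; fact c)+
  have pz: "?P i l = \<zero>" if l: "l \<ge> n + r" for l
  proof -
    have "r \<le> l - n" using l by linarith
    then show ?thesis using l matrices_zero[OF r, of "i - m" "l - n"] x[of l i] by (auto simp: block_sum_def)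
  qed
  have e: "(?P \<otimes>\<^bsub>M\<^esub> ?Q) i j = (\<Oplus>l\<in>{..<n + r}. ?P i l \<otimes> ?Q l j)"
    using pz by (intro Minf_mult_eq_aux[OF P]) blast
  have PQ: "?P i l \<in> carrier A" "?Q l j \<in> carrier A" for l using Minf_entry P by blast+
  consider "i < m" "j < k" | "m \<le> i" "k \<le> j" | "i < m" "k \<le> j" | "m \<le> i" "j < k" by linarith
  then show "(?P \<otimes>\<^bsub>M\<^esub> ?Q) i j = block_sum A m k (x \<otimes>\<^bsub>M\<^esub> x') (y \<otimes>\<^bsub>M\<^esub> y') i j"
  proof cases
    case 1
    have "(\<Oplus>l\<in>{..<n + r}. ?P i l \<otimes> ?Q l j) = (\<Oplus>l\<in>{..<n}. x i l \<otimes> x' l j)"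
      using 1 PQ by (intro add.finprod_mono_neutral_cong_right) (auto simp: block_sum_def)
    also have "\<dots> = (x \<otimes>\<^bsub>M\<^esub> x') i j" using c x by (intro Minf_mult_eq_aux[symmetric]) auto
    finally show ?thesis using e 1 by (simp add: block_sum_def)
  next
    case 2
    have "(\<Oplus>l\<in>{..<n + r}. ?P i l \<otimes> ?Q l j) = (\<Oplus>l\<in>{n..<n + r}. y (i - m) (l - n) \<otimes> y' (l - n) (j - k))"
      using 2 PQ by (intro add.finprod_mono_neutral_cong_right) (auto simp: block_sum_def)
    also have "{n..<n + r} = (\<lambda>l. n + l) ` {..<r}"
      by (auto simp: image_iff) (metis add_diff_inverse_nat less_diff_conv2 not_less add.commute lessThan_iff nat_add_left_cancel_less)
    also have "(\<Oplus>l\<in>(\<lambda>l. n + l) ` {..<r}. y (i - m) (l - n) \<otimes> y' (l - n) (j - k))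
      = (\<Oplus>l\<in>{..<r}. y (i - m) l \<otimes> y' l (j - k))"
      by (subst finsum_reindex) auto
    also have "\<dots> = (y \<otimes>\<^bsub>M\<^esub> y') (i - m) (j - k)" using c r by (intro Minf_mult_eq[symmetric]) auto
    finally show ?thesis using e 2 by (simp add: block_sum_def)
  next
    case 3
    have "(\<Oplus>l\<in>{..<n + r}. ?P i l \<otimes> ?Q l j) = \<zero>"
      using 3 PQ by (intro add.finprod_one_eqI) (auto simp: block_sum_def)
    then show ?thesis using e 3 by (simp add: block_sum_def)
  next
    case 4
    have "(\<Oplus>l\<in>{..<n + r}. ?P i l \<otimes> ?Q l j) = \<zero>"
      using 4 PQ by (intro add.finprod_one_eqI) (auto simp: block_sum_def)
    then show ?thesis using e 4 by (simp add: block_sum_def)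
  qed
qed

text \<open>Shifting down the diagonal respects products, so the universal property makes it
  contractive; \<open>block_sum_norm\<close> uses this for the second block.\<close>

lemma shift_star_hom: "block_sum A n n \<zero>\<^bsub>M\<^esub> \<in> star_hom M M"
proof -
  interpret M: star_algebra M by (rule Minf_star_algebra)
  show ?thesis
  proof (rule star_homI)
    fix x y assume "x \<in> carrier M" "y \<in> carrier M"
    then show "block_sum A n n \<zero>\<^bsub>M\<^esub> (x \<otimes>\<^bsub>M\<^esub> y) = block_sum A n n \<zero>\<^bsub>M\<^esub> x \<otimes>\<^bsub>M\<^esub> block_sum A n n \<zero>\<^bsub>M\<^esub> y"
      by (subst block_sum_mult) (auto simp: Minf_entries)
  qed (auto simp: block_sum_closed block_sum_star, auto simp: block_sum_def Minf_entries fun_eq_iff)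
qed

end

context cuntz_algebra
begin

interpretation N: enveloping_star_algebra M by (rule Minf_enveloping)

lemma block_sum_norm:
  assumes "x \<in> carrier M" "y \<in> carrier M"
  shows "cnorm M (block_sum A n n x y) \<le> cnorm M x + cnorm M y"
proof -
  have "block_sum A n n x y = corner A n x \<oplus>\<^bsub>M\<^esub> block_sum A n n \<zero>\<^bsub>M\<^esub> y"
    using Minf_entry[OF assms(1)] Minf_entry[OF assms(2)]
    by (auto simp: block_sum_def corner_def Minf_entries fun_eq_iff)
  moreover have "corner A n x \<in> carrier M"
    using corner_in_matrices[of x n] Minf_entry[OF assms(1)] by (auto intro: MinfI)
  ultimately have "cnorm M (block_sum A n n x y) \<le> cnorm M (corner A n x) + cnorm M (block_sum A n n \<zero>\<^bsub>M\<^esub> y)"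
    using N.p_add[of "corner A n x" "block_sum A n n \<zero>\<^bsub>M\<^esub> y"] assms by (simp add: block_sum_closed)
  also have "\<dots> \<le> cnorm M x + cnorm M y"
    using Minf_norm_corner[OF assms(1)] enveloping_contraction[OF Minf_enveloping shift_star_hom N.seminorm assms(2)]
    by (intro add_mono)
  finally show ?thesis .
qed

lemma block_sum_minus:
  assumes "x \<in> carrier M" "y \<in> carrier M" "x' \<in> carrier M" "y' \<in> carrier M"
  shows "block_sum A n n x y \<ominus>\<^bsub>M\<^esub> block_sum A n n x' y' = block_sum A n n (x \<ominus>\<^bsub>M\<^esub> x') (y \<ominus>\<^bsub>M\<^esub> y')"
  using assms
  by (intro ext) (simp add: Minf_minus_entries block_sum_closed, simp add: block_sum_def Minf_minus_entries)

section \<open>Cuntz comparison as a preorder compatible with direct sums\<close>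

lemma cuntz_le_iff:
  assumes "a \<in> carrier M" "b \<in> carrier M"
  shows "cuntz_le A a b \<longleftrightarrow>
    (\<forall>e>0. \<exists>c\<in>carrier M. cnorm M (c \<otimes>\<^bsub>M\<^esub> b \<otimes>\<^bsub>M\<^esub> star M c \<ominus>\<^bsub>M\<^esub> a) < e)" (is "?l \<longleftrightarrow> ?r")
proof
  assume ?l
  then obtain c where c: "\<And>n. c n \<in> carrier M"
    and l: "(\<lambda>n. cnorm M (c n \<otimes>\<^bsub>M\<^esub> b \<otimes>\<^bsub>M\<^esub> star M (c n) \<ominus>\<^bsub>M\<^esub> a)) \<longlonglongrightarrow> 0"
    unfolding cuntz_le_def alg_tendsto_def by blast
  show ?r
  proof (intro allI impI)
    fix e :: real assume "e > 0"
    then have "\<forall>\<^sub>F n in sequentially. cnorm M (c n \<otimes>\<^bsub>M\<^esub> b \<otimes>\<^bsub>M\<^esub> star M (c n) \<ominus>\<^bsub>M\<^esub> a) < e"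
      using order_tendstoD(2)[OF l] by blast
    then show "\<exists>c\<in>carrier M. cnorm M (c \<otimes>\<^bsub>M\<^esub> b \<otimes>\<^bsub>M\<^esub> star M c \<ominus>\<^bsub>M\<^esub> a) < e"
      using c by (auto simp: eventually_sequentially)
  qed
next
  assume ?r
  then have "\<exists>c\<in>carrier M. cnorm M (c \<otimes>\<^bsub>M\<^esub> b \<otimes>\<^bsub>M\<^esub> star M c \<ominus>\<^bsub>M\<^esub> a) < inverse (real (Suc n))" for n
    by (simp del: of_nat_Suc)
  then obtain c where c: "\<And>n. c n \<in> carrier M"
    "\<And>n. cnorm M (c n \<otimes>\<^bsub>M\<^esub> b \<otimes>\<^bsub>M\<^esub> star M (c n) \<ominus>\<^bsub>M\<^esub> a) < inverse (real (Suc n))" by metis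
  have "(\<lambda>n. cnorm M (c n \<otimes>\<^bsub>M\<^esub> b \<otimes>\<^bsub>M\<^esub> star M (c n) \<ominus>\<^bsub>M\<^esub> a)) \<longlonglongrightarrow> 0"
    by (rule tendsto_sandwich[OF _ _ tendsto_const LIMSEQ_inverse_real_of_nat])
      (use assms c(1) in \<open>auto simp del: of_nat_Suc intro!: always_eventually less_imp_le[OF c(2)]\<close>)
  then show ?l using c unfolding cuntz_le_def alg_tendsto_def by blast
qed

lemma cuntz_leI:
  assumes "a \<in> carrier M" "b \<in> carrier M"
    "\<And>e. e > 0 \<Longrightarrow> \<exists>c\<in>carrier M. cnorm M (c \<otimes>\<^bsub>M\<^esub> b \<otimes>\<^bsub>M\<^esub> star M c \<ominus>\<^bsub>M\<^esub> a) \<le> e"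
  shows "cuntz_le A a b"
  unfolding cuntz_le_iff[OF assms(1,2)]
proof (intro allI impI)
  fix e :: real assume "e > 0"
  then have "e / 2 > 0" "e / 2 < e" by simp_all
  then show "\<exists>c\<in>carrier M. cnorm M (c \<otimes>\<^bsub>M\<^esub> b \<otimes>\<^bsub>M\<^esub> star M c \<ominus>\<^bsub>M\<^esub> a) < e"
    using assms(3)[of "e/2"] by (meson le_less_trans)
qed

lemma cuntz_leE:
  assumes "cuntz_le A a b" "a \<in> carrier M" "b \<in> carrier M" "e > 0"
  obtains c where "c \<in> carrier M" "cnorm M (c \<otimes>\<^bsub>M\<^esub> b \<otimes>\<^bsub>M\<^esub> star M c \<ominus>\<^bsub>M\<^esub> a) < e"
  using assms cuntz_le_iff by blast

lemma positives_closed: "a \<in> positives M \<Longrightarrow> a \<in> carrier M"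
  by (auto simp: positives_def)

lemma positives_star: "a \<in> positives M \<Longrightarrow> star M a = a"
  by (auto simp: positives_def N.star_mult N.star_star)

text \<open>The witness is the diagonal matrix U with entries u, where u almost fixes the finitely
  many entries of a. As a is self-adjoint, a star U - a is the adjoint of U a - a, so one estimate
  serves both sides.\<close>

lemma cuntz_le_refl:
  assumes "a \<in> positives M"
  shows "cuntz_le A a a"
proof (rule cuntz_leI)
  show a: "a \<in> carrier M" using assms by (rule positives_closed)
  then show "a \<in> carrier M" .
  fix e :: real assume e: "e > 0"
  obtain n where n: "a \<in> matrices A n" using a by (rule MinfE)
  note [simp] = Minf_entry[OF a]
  \<comment> \<open>K = 2 n^2 is the factor by which \<open>Minf_norm_le_sum\<close> lets the norm
    of an n by n matrix exceed a common bound on its entries.\<close>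
  define K where "K = (\<Sum>i<n. \<Sum>j<n. (2::real))"
  have K: "K \<ge> 0" by (simp add: K_def)
  \<comment> \<open>Chosen for the final estimate K d K + K d \<le> (K + 1)^2 d = e, in which the
    second factor K bounds the norm of U.\<close>
  define d where "d = e / ((K + 1) * (K + 1))"
  have d: "d > 0" using e K by (simp add: d_def)
  have F: "finite ((\<lambda>(i,j). a i j) ` ({..<n}\<times>{..<n}))" "(\<lambda>(i,j). a i j) ` ({..<n}\<times>{..<n}) \<subseteq> carrier A" by auto
  obtain u where u: "u \<in> carrier A" "cnorm A u \<le> 1"
    and ua: "\<And>i j. \<lbrakk>i < n; j < n\<rbrakk> \<Longrightarrow> cnorm A (u \<otimes> a i j \<ominus> a i j) < d"
    using approx_unit[OF F d] by auto
  define U where "U = (\<lambda>i j. if i = j \<and> i < n then u else \<zero>)"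
  have Um: "U \<in> matrices A n" using u by (auto simp: U_def matrices_def)
  then have U: "U \<in> carrier M" by (rule MinfI)
  have "cnorm M U \<le> (\<Sum>i<n. \<Sum>j<n. 2 * cnorm A (U i j))" by (rule Minf_norm_le_sum[OF Um])
  also have "\<dots> \<le> K" unfolding K_def using u by (intro sum_mono) (simp add: U_def)
  finally have UK: "cnorm M U \<le> K" .
  have Ua: "(U \<otimes>\<^bsub>M\<^esub> a) i j = u \<otimes> a i j" for i j
  proof -
    have "(U \<otimes>\<^bsub>M\<^esub> a) i j = (\<Oplus>k\<in>{..<n}. U i k \<otimes> a k j)" using U a Um by (intro Minf_mult_eq) auto
    also have "\<dots> = u \<otimes> a i j"
    proof (cases "i < n")
      case True
      then show ?thesis using u by (subst finsum_single[of i]) (auto simp: U_def)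
    next
      case False
      then show ?thesis using u matrices_zero[OF n] by (auto simp: U_def intro!: add.finprod_one_eqI)
    qed
    finally show ?thesis .
  qed
  let ?d = "U \<otimes>\<^bsub>M\<^esub> a \<ominus>\<^bsub>M\<^esub> a"
  have dc: "?d \<in> carrier M" using U a by simp
  have de: "?d i j = u \<otimes> a i j \<ominus> a i j" for i j using U a Ua by (simp add: Minf_minus_entries)
  have "?d \<in> matrices A n" using u matrices_zero[OF n] by (auto simp: matrices_def de)
  then have "cnorm M ?d \<le> (\<Sum>i<n. \<Sum>j<n. 2 * cnorm A (?d i j))" by (rule Minf_norm_le_sum)
  also have "\<dots> \<le> (\<Sum>i<n. \<Sum>j<n. 2 * d)" using ua by (intro sum_mono) (simp add: de less_imp_le)
  also have "\<dots> = K * d" by (simp add: K_def)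
  finally have 1: "cnorm M ?d \<le> K * d" .
  have sd: "star M ?d = a \<otimes>\<^bsub>M\<^esub> star M U \<ominus>\<^bsub>M\<^esub> a"
    using U a positives_star[OF assms] by (simp add: N.minus_eq N.star_add N.star_minus N.star_mult)
  have "U \<otimes>\<^bsub>M\<^esub> a \<otimes>\<^bsub>M\<^esub> star M U \<ominus>\<^bsub>M\<^esub> a \<otimes>\<^bsub>M\<^esub> star M U = ?d \<otimes>\<^bsub>M\<^esub> star M U"
    using U a by (simp add: N.minus_eq N.distr_right N.mult_minus_left)
  then have "cnorm M (U \<otimes>\<^bsub>M\<^esub> a \<otimes>\<^bsub>M\<^esub> star M U \<ominus>\<^bsub>M\<^esub> a \<otimes>\<^bsub>M\<^esub> star M U) \<le> cnorm M ?d * cnorm M U"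
    using N.p_mult[OF dc, of "star M U"] U by simp
  also have "\<dots> \<le> K * d * K" using 1 UK U dc K d by (intro mult_mono) auto
  finally have "cnorm M (U \<otimes>\<^bsub>M\<^esub> a \<otimes>\<^bsub>M\<^esub> star M U \<ominus>\<^bsub>M\<^esub> a) \<le> K * d * K + K * d"
    using N.p_tri[of "U \<otimes>\<^bsub>M\<^esub> a \<otimes>\<^bsub>M\<^esub> star M U" "a \<otimes>\<^bsub>M\<^esub> star M U" a] 1 U a N.p_star[OF dc]
    unfolding sd by simp
  also have "\<dots> \<le> (K + 1) * (K + 1) * d" using K d by (simp add: algebra_simps)
  also have "\<dots> = e" using K by (simp add: d_def)
  finally show "\<exists>c\<in>carrier M. cnorm M (c \<otimes>\<^bsub>M\<^esub> a \<otimes>\<^bsub>M\<^esub> star M c \<ominus>\<^bsub>M\<^esub> a) \<le> e" using U by blast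
qed

lemma cuntz_le_trans:
  assumes "cuntz_le A a b" "cuntz_le A b c" "a \<in> carrier M" "b \<in> carrier M" "c \<in> carrier M"
  shows "cuntz_le A a c"
proof (rule cuntz_leI)
  show "a \<in> carrier M" "c \<in> carrier M" by fact+
  fix e :: real assume e: "e > 0"
  then obtain r where r: "r \<in> carrier M" "cnorm M (r \<otimes>\<^bsub>M\<^esub> b \<otimes>\<^bsub>M\<^esub> star M r \<ominus>\<^bsub>M\<^esub> a) < e / 2"
    using cuntz_leE[OF assms(1,3,4), of "e/2"] by auto
  \<comment> \<open>Conjugation by r multiplies the error of s by at most the square of the norm of
    r; the summand 1 keeps K positive for the division.\<close>
  define K where "K = cnorm M r * cnorm M r + 1"
  have K: "K > 0" using N.p_nonneg[OF r(1)] by (simp add: K_def add_nonneg_pos)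
  obtain s where s: "s \<in> carrier M" "cnorm M (s \<otimes>\<^bsub>M\<^esub> c \<otimes>\<^bsub>M\<^esub> star M s \<ominus>\<^bsub>M\<^esub> b) < e / 2 / K"
    using cuntz_leE[OF assms(2,4,5), of "e/2/K"] e K by auto
  let ?d = "s \<otimes>\<^bsub>M\<^esub> c \<otimes>\<^bsub>M\<^esub> star M s \<ominus>\<^bsub>M\<^esub> b"
  have dc: "?d \<in> carrier M" using s assms by simp
  have eq: "(r \<otimes>\<^bsub>M\<^esub> s) \<otimes>\<^bsub>M\<^esub> c \<otimes>\<^bsub>M\<^esub> star M (r \<otimes>\<^bsub>M\<^esub> s) \<ominus>\<^bsub>M\<^esub> r \<otimes>\<^bsub>M\<^esub> b \<otimes>\<^bsub>M\<^esub> star M r = r \<otimes>\<^bsub>M\<^esub> ?d \<otimes>\<^bsub>M\<^esub> star M r"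
    using r(1) s(1) assms(4,5) by algebra
  have "cnorm M (r \<otimes>\<^bsub>M\<^esub> ?d \<otimes>\<^bsub>M\<^esub> star M r) \<le> cnorm M r * cnorm M ?d * cnorm M r"
    using N.p_mult[of "r \<otimes>\<^bsub>M\<^esub> ?d" "star M r"] N.p_mult[of r ?d] r dc
    by (smt (verit) N.mult_closed N.p_nonneg N.p_star N.star_closed mult_right_mono)
  also have "\<dots> \<le> K * cnorm M ?d" using dc by (simp add: K_def algebra_simps)
  also have "\<dots> \<le> e / 2" using s K by (simp add: field_simps)
  finally have "cnorm M ((r \<otimes>\<^bsub>M\<^esub> s) \<otimes>\<^bsub>M\<^esub> c \<otimes>\<^bsub>M\<^esub> star M (r \<otimes>\<^bsub>M\<^esub> s) \<ominus>\<^bsub>M\<^esub> a) \<le> e"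
    using N.p_tri[of "(r \<otimes>\<^bsub>M\<^esub> s) \<otimes>\<^bsub>M\<^esub> c \<otimes>\<^bsub>M\<^esub> star M (r \<otimes>\<^bsub>M\<^esub> s)" "r \<otimes>\<^bsub>M\<^esub> b \<otimes>\<^bsub>M\<^esub> star M r" a] r s assms
    unfolding eq by simp
  then show "\<exists>d\<in>carrier M. cnorm M (d \<otimes>\<^bsub>M\<^esub> c \<otimes>\<^bsub>M\<^esub> star M d \<ominus>\<^bsub>M\<^esub> a) \<le> e"
    using r s by (intro bexI[of _ "r \<otimes>\<^bsub>M\<^esub> s"]) auto
qed

lemma col_cut_mult:
  assumes "c \<in> carrier M" "a \<in> carrier M" "a \<in> matrices A n"
  shows "col_cut A {..<n} c \<otimes>\<^bsub>M\<^esub> a = c \<otimes>\<^bsub>M\<^esub> a"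
proof (intro ext)
  fix i j
  note [simp] = Minf_entry[OF assms(1)] Minf_entry[OF assms(2)]
  have "(col_cut A {..<n} c \<otimes>\<^bsub>M\<^esub> a) i j = (\<Oplus>k\<in>{..<n}. col_cut A {..<n} c i k \<otimes> a k j)"
    using assms by (intro Minf_mult_eq Minf_norm_col_cut) auto
  also have "\<dots> = (\<Oplus>k\<in>{..<n}. c i k \<otimes> a k j)" by (intro finsum_cong') (auto simp: col_cut_def)
  also have "\<dots> = (c \<otimes>\<^bsub>M\<^esub> a) i j" using assms by (intro Minf_mult_eq[symmetric]) auto
  finally show "(col_cut A {..<n} c \<otimes>\<^bsub>M\<^esub> a) i j = (c \<otimes>\<^bsub>M\<^esub> a) i j" .
qed

text \<open>The witness is the block matrix of c and d, with the columns of c beyond n' cut off; as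
  a' is self-adjoint of size n', c a' star c does not notice the cut. Rows of c beyond n disappear
  in the block matrix, which is harmless because passing to a corner is contractive.\<close>

lemma direct_sum_le:
  assumes "cuntz_le A a a'" "cuntz_le A b b'" "a \<in> matrices A n" "a' \<in> matrices A n'"
    "b \<in> carrier M" "b' \<in> carrier M" "star M a' = a'"
  shows "cuntz_le A (direct_sum A n a b) (direct_sum A n' a' b')"
  unfolding direct_sum_eq
proof (rule cuntz_leI)
  have a: "a \<in> carrier M" "a' \<in> carrier M" using assms MinfI by auto
  show "block_sum A n n a b \<in> carrier M" "block_sum A n' n' a' b' \<in> carrier M"
    using a assms by (auto intro: block_sum_closed)
  fix e :: real assume e: "e > 0"
  obtain c where c: "c \<in> carrier M" "cnorm M (c \<otimes>\<^bsub>M\<^esub> a' \<otimes>\<^bsub>M\<^esub> star M c \<ominus>\<^bsub>M\<^esub> a) < e / 2"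
    using cuntz_leE[OF assms(1) a, of "e/2"] e by auto
  obtain d where d: "d \<in> carrier M" "cnorm M (d \<otimes>\<^bsub>M\<^esub> b' \<otimes>\<^bsub>M\<^esub> star M d \<ominus>\<^bsub>M\<^esub> b) < e / 2"
    using cuntz_leE[OF assms(2,5,6), of "e/2"] e by auto
  define c' where "c' = col_cut A {..<n'} c"
  have c': "c' \<in> carrier M" unfolding c'_def by (rule Minf_norm_col_cut(1)[OF c(1)])
  have c'a: "c' \<otimes>\<^bsub>M\<^esub> a' = c \<otimes>\<^bsub>M\<^esub> a'" unfolding c'_def by (rule col_cut_mult[OF c(1) a(2) assms(4)])
  have "a' \<otimes>\<^bsub>M\<^esub> star M c' = star M (c' \<otimes>\<^bsub>M\<^esub> a')" using c' a assms(7) by (simp add: N.star_mult)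
  also have "\<dots> = a' \<otimes>\<^bsub>M\<^esub> star M c" unfolding c'a using c a assms(7) by (simp add: N.star_mult)
  finally have ca: "c' \<otimes>\<^bsub>M\<^esub> a' \<otimes>\<^bsub>M\<^esub> star M c' = c \<otimes>\<^bsub>M\<^esub> a' \<otimes>\<^bsub>M\<^esub> star M c"
    unfolding c'a using c(1) c' a by (simp add: N.mult_assoc)
  let ?E = "block_sum A n n' c' d"
  have E: "?E \<in> carrier M" using c' d by (intro block_sum_closed)
  have z: "(c' \<otimes>\<^bsub>M\<^esub> a') i l = \<zero>" if "n' \<le> l" for i l
  proof -
    have "(c' \<otimes>\<^bsub>M\<^esub> a') i l = (\<Oplus>k\<in>{..<n'}. c' i k \<otimes> a' k l)" using c' a assms(4) by (intro Minf_mult_eq) auto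
    also have "\<dots> = \<zero>" using that matrices_zero[OF assms(4)] Minf_entry[OF c']
      by (intro add.finprod_one_eqI) simp
    finally show ?thesis .
  qed
  have "?E \<otimes>\<^bsub>M\<^esub> block_sum A n' n' a' b' = block_sum A n n' (c' \<otimes>\<^bsub>M\<^esub> a') (d \<otimes>\<^bsub>M\<^esub> b')"
    using c' d a assms by (intro block_sum_mult) (auto simp: c'_def col_cut_def)
  then have "?E \<otimes>\<^bsub>M\<^esub> block_sum A n' n' a' b' \<otimes>\<^bsub>M\<^esub> star M ?E
    = block_sum A n n (c \<otimes>\<^bsub>M\<^esub> a' \<otimes>\<^bsub>M\<^esub> star M c) (d \<otimes>\<^bsub>M\<^esub> b' \<otimes>\<^bsub>M\<^esub> star M d)"
    using c' d a assms z by (simp add: block_sum_star block_sum_mult flip: ca)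
  then have "cnorm M (?E \<otimes>\<^bsub>M\<^esub> block_sum A n' n' a' b' \<otimes>\<^bsub>M\<^esub> star M ?E \<ominus>\<^bsub>M\<^esub> block_sum A n n a b) \<le> e"
    using block_sum_norm[of "c \<otimes>\<^bsub>M\<^esub> a' \<otimes>\<^bsub>M\<^esub> star M c \<ominus>\<^bsub>M\<^esub> a" "d \<otimes>\<^bsub>M\<^esub> b' \<otimes>\<^bsub>M\<^esub> star M d \<ominus>\<^bsub>M\<^esub> b" n] c d a assms
    by (simp add: block_sum_minus)
  then show "\<exists>c\<in>carrier M. cnorm M (c \<otimes>\<^bsub>M\<^esub> block_sum A n' n' a' b' \<otimes>\<^bsub>M\<^esub> star M c \<ominus>\<^bsub>M\<^esub> block_sum A n n a b) \<le> e"
    using E by blast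
qed

text \<open>The square root x of a may have columns beyond n. Cutting them off leaves star x x
  unchanged, since a lives in the n by n corner, and makes the rule for block products
  applicable.\<close>

lemma direct_sum_positive:
  assumes "a \<in> positives M" "b \<in> positives M" "a \<in> matrices A n"
  shows "direct_sum A n a b \<in> positives M"
proof -
  obtain x y where x: "x \<in> carrier M" "a = star M x \<otimes>\<^bsub>M\<^esub> x" and y: "y \<in> carrier M" "b = star M y \<otimes>\<^bsub>M\<^esub> y"
    using assms by (auto simp: positives_def)
  define x' where "x' = col_cut A {..<n} x"
  have x': "x' \<in> carrier M" unfolding x'_def by (rule Minf_norm_col_cut(1)[OF x(1)])
  obtain m where m: "x \<in> matrices A m" "x' \<in> matrices A m" using x(1) x' by (rule MinfE2)
  note [simp] = Minf_entry[OF x(1)] Minf_entry[OF x']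
  have "star M x' \<otimes>\<^bsub>M\<^esub> x' = a"
  proof (intro ext)
    fix i j
    have e: "(star M x' \<otimes>\<^bsub>M\<^esub> x') i j = (\<Oplus>k\<in>{..<m}. star A (x' k i) \<otimes> x' k j)"
      "a i j = (\<Oplus>k\<in>{..<m}. star A (x k i) \<otimes> x k j)"
      unfolding x(2) using x x' m by (subst Minf_mult_eq[of _ _ m]; auto simp: Minf_entries)+
    show "(star M x' \<otimes>\<^bsub>M\<^esub> x') i j = a i j"
    proof (cases "i < n \<and> j < n")
      case True
      then show ?thesis unfolding e by (simp add: x'_def col_cut_def)
    next
      case False
      have "(\<Oplus>k\<in>{..<m}. star A (x' k i) \<otimes> x' k j) = \<zero>"
        using False by (intro add.finprod_one_eqI) (auto simp: x'_def col_cut_def)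
      then show ?thesis using e(1) False matrices_zero[OF assms(3)] by auto
    qed
  qed
  moreover have "star M (block_sum A m n x' y) \<otimes>\<^bsub>M\<^esub> block_sum A m n x' y
    = block_sum A n n (star M x' \<otimes>\<^bsub>M\<^esub> x') (star M y \<otimes>\<^bsub>M\<^esub> y)"
    using x' y matrices_zero[OF m(2)] by (simp add: block_sum_star block_sum_mult Minf_entries)
  ultimately have "direct_sum A n a b = star M (block_sum A m n x' y) \<otimes>\<^bsub>M\<^esub> block_sum A m n x' y"
    unfolding direct_sum_eq y(2) by simp
  then show ?thesis
    using block_sum_closed[OF x' y(1)] unfolding positives_def by blast
qed

section \<open>The Cuntz semigroup in terms of representatives\<close>

lemma cuntz_rel_iff:
  "(a, b) \<in> cuntz_rel A \<longleftrightarrow> a \<in> positives M \<and> b \<in> positives M \<and> cuntz_le A a b \<and> cuntz_le A b a"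
  by (simp add: cuntz_rel_def)

lemma cuntz_rel_equiv: "equiv (positives M) (cuntz_rel A)"
proof (rule equivI)
  show "cuntz_rel A \<subseteq> positives M \<times> positives M" by (auto simp: cuntz_rel_def)
  show "refl_on (positives M) (cuntz_rel A)" by (auto simp: refl_on_def cuntz_rel_iff cuntz_le_refl)
  show "sym (cuntz_rel A)" by (auto simp: sym_def cuntz_rel_iff)
  show "trans (cuntz_rel A)"
  proof (rule transI)
    fix a b c assume "(a, b) \<in> cuntz_rel A" "(b, c) \<in> cuntz_rel A"
    then show "(a, c) \<in> cuntz_rel A"
      using cuntz_le_trans[of a b c] cuntz_le_trans[of c b a] by (simp add: cuntz_rel_iff positives_closed)
  qed
qed

lemma W_carrierE:
  assumes "X \<in> carrier (W A)"
  obtains a where "a \<in> positives M" "X = cuntz_rel A `` {a}"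
  using assms by (auto simp: W_def elim: quotientE)

lemma W_le_class:
  assumes "a \<in> positives M" "b \<in> positives M"
  shows "sg_le (W A) (cuntz_rel A `` {a}) (cuntz_rel A `` {b}) \<longleftrightarrow> cuntz_le A a b"
proof
  assume "sg_le (W A) (cuntz_rel A `` {a}) (cuntz_rel A `` {b})"
  then obtain a' b' where "(a, a') \<in> cuntz_rel A" "(b, b') \<in> cuntz_rel A" "cuntz_le A a' b'"
    by (auto simp: W_def)
  then show "cuntz_le A a b"
    using cuntz_le_trans[of a a' b'] cuntz_le_trans[of a b' b] by (simp add: cuntz_rel_iff positives_closed)
next
  assume l: "cuntz_le A a b"
  have "(a, a) \<in> cuntz_rel A" "(b, b) \<in> cuntz_rel A"
    using assms by (auto simp: cuntz_rel_iff cuntz_le_refl)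
  with l have "\<exists>x\<in>cuntz_rel A `` {a}. \<exists>y\<in>cuntz_rel A `` {b}. cuntz_le A x y" by blast
  then show "sg_le (W A) (cuntz_rel A `` {a}) (cuntz_rel A `` {b})" by (simp add: W_def)
qed

text \<open>\<open>direct_sum\<close> depends on the representatives and on the size assigned to the
  first of them. By \<open>direct_sum_le\<close> all classes in the union of the definition
  coincide, so the union is a single class.\<close>

lemma W_add_class:
  assumes "a \<in> positives M" "b \<in> positives M" "a \<in> matrices A n"
  shows "sg_add (W A) (cuntz_rel A `` {a}) (cuntz_rel A `` {b}) = cuntz_rel A `` {direct_sum A n a b}"
proof -
  have "cuntz_rel A `` {direct_sum A n' a' b'} = cuntz_rel A `` {direct_sum A n a b}"
    if "(a, a') \<in> cuntz_rel A" "a' \<in> matrices A n'" "(b, b') \<in> cuntz_rel A" for n' a' b'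
  proof (rule equiv_class_eq[OF cuntz_rel_equiv])
    show "(direct_sum A n' a' b', direct_sum A n a b) \<in> cuntz_rel A"
      using that assms
      by (auto simp: cuntz_rel_iff direct_sum_positive positives_closed positives_star intro!: direct_sum_le)
  qed
  note eq = this
  define S where "S = {cuntz_rel A `` {direct_sum A n' a' b'} |n' a' b'.
      a' \<in> cuntz_rel A `` {a} \<and> a' \<in> matrices A n' \<and> b' \<in> cuntz_rel A `` {b}}"
  have "X = cuntz_rel A `` {direct_sum A n a b}" if X: "X \<in> S" for X
  proof -
    obtain n' a' b' where "X = cuntz_rel A `` {direct_sum A n' a' b'}" "(a, a') \<in> cuntz_rel A"
      "a' \<in> matrices A n'" "(b, b') \<in> cuntz_rel A"
      using X unfolding S_def by blast
    then show ?thesis using eq by simp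
  qed
  moreover have "cuntz_rel A `` {direct_sum A n a b} \<in> S"
  proof -
    have "a \<in> cuntz_rel A `` {a}" "b \<in> cuntz_rel A `` {b}"
      using assms by (auto simp: cuntz_rel_iff cuntz_le_refl)
    then show ?thesis unfolding S_def using assms(3) by blast
  qed
  ultimately have "\<Union>S = cuntz_rel A `` {direct_sum A n a b}" by blast
  then show ?thesis by (simp add: W_def S_def)
qed

end

lemma amplify_direct_sum:
  assumes "\<psi> \<zero>\<^bsub>A\<^esub> = \<zero>\<^bsub>B\<^esub>"
  shows "amplify \<psi> (direct_sum A n a b) = direct_sum B n (amplify \<psi> a) (amplify \<psi> b)"
  using assms by (simp add: amplify_def direct_sum_def fun_eq_iff)

text \<open>A *-homomorphism is contractive on matrices and hence preserves comparison; with
  \<open>reflect\<close> the induced map on classes is an order embedding. Injectivity follows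
  because equality of classes is comparison both ways, additivity because amplification respects
  block sums.\<close>

theorem W_map_iso_onto_range:
  assumes "cuntz_algebra A" "cuntz_algebra B" and h: "\<psi> \<in> star_hom A B"
    and reflect: "\<And>a b. \<lbrakk>a \<in> carrier (Minf A); b \<in> carrier (Minf A);
      cuntz_le B (amplify \<psi> a) (amplify \<psi> b)\<rbrakk> \<Longrightarrow> cuntz_le A a b"
  shows "iso_onto_range (W A) (W B) (W_map B \<psi>)"
proof -
  interpret A: cuntz_algebra A by fact
  interpret B: cuntz_algebra B by fact
  interpret MA: enveloping_star_algebra "Minf A" by (rule A.Minf_enveloping)
  interpret MB: enveloping_star_algebra "Minf B" by (rule B.Minf_enveloping)
  interpret linear_map_pair A B \<psi>
    using A.star_algebra_axioms B.star_algebra_axioms h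
    by (simp add: linear_map_pair_def linear_map_pair_axioms_def star_hom_linear)
  interpret L: linear_map_pair "Minf A" "Minf B" "amplify \<psi>"
    using MA.star_algebra_axioms MB.star_algebra_axioms amplify_linear
    by (simp add: linear_map_pair_def linear_map_pair_axioms_def)
  have H: "amplify \<psi> \<in> star_hom (Minf A) (Minf B)"
    by (rule amplify_star_hom[OF A.star_algebra_axioms B.star_algebra_axioms h])
  note HD = star_homD[OF H]
  have pos: "amplify \<psi> a \<in> positives (Minf B)" if a: "a \<in> positives (Minf A)" for a
  proof -
    obtain x where "x \<in> carrier (Minf A)" "a = star (Minf A) x \<otimes>\<^bsub>Minf A\<^esub> x"
      using a unfolding positives_def by blast
    then have "amplify \<psi> a = star (Minf B) (amplify \<psi> x) \<otimes>\<^bsub>Minf B\<^esub> amplify \<psi> x" "amplify \<psi> x \<in> carrier (Minf B)"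
      by (simp_all add: HD)
    then show ?thesis unfolding positives_def by blast
  qed
  have le: "cuntz_le B (amplify \<psi> a) (amplify \<psi> b) \<longleftrightarrow> cuntz_le A a b"
    if ab: "a \<in> carrier (Minf A)" "b \<in> carrier (Minf A)" for a b
  proof
    assume l: "cuntz_le A a b"
    show "cuntz_le B (amplify \<psi> a) (amplify \<psi> b)"
    proof (rule B.cuntz_leI)
      fix e :: real assume "e > 0"
      then obtain c where c: "c \<in> carrier (Minf A)"
        "cnorm (Minf A) (c \<otimes>\<^bsub>Minf A\<^esub> b \<otimes>\<^bsub>Minf A\<^esub> star (Minf A) c \<ominus>\<^bsub>Minf A\<^esub> a) < e"
        using A.cuntz_leE[OF l ab] by blast
      let ?x = "c \<otimes>\<^bsub>Minf A\<^esub> b \<otimes>\<^bsub>Minf A\<^esub> star (Minf A) c \<ominus>\<^bsub>Minf A\<^esub> a"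
      have "cnorm (Minf B) (amplify \<psi> ?x) \<le> cnorm (Minf A) ?x"
        using ab c by (intro enveloping_contraction[OF A.Minf_enveloping H MB.seminorm]) simp
      then show "\<exists>c\<in>carrier (Minf B). cnorm (Minf B)
          (c \<otimes>\<^bsub>Minf B\<^esub> amplify \<psi> b \<otimes>\<^bsub>Minf B\<^esub> star (Minf B) c \<ominus>\<^bsub>Minf B\<^esub> amplify \<psi> a) \<le> e"
        using c ab by (intro bexI[of _ "amplify \<psi> c"]) (simp_all add: HD L.map_minus)
    qed (use ab HD in auto)
  qed (use reflect ab in blast)
  note pc = A.positives_closed
  have rel: "(amplify \<psi> a, amplify \<psi> b) \<in> cuntz_rel B \<longleftrightarrow> (a, b) \<in> cuntz_rel A"
    if "a \<in> positives (Minf A)" "b \<in> positives (Minf A)" for a b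
    using that by (simp add: A.cuntz_rel_iff B.cuntz_rel_iff pos le pc)
  have cls: "W_map B \<psi> (cuntz_rel A `` {a}) = cuntz_rel B `` {amplify \<psi> a}"
    if a: "a \<in> positives (Minf A)" for a
  proof -
    have "cuntz_rel B `` {amplify \<psi> a'} = cuntz_rel B `` {amplify \<psi> a}" if "(a, a') \<in> cuntz_rel A" for a'
      using that a rel[of a' a] unfolding A.cuntz_rel_iff
      by (intro equiv_class_eq[OF B.cuntz_rel_equiv]) (auto simp: A.cuntz_rel_iff)
    moreover have "(a, a) \<in> cuntz_rel A" using a by (simp add: A.cuntz_rel_iff A.cuntz_le_refl)
    ultimately show ?thesis unfolding W_map_def by blast
  qed
  have in_W: "cuntz_rel B `` {b} \<in> carrier (W B)" if "b \<in> positives (Minf B)" for b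
    using that by (simp add: W_def quotientI)
  have f: "W_map B \<psi> \<in> carrier (W A) \<rightarrow> carrier (W B)"
    by (auto elim!: A.W_carrierE simp: cls in_W pos)
  have inj: "inj_on (W_map B \<psi>) (carrier (W A))"
  proof (rule inj_onI)
    fix X Y assume XY: "X \<in> carrier (W A)" "Y \<in> carrier (W A)" "W_map B \<psi> X = W_map B \<psi> Y"
    obtain a where a: "a \<in> positives (Minf A)" "X = cuntz_rel A `` {a}" using XY(1) by (rule A.W_carrierE)
    obtain b where b: "b \<in> positives (Minf A)" "Y = cuntz_rel A `` {b}" using XY(2) by (rule A.W_carrierE)
    have "cuntz_rel B `` {amplify \<psi> a} = cuntz_rel B `` {amplify \<psi> b}" using XY(3) a b by (simp add: cls)
    then have "(amplify \<psi> a, amplify \<psi> b) \<in> cuntz_rel B"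
      using eq_equiv_class[OF _ B.cuntz_rel_equiv] pos[OF b(1)] by blast
    then have "(a, b) \<in> cuntz_rel A" using rel a b by blast
    then show "X = Y" using equiv_class_eq[OF A.cuntz_rel_equiv] a b by blast
  qed
  have add: "W_map B \<psi> (sg_add (W A) X Y) = sg_add (W B) (W_map B \<psi> X) (W_map B \<psi> Y)"
    and ord: "sg_le (W A) X Y \<longleftrightarrow> sg_le (W B) (W_map B \<psi> X) (W_map B \<psi> Y)"
    if XY: "X \<in> carrier (W A)" "Y \<in> carrier (W A)" for X Y
  proof -
    obtain a where a: "a \<in> positives (Minf A)" "X = cuntz_rel A `` {a}" using XY(1) by (rule A.W_carrierE)
    obtain b where b: "b \<in> positives (Minf A)" "Y = cuntz_rel A `` {b}" using XY(2) by (rule A.W_carrierE)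
    obtain n where n: "a \<in> matrices A n" using pc[OF a(1)] by (rule MinfE)
    show "W_map B \<psi> (sg_add (W A) X Y) = sg_add (W B) (W_map B \<psi> X) (W_map B \<psi> Y)"
      using a b n
      by (simp add: A.W_add_class[of a b n] B.W_add_class[of "amplify \<psi> a" "amplify \<psi> b" n] cls pos
          amplify_matrices A.direct_sum_positive amplify_direct_sum)
    show "sg_le (W A) X Y \<longleftrightarrow> sg_le (W B) (W_map B \<psi> X) (W_map B \<psi> Y)"
      using a b by (simp add: A.W_le_class B.W_le_class cls pos le pc)
  qed
  show ?thesis
    unfolding iso_onto_range_def ordered_semigroup_iso_def
    using f inj add ord by (simp add: bij_betw_def)
qed

subsection \<open>The crossed product\<close>

text \<open>Lets the laws of the crossed product be read off in the matrix algebra, into which the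
  regular representation maps it injectively, instead of being verified on convolution sums.\<close>

lemma star_algebra_if_injective:
  assumes Y: "star_algebra Y" and h: "\<phi> \<in> star_hom X Y" and inj: "inj_on \<phi> (carrier X)"
    and z: "\<zero>\<^bsub>X\<^esub> \<in> carrier X" "\<phi> \<zero>\<^bsub>X\<^esub> = \<zero>\<^bsub>Y\<^esub>"
    and c: "\<And>x y. \<lbrakk>x \<in> carrier X; y \<in> carrier X\<rbrakk> \<Longrightarrow> x \<oplus>\<^bsub>X\<^esub> y \<in> carrier X"
      "\<And>x y. \<lbrakk>x \<in> carrier X; y \<in> carrier X\<rbrakk> \<Longrightarrow> x \<otimes>\<^bsub>X\<^esub> y \<in> carrier X"
      "\<And>c x. x \<in> carrier X \<Longrightarrow> c \<odot>\<^bsub>X\<^esub> x \<in> carrier X"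
      "\<And>x. x \<in> carrier X \<Longrightarrow> star X x \<in> carrier X"
  shows "star_algebra X"
proof -
  interpret Y: star_algebra Y by fact
  note H = star_homD[OF h]
  have eq: "x = y" if "x \<in> carrier X" "y \<in> carrier X" "\<phi> x = \<phi> y" for x y
    using inj_onD[OF inj] that by blast
  show ?thesis
  proof (intro star_algebra.intro star_algebra_axioms.intro abelian_groupI)
    fix x assume x: "x \<in> carrier X"
    show "\<exists>y\<in>carrier X. y \<oplus>\<^bsub>X\<^esub> x = \<zero>\<^bsub>X\<^esub>"
    proof
      show "(-1) \<odot>\<^bsub>X\<^esub> x \<in> carrier X" using c x by blast
      show "(-1) \<odot>\<^bsub>X\<^esub> x \<oplus>\<^bsub>X\<^esub> x = \<zero>\<^bsub>X\<^esub>"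
        by (rule eq) (use x c z in \<open>simp_all add: H Y.scale_minus_one Y.l_neg\<close>)
    qed
  qed (simp_all add: c z, (rule eq; simp add: c z H Y.a_ac Y.mult_assoc Y.distr_left Y.distr_right
      Y.scale_add_left Y.scale_add_right Y.scale_scale Y.scale_one Y.scale_mult_left Y.scale_mult_right
      Y.star_star Y.star_add Y.star_scale Y.star_mult)+)
qed

lemma crossed_product_simps:
  "carrier (crossed_product G A \<alpha>) = carrier G \<rightarrow>\<^sub>E carrier A"
  "mult (crossed_product G A \<alpha>) = (\<lambda>x y. \<lambda>g\<in>carrier G.
        \<Oplus>\<^bsub>A\<^esub>h\<in>carrier G. x h \<otimes>\<^bsub>A\<^esub> \<alpha> h (y (inv\<^bsub>G\<^esub> h \<otimes>\<^bsub>G\<^esub> g)))"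
  "one (crossed_product G A \<alpha>) = (\<lambda>g\<in>carrier G. if g = \<one>\<^bsub>G\<^esub> then \<one>\<^bsub>A\<^esub> else \<zero>\<^bsub>A\<^esub>)"
  "zero (crossed_product G A \<alpha>) = (\<lambda>g\<in>carrier G. \<zero>\<^bsub>A\<^esub>)"
  "add (crossed_product G A \<alpha>) = (\<lambda>x y. \<lambda>g\<in>carrier G. x g \<oplus>\<^bsub>A\<^esub> y g)"
  "smult (crossed_product G A \<alpha>) = (\<lambda>c x. \<lambda>g\<in>carrier G. c \<odot>\<^bsub>A\<^esub> x g)"
  "star (crossed_product G A \<alpha>) = (\<lambda>x. \<lambda>g\<in>carrier G. \<alpha> g (star A (x (inv\<^bsub>G\<^esub> g))))"
  by (simp_all add: crossed_product_def crossed_star_alg_def)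

locale finite_cstar_action = unital_cstar_algebra A + G: group G
  for A :: "('a, 'm) cstar_alg_scheme" (structure) and G :: "('g, 'h) monoid_scheme" +
  fixes \<alpha> :: "'g \<Rightarrow> 'a \<Rightarrow> 'a"
  assumes fin: "finite (carrier G)" and act: "\<alpha> \<in> hom G (Aut_cstar A)"
begin

abbreviation "B \<equiv> crossed_product G A \<alpha>"

lemma act_star_hom: "g \<in> carrier G \<Longrightarrow> \<alpha> g \<in> star_hom A A"
  and act_bij: "g \<in> carrier G \<Longrightarrow> \<alpha> g \<in> Bij (carrier A)"
  using act by (auto simp: hom_def Aut_cstar_def)

lemmas act_simps = star_homD[OF act_star_hom]

lemma act_mult:
  assumes "g \<in> carrier G" "h \<in> carrier G" "a \<in> carrier A"
  shows "\<alpha> g (\<alpha> h a) = \<alpha> (g \<otimes>\<^bsub>G\<^esub> h) a"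
proof -
  have "\<alpha> (g \<otimes>\<^bsub>G\<^esub> h) = \<alpha> g \<otimes>\<^bsub>Aut_cstar A\<^esub> \<alpha> h" using act assms by (simp add: hom_mult)
  also have "\<dots> = compose (carrier A) (\<alpha> g) (\<alpha> h)"
    using assms act_bij by (simp add: Aut_cstar_def BijGroup_def)
  finally show ?thesis using assms by (simp add: compose_def)
qed

text \<open>\<alpha>_1 is idempotent by multiplicativity, and an injective idempotent map is the
  identity.\<close>

lemma act_one: "a \<in> carrier A \<Longrightarrow> \<alpha> \<one>\<^bsub>G\<^esub> a = a"
  using act_mult[of "\<one>\<^bsub>G\<^esub>" "\<one>\<^bsub>G\<^esub>" a] act_bij[OF G.one_closed] act_simps(1)[of "\<one>\<^bsub>G\<^esub>" a]
  by (auto simp: Bij_def bij_betw_def dest: inj_onD)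

lemma act_zero [simp]: "g \<in> carrier G \<Longrightarrow> \<alpha> g \<zero> = \<zero>"
  using act_simps(3)[of g \<zero> 0] act_simps(1)[of g \<zero>] by simp

text \<open>\<open>star_hom\<close> does not mention units. By surjectivity \<one> = \<alpha>_g(b)
  for some b, so \<alpha>_g(\<one>) = \<alpha>_g(\<one>) \<alpha>_g(b) = \<alpha>_g(b) =
  \<one>.\<close>

lemma act_unit [simp]:
  assumes "g \<in> carrier G"
  shows "\<alpha> g \<one> = \<one>"
proof -
  let ?b = "\<alpha> (inv\<^bsub>G\<^esub> g) \<one>"
  have b: "?b \<in> carrier A" "\<alpha> g ?b = \<one>" using assms by (simp_all add: act_simps act_mult act_one)
  have "\<alpha> g \<one> = \<alpha> g \<one> \<otimes> \<alpha> g ?b" unfolding b(2) using assms by (simp add: act_simps)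
  also have "\<dots> = \<alpha> g (\<one> \<otimes> ?b)" by (rule act_simps(4)[symmetric]) (use assms b in auto)
  finally show ?thesis using b by simp
qed

lemma act_norm: "\<lbrakk>g \<in> carrier G; a \<in> carrier A\<rbrakk> \<Longrightarrow> cnorm A (\<alpha> g a) \<le> 2 * cnorm A a"
  using cstar_seminorm_le[OF cstar_seminorm_pullback[OF star_algebra_axioms act_star_hom seminorm]] .

lemma act_finsum:
  assumes "g \<in> carrier G" "f \<in> I \<rightarrow> carrier A"
  shows "\<alpha> g (\<Oplus>i\<in>I. f i) = (\<Oplus>i\<in>I. \<alpha> g (f i))"
proof -
  interpret linear_map_pair A A "\<alpha> g"
    using star_algebra_axioms star_hom_linear[OF act_star_hom[OF assms(1)]]
    by (simp add: linear_map_pair_def linear_map_pair_axioms_def)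
  show ?thesis using assms by (intro map_finsum)
qed

section \<open>Enumeration of the group and the regular representation\<close>

abbreviation "m \<equiv> card (carrier G)"

definition enum :: "nat \<Rightarrow> 'g" where
  "enum = (SOME f. bij_betw f {..<m} (carrier G))"

lemma enum_bij: "bij_betw enum {..<m} (carrier G)"
proof -
  have "\<exists>f. bij_betw f {..<m} (carrier G)"
    using ex_bij_betw_nat_finite[OF fin] by (simp add: atLeast0LessThan)
  then show ?thesis unfolding enum_def by (rule someI_ex)
qed

lemma enum_closed [simp]: "r < m \<Longrightarrow> enum r \<in> carrier G"
  using enum_bij by (auto simp: bij_betw_def)

lemma m_pos: "m > 0"
  using fin G.one_closed by (auto simp: card_gt_0_iff)

definition index :: "'g \<Rightarrow> nat" where
  "index g = the_inv_into {..<m} enum g"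

lemma index: "g \<in> carrier G \<Longrightarrow> index g < m" "g \<in> carrier G \<Longrightarrow> enum (index g) = g"
  using enum_bij the_inv_into_into[of enum "{..<m}" g "{..<m}"] f_the_inv_into_f[of enum "{..<m}" g]
  by (auto simp: index_def bij_betw_def)

text \<open>The regular representation of the crossed product on \<open>A\<^sup>m\<close>, where \<^term>\<open>m\<close> is the order
  of the group.\<close>

definition reg :: "('g \<Rightarrow> 'a) \<Rightarrow> nat \<Rightarrow> nat \<Rightarrow> 'a" where
  "reg x r s = (if r < m \<and> s < m
     then \<alpha> (inv\<^bsub>G\<^esub> (enum r)) (x (enum r \<otimes>\<^bsub>G\<^esub> inv\<^bsub>G\<^esub> (enum s))) else \<zero>)"

lemma B_entry: "\<lbrakk>x \<in> carrier B; g \<in> carrier G\<rbrakk> \<Longrightarrow> x g \<in> carrier A"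
  by (auto simp: crossed_product_simps)

lemma B_eqI: "\<lbrakk>x \<in> carrier B; y \<in> carrier B; \<And>g. g \<in> carrier G \<Longrightarrow> x g = y g\<rbrakk> \<Longrightarrow> x = y"
  unfolding crossed_product_simps by (rule PiE_ext)

lemma reg_matrices: "x \<in> carrier B \<Longrightarrow> reg x \<in> matrices A m"
  by (auto simp: matrices_def reg_def B_entry act_simps)

lemma reg_closed: "x \<in> carrier B \<Longrightarrow> reg x \<in> carrier M"
  by (rule MinfI[OF reg_matrices])

text \<open>The row of the neutral element removes the automorphism, and the column of the inverse
  of g selects x g. Coefficients are thus entries of \<open>reg x\<close>, which gives injectivity
  and the bound \<open>entry_le_regnorm\<close>.\<close>

lemma reg_entry:
  assumes "x \<in> carrier B" "g \<in> carrier G"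
  shows "x g = reg x (index \<one>\<^bsub>G\<^esub>) (index (inv\<^bsub>G\<^esub> g))"
  using assms by (simp add: reg_def index act_one B_entry)

lemma reg_inj: "inj_on reg (carrier B)"
  by (rule inj_onI, rule B_eqI) (simp_all add: reg_entry)

lemma B_closed:
  assumes "x \<in> carrier B" "y \<in> carrier B"
  shows "x \<oplus>\<^bsub>B\<^esub> y \<in> carrier B" "x \<otimes>\<^bsub>B\<^esub> y \<in> carrier B" "c \<odot>\<^bsub>B\<^esub> x \<in> carrier B" "star B x \<in> carrier B"
proof -
  note e = B_entry[OF assms(1)] B_entry[OF assms(2)]
  show "x \<oplus>\<^bsub>B\<^esub> y \<in> carrier B" "c \<odot>\<^bsub>B\<^esub> x \<in> carrier B" "star B x \<in> carrier B"
    using e by (auto simp: crossed_product_simps act_simps)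
  show "x \<otimes>\<^bsub>B\<^esub> y \<in> carrier B"
    using e by (auto simp: crossed_product_simps act_simps intro!: finsum_closed)
qed

lemma B_zero_closed: "\<zero>\<^bsub>B\<^esub> \<in> carrier B" and B_one_closed: "\<one>\<^bsub>B\<^esub> \<in> carrier B"
  by (auto simp: crossed_product_simps)

text \<open>For a fixed row r, substituting h = r times the inverse of t, with t running through the
  enumeration, turns the convolution sum into the sum of the matrix product.\<close>

lemma reg_mult:
  assumes "x \<in> carrier B" "y \<in> carrier B"
  shows "reg (x \<otimes>\<^bsub>B\<^esub> y) = reg x \<otimes>\<^bsub>M\<^esub> reg y"
proof (intro ext)
  fix r s
  note e = B_entry[OF assms(1)] B_entry[OF assms(2)]
  have M: "(reg x \<otimes>\<^bsub>M\<^esub> reg y) r s = (\<Oplus>t\<in>{..<m}. reg x r t \<otimes> reg y t s)"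
    using assms by (intro Minf_mult_eq reg_closed) (simp_all add: reg_matrices)
  show "reg (x \<otimes>\<^bsub>B\<^esub> y) r s = (reg x \<otimes>\<^bsub>M\<^esub> reg y) r s"
  proof (cases "r < m \<and> s < m")
    case True
    let ?r = "enum r" and ?s = "enum s"
    let ?k = "\<lambda>t. ?r \<otimes>\<^bsub>G\<^esub> inv\<^bsub>G\<^esub> (enum t)"
    let ?f = "\<lambda>h. \<alpha> (inv\<^bsub>G\<^esub> ?r) (x h) \<otimes> \<alpha> (inv\<^bsub>G\<^esub> ?r \<otimes>\<^bsub>G\<^esub> h) (y (inv\<^bsub>G\<^esub> h \<otimes>\<^bsub>G\<^esub> (?r \<otimes>\<^bsub>G\<^esub> inv\<^bsub>G\<^esub> ?s)))"
    have fc: "?f \<in> carrier G \<rightarrow> carrier A" using True e by (auto simp: act_simps)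
    have inj: "inj_on ?k {..<m}"
    proof (rule inj_onI)
      fix t t' assume t: "t \<in> {..<m}" "t' \<in> {..<m}" "?k t = ?k t'"
      then have "inv\<^bsub>G\<^esub> (enum t) = inv\<^bsub>G\<^esub> (enum t')" using True by simp
      then have "enum t = enum t'" using t by (metis G.inv_inv enum_closed lessThan_iff)
      then show "t = t'" using t enum_bij by (auto simp: bij_betw_def dest: inj_onD)
    qed
    have img: "?k ` {..<m} = carrier G"
      using inj True by (intro card_subset_eq[OF fin]) (auto simp: card_image)
    have "reg (x \<otimes>\<^bsub>B\<^esub> y) r s = \<alpha> (inv\<^bsub>G\<^esub> ?r) (\<Oplus>h\<in>carrier G. x h \<otimes> \<alpha> h (y (inv\<^bsub>G\<^esub> h \<otimes>\<^bsub>G\<^esub> (?r \<otimes>\<^bsub>G\<^esub> inv\<^bsub>G\<^esub> ?s))))"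
      using True by (simp add: reg_def crossed_product_simps)
    also have "\<dots> = (\<Oplus>h\<in>carrier G. ?f h)"
      using True e by (subst act_finsum) (auto simp: act_simps act_mult intro!: finsum_cong')
    also have "\<dots> = (\<Oplus>t\<in>{..<m}. ?f (?k t))"
      using finsum_reindex[of ?f ?k "{..<m}"] fc inj unfolding img by simp
    also have "\<dots> = (\<Oplus>t\<in>{..<m}. reg x r t \<otimes> reg y t s)"
    proof (rule finsum_cong')
      show "(\<lambda>t. reg x r t \<otimes> reg y t s) \<in> {..<m} \<rightarrow> carrier A"
        using assms matrices_entry reg_matrices by (blast intro: mult_closed)
      fix t assume "t \<in> {..<m}"
      then have t: "t < m" by simp
      have 1: "inv\<^bsub>G\<^esub> ?r \<otimes>\<^bsub>G\<^esub> ?k t = inv\<^bsub>G\<^esub> (enum t)"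
        using True t by (simp flip: G.m_assoc)
      have 2: "inv\<^bsub>G\<^esub> (?k t) \<otimes>\<^bsub>G\<^esub> (?r \<otimes>\<^bsub>G\<^esub> inv\<^bsub>G\<^esub> ?s) = enum t \<otimes>\<^bsub>G\<^esub> inv\<^bsub>G\<^esub> ?s"
      proof -
        have "inv\<^bsub>G\<^esub> (?k t) \<otimes>\<^bsub>G\<^esub> (?r \<otimes>\<^bsub>G\<^esub> inv\<^bsub>G\<^esub> ?s) = enum t \<otimes>\<^bsub>G\<^esub> (inv\<^bsub>G\<^esub> ?r \<otimes>\<^bsub>G\<^esub> (?r \<otimes>\<^bsub>G\<^esub> inv\<^bsub>G\<^esub> ?s))"
          using True t by (simp add: G.inv_mult_group G.m_assoc)
        also have "inv\<^bsub>G\<^esub> ?r \<otimes>\<^bsub>G\<^esub> (?r \<otimes>\<^bsub>G\<^esub> inv\<^bsub>G\<^esub> ?s) = inv\<^bsub>G\<^esub> ?s"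
          using True by (simp flip: G.m_assoc)
        finally show ?thesis .
      qed
      show "?f (?k t) = reg x r t \<otimes> reg y t s" unfolding 1 2 using True t by (simp add: reg_def)
    qed simp
    finally show ?thesis using M by simp
  next
    case False
    have "(\<Oplus>t\<in>{..<m}. reg x r t \<otimes> reg y t s) = \<zero>"
    proof (rule add.finprod_one_eqI)
      fix t
      note [simp] = matrices_entry[OF reg_matrices[OF assms(1)]] matrices_entry[OF reg_matrices[OF assms(2)]]
      have "reg x r t = \<zero> \<or> reg y t s = \<zero>" using False by (auto simp: reg_def)
      then show "reg x r t \<otimes> reg y t s = \<zero>" by auto
    qed
    then show ?thesis using M False by (auto simp: reg_def)
  qed
qed

lemma reg_star_hom: "reg \<in> star_hom B M"
proof (rule star_homI)
  fix x assume x: "x \<in> carrier B"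
  note e = B_entry[OF x]
  show "reg x \<in> carrier M" by (rule reg_closed[OF x])
  show "reg (c \<odot>\<^bsub>B\<^esub> x) = c \<odot>\<^bsub>M\<^esub> reg x" for c
    using e by (intro ext) (simp add: reg_def Minf_entries crossed_product_simps act_simps)
  show "reg (star B x) = star M (reg x)"
  proof (intro ext)
    fix r s
    show "reg (star B x) r s = star M (reg x) r s"
    proof (cases "r < m \<and> s < m")
      case True
      let ?r = "enum r" and ?s = "enum s"
      have 1: "inv\<^bsub>G\<^esub> (?r \<otimes>\<^bsub>G\<^esub> inv\<^bsub>G\<^esub> ?s) = ?s \<otimes>\<^bsub>G\<^esub> inv\<^bsub>G\<^esub> ?r"
        using True by (simp add: G.inv_mult_group)
      have 2: "inv\<^bsub>G\<^esub> ?r \<otimes>\<^bsub>G\<^esub> (?r \<otimes>\<^bsub>G\<^esub> inv\<^bsub>G\<^esub> ?s) = inv\<^bsub>G\<^esub> ?s"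
        using True by (simp flip: G.m_assoc)
      show ?thesis using True e
        by (simp add: reg_def Minf_entries crossed_product_simps act_mult 1 2 act_simps(5)[symmetric])
    qed (auto simp: reg_def Minf_entries)
  qed
  fix y assume y: "y \<in> carrier B"
  show "reg (x \<otimes>\<^bsub>B\<^esub> y) = reg x \<otimes>\<^bsub>M\<^esub> reg y" by (rule reg_mult[OF x y])
  show "reg (x \<oplus>\<^bsub>B\<^esub> y) = reg x \<oplus>\<^bsub>M\<^esub> reg y"
    using e B_entry[OF y] by (intro ext) (simp add: reg_def Minf_entries crossed_product_simps act_simps)
qed

lemma B_star_algebra: "star_algebra B"
proof (rule star_algebra_if_injective[OF Minf_star_algebra reg_star_hom reg_inj])
  show "reg \<zero>\<^bsub>B\<^esub> = \<zero>\<^bsub>M\<^esub>" by (intro ext) (simp add: reg_def Minf_entries crossed_product_simps)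
qed (use B_closed B_zero_closed in auto)

lemma crossed_inclusion_star_hom: "crossed_inclusion G A \<in> star_hom A B"
proof (rule star_homI)
  fix a assume a: "a \<in> carrier A"
  let ?i = "crossed_inclusion G A"
  show ia: "?i a \<in> carrier B" using a by (auto simp: crossed_inclusion_def crossed_product_simps)
  show "?i (c \<odot> a) = c \<odot>\<^bsub>B\<^esub> ?i a" for c
    by (auto simp: crossed_inclusion_def crossed_product_simps fun_eq_iff)
  show "?i (star A a) = star B (?i a)"
  proof
    fix g
    have "inv\<^bsub>G\<^esub> g = \<one>\<^bsub>G\<^esub> \<longleftrightarrow> g = \<one>\<^bsub>G\<^esub>" if "g \<in> carrier G" using that by (metis G.inv_inv G.inv_one)
    then show "?i (star A a) g = star B (?i a) g"
      using a by (auto simp: crossed_inclusion_def crossed_product_simps act_one)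
  qed
  fix b assume b: "b \<in> carrier A"
  show "?i (a \<oplus> b) = ?i a \<oplus>\<^bsub>B\<^esub> ?i b"
    by (auto simp: crossed_inclusion_def crossed_product_simps fun_eq_iff)
  show "?i (a \<otimes> b) = ?i a \<otimes>\<^bsub>B\<^esub> ?i b"
  proof
    fix g
    show "?i (a \<otimes> b) g = (?i a \<otimes>\<^bsub>B\<^esub> ?i b) g"
    proof (cases "g \<in> carrier G")
      case True
      have "(?i a \<otimes>\<^bsub>B\<^esub> ?i b) g = (\<Oplus>h\<in>carrier G. ?i a h \<otimes> \<alpha> h (?i b (inv\<^bsub>G\<^esub> h \<otimes>\<^bsub>G\<^esub> g)))"
        using True by (simp add: crossed_product_simps)
      also have "\<dots> = a \<otimes> \<alpha> \<one>\<^bsub>G\<^esub> (?i b g)"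
        using True a b fin by (subst finsum_single[of "\<one>\<^bsub>G\<^esub>"]) (auto simp: crossed_inclusion_def act_simps)
      also have "\<dots> = ?i (a \<otimes> b) g" using True a b by (auto simp: crossed_inclusion_def act_one)
      finally show ?thesis by simp
    qed (simp add: crossed_inclusion_def crossed_product_simps)
  qed
qed

text \<open>A provisional norm on B: it is complete because it is equivalent to convergence of
  coefficients, and it can be used before the enveloping norm is known to be finite.\<close>

definition regnorm :: "('g \<Rightarrow> 'a) \<Rightarrow> real" where
  "regnorm x = cnorm M (reg x)"

interpretation N: enveloping_star_algebra M by (rule Minf_enveloping)
interpretation BB: star_algebra B by (rule B_star_algebra)

lemma regnorm_seminorm: "cstar_seminorm B regnorm"
  unfolding regnorm_def by (rule cstar_seminorm_pullback[OF B_star_algebra reg_star_hom N.seminorm])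

interpretation R: seminormed_star_algebra B regnorm
  by unfold_locales (rule regnorm_seminorm)

lemma B_minus_entry: "\<lbrakk>x \<in> carrier B; y \<in> carrier B; g \<in> carrier G\<rbrakk> \<Longrightarrow> (x \<ominus>\<^bsub>B\<^esub> y) g = x g \<ominus> y g"
  using B_entry[of y g]
  by (simp add: BB.minus_eq minus_eq crossed_product_simps(5,6) scale_minus_one flip: BB.scale_minus_one)

lemma entry_le_regnorm: "\<lbrakk>x \<in> carrier B; g \<in> carrier G\<rbrakk> \<Longrightarrow> cnorm A (x g) \<le> regnorm x"
  unfolding regnorm_def using entry_le_Minf_norm[OF reg_closed, of x] by (metis reg_entry)

text \<open>The constant 4 is a factor 2 from bounding a matrix norm by its entries and a factor 2
  from \<open>act_norm\<close>.\<close>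

lemma regnorm_le: 
  assumes "x \<in> carrier B"
  shows "regnorm x \<le> (\<Sum>r<m. \<Sum>s<m. 4 * cnorm A (x (enum r \<otimes>\<^bsub>G\<^esub> inv\<^bsub>G\<^esub> (enum s))))"
proof -
  have "regnorm x \<le> (\<Sum>r<m. \<Sum>s<m. 2 * cnorm A (reg x r s))"
    unfolding regnorm_def by (rule Minf_norm_le_sum[OF reg_matrices[OF assms]])
  also have "\<dots> \<le> (\<Sum>r<m. \<Sum>s<m. 4 * cnorm A (x (enum r \<otimes>\<^bsub>G\<^esub> inv\<^bsub>G\<^esub> (enum s))))"
    using act_norm B_entry[OF assms] by (intro sum_mono) (fastforce simp: reg_def)
  finally show ?thesis .
qed

text \<open>Coefficients of a Cauchy sequence are Cauchy in A by \<open>entry_le_regnorm\<close>;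
  conversely, over a finite group coefficientwise convergence is convergence in
  \<open>regnorm\<close> by \<open>regnorm_le\<close>.\<close>

lemma regnorm_complete:
  assumes s: "Cauchy_seq B regnorm s"
  obtains x where "x \<in> carrier B" "R.asy sequentially s (\<lambda>_. x)"
proof -
  have sc: "s n \<in> carrier B" for n using s by (simp add: Cauchy_seq_def)
  have "\<exists>l\<in>carrier A. asy sequentially (\<lambda>n. s n g) (\<lambda>_. l)" if g: "g \<in> carrier G" for g
  proof (rule complete_asy)
    show "s n g \<in> carrier A" for n by (rule B_entry[OF sc g])
    show "alg_Cauchy A (\<lambda>n. s n g)" unfolding alg_Cauchy_def
    proof (intro allI impI)
      fix e :: real assume "e > 0"
      then obtain K where K: "\<And>m n. m \<ge> K \<Longrightarrow> n \<ge> K \<Longrightarrow> regnorm (s m \<ominus>\<^bsub>B\<^esub> s n) < e"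
        using s unfolding Cauchy_seq_def by meson
      have "cnorm A (s m g \<ominus> s n g) < e" if "m \<ge> K" "n \<ge> K" for m n
        using entry_le_regnorm[of "s m \<ominus>\<^bsub>B\<^esub> s n" g] sc g K[OF that] by (simp add: B_minus_entry)
      then show "\<exists>K. \<forall>m\<ge>K. \<forall>n\<ge>K. cnorm A (s m g \<ominus> s n g) < e" by blast
    qed
  qed
  then obtain x0 where x0: "\<And>g. g \<in> carrier G \<Longrightarrow> x0 g \<in> carrier A \<and> asy sequentially (\<lambda>n. s n g) (\<lambda>_. x0 g)"
    by metis
  define x where "x = restrict x0 (carrier G)"
  have x: "x \<in> carrier B" "\<And>g. g \<in> carrier G \<Longrightarrow> asy sequentially (\<lambda>n. s n g) (\<lambda>_. x g)"
    using x0 by (auto simp: x_def crossed_product_simps)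
  have "R.asy sequentially s (\<lambda>_. x)"
  proof (rule R.asyI[OF sc x(1)])
    show "regnorm (s n \<ominus>\<^bsub>B\<^esub> x) \<le> (\<Sum>r<m. \<Sum>t<m. 4 * cnorm A (s n (enum r \<otimes>\<^bsub>G\<^esub> inv\<^bsub>G\<^esub> (enum t)) \<ominus> x (enum r \<otimes>\<^bsub>G\<^esub> inv\<^bsub>G\<^esub> (enum t))))" for n
      using regnorm_le[of "s n \<ominus>\<^bsub>B\<^esub> x"] sc x(1) by (simp add: B_minus_entry)
    have "(\<lambda>n. \<Sum>r<m. \<Sum>t<m. 4 * cnorm A (s n (enum r \<otimes>\<^bsub>G\<^esub> inv\<^bsub>G\<^esub> (enum t)) \<ominus> x (enum r \<otimes>\<^bsub>G\<^esub> inv\<^bsub>G\<^esub> (enum t)))) \<longlonglongrightarrow> (\<Sum>r<m. \<Sum>t<m. 4 * 0)"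
      by (intro tendsto_sum tendsto_mult tendsto_const asy_tendsto x) simp
    then show "(\<lambda>n. \<Sum>r<m. \<Sum>t<m. 4 * cnorm A (s n (enum r \<otimes>\<^bsub>G\<^esub> inv\<^bsub>G\<^esub> (enum t)) \<ominus> x (enum r \<otimes>\<^bsub>G\<^esub> inv\<^bsub>G\<^esub> (enum t)))) \<longlonglongrightarrow> 0"
      by simp
  qed
  then show ?thesis using that x by blast
qed

lemma regnorm_definite:
  assumes "x \<in> carrier B" "regnorm x = 0"
  shows "x = \<zero>\<^bsub>B\<^esub>"
proof (rule B_eqI[OF assms(1) B_zero_closed])
  fix g assume g: "g \<in> carrier G"
  have "cnorm A (x g) = 0"
    using entry_le_regnorm[OF assms(1) g] assms(2) p_nonneg[OF B_entry[OF assms(1) g]] by linarith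
  then show "x g = \<zero>\<^bsub>B\<^esub> g"
    using cnorm_definite[OF B_entry[OF assms(1) g]] g by (simp add: crossed_product_simps(4))
qed

text \<open>The crossed product is a C*-algebra for the norm of the regular representation, so that all
  C*-seminorms on it are at most twice this norm.\<close>

lemma seminorm_le_regnorm:
  assumes "cstar_seminorm B p" "x \<in> carrier B"
  shows "p x \<le> 2 * regnorm x"
proof -
  \<comment> \<open>Exchanging only the norm field gives a C*-algebra to which automatic continuity
    applies, while its C*-seminorms remain those of B, their definition not referring to the
    norm.\<close>
  let ?B = "B\<lparr>cnorm := regnorm\<rparr>"
  have sg: "star_algebra ?B" using B_star_algebra by (simp add: star_algebra_def star_algebra_axioms_def
      abelian_group_def abelian_group_axioms_def abelian_monoid_def)
  have min: "a_minus ?B = a_minus B" by (simp add: fun_eq_iff a_minus_def a_inv_def)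
  have "cstar_algebra ?B"
  proof (intro cstar_algebra.intro cstar_algebra_axioms.intro sg)
    show "cstar_seminorm ?B (cnorm ?B)" using regnorm_seminorm by (simp add: cstar_seminorm_def)
    show "x = \<zero>\<^bsub>?B\<^esub>" if "x \<in> carrier ?B" "cnorm ?B x = 0" for x
      using regnorm_definite that by simp
    fix s :: "nat \<Rightarrow> 'g \<Rightarrow> 'a" assume "\<And>n. s n \<in> carrier ?B" "alg_Cauchy ?B s"
    then have "Cauchy_seq B regnorm s" by (simp add: Cauchy_seq_def alg_Cauchy_def min)
    then obtain x where "x \<in> carrier B" "R.asy sequentially s (\<lambda>_. x)" by (rule regnorm_complete)
    then show "\<exists>l\<in>carrier ?B. alg_tendsto ?B s l"
      by (auto simp: R.asy_def alg_tendsto_def min)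
  qed
  then interpret B': cstar_algebra ?B .
  show ?thesis using B'.cstar_seminorm_le[of p x] assms by (simp add: cstar_seminorm_def)
qed

lemma B_enveloping: "enveloping_star_algebra B"
proof (intro enveloping_star_algebra.intro enveloping_star_algebra_axioms.intro B_star_algebra)
  fix x assume x: "x \<in> carrier B"
  show "cnorm B x = Sup {p x |p. cstar_seminorm B p}"
    unfolding crossed_product_def by (simp add: enveloping_norm_def cstar_seminorm_with_enveloping_norm)
  show "bdd_above {p x |p. cstar_seminorm B p}"
    using seminorm_le_regnorm[OF _ x] by (intro bdd_aboveI[of _ "2 * regnorm x"]) blast
qed

text \<open>The equivalence of the enveloping norm with \<open>regnorm\<close> transfers
  definiteness and completeness. The left unit law is read off the regular representation, where the
  unit becomes the corner unit of size m; the right one follows by the involution.\<close>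

theorem crossed_product_unital_cstar_algebra: "unital_cstar_algebra B"
proof -
  interpret E: enveloping_star_algebra B by (rule B_enveloping)
  have le: "regnorm x \<le> cnorm B x" "cnorm B x \<le> 2 * regnorm x" if "x \<in> carrier B" for x
    using E.seminorm_le[OF regnorm_seminorm that] seminorm_le_regnorm[OF E.seminorm that] .
  have reg1: "reg \<one>\<^bsub>B\<^esub> = corner_unit m"
  proof (intro ext)
    fix r s
    have "enum r \<otimes>\<^bsub>G\<^esub> inv\<^bsub>G\<^esub> (enum s) = \<one>\<^bsub>G\<^esub> \<longleftrightarrow> r = s" if "r < m" "s < m"
    proof -
      have "enum r \<otimes>\<^bsub>G\<^esub> inv\<^bsub>G\<^esub> (enum s) = \<one>\<^bsub>G\<^esub> \<longleftrightarrow> enum r = enum s"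
        using that G.inv_equality[of "enum r" "inv\<^bsub>G\<^esub> (enum s)"] by (auto simp: G.inv_inv)
      also have "\<dots> \<longleftrightarrow> r = s" using that enum_bij by (auto simp: bij_betw_def dest: inj_onD)
      finally show ?thesis .
    qed
    then show "reg \<one>\<^bsub>B\<^esub> r s = corner_unit m r s"
      by (auto simp: reg_def corner_unit_def crossed_product_simps(3))
  qed
  have one_left: "\<one>\<^bsub>B\<^esub> \<otimes>\<^bsub>B\<^esub> x = x" if x: "x \<in> carrier B" for x
  proof (rule inj_onD[OF reg_inj])
    show "reg (\<one>\<^bsub>B\<^esub> \<otimes>\<^bsub>B\<^esub> x) = reg x"
      unfolding reg_mult[OF B_one_closed x] reg1 corner_unit_mult[OF reg_closed[OF x]]
      by (auto simp: row_cut_def reg_def fun_eq_iff)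
  qed (use x B_closed B_one_closed in auto)
  have star_one: "star B \<one>\<^bsub>B\<^esub> = \<one>\<^bsub>B\<^esub>"
    using one_left[of "star B \<one>\<^bsub>B\<^esub>"] BB.star_mult[of "\<one>\<^bsub>B\<^esub>" "star B \<one>\<^bsub>B\<^esub>"] B_one_closed
    by (simp add: BB.star_star)
  show ?thesis
  proof (intro unital_cstar_algebra.intro unital_cstar_algebra_axioms.intro
      cstar_algebra.intro cstar_algebra_axioms.intro B_star_algebra E.seminorm B_one_closed one_left)
    show "x = \<zero>\<^bsub>B\<^esub>" if "x \<in> carrier B" "cnorm B x = 0" for x
      using regnorm_definite[OF that(1)] le[OF that(1)] that(2) R.p_nonneg[OF that(1)] by simp
    show "x \<otimes>\<^bsub>B\<^esub> \<one>\<^bsub>B\<^esub> = x" if x: "x \<in> carrier B" for x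
      using BB.star_mult[of "star B \<one>\<^bsub>B\<^esub>" "star B x"] one_left[of "star B x"] x B_one_closed star_one
      by (simp add: BB.star_star)
    fix s :: "nat \<Rightarrow> 'g \<Rightarrow> 'a" assume s: "\<And>n. s n \<in> carrier B" "alg_Cauchy B s"
    have "Cauchy_seq B regnorm s"
      unfolding Cauchy_seq_def
    proof (intro conjI allI impI)
      fix e :: real assume "e > 0"
      then obtain K where K: "\<And>m n. m \<ge> K \<Longrightarrow> n \<ge> K \<Longrightarrow> cnorm B (s m \<ominus>\<^bsub>B\<^esub> s n) < e"
        using s(2) unfolding alg_Cauchy_def by blast
      have "regnorm (s m \<ominus>\<^bsub>B\<^esub> s n) < e" if "m \<ge> K" "n \<ge> K" for m n
        using le(1)[of "s m \<ominus>\<^bsub>B\<^esub> s n"] K[OF that] s(1) by simp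
      then show "\<exists>K. \<forall>m\<ge>K. \<forall>n\<ge>K. regnorm (s m \<ominus>\<^bsub>B\<^esub> s n) < e" by blast
    qed (rule s(1))
    then obtain x where x: "x \<in> carrier B" "R.asy sequentially s (\<lambda>_. x)" by (rule regnorm_complete)
    have "E.asy sequentially s (\<lambda>_. x)"
    proof (rule E.asyI[OF s(1) x(1)])
      show "cnorm B (s n \<ominus>\<^bsub>B\<^esub> x) \<le> 2 * regnorm (s n \<ominus>\<^bsub>B\<^esub> x)" for n using le(2) s x by simp
      show "(\<lambda>n. 2 * regnorm (s n \<ominus>\<^bsub>B\<^esub> x)) \<longlonglongrightarrow> 0"
        using tendsto_mult[OF tendsto_const R.asy_tendsto[OF x(2)], of 2] by simp
    qed
    then show "\<exists>l\<in>carrier B. alg_tendsto B s l" using x by (auto simp: E.asy_def alg_tendsto_def)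
  qed
qed

end

subsection \<open>Asymptotic left inverses\<close>

context seminormed_star_algebra
begin

lemma asy_finsum:
  "\<lbrakk>finite I; \<And>k. k \<in> I \<Longrightarrow> asy F (\<lambda>i. s i k) (\<lambda>i. t i k)\<rbrakk>
    \<Longrightarrow> asy F (\<lambda>i. \<Oplus>k\<in>I. s i k) (\<lambda>i. \<Oplus>k\<in>I. t i k)"
proof (induction I rule: finite_induct)
  case empty
  then show ?case by (simp add: asy_refl)
next
  case (insert k I)
  have 1: "s i l \<in> carrier A" "t i l \<in> carrier A" if "l \<in> insert k I" for i l
    using asy_closed[OF insert.prems[OF that]] .
  have "(\<Oplus>l\<in>insert k I. s i l) = s i k \<oplus> (\<Oplus>l\<in>I. s i l)" "(\<Oplus>l\<in>insert k I. t i l) = t i k \<oplus> (\<Oplus>l\<in>I. t i l)" for i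
    using insert.hyps 1 by (auto intro!: finsum_insert)
  moreover have "asy F (\<lambda>i. s i k \<oplus> (\<Oplus>l\<in>I. s i l)) (\<lambda>i. t i k \<oplus> (\<Oplus>l\<in>I. t i l))"
    using insert by (intro asy_add) auto
  ultimately show ?case by simp
qed

text \<open>The approximations are uniform in the index i, so for a given tolerance a single
  approximating pair decides the matter.\<close>

lemma asy_approx:
  assumes "\<And>i. s i \<in> carrier A" "\<And>i. t i \<in> carrier A"
    and ap: "\<And>e. e > 0 \<Longrightarrow> \<exists>s' t'. asy F s' t' \<and> (\<forall>i. p (s i \<ominus> s' i) \<le> e) \<and> (\<forall>i. p (t i \<ominus> t' i) \<le> e)"
  shows "asy F s t"
  unfolding asy_def
proof (intro conjI allI tendstoI)
  fix e :: real assume "e > 0"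
  then obtain s' t' where a: "asy F s' t'" "\<And>i. p (s i \<ominus> s' i) \<le> e/4" "\<And>i. p (t i \<ominus> t' i) \<le> e/4"
    using ap[of "e/4"] by auto
  note c = asy_closed[OF a(1)]
  have "\<forall>\<^sub>F i in F. p (s' i \<ominus> t' i) < e/4" using \<open>e > 0\<close> by (intro order_tendstoD(2)[OF asy_tendsto[OF a(1)]]) simp
  then show "\<forall>\<^sub>F i in F. dist (p (s i \<ominus> t i)) 0 < e"
  proof eventually_elim
    case (elim i)
    have "p (s i \<ominus> t i) \<le> p (s i \<ominus> s' i) + (p (s' i \<ominus> t' i) + p (t' i \<ominus> t i))"
      using p_tri[of "s i" "s' i" "t i"] p_tri[of "s' i" "t' i" "t i"] assms c by simp
    then show ?case
      using elim a(2)[of i] a(3)[of i] p_diff_commute[of "t i" "t' i"] assms c \<open>e > 0\<close>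
        p_nonneg[of "s i \<ominus> t i"] by simp
  qed
qed (use assms in auto)

end

context cstar_algebra
begin

interpretation N: enveloping_star_algebra M by (rule Minf_enveloping)

text \<open>The size n is common to all indices, so finitely many entries control the norm.\<close>

lemma asy_entrywise:
  assumes "\<And>i. s i \<in> matrices A n" "\<And>i. t i \<in> matrices A n" "\<And>k l. asy F (\<lambda>i. s i k l) (\<lambda>i. t i k l)"
  shows "N.asy F s t"
proof (rule N.asyI)
  note c = MinfI[OF assms(1)] MinfI[OF assms(2)]
  show "s i \<in> carrier M" "t i \<in> carrier M" for i by (rule c)+
  note e = Minf_minus_entries[OF c]
  show "cnorm M (s i \<ominus>\<^bsub>M\<^esub> t i) \<le> (\<Sum>k<n. \<Sum>l<n. 2 * cnorm A (s i k l \<ominus> t i k l))" for i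
  proof -
    have "s i \<ominus>\<^bsub>M\<^esub> t i \<in> matrices A n"
      using assms(1)[of i] assms(2)[of i] by (auto simp: matrices_def e)
    from Minf_norm_le_sum[OF this] show ?thesis by (simp add: e)
  qed
  have "((\<lambda>i. \<Sum>k<n. \<Sum>l<n. 2 * cnorm A (s i k l \<ominus> t i k l)) \<longlongrightarrow> (\<Sum>k<n. \<Sum>l<n. 2 * 0)) F"
    by (intro tendsto_sum tendsto_mult tendsto_const asy_tendsto assms)
  then show "((\<lambda>i. \<Sum>k<n. \<Sum>l<n. 2 * cnorm A (s i k l \<ominus> t i k l)) \<longlongrightarrow> 0) F" by simp
qed

lemma bd_entrywise:
  assumes "\<And>i. s i \<in> matrices A n" "\<And>k l. bd F (\<lambda>i. s i k l)"
  shows "N.bd F s"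
proof -
  obtain C where C: "\<And>k l. \<forall>\<^sub>F i in F. cnorm A (s i k l) \<le> C k l" using assms(2) unfolding bd_def by metis
  have "\<forall>\<^sub>F i in F. \<forall>k\<in>{..<n}. \<forall>l\<in>{..<n}. cnorm A (s i k l) \<le> C k l"
    by (intro eventually_ball_finite finite_lessThan ballI C)
  then have "\<forall>\<^sub>F i in F. cnorm M (s i) \<le> (\<Sum>k<n. \<Sum>l<n. 2 * C k l)"
  proof eventually_elim
    case (elim i)
    have "cnorm M (s i) \<le> (\<Sum>k<n. \<Sum>l<n. 2 * cnorm A (s i k l))" by (rule Minf_norm_le_sum[OF assms(1)])
    also have "\<dots> \<le> (\<Sum>k<n. \<Sum>l<n. 2 * C k l)" using elim by (intro sum_mono) simp
    finally show ?case .
  qed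
  then show ?thesis using MinfI[OF assms(1)] unfolding N.bd_def by blast
qed

end

lemma le_limit_at_right:
  fixes f :: "real \<Rightarrow> real"
  assumes "\<And>e. e > 0 \<Longrightarrow> c \<le> f e" "(f \<longlongrightarrow> l) (at_right 0)"
  shows "c \<le> l"
  by (rule tendsto_lowerbound[OF assms(2)]) (auto simp: eventually_at_right_less assms(1) eventually_at_filter)

lemma (in unital_cstar_algebra) Minf_mult_eq_D:
  assumes "x \<in> carrier M" "y \<in> carrier M"
  shows "x \<otimes>\<^bsub>D\<^esub> y = x \<otimes>\<^bsub>M\<^esub> y"
proof -
  interpret MM: star_algebra M by (rule Minf_star_algebra)
  show ?thesis
    by (rule conv_unique[OF conv_mult[OF conv_const conv_const] conv_const])
      (simp_all add: assms Minf_subset_D)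
qed

text \<open>The asymptotic homomorphisms \<^term>\<open>\<theta> i\<close> induce the C*-seminorm \<open>lim sup \<Parallel>\<theta>\<^sub>i(x)\<Parallel>\<close> on
  \<open>M\<^sub>\<infinity>(X)\<close>, which is dominated by the enveloping norm. This bounds \<open>\<theta>\<^sub>i(c b c\<^sup>* - a)\<close>.\<close>

locale asymptotic_left_inverse = X: cstar_algebra X + Y: cuntz_algebra Y
  for X :: "('x, 'm) cstar_alg_scheme" and Y :: "('y, 'n) cstar_alg_scheme" +
  fixes \<iota> :: "'y \<Rightarrow> 'x" and F :: "'i filter" and \<theta> :: "'i \<Rightarrow> 'x \<Rightarrow> 'y"
  assumes \<iota>: "\<iota> \<in> star_hom Y X"
    and F: "F \<noteq> bot"
    and \<theta>_linear: "linear_map X Y (\<theta> i)"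
    and \<theta>_mult: "\<lbrakk>x \<in> carrier X; y \<in> carrier X\<rbrakk> \<Longrightarrow> Y.asy F (\<lambda>i. \<theta> i (x \<otimes>\<^bsub>X\<^esub> y)) (\<lambda>i. \<theta> i x \<otimes>\<^bsub>Y\<^esub> \<theta> i y)"
    and \<theta>_star: "x \<in> carrier X \<Longrightarrow> Y.asy F (\<lambda>i. \<theta> i (star X x)) (\<lambda>i. star Y (\<theta> i x))"
    and \<theta>_bd: "x \<in> carrier X \<Longrightarrow> Y.bd F (\<lambda>i. \<theta> i x)"
    and \<theta>_\<iota>: "b \<in> carrier Y \<Longrightarrow> Y.asy F (\<lambda>i. \<theta> i (\<iota> b)) (\<lambda>_. b)"
begin

abbreviation "MX \<equiv> Minf X"
abbreviation "MY \<equiv> Minf Y"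

interpretation NX: enveloping_star_algebra MX by (rule X.Minf_enveloping)
interpretation NY: enveloping_star_algebra MY by (rule Y.Minf_enveloping)

lemma linear_pair: "linear_map_pair X Y (\<theta> i)"
  using X.star_algebra_axioms Y.star_algebra_axioms \<theta>_linear
  by (simp add: linear_map_pair_def linear_map_pair_axioms_def)

lemma amplify_linear_pair: "linear_map_pair MX MY (amplify (\<theta> i))"
  using NX.star_algebra_axioms NY.star_algebra_axioms linear_map_pair.amplify_linear[OF linear_pair]
  by (simp add: linear_map_pair_def linear_map_pair_axioms_def)

lemmas amp = linear_mapD[OF linear_map_pair.amplify_linear[OF linear_pair]]
lemmas amp_minus = linear_map_pair.map_minus[OF amplify_linear_pair]
lemmas amp_matrices = linear_map_pair.amplify_matrices[OF linear_pair]

lemma amp_mult: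
  assumes "x \<in> carrier MX" "y \<in> carrier MX"
  shows "NY.asy F (\<lambda>i. amplify (\<theta> i) (x \<otimes>\<^bsub>MX\<^esub> y)) (\<lambda>i. amplify (\<theta> i) x \<otimes>\<^bsub>MY\<^esub> amplify (\<theta> i) y)"
proof -
  obtain n where n: "x \<in> matrices X n" "y \<in> matrices X n" using assms by (rule MinfE2)
  note e = Minf_entry[OF assms(1)] Minf_entry[OF assms(2)]
  show ?thesis
  proof (rule Y.asy_entrywise)
    show "amplify (\<theta> i) (x \<otimes>\<^bsub>MX\<^esub> y) \<in> matrices Y n" for i
      by (intro amp_matrices X.mult_in_matrices n)
    show "amplify (\<theta> i) x \<otimes>\<^bsub>MY\<^esub> amplify (\<theta> i) y \<in> matrices Y n" for i
      by (intro Y.mult_in_matrices amp_matrices n)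
    fix k l
    have "amplify (\<theta> i) (x \<otimes>\<^bsub>MX\<^esub> y) k l = (\<Oplus>\<^bsub>Y\<^esub>j\<in>{..<n}. \<theta> i (x k j \<otimes>\<^bsub>X\<^esub> y j l))" for i
      using e n by (simp add: amplify_def X.Minf_mult_eq[OF assms, of n] linear_map_pair.map_finsum[OF linear_pair])
    moreover have "(amplify (\<theta> i) x \<otimes>\<^bsub>MY\<^esub> amplify (\<theta> i) y) k l = (\<Oplus>\<^bsub>Y\<^esub>j\<in>{..<n}. \<theta> i (x k j) \<otimes>\<^bsub>Y\<^esub> \<theta> i (y j l))" for i
      using amp_matrices[OF n(1)] assms
      by (subst Y.Minf_mult_eq[of _ _ n]) (auto simp: amp, simp add: amplify_def)
    ultimately show "Y.asy F (\<lambda>i. amplify (\<theta> i) (x \<otimes>\<^bsub>MX\<^esub> y) k l) (\<lambda>i. (amplify (\<theta> i) x \<otimes>\<^bsub>MY\<^esub> amplify (\<theta> i) y) k l)"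
      using e by (simp only:) (intro Y.asy_finsum \<theta>_mult finite_lessThan)
  qed
qed

lemma amp_star:
  assumes "x \<in> carrier MX"
  shows "NY.asy F (\<lambda>i. amplify (\<theta> i) (star MX x)) (\<lambda>i. star MY (amplify (\<theta> i) x))"
proof -
  obtain n where n: "x \<in> matrices X n" using assms by (rule MinfE)
  note e = Minf_entry[OF assms]
  have "star MX x \<in> matrices X n" using n by (auto simp: matrices_def Minf_entries)
  moreover have "star MY (amplify (\<theta> i) x) \<in> matrices Y n" for i
    using amp_matrices[OF n, of i] by (auto simp: matrices_def Minf_entries)
  ultimately show ?thesis
    using e by (intro Y.asy_entrywise[of _ n]) (auto simp: amp_matrices, simp add: amplify_def Minf_entries \<theta>_star)
qed

lemma amp_bd:
  assumes "x \<in> carrier MX"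
  shows "NY.bd F (\<lambda>i. amplify (\<theta> i) x)"
proof -
  obtain n where n: "x \<in> matrices X n" using assms by (rule MinfE)
  show ?thesis using Minf_entry[OF assms]
    by (intro Y.bd_entrywise[of _ n]) (auto simp: amp_matrices[OF n], simp add: amplify_def \<theta>_bd)
qed

lemma amp_\<iota>:
  assumes "y \<in> carrier MY"
  shows "NY.asy F (\<lambda>i. amplify (\<theta> i) (amplify \<iota> y)) (\<lambda>_. y)"
proof -
  obtain n where n: "y \<in> matrices Y n" using assms by (rule MinfE)
  interpret L: linear_map_pair Y X \<iota>
    using X.star_algebra_axioms Y.star_algebra_axioms star_hom_linear[OF \<iota>]
    by (simp add: linear_map_pair_def linear_map_pair_axioms_def)
  show ?thesis using Minf_entry[OF assms]
    by (intro Y.asy_entrywise[of _ n])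
      (auto simp: amp_matrices[OF L.amplify_matrices[OF n]] n, simp add: amplify_def \<theta>_\<iota>)
qed

text \<open>The upper limit along F, written as an infimum of eventual upper bounds so that it is a
  real number. Boundedness of the maps makes the set nonempty, and properness of F bounds it below
  by 0.\<close>

definition q :: "(nat \<Rightarrow> nat \<Rightarrow> 'x) \<Rightarrow> real" where
  "q x = Inf {r. \<forall>\<^sub>F i in F. cnorm MY (amplify (\<theta> i) x) \<le> r}"

lemma q_facts:
  assumes "x \<in> carrier MX"
  shows "0 \<le> q x" "q x < r \<Longrightarrow> \<forall>\<^sub>F i in F. cnorm MY (amplify (\<theta> i) x) \<le> r"
    "\<forall>\<^sub>F i in F. cnorm MY (amplify (\<theta> i) x) \<le> r \<Longrightarrow> q x \<le> r"
proof -
  let ?S = "{r. \<forall>\<^sub>F i in F. cnorm MY (amplify (\<theta> i) x) \<le> r}"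
  have ne: "?S \<noteq> {}" using amp_bd[OF assms] by (auto simp: NY.bd_def)
  have pos: "0 \<le> r" if r: "r \<in> ?S" for r
  proof -
    obtain i where "cnorm MY (amplify (\<theta> i) x) \<le> r" using eventually_happens[of _ F] r F by blast
    then show ?thesis using NY.p_nonneg[OF amp(1)[OF assms, of i]] by linarith
  qed
  then have bdd: "bdd_below ?S" by (intro bdd_belowI)
  show "0 \<le> q x" unfolding q_def using ne pos by (intro cInf_greatest)
  show "q x \<le> r" if "\<forall>\<^sub>F i in F. cnorm MY (amplify (\<theta> i) x) \<le> r"
    unfolding q_def using that bdd by (intro cInf_lower) auto
  assume "q x < r"
  then obtain s where "s \<in> ?S" "s < r" unfolding q_def using cInf_lessD[OF ne] by blast
  then show "\<forall>\<^sub>F i in F. cnorm MY (amplify (\<theta> i) x) \<le> r"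
    by (auto elim!: eventually_mono)
qed

text \<open>The inequalities needing work are proved with a slack e > 0 at eventually all indices,
  and e is sent to 0. The slack also absorbs the defects of multiplicativity and of compatibility
  with the involution.\<close>

lemma q_seminorm: "cstar_seminorm MX q"
proof (rule cstar_seminormI[OF NX.star_algebra_axioms])
  fix x assume x: "x \<in> carrier MX"
  show "0 \<le> q x" by (rule q_facts[OF x])
  have ev: "\<forall>\<^sub>F i in F. cnorm MY (amplify (\<theta> i) x) \<le> q x + e" if "e > 0" "x \<in> carrier MX" for x e
    using q_facts(2)[OF that(2), of "q x + e"] that(1) by simp
  show "q (c \<odot>\<^bsub>MX\<^esub> x) \<le> cmod c * q x" for c
  proof (rule le_limit_at_right[of _ "\<lambda>e. cmod c * (q x + e)"])
    fix e :: real assume "e > 0"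
    from ev[OF this x] show "q (c \<odot>\<^bsub>MX\<^esub> x) \<le> cmod c * (q x + e)"
      using x by (intro q_facts(3)) (auto simp: amp NY.p_scale mult_left_mono elim!: eventually_mono)
  qed (auto intro!: tendsto_eq_intros)
  show "(q x)\<^sup>2 \<le> q (star MX x \<otimes>\<^bsub>MX\<^esub> x)"
  proof (rule le_limit_at_right[of _ "\<lambda>e. q (star MX x \<otimes>\<^bsub>MX\<^esub> x) + e + e"])
    fix e :: real assume e: "e > 0"
    let ?y = "star MX x \<otimes>\<^bsub>MX\<^esub> x"
    have y: "?y \<in> carrier MX" using x by simp
    note a = NY.asy_trans[OF amp_mult[OF NX.star_closed[OF x] x]
        NY.asy_mult[OF amp_star[OF x] NY.asy_refl[of "\<lambda>i. amplify (\<theta> i) x"] NY.bd_star[OF amp_bd[OF x]] amp_bd[OF x]]]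
    have "\<forall>\<^sub>F i in F. cnorm MY (amplify (\<theta> i) ?y \<ominus>\<^bsub>MY\<^esub> star MY (amplify (\<theta> i) x) \<otimes>\<^bsub>MY\<^esub> amplify (\<theta> i) x) < e"
      using order_tendstoD(2)[OF NY.asy_tendsto[OF a]] x e amp by simp
    with ev[OF e y] have "\<forall>\<^sub>F i in F. cnorm MY (amplify (\<theta> i) x) \<le> sqrt (q ?y + e + e)"
    proof eventually_elim
      case (elim i)
      let ?z = "amplify (\<theta> i) x"
      have z: "?z \<in> carrier MY" using amp x by simp
      have "(cnorm MY ?z)\<^sup>2 = cnorm MY (star MY ?z \<otimes>\<^bsub>MY\<^esub> ?z)" using z by (simp add: NY.p_star_mult)
      also have "\<dots> \<le> cnorm MY (amplify (\<theta> i) ?y) + cnorm MY (star MY ?z \<otimes>\<^bsub>MY\<^esub> ?z \<ominus>\<^bsub>MY\<^esub> amplify (\<theta> i) ?y)"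
        using z amp(1)[OF y] by (intro NY.p_le_diff) auto
      also have "\<dots> \<le> q ?y + e + e"
        using elim NY.p_diff_commute[of "star MY ?z \<otimes>\<^bsub>MY\<^esub> ?z" "amplify (\<theta> i) ?y"] z amp(1)[OF y] by simp
      finally show ?case by (rule real_le_rsqrt)
    qed
    then have "q x \<le> sqrt (q ?y + e + e)" by (rule q_facts(3)[OF x])
    then have "(q x)\<^sup>2 \<le> (sqrt (q ?y + e + e))\<^sup>2" using q_facts(1)[OF x] by (intro power_mono)
    then show "(q x)\<^sup>2 \<le> q ?y + e + e" using q_facts(1)[OF y] e by simp
  qed (auto intro!: tendsto_eq_intros)
  fix y assume y: "y \<in> carrier MX"
  show "q (x \<oplus>\<^bsub>MX\<^esub> y) \<le> q x + q y"
  proof (rule le_limit_at_right[of _ "\<lambda>e. (q x + e) + (q y + e)"])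
    fix e :: real assume e: "e > 0"
    have "\<forall>\<^sub>F i in F. cnorm MY (amplify (\<theta> i) (x \<oplus>\<^bsub>MX\<^esub> y)) \<le> (q x + e) + (q y + e)"
      using ev[OF e x] ev[OF e y]
    proof eventually_elim
      case (elim i)
      then show ?case using NY.p_add[OF amp(1)[OF x, of i] amp(1)[OF y, of i]] x y by (simp add: amp)
    qed
    then show "q (x \<oplus>\<^bsub>MX\<^esub> y) \<le> (q x + e) + (q y + e)" using x y by (intro q_facts(3)) auto
  qed (auto intro!: tendsto_eq_intros)
  show "q (x \<otimes>\<^bsub>MX\<^esub> y) \<le> q x * q y"
  proof (rule le_limit_at_right[of _ "\<lambda>e. (q x + e) * (q y + e) + e"])
    fix e :: real assume e: "e > 0"
    have xy: "x \<otimes>\<^bsub>MX\<^esub> y \<in> carrier MX" using x y by simp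
    have "\<forall>\<^sub>F i in F. cnorm MY (amplify (\<theta> i) (x \<otimes>\<^bsub>MX\<^esub> y) \<ominus>\<^bsub>MY\<^esub> amplify (\<theta> i) x \<otimes>\<^bsub>MY\<^esub> amplify (\<theta> i) y) < e"
      using order_tendstoD(2)[OF NY.asy_tendsto[OF amp_mult[OF x y]] e] .
    then have "\<forall>\<^sub>F i in F. cnorm MY (amplify (\<theta> i) (x \<otimes>\<^bsub>MX\<^esub> y)) \<le> (q x + e) * (q y + e) + e"
      using ev[OF e x] ev[OF e y]
    proof eventually_elim
      case (elim i)
      note c = amp(1)[OF x, of i] amp(1)[OF y, of i] amp(1)[OF xy, of i]
      have "cnorm MY (amplify (\<theta> i) x) * cnorm MY (amplify (\<theta> i) y) \<le> (q x + e) * (q y + e)"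
        using elim c q_facts(1)[OF x] e by (intro mult_mono) auto
      then show ?case
        using NY.p_le_diff[OF c(3) NY.mult_closed[OF c(1,2)]] NY.p_mult[OF c(1,2)] elim by linarith
    qed
    then show "q (x \<otimes>\<^bsub>MX\<^esub> y) \<le> (q x + e) * (q y + e) + e" by (rule q_facts(3)[OF xy])
  qed (auto intro!: tendsto_eq_intros)
qed

theorem cuntz_le_reflect:
  assumes a: "a \<in> carrier MY" and b: "b \<in> carrier MY" and le: "cuntz_le X (amplify \<iota> a) (amplify \<iota> b)"
  shows "cuntz_le Y a b"
proof (rule Y.cuntz_leI[OF a b])
  fix e :: real assume e: "e > 0"
  note HI = star_homD[OF amplify_star_hom[OF Y.star_algebra_axioms X.star_algebra_axioms \<iota>]]
  obtain c where c: "\<And>n. c n \<in> carrier MX"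
    and l: "(\<lambda>n. cnorm MX (c n \<otimes>\<^bsub>MX\<^esub> amplify \<iota> b \<otimes>\<^bsub>MX\<^esub> star MX (c n) \<ominus>\<^bsub>MX\<^esub> amplify \<iota> a)) \<longlonglongrightarrow> 0"
    using le unfolding cuntz_le_def alg_tendsto_def by blast
  have "\<forall>\<^sub>F n in sequentially. cnorm MX (c n \<otimes>\<^bsub>MX\<^esub> amplify \<iota> b \<otimes>\<^bsub>MX\<^esub> star MX (c n) \<ominus>\<^bsub>MX\<^esub> amplify \<iota> a) < e/2"
    using e by (intro order_tendstoD(2)[OF l]) simp
  then obtain d where d: "d \<in> carrier MX"
    "cnorm MX (d \<otimes>\<^bsub>MX\<^esub> amplify \<iota> b \<otimes>\<^bsub>MX\<^esub> star MX d \<ominus>\<^bsub>MX\<^esub> amplify \<iota> a) < e/2"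
    using c by (auto simp: eventually_sequentially)
  note bI = HI(1)[OF b] and aI = HI(1)[OF a]
  let ?x = "d \<otimes>\<^bsub>MX\<^esub> amplify \<iota> b \<otimes>\<^bsub>MX\<^esub> star MX d \<ominus>\<^bsub>MX\<^esub> amplify \<iota> a"
  let ?D = "\<lambda>i. amplify (\<theta> i) d"
  have x: "?x \<in> carrier MX" using d bI aI by simp
  have "q ?x < e/2" using NX.seminorm_le[OF q_seminorm x] d by linarith
  then have 1: "\<forall>\<^sub>F i in F. cnorm MY (amplify (\<theta> i) ?x) \<le> e/2" by (rule q_facts(2)[OF x])
  have D: "?D i \<in> carrier MY" for i by (rule amp(1)[OF d(1)])
  have db: "NY.asy F (\<lambda>i. amplify (\<theta> i) (d \<otimes>\<^bsub>MX\<^esub> amplify \<iota> b)) (\<lambda>i. ?D i \<otimes>\<^bsub>MY\<^esub> b)"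
    by (rule NY.asy_trans[OF amp_mult[OF d(1) bI]
          NY.asy_mult[OF NY.asy_refl amp_\<iota>[OF b] amp_bd[OF d(1)] NY.bd_const[OF b]]]) (rule D)
  have dbd: "NY.asy F (\<lambda>i. amplify (\<theta> i) (d \<otimes>\<^bsub>MX\<^esub> amplify \<iota> b \<otimes>\<^bsub>MX\<^esub> star MX d)) (\<lambda>i. ?D i \<otimes>\<^bsub>MY\<^esub> b \<otimes>\<^bsub>MY\<^esub> star MY (?D i))"
    by (rule NY.asy_trans[OF amp_mult NY.asy_mult[OF db amp_star[OF d(1)]]])
      (auto intro!: NY.bd_mult NY.bd_star NY.bd_const amp_bd d b bI)
  have "NY.asy F (\<lambda>i. amplify (\<theta> i) ?x) (\<lambda>i. ?D i \<otimes>\<^bsub>MY\<^esub> b \<otimes>\<^bsub>MY\<^esub> star MY (?D i) \<ominus>\<^bsub>MY\<^esub> a)"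
    using NY.asy_minus[OF dbd amp_\<iota>[OF a]] d aI bI by (simp add: amp_minus)
  note A = this
  have "\<forall>\<^sub>F i in F. cnorm MY (amplify (\<theta> i) ?x \<ominus>\<^bsub>MY\<^esub> (?D i \<otimes>\<^bsub>MY\<^esub> b \<otimes>\<^bsub>MY\<^esub> star MY (?D i) \<ominus>\<^bsub>MY\<^esub> a)) < e/2"
    using e by (intro order_tendstoD(2)[OF NY.asy_tendsto[OF A]]) simp
  with 1 have "\<forall>\<^sub>F i in F. cnorm MY (?D i \<otimes>\<^bsub>MY\<^esub> b \<otimes>\<^bsub>MY\<^esub> star MY (?D i) \<ominus>\<^bsub>MY\<^esub> a) \<le> e"
  proof eventually_elim
    case (elim i)
    let ?y = "?D i \<otimes>\<^bsub>MY\<^esub> b \<otimes>\<^bsub>MY\<^esub> star MY (?D i) \<ominus>\<^bsub>MY\<^esub> a"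
    have y: "?y \<in> carrier MY" using D b a by simp
    show ?case
      using NY.p_le_diff[OF y amp(1)[OF x, of i]] NY.p_diff_commute[OF y amp(1)[OF x, of i]] elim by linarith
  qed
  \<comment> \<open>Comparison asks only for approximate witnesses, so one index, supplied by
    properness of F, settles the given e.\<close>
  then obtain i where "cnorm MY (?D i \<otimes>\<^bsub>MY\<^esub> b \<otimes>\<^bsub>MY\<^esub> star MY (?D i) \<ominus>\<^bsub>MY\<^esub> a) \<le> e"
    using eventually_happens[of _ F] F by blast
  then show "\<exists>c\<in>carrier MY. cnorm MY (c \<otimes>\<^bsub>MY\<^esub> b \<otimes>\<^bsub>MY\<^esub> star MY c \<ominus>\<^bsub>MY\<^esub> a) \<le> e" using D by blast
qed

end

text \<open>On finite matrices the asymptotic identities hold entrywise. An element of the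
  stabilisation is close in norm to its corners, and since C does not depend on i, replacing it by a
  corner costs an error uniform in i.\<close>

theorem (in asymptotic_left_inverse) compacts_tensor_asymptotic_left_inverse:
  assumes X: "unital_cstar_algebra X" and Y: "unital_cstar_algebra Y"
    and bounded: "\<And>i. bounded_amplification X Y (\<theta> i) C"
  shows "asymptotic_left_inverse (compacts_tensor X) (compacts_tensor Y) (amplify \<iota>) F (\<lambda>i. amplify (\<theta> i))"
proof -
  let ?DX = "compacts_tensor X" and ?DY = "compacts_tensor Y"
  interpret UX: unital_cstar_algebra X by fact
  interpret UY: unital_cstar_algebra Y by fact
  interpret NX: enveloping_star_algebra MX by (rule X.Minf_enveloping)
  interpret NY: enveloping_star_algebra MY by (rule Y.Minf_enveloping)
  interpret DX: cuntz_algebra ?DX by (rule UX.compacts_tensor_cuntz_algebra)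
  interpret DY: cuntz_algebra ?DY by (rule UY.compacts_tensor_cuntz_algebra)
  have H: "amplify \<iota> \<in> star_hom ?DY ?DX" by (rule amplify_star_hom_compacts[OF Y X \<iota>])
  have lin: "linear_map ?DX ?DY (amplify (\<theta> i))" for i
    by (rule bounded_amplification.amplify_linear_compacts[OF bounded])
  have L: "linear_map_pair ?DX ?DY (amplify (\<theta> i))" for i
    using lin DX.star_algebra_axioms DY.star_algebra_axioms
    by (simp add: linear_map_pair_def linear_map_pair_axioms_def)
  note Lc = linear_mapD(1)[OF lin]
  \<comment> \<open>The absolute value makes the constant nonnegative, as is needed when bounds are
    multiplied below.\<close>
  have C: "cnorm ?DY (amplify (\<theta> i) x) \<le> \<bar>C\<bar> * cnorm ?DX x" if x: "x \<in> carrier ?DX" for i x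
  proof -
    have "cnorm ?DY (amplify (\<theta> i) x) \<le> C * cnorm ?DX x"
      by (rule bounded_amplification.amplify_bound[OF bounded x])
    also have "\<dots> \<le> \<bar>C\<bar> * cnorm ?DX x" using x by (intro mult_right_mono) auto
    finally show ?thesis .
  qed
  have Cd: "cnorm ?DY (amplify (\<theta> i) x \<ominus>\<^bsub>?DY\<^esub> amplify (\<theta> i) y) \<le> \<bar>C\<bar> * cnorm ?DX (x \<ominus>\<^bsub>?DX\<^esub> y)"
    if "x \<in> carrier ?DX" "y \<in> carrier ?DX" for i x y
    using C[of "x \<ominus>\<^bsub>?DX\<^esub> y"] that by (simp add: linear_map_pair.map_minus[OF L])
  have MD: "DY.asy F s t" if "NY.asy F s t" for s t
    using that NY.asy_closed[OF that]
    by (auto simp: DY.asy_def NY.asy_def UY.Minf_subset_D UY.Minf_minus_eq_D UY.cnorm_D_Minf)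
  have cX: "corner X n x \<in> carrier MX" "corner X n x \<in> carrier ?DX" if x: "x \<in> carrier ?DX" for x n
    using UX.Minf_subset_D UX.conv_closed[OF UX.conv_corner[OF x]] by auto
  have limX: "(\<lambda>n. cnorm ?DX (x \<ominus>\<^bsub>?DX\<^esub> corner X n x)) \<longlonglongrightarrow> 0" if x: "x \<in> carrier ?DX" for x
    using UX.conv_tendsto_D[OF UX.conv_corner[OF x] x] x cX[OF x] by (simp add: DX.p_diff_commute)
  have asyX: "DX.asy sequentially (\<lambda>_. x) (\<lambda>n. corner X n x)" if x: "x \<in> carrier ?DX" for x
    unfolding DX.asy_def using limX[OF x] x cX[OF x] by blast
  have cY: "corner Y n y \<in> carrier MY" "corner Y n y \<in> carrier ?DY" if y: "y \<in> carrier ?DY" for y n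
    using UY.Minf_subset_D UY.conv_closed[OF UY.conv_corner[OF y]] by auto
  have limY: "(\<lambda>n. cnorm ?DY (y \<ominus>\<^bsub>?DY\<^esub> corner Y n y)) \<longlonglongrightarrow> 0" if y: "y \<in> carrier ?DY" for y
    using UY.conv_tendsto_D[OF UY.conv_corner[OF y] y] y cY[OF y] by (simp add: DY.p_diff_commute)
  have approx: "DY.asy F s t"
    if "\<And>i. s i \<in> carrier ?DY" "\<And>i. t i \<in> carrier ?DY"
      and "\<And>n. DY.asy F (s' n) (t' n)"
      and "\<And>n i. cnorm ?DY (s i \<ominus>\<^bsub>?DY\<^esub> s' n i) \<le> f n" "\<And>n i. cnorm ?DY (t i \<ominus>\<^bsub>?DY\<^esub> t' n i) \<le> g n"
      and "f \<longlonglongrightarrow> 0" "g \<longlonglongrightarrow> 0" for s t and s' t' :: "nat \<Rightarrow> _" and f g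
  proof (rule DY.asy_approx[OF that(1,2)])
    fix e :: real assume "e > 0"
    then have "\<forall>\<^sub>F n in sequentially. f n < e \<and> g n < e"
      using order_tendstoD(2)[OF that(6)] order_tendstoD(2)[OF that(7)] by (intro eventually_conj)
    then obtain n where n: "f n < e" "g n < e" by (auto simp: eventually_sequentially)
    have "cnorm ?DY (s i \<ominus>\<^bsub>?DY\<^esub> s' n i) \<le> e \<and> cnorm ?DY (t i \<ominus>\<^bsub>?DY\<^esub> t' n i) \<le> e" for i
      using that(4)[of i n] that(5)[of i n] n by linarith
    then show "\<exists>s' t'. DY.asy F s' t' \<and> (\<forall>i. cnorm ?DY (s i \<ominus>\<^bsub>?DY\<^esub> s' i) \<le> e)
        \<and> (\<forall>i. cnorm ?DY (t i \<ominus>\<^bsub>?DY\<^esub> t' i) \<le> e)"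
      using that(3)[of n] by blast
  qed
  show ?thesis
  proof (intro asymptotic_left_inverse.intro asymptotic_left_inverse_axioms.intro
      DX.cstar_algebra_axioms DY.cuntz_algebra_axioms H F lin)
    fix x assume x: "x \<in> carrier ?DX"
    show "DY.bd F (\<lambda>i. amplify (\<theta> i) x)" unfolding DY.bd_def
      by (intro conjI allI exI[of _ "\<bar>C\<bar> * cnorm ?DX x"] always_eventually C Lc x)
    show "DY.asy F (\<lambda>i. amplify (\<theta> i) (star ?DX x)) (\<lambda>i. star ?DY (amplify (\<theta> i) x))"
    proof (rule approx)
      show "DY.asy F (\<lambda>i. amplify (\<theta> i) (star ?DX (corner X n x))) (\<lambda>i. star ?DY (amplify (\<theta> i) (corner X n x)))" for n
        using MD[OF amp_star[OF cX(1)[OF x]]] by (simp add: compacts_tensor_simps)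
      show "cnorm ?DY (amplify (\<theta> i) (star ?DX x) \<ominus>\<^bsub>?DY\<^esub> amplify (\<theta> i) (star ?DX (corner X n x)))
          \<le> \<bar>C\<bar> * cnorm ?DX (x \<ominus>\<^bsub>?DX\<^esub> corner X n x)" for n i
        using Cd[of "star ?DX x" "star ?DX (corner X n x)" i] x cX[OF x] by (simp add: DX.p_star_diff)
      show "cnorm ?DY (star ?DY (amplify (\<theta> i) x) \<ominus>\<^bsub>?DY\<^esub> star ?DY (amplify (\<theta> i) (corner X n x)))
          \<le> \<bar>C\<bar> * cnorm ?DX (x \<ominus>\<^bsub>?DX\<^esub> corner X n x)" for n i
        using Cd[of x "corner X n x" i] x cX[OF x] Lc by (simp add: DY.p_star_diff)
      show "(\<lambda>n. \<bar>C\<bar> * cnorm ?DX (x \<ominus>\<^bsub>?DX\<^esub> corner X n x)) \<longlonglongrightarrow> 0"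
        using tendsto_mult[OF tendsto_const limX[OF x], of "\<bar>C\<bar>"] by simp
      then show "(\<lambda>n. \<bar>C\<bar> * cnorm ?DX (x \<ominus>\<^bsub>?DX\<^esub> corner X n x)) \<longlonglongrightarrow> 0" .
    qed (use x Lc in auto)
    fix y assume y: "y \<in> carrier ?DX"
    let ?x = "\<lambda>n. corner X n x" and ?y = "\<lambda>n. corner X n y"
    show "DY.asy F (\<lambda>i. amplify (\<theta> i) (x \<otimes>\<^bsub>?DX\<^esub> y)) (\<lambda>i. amplify (\<theta> i) x \<otimes>\<^bsub>?DY\<^esub> amplify (\<theta> i) y)"
    proof (rule approx)
      show "DY.asy F (\<lambda>i. amplify (\<theta> i) (?x n \<otimes>\<^bsub>?DX\<^esub> ?y n)) (\<lambda>i. amplify (\<theta> i) (?x n) \<otimes>\<^bsub>?DY\<^esub> amplify (\<theta> i) (?y n))" for n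
        using MD[OF amp_mult[OF cX(1)[OF x] cX(1)[OF y]]] cX[OF x] cX[OF y] amp(1)
        by (simp add: UX.Minf_mult_eq_D UY.Minf_mult_eq_D)
      show "cnorm ?DY (amplify (\<theta> i) (x \<otimes>\<^bsub>?DX\<^esub> y) \<ominus>\<^bsub>?DY\<^esub> amplify (\<theta> i) (?x n \<otimes>\<^bsub>?DX\<^esub> ?y n))
          \<le> \<bar>C\<bar> * cnorm ?DX (x \<otimes>\<^bsub>?DX\<^esub> y \<ominus>\<^bsub>?DX\<^esub> ?x n \<otimes>\<^bsub>?DX\<^esub> ?y n)" for n i
        using x y cX[OF x] cX[OF y] by (intro Cd) auto
      have "DX.asy sequentially (\<lambda>n. ?x n \<otimes>\<^bsub>?DX\<^esub> ?y n) (\<lambda>_. x \<otimes>\<^bsub>?DX\<^esub> y)"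
        by (intro DX.asy_mult DX.asy_sym[OF asyX] DX.bd_const x y)
      from tendsto_mult[OF tendsto_const DX.asy_tendsto[OF DX.asy_sym[OF this]], of "\<bar>C\<bar>"]
      show "(\<lambda>n. \<bar>C\<bar> * cnorm ?DX (x \<otimes>\<^bsub>?DX\<^esub> y \<ominus>\<^bsub>?DX\<^esub> ?x n \<otimes>\<^bsub>?DX\<^esub> ?y n)) \<longlonglongrightarrow> 0"
        by simp
      \<comment> \<open>The norms of the corners of x occur as a factor. They converge to the norm
        of x, so the second summand tends to 0 like the first.\<close>
      let ?g = "\<lambda>n. \<bar>C\<bar> * cnorm ?DX (x \<ominus>\<^bsub>?DX\<^esub> ?x n) * (\<bar>C\<bar> * cnorm ?DX y)
          + \<bar>C\<bar> * cnorm ?DX (?x n) * (\<bar>C\<bar> * cnorm ?DX (y \<ominus>\<^bsub>?DX\<^esub> ?y n))"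
      show "cnorm ?DY (amplify (\<theta> i) x \<otimes>\<^bsub>?DY\<^esub> amplify (\<theta> i) y \<ominus>\<^bsub>?DY\<^esub> amplify (\<theta> i) (?x n) \<otimes>\<^bsub>?DY\<^esub> amplify (\<theta> i) (?y n))
          \<le> ?g n" for n i
      proof -
        note c = Lc[OF x, of i] Lc[OF y, of i] Lc[OF cX(2)[OF x, of n], of i] Lc[OF cX(2)[OF y, of n], of i]
        have "cnorm ?DY (amplify (\<theta> i) x \<otimes>\<^bsub>?DY\<^esub> amplify (\<theta> i) y \<ominus>\<^bsub>?DY\<^esub> amplify (\<theta> i) (?x n) \<otimes>\<^bsub>?DY\<^esub> amplify (\<theta> i) (?y n))
          \<le> cnorm ?DY (amplify (\<theta> i) x \<ominus>\<^bsub>?DY\<^esub> amplify (\<theta> i) (?x n)) * cnorm ?DY (amplify (\<theta> i) y)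
            + cnorm ?DY (amplify (\<theta> i) (?x n)) * cnorm ?DY (amplify (\<theta> i) y \<ominus>\<^bsub>?DY\<^esub> amplify (\<theta> i) (?y n))"
          by (intro DY.p_mult_diff c)
        also have "\<dots> \<le> ?g n"
          using x y cX[OF x] cX[OF y] c
          by (intro add_mono mult_mono Cd C mult_nonneg_nonneg) auto
        finally show ?thesis .
      qed
      have n: "(\<lambda>n. cnorm ?DX (?x n)) \<longlonglongrightarrow> cnorm ?DX x"
        by (rule DX.asy_norm[OF DX.asy_sym[OF asyX[OF x]] tendsto_const])
      have "?g \<longlonglongrightarrow> \<bar>C\<bar> * 0 * (\<bar>C\<bar> * cnorm ?DX y) + \<bar>C\<bar> * cnorm ?DX x * (\<bar>C\<bar> * 0)"
        by (intro tendsto_add tendsto_mult tendsto_const limX n x y)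
      then show "?g \<longlonglongrightarrow> 0" by simp
    qed (use x y Lc in auto)
  next
    fix y assume y: "y \<in> carrier ?DY"
    note Hc = star_homD(1)[OF H]
    interpret I: bounded_amplification Y X \<iota> 1 by (rule star_hom_bounded_amplification[OF Y X \<iota>])
    interpret LI: linear_map_pair ?DY ?DX "amplify \<iota>"
      using DX.star_algebra_axioms DY.star_algebra_axioms star_hom_linear[OF H]
      by (simp add: linear_map_pair_def linear_map_pair_axioms_def)
    show "DY.asy F (\<lambda>i. amplify (\<theta> i) (amplify \<iota> y)) (\<lambda>_. y)"
    proof (rule approx)
      show "DY.asy F (\<lambda>i. amplify (\<theta> i) (amplify \<iota> (corner Y n y))) (\<lambda>_. corner Y n y)" for n
        by (rule MD[OF amp_\<iota>[OF cY(1)[OF y]]])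
      show "cnorm ?DY (amplify (\<theta> i) (amplify \<iota> y) \<ominus>\<^bsub>?DY\<^esub> amplify (\<theta> i) (amplify \<iota> (corner Y n y)))
          \<le> \<bar>C\<bar> * cnorm ?DY (y \<ominus>\<^bsub>?DY\<^esub> corner Y n y)" for n i
      proof -
        have "cnorm ?DY (amplify (\<theta> i) (amplify \<iota> y) \<ominus>\<^bsub>?DY\<^esub> amplify (\<theta> i) (amplify \<iota> (corner Y n y)))
          \<le> \<bar>C\<bar> * cnorm ?DX (amplify \<iota> y \<ominus>\<^bsub>?DX\<^esub> amplify \<iota> (corner Y n y))"
          using y cY[OF y] by (intro Cd Hc) auto
        also have "\<dots> \<le> \<bar>C\<bar> * cnorm ?DY (y \<ominus>\<^bsub>?DY\<^esub> corner Y n y)"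
          using I.amplify_bound[of "y \<ominus>\<^bsub>?DY\<^esub> corner Y n y"] y cY[OF y]
          by (intro mult_left_mono) (auto simp: LI.map_minus)
        finally show ?thesis .
      qed
      show "(\<lambda>n. \<bar>C\<bar> * cnorm ?DY (y \<ominus>\<^bsub>?DY\<^esub> corner Y n y)) \<longlonglongrightarrow> 0"
        using tendsto_mult[OF tendsto_const limY[OF y], of "\<bar>C\<bar>"] by simp
      show "cnorm ?DY (y \<ominus>\<^bsub>?DY\<^esub> corner Y n y) \<le> cnorm ?DY (y \<ominus>\<^bsub>?DY\<^esub> corner Y n y)" for n by simp
      show "(\<lambda>n. cnorm ?DY (y \<ominus>\<^bsub>?DY\<^esub> corner Y n y)) \<longlonglongrightarrow> 0" by (rule limY[OF y])
    qed (use y cY[OF y] Hc[OF y] Lc in auto)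
  qed
qed

subsection \<open>Strictly approximately inner actions\<close>

lemma (in star_algebra) finsum_blocks:
  fixes n m :: nat
  assumes "\<And>k t. f k t \<in> carrier A"
  shows "(\<Oplus>K\<in>{..<n * m}. f (K div m) (K mod m)) = (\<Oplus>k\<in>{..<n}. \<Oplus>t\<in>{..<m}. f k t)"
proof (induction n)
  case 0
  then show ?case by simp
next
  case (Suc n)
  have U: "{..<Suc n * m} = {..<n * m} \<union> (\<lambda>t. n * m + t) ` {..<m}"
  proof (intro equalityI subsetI)
    fix K assume K: "K \<in> {..<Suc n * m}"
    show "K \<in> {..<n * m} \<union> (\<lambda>t. n * m + t) ` {..<m}"
    proof (cases "K < n * m")
      case False
      then show ?thesis using K by (auto intro!: image_eqI[of _ _ "K - n * m"])
    qed simp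
  qed auto
  have "(\<Oplus>K\<in>{..<Suc n * m}. f (K div m) (K mod m))
    = (\<Oplus>K\<in>{..<n * m}. f (K div m) (K mod m)) \<oplus> (\<Oplus>K\<in>(\<lambda>t. n * m + t) ` {..<m}. f (K div m) (K mod m))"
    unfolding U using assms by (intro finsum_Un_disjoint) auto
  also have "(\<Oplus>K\<in>(\<lambda>t. n * m + t) ` {..<m}. f (K div m) (K mod m))
    = (\<Oplus>t\<in>{..<m}. f ((n * m + t) div m) ((n * m + t) mod m))"
    using assms by (intro finsum_reindex) auto
  also have "\<dots> = (\<Oplus>t\<in>{..<m}. f n t)" using assms by (intro finsum_cong') auto
  also have "(\<Oplus>K\<in>{..<n * m}. f (K div m) (K mod m)) \<oplus> (\<Oplus>t\<in>{..<m}. f n t)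
    = (\<Oplus>k\<in>{..<Suc n}. \<Oplus>t\<in>{..<m}. f k t)"
    using assms Suc by (simp add: lessThan_Suc a_comm finsum_closed)
  finally show ?case .
qed

context cstar_algebra
begin

interpretation N: enveloping_star_algebra M by (rule Minf_enveloping)

text \<open>The selected rows y and the cut r of x to the rows in the range of f satisfy star y y =
  star r r, by reindexing along f, so their norms agree. The condition \<open>i \<le> f i\<close>
  keeps y within the size of x.\<close>

lemma row_select:
  assumes x: "x \<in> carrier M" and f: "inj f" "\<And>i. i \<le> f i"
  shows "(\<lambda>i j. x (f i) j) \<in> carrier M" "cnorm M (\<lambda>i j. x (f i) j) \<le> cnorm M x"
proof -
  obtain n where n: "x \<in> matrices A n" using x by (rule MinfE)
  note [simp] = Minf_entry[OF x]
  let ?y = "\<lambda>i j. x (f i) j" and ?r = "row_cut A (range f) x"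
  have "x (f i) j = \<zero>" if "n \<le> i \<or> n \<le> j" for i j
    using that matrices_zero[OF n] order_trans[OF _ f(2)] by blast
  then have ym: "?y \<in> matrices A n" by (auto simp: matrices_def)
  then show y: "?y \<in> carrier M" by (rule MinfI)
  have rm: "?r \<in> matrices A n" using n by (auto simp: matrices_def row_cut_def)
  have r: "?r \<in> carrier M" by (rule row_cut_closed[OF x])
  have "star M ?y \<otimes>\<^bsub>M\<^esub> ?y = star M ?r \<otimes>\<^bsub>M\<^esub> ?r"
  proof (intro ext)
    fix a b
    let ?g = "\<lambda>k. star A (x k a) \<otimes> x k b" and ?S = "{i. f i < n}"
    have S: "?S \<subseteq> {..<n}" using f(2) by (auto intro: le_less_trans)
    have fS: "f ` ?S \<subseteq> {..<n}" by auto
    have g0: "?g k = \<zero>" if "n \<le> k" for k using matrices_zero[OF n] that by simp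
    have "(star M ?y \<otimes>\<^bsub>M\<^esub> ?y) a b = (\<Oplus>i\<in>{..<n}. ?g (f i))"
      using y ym by (subst Minf_mult_eq[of _ _ n]) (auto simp: Minf_entries)
    also have "\<dots> = (\<Oplus>i\<in>?S. ?g (f i))"
      using S g0 by (intro add.finprod_mono_neutral_cong_right) auto
    also have "\<dots> = (\<Oplus>k\<in>f ` ?S. ?g k)"
      using f(1) by (intro finsum_reindex[symmetric]) (auto intro: inj_on_subset)
    also have "\<dots> = (\<Oplus>k\<in>{..<n}. star A (?r k a) \<otimes> ?r k b)"
      using fS by (intro add.finprod_mono_neutral_cong_left) (auto simp: row_cut_def)
    also have "\<dots> = (star M ?r \<otimes>\<^bsub>M\<^esub> ?r) a b"
      using N.star_closed[OF r] r rm by (subst Minf_mult_eq[of _ _ n]) (auto simp: Minf_entries)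
    finally show "(star M ?y \<otimes>\<^bsub>M\<^esub> ?y) a b = (star M ?r \<otimes>\<^bsub>M\<^esub> ?r) a b" .
  qed
  then have "(cnorm M ?y)\<^sup>2 = (cnorm M ?r)\<^sup>2" using N.p_star_mult[OF y] N.p_star_mult[OF r] by simp
  then have "cnorm M ?y = cnorm M ?r" using y r by (simp add: power2_eq_iff_nonneg)
  then show "cnorm M ?y \<le> cnorm M x" using Minf_norm_row_cut[OF x] by simp
qed

lemma submatrix_norm:
  assumes x: "x \<in> carrier M" and f: "inj f" "\<And>i. i \<le> f i" and h: "inj h" "\<And>i. i \<le> h i"
  shows "(\<lambda>i j. x (f i) (h j)) \<in> carrier M" "cnorm M (\<lambda>i j. x (f i) (h j)) \<le> cnorm M x"
proof -
  let ?y = "\<lambda>i j. x (f i) j"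
  let ?z = "\<lambda>i j. star M ?y (h i) j"
  note y = row_select[OF x f]
  note z = row_select[OF N.star_closed[OF y(1)] h]
  have "(\<lambda>i j. x (f i) (h j)) = star M ?z"
    using Minf_entry[OF x] by (intro ext) (simp add: Minf_entries star_star)
  then show "(\<lambda>i j. x (f i) (h j)) \<in> carrier M" "cnorm M (\<lambda>i j. x (f i) (h j)) \<le> cnorm M x"
    using y z by (simp_all add: z(1))
qed

end

context unital_cstar_algebra
begin

interpretation N: enveloping_star_algebra M by (rule Minf_enveloping)

lemma unitary_norm: "u \<in> unitaries A \<Longrightarrow> cnorm A u \<le> 1"
  using p_star_mult[of u] norm_one_le
  by (auto simp: unitaries_def intro!: power2_le_imp_le[of "cnorm A u" 1])

lemma unitary_cancel:
  assumes "u \<in> unitaries A" "x \<in> carrier A"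
  shows "u \<otimes> (star A u \<otimes> x) = x" "star A u \<otimes> (u \<otimes> x) = x"
  using assms by (auto simp: unitaries_def simp flip: mult_assoc)

text \<open>For the resulting matrix w, w star w = y star y because u cancels in each term. An
  infinite diagonal matrix with entries u is not in M, which is why the entries are multiplied
  directly.\<close>

lemma mult_unitary_entries:
  assumes "y \<in> carrier M" "u \<in> unitaries A"
  shows "(\<lambda>i j. y i j \<otimes> u) \<in> carrier M" "cnorm M (\<lambda>i j. y i j \<otimes> u) \<le> cnorm M y"
proof -
  obtain n where n: "y \<in> matrices A n" using assms(1) by (rule MinfE)
  note [simp] = Minf_entry[OF assms(1)]
  let ?w = "\<lambda>i j. y i j \<otimes> u"
  have u: "u \<in> carrier A" using assms(2) by (simp add: unitaries_def)
  have wm: "?w \<in> matrices A n" using n u by (auto simp: matrices_def)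
  then show w: "?w \<in> carrier M" by (rule MinfI)
  have "?w \<otimes>\<^bsub>M\<^esub> star M ?w = y \<otimes>\<^bsub>M\<^esub> star M y"
  proof (intro ext)
    fix i j
    have "(?w \<otimes>\<^bsub>M\<^esub> star M ?w) i j = (\<Oplus>k\<in>{..<n}. (y i k \<otimes> u) \<otimes> star A (y j k \<otimes> u))"
      using w N.star_closed[OF w] wm by (subst Minf_mult_eq[of _ _ n]) (auto simp: Minf_entries)
    also have "\<dots> = (\<Oplus>k\<in>{..<n}. y i k \<otimes> star A (y j k))"
      using u by (simp add: star_mult mult_assoc unitary_cancel[OF assms(2)])
    also have "\<dots> = (y \<otimes>\<^bsub>M\<^esub> star M y) i j"
      using assms(1) N.star_closed[OF assms(1)] n
      by (subst Minf_mult_eq[of _ _ n]) (auto simp: Minf_entries)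
    finally show "(?w \<otimes>\<^bsub>M\<^esub> star M ?w) i j = (y \<otimes>\<^bsub>M\<^esub> star M y) i j" .
  qed
  then have "(cnorm M ?w)\<^sup>2 = (cnorm M y)\<^sup>2" using N.p_mult_star[OF w] N.p_mult_star[OF assms(1)] by simp
  then show "cnorm M ?w \<le> cnorm M y" using w assms(1) by (simp add: power2_eq_iff_nonneg)
qed

end

context finite_cstar_action
begin

interpretation N: enveloping_star_algebra M by (rule Minf_enveloping)
interpretation BU: unital_cstar_algebra B by (rule crossed_product_unital_cstar_algebra)
interpretation NB: enveloping_star_algebra "Minf B" by (rule BU.Minf_enveloping)

text \<open>Identifies n by n matrices over B with matrices of size n m over A, replacing each entry
  by its m by m regular representation; quotient and remainder modulo m give the block and the
  position inside it.\<close>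

definition flat :: "(nat \<Rightarrow> nat \<Rightarrow> 'g \<Rightarrow> 'a) \<Rightarrow> nat \<Rightarrow> nat \<Rightarrow> 'a" where
  "flat X = (\<lambda>I J. reg (X (I div m) (J div m)) (I mod m) (J mod m))"

lemma reg_entry_linear: "linear_map_pair B A (\<lambda>x. reg x r s)"
  using BU.star_algebra_axioms star_algebra_axioms star_homD[OF reg_star_hom] Minf_entry[OF reg_closed]
  by (simp add: linear_map_pair_def linear_map_pair_axioms_def linear_map_def Minf_entries)

lemma flat_matrices:
  assumes "X \<in> matrices B n"
  shows "flat X \<in> matrices A (n * m)"
proof -
  have z: "reg \<zero>\<^bsub>B\<^esub> r s = \<zero>" for r s using linear_map_pair.map_zero[OF reg_entry_linear] .
  have "flat X I J = \<zero>" if "n * m \<le> I \<or> n * m \<le> J" for I J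
  proof -
    have "n \<le> I div m \<or> n \<le> J div m" using that m_pos by (auto simp: less_eq_div_iff_mult_less_eq)
    then show ?thesis using matrices_zero[OF assms] z by (simp add: flat_def)
  qed
  then show ?thesis using Minf_entry[OF reg_closed[OF matrices_entry[OF assms]]]
    by (auto simp: matrices_def) (simp add: flat_def)
qed

lemma flat_star_hom: "flat \<in> star_hom (Minf B) M"
proof (rule star_homI)
  note H = star_homD[OF reg_star_hom]
  fix x assume x: "x \<in> carrier (Minf B)"
  note e = Minf_entry[OF x]
  obtain n where n: "x \<in> matrices B n" using x by (rule MinfE)
  show fx: "flat x \<in> carrier M" by (rule MinfI[OF flat_matrices[OF n]])
  show "flat (c \<odot>\<^bsub>Minf B\<^esub> x) = c \<odot>\<^bsub>M\<^esub> flat x" for c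
    using e by (intro ext) (simp add: flat_def Minf_entries H)
  show "flat (star (Minf B) x) = star M (flat x)"
    using e by (intro ext) (simp add: flat_def Minf_entries H)
  fix y assume y: "y \<in> carrier (Minf B)"
  note e = e Minf_entry[OF y]
  show "flat (x \<oplus>\<^bsub>Minf B\<^esub> y) = flat x \<oplus>\<^bsub>M\<^esub> flat y"
    using e by (intro ext) (simp add: flat_def Minf_entries H)
  obtain n where n: "x \<in> matrices B n" "y \<in> matrices B n" using x y by (rule MinfE2)
  have fy: "flat y \<in> carrier M" by (rule MinfI[OF flat_matrices[OF n(2)]])
  note r = Minf_entry[OF reg_closed]
  show "flat (x \<otimes>\<^bsub>Minf B\<^esub> y) = flat x \<otimes>\<^bsub>M\<^esub> flat y"
  proof (intro ext)
    fix I J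
    let ?i = "I div m" and ?r = "I mod m" and ?j = "J div m" and ?s = "J mod m"
    have "flat (x \<otimes>\<^bsub>Minf B\<^esub> y) I J = (\<Oplus>k\<in>{..<n}. reg (x ?i k \<otimes>\<^bsub>B\<^esub> y k ?j) ?r ?s)"
      using e n by (simp add: flat_def BU.Minf_mult_eq[OF x y, of n] linear_map_pair.map_finsum[OF reg_entry_linear])
    also have "\<dots> = (\<Oplus>k\<in>{..<n}. \<Oplus>t\<in>{..<m}. reg (x ?i k) ?r t \<otimes> reg (y k ?j) t ?s)"
    proof (rule finsum_cong')
      fix k
      show "reg (x ?i k \<otimes>\<^bsub>B\<^esub> y k ?j) ?r ?s = (\<Oplus>t\<in>{..<m}. reg (x ?i k) ?r t \<otimes> reg (y k ?j) t ?s)"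
        unfolding H(4)[OF e]
        by (intro Minf_mult_eq reg_closed e disjI1 reg_matrices)
    qed (use e r in \<open>auto intro!: finsum_closed\<close>)
    also have "\<dots> = (\<Oplus>K\<in>{..<n * m}. reg (x ?i (K div m)) ?r (K mod m) \<otimes> reg (y (K div m) ?j) (K mod m) ?s)"
      using e r by (intro finsum_blocks[symmetric]) auto
    also have "\<dots> = (flat x \<otimes>\<^bsub>M\<^esub> flat y) I J"
      using fx fy flat_matrices[OF n(1)] by (subst Minf_mult_eq[of _ _ "n * m"]) (auto simp: flat_def)
    finally show "flat (x \<otimes>\<^bsub>Minf B\<^esub> y) I J = (flat x \<otimes>\<^bsub>M\<^esub> flat y) I J" .
  qed
qed

lemma coefficient_norm:
  assumes X: "X \<in> carrier (Minf B)" and g: "g \<in> carrier G"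
  shows "(\<lambda>i j. X i j g) \<in> carrier M" "cnorm M (\<lambda>i j. X i j g) \<le> cnorm (Minf B) X"
proof -
  let ?r = "index \<one>\<^bsub>G\<^esub>" and ?s = "index (inv\<^bsub>G\<^esub> g)"
  have lt: "?r < m" "?s < m" using g by (simp_all add: index)
  have eq: "(\<lambda>i j. X i j g) = (\<lambda>i j. flat X (i * m + ?r) (j * m + ?s))"
    using g lt m_pos by (intro ext) (simp add: flat_def reg_entry[OF Minf_entry[OF X]])
  have F: "flat X \<in> carrier M" using star_homD(1)[OF flat_star_hom X] .
  have *: "inj (\<lambda>i. i * m + r)" "i \<le> i * m + r" for i r
    using m_pos by (auto simp: inj_def intro: trans_le_add1)
  note sub = submatrix_norm[OF F *(1) *(2) *(1) *(2), of ?r ?s]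
  show "(\<lambda>i j. X i j g) \<in> carrier M" unfolding eq by (rule sub)
  show "cnorm M (\<lambda>i j. X i j g) \<le> cnorm (Minf B) X"
    unfolding eq using sub(2) enveloping_contraction[OF BU.Minf_enveloping flat_star_hom N.seminorm X] by linarith
qed

section \<open>Twisted sums for a family of unitaries\<close>

definition twisted_sum :: "('g \<Rightarrow> 'a) \<Rightarrow> ('g \<Rightarrow> 'a) \<Rightarrow> 'a" where
  "twisted_sum z x = (\<Oplus>g\<in>carrier G. x g \<otimes> z g)"

context
  fixes z :: "'g \<Rightarrow> 'a"
  assumes z: "z \<in> carrier G \<rightarrow> unitaries A"
begin

lemma z_unitary: "g \<in> carrier G \<Longrightarrow> z g \<in> unitaries A"
  using z by auto

lemma z_closed: "g \<in> carrier G \<Longrightarrow> z g \<in> carrier A"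
  using z by (auto simp: unitaries_def)

lemma twisted_sum_linear: "linear_map B A (twisted_sum z)"
  unfolding linear_map_def
proof (intro conjI ballI allI)
  fix x assume x: "x \<in> carrier B"
  note e = B_entry[OF x]
  show "twisted_sum z x \<in> carrier A"
    unfolding twisted_sum_def using e z_closed by (intro finsum_closed) auto
  have "twisted_sum z (c \<odot>\<^bsub>B\<^esub> x) = (\<Oplus>g\<in>carrier G. c \<odot> (x g \<otimes> z g))" for c
    unfolding twisted_sum_def using e z_closed
    by (intro finsum_cong') (auto simp: crossed_product_simps scale_mult_left)
  then show "twisted_sum z (c \<odot>\<^bsub>B\<^esub> x) = c \<odot> twisted_sum z x" for c
    using e z_closed by (simp add: twisted_sum_def finsum_scale)
  fix y assume y: "y \<in> carrier B"
  note e = e B_entry[OF y]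
  have "twisted_sum z (x \<oplus>\<^bsub>B\<^esub> y) = (\<Oplus>g\<in>carrier G. x g \<otimes> z g \<oplus> y g \<otimes> z g)"
    unfolding twisted_sum_def using e z_closed
    by (intro finsum_cong') (auto simp: crossed_product_simps distr_right)
  then show "twisted_sum z (x \<oplus>\<^bsub>B\<^esub> y) = twisted_sum z x \<oplus> twisted_sum z y"
    using e z_closed by (simp add: twisted_sum_def finsum_addf)
qed

lemma twisted_sum_norm:
  assumes "x \<in> carrier B"
  shows "cnorm A (twisted_sum z x) \<le> (\<Sum>g\<in>carrier G. cnorm A (x g))"
proof -
  note e = B_entry[OF assms]
  have "cnorm A (twisted_sum z x) \<le> (\<Sum>g\<in>carrier G. cnorm A (x g \<otimes> z g))"
    unfolding twisted_sum_def using e z_closed by (intro p_finsum) auto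
  also have "\<dots> \<le> (\<Sum>g\<in>carrier G. cnorm A (x g))"
  proof (rule sum_mono)
    fix g assume g: "g \<in> carrier G"
    have "cnorm A (x g \<otimes> z g) \<le> cnorm A (x g) * cnorm A (z g)" using e z_closed g by (intro p_mult) auto
    also have "\<dots> \<le> cnorm A (x g) * 1" using unitary_norm[OF z_unitary[OF g]] e g by (intro mult_left_mono) auto
    finally show "cnorm A (x g \<otimes> z g) \<le> cnorm A (x g)" by simp
  qed
  finally show ?thesis .
qed

text \<open>The amplified twisted sum is the sum over g of the coefficient matrix at g with entries
  multiplied by z_g. Each summand is contractive in X, so the number m of summands is a bound for
  all sizes at once.\<close>

lemma twisted_sum_bounded_amplification: "bounded_amplification B A (twisted_sum z) (real m)"
proof -
  have "cnorm M (amplify (twisted_sum z) X) \<le> real m * cnorm (Minf B) X" if X: "X \<in> carrier (Minf B)" for X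
  proof -
    let ?W = "\<lambda>g i j. X i j g \<otimes> z g"
    have W: "?W g \<in> carrier M" "cnorm M (?W g) \<le> cnorm (Minf B) X" if g: "g \<in> carrier G" for g
      using mult_unitary_entries[OF coefficient_norm(1)[OF X g] z_unitary[OF g]] coefficient_norm(2)[OF X g]
      by simp_all
    have "amplify (twisted_sum z) X = (\<Oplus>\<^bsub>M\<^esub>g\<in>carrier G. ?W g)"
    proof (intro ext)
      fix i j
      interpret E: linear_map_pair M A "\<lambda>x. x i j"
        using N.star_algebra_axioms star_algebra_axioms
        by (simp add: linear_map_pair_def linear_map_pair_axioms_def linear_map_def Minf_entries Minf_entry)
      show "amplify (twisted_sum z) X i j = (\<Oplus>\<^bsub>M\<^esub>g\<in>carrier G. ?W g) i j"
        using W by (subst E.map_finsum) (auto simp: amplify_def twisted_sum_def)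
    qed
    then have "cnorm M (amplify (twisted_sum z) X) \<le> (\<Sum>g\<in>carrier G. cnorm M (?W g))"
      using W N.p_finsum[of ?W "carrier G"] by auto
    also have "\<dots> \<le> (\<Sum>g\<in>carrier G. cnorm (Minf B) X)" using W by (intro sum_mono) auto
    finally show ?thesis by simp
  qed
  then show ?thesis
    using BU.unital_cstar_algebra_axioms unital_cstar_algebra_axioms BU.star_algebra_axioms
      star_algebra_axioms twisted_sum_linear
    by (simp add: bounded_amplification_def bounded_amplification_axioms_def linear_map_pair_def
        linear_map_pair_axioms_def)
qed

lemma twisted_sum_inclusion:
  assumes "a \<in> carrier A"
  shows "twisted_sum z (crossed_inclusion G A a) = a \<otimes> z \<one>\<^bsub>G\<^esub>"
  unfolding twisted_sum_def using assms z_closed fin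
  by (subst finsum_single[of "\<one>\<^bsub>G\<^esub>"]) (auto simp: crossed_inclusion_def)

text \<open>Substituting g = h k in the convolution produces a double sum that can be compared term
  by term with \<open>mult_twisted_sums\<close>.\<close>

lemma twisted_sum_mult:
  assumes "x \<in> carrier B" "y \<in> carrier B"
  shows "twisted_sum z (x \<otimes>\<^bsub>B\<^esub> y)
    = (\<Oplus>h\<in>carrier G. \<Oplus>k\<in>carrier G. (x h \<otimes> \<alpha> h (y k)) \<otimes> z (h \<otimes>\<^bsub>G\<^esub> k))"
proof -
  note e = B_entry[OF assms(1)] B_entry[OF assms(2)]
  let ?f = "\<lambda>h g. (x h \<otimes> \<alpha> h (y (inv\<^bsub>G\<^esub> h \<otimes>\<^bsub>G\<^esub> g))) \<otimes> z g"
  have f: "?f h g \<in> carrier A" if "h \<in> carrier G" "g \<in> carrier G" for h g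
    using that e z_closed by (auto simp: act_simps)
  have "twisted_sum z (x \<otimes>\<^bsub>B\<^esub> y) = (\<Oplus>g\<in>carrier G. \<Oplus>h\<in>carrier G. ?f h g)"
    unfolding twisted_sum_def
  proof (rule finsum_cong')
    fix g assume g: "g \<in> carrier G"
    show "(x \<otimes>\<^bsub>B\<^esub> y) g \<otimes> z g = (\<Oplus>h\<in>carrier G. ?f h g)"
      using g e z_closed by (simp add: crossed_product_simps, subst finsum_mult_right) (auto simp: act_simps)
  qed (use f in \<open>auto intro!: finsum_closed\<close>)
  also have "\<dots> = (\<Oplus>h\<in>carrier G. \<Oplus>g\<in>carrier G. ?f h g)" using f fin by (intro finsum_swap) auto
  also have "\<dots> = (\<Oplus>h\<in>carrier G. \<Oplus>k\<in>carrier G. (x h \<otimes> \<alpha> h (y k)) \<otimes> z (h \<otimes>\<^bsub>G\<^esub> k))"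
  proof (rule finsum_cong')
    fix h assume h: "h \<in> carrier G"
    have inj: "inj_on (\<lambda>k. h \<otimes>\<^bsub>G\<^esub> k) (carrier G)" using h by (auto simp: inj_on_def)
    have img: "(\<lambda>k. h \<otimes>\<^bsub>G\<^esub> k) ` carrier G = carrier G"
      using inj h by (intro card_subset_eq[OF fin]) (auto simp: card_image)
    have "(\<Oplus>g\<in>carrier G. ?f h g) = (\<Oplus>k\<in>carrier G. ?f h (h \<otimes>\<^bsub>G\<^esub> k))"
      using finsum_reindex[of "?f h" "\<lambda>k. h \<otimes>\<^bsub>G\<^esub> k" "carrier G"] inj f[OF h] unfolding img by auto
    also have "\<dots> = (\<Oplus>k\<in>carrier G. (x h \<otimes> \<alpha> h (y k)) \<otimes> z (h \<otimes>\<^bsub>G\<^esub> k))"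
      using h e z_closed by (intro finsum_cong') (auto simp: act_simps simp flip: G.m_assoc)
    finally show "(\<Oplus>g\<in>carrier G. ?f h g) = (\<Oplus>k\<in>carrier G. (x h \<otimes> \<alpha> h (y k)) \<otimes> z (h \<otimes>\<^bsub>G\<^esub> k))" .
  qed (use e z_closed in \<open>auto simp: act_simps intro!: finsum_closed\<close>)
  finally show ?thesis .
qed

text \<open>Inserting star(z_h) z_h = 1 after y_k gives the terms of \<open>twisted_sum_mult\<close>
  with \<alpha>_h(y_k) replaced by z_h y_k star(z_h) and z at h k replaced by z_h z_k: the two
  quantities that the approximation controls.\<close>

lemma mult_twisted_sums:
  assumes "x \<in> carrier B" "y \<in> carrier B"
  shows "twisted_sum z x \<otimes> twisted_sum z y
    = (\<Oplus>h\<in>carrier G. \<Oplus>k\<in>carrier G. (x h \<otimes> (z h \<otimes> y k \<otimes> star A (z h))) \<otimes> (z h \<otimes> z k))"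
proof -
  note e = B_entry[OF assms(1)] B_entry[OF assms(2)]
  have "twisted_sum z x \<otimes> twisted_sum z y
    = (\<Oplus>h\<in>carrier G. \<Oplus>k\<in>carrier G. (x h \<otimes> z h) \<otimes> (y k \<otimes> z k))"
    unfolding twisted_sum_def using e z_closed
    by (subst finsum_mult_right) (auto simp: finsum_mult_left intro!: finsum_cong' finsum_closed)
  also have "\<dots> = (\<Oplus>h\<in>carrier G. \<Oplus>k\<in>carrier G. (x h \<otimes> (z h \<otimes> y k \<otimes> star A (z h))) \<otimes> (z h \<otimes> z k))"
    using e z_closed
    by (intro finsum_cong' refl) (auto simp: mult_assoc unitary_cancel[OF z_unitary] intro!: finsum_closed)
  finally show ?thesis .
qed

lemma twisted_sum_star:
  assumes "x \<in> carrier B"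
  shows "twisted_sum z (star B x) = (\<Oplus>g\<in>carrier G. \<alpha> g (star A (x (inv\<^bsub>G\<^esub> g))) \<otimes> z g)"
  unfolding twisted_sum_def using B_entry[OF assms] z_closed
  by (intro finsum_cong') (auto simp: crossed_product_simps act_simps)

text \<open>Summing over inverses aligns the terms with \<open>twisted_sum_star\<close>, whose term
  at g involves x at the inverse of g.\<close>

lemma star_twisted_sum:
  assumes "x \<in> carrier B"
  shows "star A (twisted_sum z x) = (\<Oplus>g\<in>carrier G. star A (z (inv\<^bsub>G\<^esub> g)) \<otimes> star A (x (inv\<^bsub>G\<^esub> g)))"
proof -
  note e = B_entry[OF assms]
  let ?f = "\<lambda>g. star A (z g) \<otimes> star A (x g)"
  have "star A (twisted_sum z x) = (\<Oplus>g\<in>carrier G. ?f g)"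
    unfolding twisted_sum_def using e z_closed
    by (subst finsum_star) (auto simp: star_mult intro!: finsum_cong')
  also have "\<dots> = (\<Oplus>g\<in>carrier G. ?f (inv\<^bsub>G\<^esub> g))"
  proof -
    have inj: "inj_on (\<lambda>g. inv\<^bsub>G\<^esub> g) (carrier G)" by (auto simp: inj_on_def dest: G.inv_inj[THEN inj_onD])
    have img: "(\<lambda>g. inv\<^bsub>G\<^esub> g) ` carrier G = carrier G"
      using inj by (intro card_subset_eq[OF fin]) (auto simp: card_image)
    show ?thesis
      using finsum_reindex[of ?f "\<lambda>g. inv\<^bsub>G\<^esub> g" "carrier G"] inj e z_closed unfolding img by auto
  qed
  finally show ?thesis .
qed

end

end

section \<open>The net of approximating unitaries\<close>

locale strictly_approximately_inner_action = finite_cstar_action A G \<alpha>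
  for A :: "('a, 'm) cstar_alg_scheme" (structure) and G :: "('g, 'h) monoid_scheme"
    and \<alpha> :: "'g \<Rightarrow> 'a \<Rightarrow> 'a" +
  assumes inner: "strictly_approximately_inner G A \<alpha>"
begin

interpretation BU: unital_cstar_algebra B by (rule crossed_product_unital_cstar_algebra)

definition good :: "'a set \<times> nat \<Rightarrow> ('g \<Rightarrow> 'a) \<Rightarrow> bool" where
  "good i z \<longleftrightarrow> z \<in> carrier G \<rightarrow> unitaries A \<and>
     (\<forall>g\<in>carrier G. \<forall>a\<in>fst i. cnorm A (\<alpha> g a \<ominus> z g \<otimes> a \<otimes> star A (z g)) < inverse (real (Suc (snd i)))) \<and>
     (\<forall>g\<in>carrier G. \<forall>h\<in>carrier G. cnorm A (z g \<otimes> z h \<ominus> z (g \<otimes>\<^bsub>G\<^esub> h)) < inverse (real (Suc (snd i))))"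

text \<open>Off the finite subsets of A the value is the constant family 1, so that every index
  yields unitaries: linearity and the bound on amplifications are demanded at all indices, not just
  eventually.\<close>

definition net :: "'a set \<times> nat \<Rightarrow> 'g \<Rightarrow> 'a" where
  "net i = (if finite (fst i) \<and> fst i \<subseteq> carrier A then SOME z. good i z else (\<lambda>_. \<one>))"

text \<open>The index is a finite set together with an n that stands for the tolerance 1/(n+1).
  Along this filter every element of A eventually lies in the finite set, whether or not A is
  separable.\<close>

definition net_filter :: "('a set \<times> nat) filter" where
  "net_filter = finite_subsets_at_top (carrier A) \<times>\<^sub>F sequentially"

lemma net_filter_neq_bot: "net_filter \<noteq> bot"
  by (simp add: net_filter_def prod_filter_eq_bot)

lemma net_good:
  assumes "finite (fst i)" "fst i \<subseteq> carrier A"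
  shows "good i (net i)"
proof -
  have "\<exists>z. good i z"
    using inner[unfolded strictly_approximately_inner_def, rule_format, of "fst i" "inverse (real (Suc (snd i)))"]
      assms unfolding good_def by auto
  then have "good i (SOME z. good i z)" by (rule someI_ex)
  then show ?thesis using assms by (simp add: net_def)
qed

lemma net_unitary: "net i \<in> carrier G \<rightarrow> unitaries A"
proof (cases "finite (fst i) \<and> fst i \<subseteq> carrier A")
  case True
  then show ?thesis using net_good by (auto simp: good_def)
next
  case False
  then show ?thesis by (auto simp: net_def unitaries_def)
qed

lemmas net_closed = z_closed[OF net_unitary]

lemma net_radius: "((\<lambda>i. inverse (real (Suc (snd i)))) \<longlongrightarrow> 0) net_filter"
  unfolding net_filter_def by (rule filterlim_compose[OF LIMSEQ_inverse_real_of_nat filterlim_snd])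

lemma net_eventually:
  assumes "a \<in> carrier A"
  shows "\<forall>\<^sub>F i in net_filter. good i (net i) \<and> a \<in> fst i"
proof -
  have "\<forall>\<^sub>F F in finite_subsets_at_top (carrier A). finite F \<and> F \<subseteq> carrier A \<and> a \<in> F"
    unfolding eventually_finite_subsets_at_top using assms by (intro exI[of _ "{a}"]) auto
  then have "\<forall>\<^sub>F i in net_filter. finite (fst i) \<and> fst i \<subseteq> carrier A \<and> a \<in> fst i"
    unfolding net_filter_def by (rule eventually_compose_filterlim[OF _ filterlim_fst])
  then show ?thesis by eventually_elim (auto intro: net_good)
qed

lemma net_conj:
  assumes "g \<in> carrier G" "a \<in> carrier A"
  shows "asy net_filter (\<lambda>_. \<alpha> g a) (\<lambda>i. net i g \<otimes> a \<otimes> star A (net i g))"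
  unfolding asy_def
proof (intro conjI allI)
  show "((\<lambda>i. cnorm A (\<alpha> g a \<ominus> net i g \<otimes> a \<otimes> star A (net i g))) \<longlongrightarrow> 0) net_filter"
  proof (rule tendsto_sandwich[OF _ _ tendsto_const net_radius])
    show "\<forall>\<^sub>F i in net_filter. cnorm A (\<alpha> g a \<ominus> net i g \<otimes> a \<otimes> star A (net i g)) \<le> inverse (real (Suc (snd i)))"
      using net_eventually[OF assms(2)]
      by eventually_elim (use assms in \<open>auto simp: good_def intro: less_imp_le simp del: of_nat_Suc\<close>)
  qed (use assms net_closed in \<open>auto simp: act_simps\<close>)
qed (use assms net_closed in \<open>auto simp: act_simps\<close>)

lemma net_mult:
  assumes "g \<in> carrier G" "h \<in> carrier G"
  shows "asy net_filter (\<lambda>i. net i g \<otimes> net i h) (\<lambda>i. net i (g \<otimes>\<^bsub>G\<^esub> h))"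
  unfolding asy_def
proof (intro conjI allI)
  show "((\<lambda>i. cnorm A (net i g \<otimes> net i h \<ominus> net i (g \<otimes>\<^bsub>G\<^esub> h))) \<longlongrightarrow> 0) net_filter"
  proof (rule tendsto_sandwich[OF _ _ tendsto_const net_radius])
    show "\<forall>\<^sub>F i in net_filter. cnorm A (net i g \<otimes> net i h \<ominus> net i (g \<otimes>\<^bsub>G\<^esub> h)) \<le> inverse (real (Suc (snd i)))"
      using net_eventually[OF zero_closed]
      by eventually_elim (use assms in \<open>auto simp: good_def intro: less_imp_le simp del: of_nat_Suc\<close>)
  qed (use assms net_closed in auto)
qed (use assms net_closed in auto)

lemma net_bd: "g \<in> carrier G \<Longrightarrow> bd net_filter (\<lambda>i. net i g)"
  unfolding bd_def using unitary_norm[OF z_unitary[OF net_unitary]] net_closed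
  by (auto intro!: exI[of _ 1] always_eventually)

text \<open>z_1 z_1 is close to z_1; multiplying by star(z_1) from the left leaves z_1 close to
  1.\<close>

lemma net_one: "asy net_filter (\<lambda>i. net i \<one>\<^bsub>G\<^esub>) (\<lambda>_. \<one>)"
proof -
  let ?z = "\<lambda>i. net i \<one>\<^bsub>G\<^esub>"
  have u: "?z i \<in> unitaries A" for i by (rule z_unitary[OF net_unitary]) simp
  have c: "?z i \<in> carrier A" for i by (rule net_closed) simp
  have "asy net_filter (\<lambda>i. star A (?z i) \<otimes> (?z i \<otimes> ?z i)) (\<lambda>i. star A (?z i) \<otimes> ?z i)"
    using net_mult[of "\<one>\<^bsub>G\<^esub>" "\<one>\<^bsub>G\<^esub>"] c by (intro asy_mult asy_refl bd_star net_bd) auto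
  then show ?thesis using u unitary_cancel(2)[OF u c] by (simp add: unitaries_def)
qed

text \<open>With h the inverse of g, z_g z_h is close to z_1 and hence to 1; multiplying by
  star(z_h) from the right cancels z_h exactly.\<close>

lemma net_inv:
  assumes "g \<in> carrier G"
  shows "asy net_filter (\<lambda>i. net i g) (\<lambda>i. star A (net i (inv\<^bsub>G\<^esub> g)))"
proof -
  let ?z = "\<lambda>i. net i g" and ?w = "\<lambda>i. net i (inv\<^bsub>G\<^esub> g)"
  have u: "?w i \<in> unitaries A" for i by (rule z_unitary[OF net_unitary]) (use assms in simp)
  have c: "?z i \<in> carrier A" "?w i \<in> carrier A" for i using assms by (simp_all add: net_closed)
  have "asy net_filter (\<lambda>i. ?z i \<otimes> ?w i) (\<lambda>_. \<one>)"
    using asy_trans[OF _ net_one] net_mult[OF assms, of "inv\<^bsub>G\<^esub> g"] assms by simp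
  then have "asy net_filter (\<lambda>i. (?z i \<otimes> ?w i) \<otimes> star A (?w i)) (\<lambda>i. \<one> \<otimes> star A (?w i))"
    using assms c by (intro asy_mult asy_refl bd_star net_bd bd_const) auto
  moreover have "(?z i \<otimes> ?w i) \<otimes> star A (?w i) = ?z i" for i
    using u[of i] c by (simp add: mult_assoc unitaries_def)
  ultimately show ?thesis using c by simp
qed

theorem twisted_sum_asymptotic_left_inverse:
  "asymptotic_left_inverse B A (crossed_inclusion G A) net_filter (\<lambda>i. twisted_sum (net i))"
proof (intro asymptotic_left_inverse.intro asymptotic_left_inverse_axioms.intro
    BU.cstar_algebra_axioms cuntz_algebra_axioms crossed_inclusion_star_hom net_filter_neq_bot
    twisted_sum_linear net_unitary)
  fix x assume x: "x \<in> carrier B"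
  note e = B_entry[OF x]
  note tc = linear_mapD(1)[OF twisted_sum_linear[OF net_unitary]]
  show "bd net_filter (\<lambda>i. twisted_sum (net i) x)"
    unfolding bd_def
    by (intro conjI allI exI[of _ "\<Sum>g\<in>carrier G. cnorm A (x g)"] always_eventually
        twisted_sum_norm[OF net_unitary x] tc[OF x])
  show "asy net_filter (\<lambda>i. twisted_sum (net i) (star B x)) (\<lambda>i. star A (twisted_sum (net i) x))"
    unfolding twisted_sum_star[OF net_unitary x] star_twisted_sum[OF net_unitary x]
  proof (rule asy_finsum[OF fin])
    fix g assume g: "g \<in> carrier G"
    let ?c = "star A (x (inv\<^bsub>G\<^esub> g))"
    have c: "?c \<in> carrier A" using e g by simp
    \<comment> \<open>With h the inverse of g the chain is \<alpha>_g(c) z_g ~ z_g c star(z_g) z_g =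
      z_g c ~ star(z_h) c.\<close>
    have "asy net_filter (\<lambda>i. \<alpha> g ?c \<otimes> net i g) (\<lambda>i. (net i g \<otimes> ?c \<otimes> star A (net i g)) \<otimes> net i g)"
      using g c by (intro asy_mult net_conj asy_refl net_closed net_bd bd_mult bd_star bd_const)
    moreover have "(net i g \<otimes> ?c \<otimes> star A (net i g)) \<otimes> net i g = net i g \<otimes> ?c" for i
      using c net_closed[OF g] z_unitary[OF net_unitary g, of i] by (simp add: mult_assoc unitaries_def)
    moreover have "asy net_filter (\<lambda>i. net i g \<otimes> ?c) (\<lambda>i. star A (net i (inv\<^bsub>G\<^esub> g)) \<otimes> ?c)"
      using g c by (intro asy_mult net_inv asy_refl bd_star net_bd bd_const) auto
    ultimately show "asy net_filter (\<lambda>i. \<alpha> g ?c \<otimes> net i g) (\<lambda>i. star A (net i (inv\<^bsub>G\<^esub> g)) \<otimes> ?c)"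
      using asy_trans by simp
  qed
  fix y assume y: "y \<in> carrier B"
  show "asy net_filter (\<lambda>i. twisted_sum (net i) (x \<otimes>\<^bsub>B\<^esub> y)) (\<lambda>i. twisted_sum (net i) x \<otimes> twisted_sum (net i) y)"
    unfolding twisted_sum_mult[OF net_unitary x y] mult_twisted_sums[OF net_unitary x y]
  proof (intro asy_finsum fin)
    fix h k assume hk: "h \<in> carrier G" "k \<in> carrier G"
    \<comment> \<open>Compared factor by factor, with \<open>net_conj\<close> in the middle and
      \<open>net_mult\<close> on the right; unitarity bounds all factors.\<close>
    show "asy net_filter (\<lambda>i. (x h \<otimes> \<alpha> h (y k)) \<otimes> net i (h \<otimes>\<^bsub>G\<^esub> k))
      (\<lambda>i. (x h \<otimes> (net i h \<otimes> y k \<otimes> star A (net i h))) \<otimes> (net i h \<otimes> net i k))"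
      using hk e B_entry[OF y]
      by (intro asy_mult net_conj asy_refl asy_sym[OF net_mult] bd_mult bd_star net_bd bd_const) auto
  qed
next
  fix a assume a: "a \<in> carrier A"
  have "asy net_filter (\<lambda>i. a \<otimes> net i \<one>\<^bsub>G\<^esub>) (\<lambda>_. a \<otimes> \<one>)"
    using a by (intro asy_mult asy_refl net_one bd_const) auto
  then show "asy net_filter (\<lambda>i. twisted_sum (net i) (crossed_inclusion G A a)) (\<lambda>_. a)"
    using a by (simp add: twisted_sum_inclusion[OF net_unitary])
qed

end

theorem theorem3p18:
  fixes A :: "'a cstar_alg"
    and G :: "('g, 'h) monoid_scheme"
    and \<alpha> :: "'g \<Rightarrow> 'a \<Rightarrow> 'a"
  assumes "unital_cstar_algebra A"
    and "group G" and "finite (carrier G)"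
    and "\<alpha> \<in> hom G (Aut_cstar A)"
    and "strictly_approximately_inner G A \<alpha>"
  defines "B \<equiv> crossed_product G A \<alpha>"
    and "\<iota> \<equiv> crossed_inclusion G A"
  shows "iso_onto_range (W A) (W B) (W_map B \<iota>) \<and>
         iso_onto_range (Cu A) (Cu B) (Cu_map B \<iota>)"
proof -
  interpret strictly_approximately_inner_action A G \<alpha>
    using assms by (simp add: strictly_approximately_inner_action_def finite_cstar_action_def
        finite_cstar_action_axioms_def strictly_approximately_inner_action_axioms_def)
  have B: "unital_cstar_algebra B" unfolding B_def by (rule crossed_product_unital_cstar_algebra)
  interpret BU: unital_cstar_algebra B by (rule B)
  have \<iota>: "\<iota> \<in> star_hom A B" unfolding \<iota>_def B_def by (rule crossed_inclusion_star_hom)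
  interpret T: asymptotic_left_inverse B A \<iota> net_filter "\<lambda>i. twisted_sum (net i)"
    unfolding \<iota>_def B_def by (rule twisted_sum_asymptotic_left_inverse)
  interpret T': asymptotic_left_inverse "compacts_tensor B" "compacts_tensor A" "amplify \<iota>" net_filter
      "\<lambda>i. amplify (twisted_sum (net i))"
    by (rule T.compacts_tensor_asymptotic_left_inverse[OF B assms(1)])
      (unfold B_def, rule twisted_sum_bounded_amplification[OF net_unitary])
  have "iso_onto_range (W A) (W B) (W_map B \<iota>)"
    by (rule W_map_iso_onto_range[OF cuntz_algebra_axioms BU.cuntz_algebra_axioms \<iota> T.cuntz_le_reflect])
  moreover have "iso_onto_range (Cu A) (Cu B) (Cu_map B \<iota>)"
    unfolding Cu_def Cu_map_def
    by (rule W_map_iso_onto_range[OF compacts_tensor_cuntz_algebra BU.compacts_tensor_cuntz_algebra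
          amplify_star_hom_compacts[OF assms(1) B \<iota>] T'.cuntz_le_reflect])
  ultimately show ?thesis ..
qed

end
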